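(* For any $1<\delta\le 2$ there is a deterministic algorithm that, given a (directed or undirected) graph $G=(V,E)$ and an integer $k\ge 1$, approximates the number of simple (directed, resp. undirected) paths of length $k-1$ in $G$ up to a multiplicative factor of $\delta$, in time $\frac{2^{O(k\log\log k)}}{(\delta-1)^{O(\log k)}}|E|\log|V|+(\delta-1)^{-O(k/\log k)}$, where the implied constants are absolute.
   Context: A path of length $k-1$ is a path with $k$ vertices and $k-1$ edges; simple means its vertices are distinct. An algorithm approximates a counting problem by a multiplicative factor $\delta\ge1$ if for every input $x$ its output $ALG(x)$ satisfies $N(x)/\delta\le ALG(x)\le\delta N(x)$, where $N(x)$ is the exact answer of the counting problem on $x$. *)

theory Defs
  imports Complex_Main "Graph_Theory.Graph_Theory"
begin

section \<open>Counting simple paths\<close>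

text \<open>
  A simple path is a \<^const>\<open>vpath\<close> (a nonempty list of distinct vertices whose consecutive
  pairs are arcs); \<^const>\<open>vwalk_length\<close> is its number of edges.
\<close>

definition directed_paths :: "'a pair_pre_digraph \<Rightarrow> nat \<Rightarrow> 'a list set" where
  "directed_paths G l = {p. vpath p (with_proj G) \<and> vwalk_length p = l}"

text \<open>
  Undirected graphs are loop-free symmetric digraphs (\<^locale>\<open>pair_graph\<close>). Reading an undirected
  path from its other end gives the same path, so it is the class \<open>{p, rev p}\<close> of its two
  traversals, which coincide when there is only one vertex. Likewise an undirected edge is a pair
  of opposite arcs.
\<close>

definition undirected_paths :: "'a pair_pre_digraph \<Rightarrow> nat \<Rightarrow> 'a list set set" where
  "undirected_paths G l = (\<lambda>p. {p, rev p}) ` directed_paths G l"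

definition undirected_edges :: "'a pair_pre_digraph \<Rightarrow> 'a set set" where
  "undirected_edges G = (\<lambda>(u, v). {u, v}) ` parcs G"


section \<open>Random access machines\<close>

text \<open>
  A unit-cost RAM in the style of Cook and Reckhow: finite deterministic programs over natural
  numbers, with addition, truncated subtraction, indirect addressing and a zero test. There is no
  multiplication, division or bit operation: with these at unit cost on unbounded numbers the
  model would be unreasonably powerful. Registers (of which a program names only finitely many)
  are kept apart from the memory, which is reached only through \<open>Load\<close> and \<open>Store\<close>.
\<close>

datatype instr =
    Const nat nat
  | Add nat nat nat
  | Sub nat nat nat
  | Load nat nat
  | Store nat nat
  | Jump nat
  | JumpZero nat nat

type_synonym program = "instr list"

record config =
  pc :: nat
  regs :: "nat \<Rightarrow> nat"
  mem :: "nat \<Rightarrow> nat"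

fun exec :: "instr \<Rightarrow> config \<Rightarrow> config" where
  "exec (Const r c) s = s\<lparr>pc := Suc (pc s), regs := (regs s)(r := c)\<rparr>"
| "exec (Add r x y) s = s\<lparr>pc := Suc (pc s), regs := (regs s)(r := regs s x + regs s y)\<rparr>"
| "exec (Sub r x y) s = s\<lparr>pc := Suc (pc s), regs := (regs s)(r := regs s x - regs s y)\<rparr>"
| "exec (Load r x) s = s\<lparr>pc := Suc (pc s), regs := (regs s)(r := mem s (regs s x))\<rparr>"
| "exec (Store x r) s = s\<lparr>pc := Suc (pc s), mem := (mem s)(regs s x := regs s r)\<rparr>"
| "exec (Jump l) s = s\<lparr>pc := l\<rparr>"
| "exec (JumpZero r l) s = s\<lparr>pc := (if regs s r = 0 then l else Suc (pc s))\<rparr>"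

definition halted :: "program \<Rightarrow> config \<Rightarrow> bool" where
  "halted P s \<longleftrightarrow> length P \<le> pc s"

definition step :: "program \<Rightarrow> config \<Rightarrow> config" where
  "step P s = (if halted P s then s else exec (P ! pc s) s)"


section \<open>Input, output and running time\<close>

text \<open>
  The vertices of an input graph are \<open>0, \<dots>, n - 1\<close>; its edges are given in memory, from address 0
  on, as a list in arbitrary order. Registers 0, 1 and 2 hold \<open>|V|\<close>, \<open>k\<close> and \<open>|E|\<close>; everything
  else is initially 0.
\<close>

definition input_config :: "nat \<Rightarrow> nat \<Rightarrow> (nat \<times> nat) list \<Rightarrow> config" where
  "input_config n k es =
    \<lparr>pc = 0,
     regs = (\<lambda>_. 0)(0 := n, 1 := k, 2 := length es),
     mem = (\<lambda>a. if a < 2 * length es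
                then (if even a then fst (es ! (a div 2)) else snd (es ! (a div 2)))
                else 0)\<rparr>"

definition directed_input :: "nat \<Rightarrow> nat pair_pre_digraph \<Rightarrow> (nat \<times> nat) list \<Rightarrow> bool" where
  "directed_input n G es \<longleftrightarrow>
     pair_digraph G \<and> pverts G = {..<n} \<and> distinct es \<and> set es = parcs G"

text \<open>Each undirected edge is listed exactly once, in either orientation.\<close>

definition undirected_input :: "nat \<Rightarrow> nat pair_pre_digraph \<Rightarrow> (nat \<times> nat) list \<Rightarrow> bool" where
  "undirected_input n G es \<longleftrightarrow>
     pair_graph G \<and> pverts G = {..<n} \<and>
     distinct (map (\<lambda>(u, v). {u, v}) es) \<and> set es \<union> (set es)\<inverse> = parcs G"

definition approximates :: "real \<Rightarrow> real \<Rightarrow> nat \<Rightarrow> bool" where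
  "approximates \<delta> alg N \<longleftrightarrow> real N / \<delta> \<le> alg \<and> alg \<le> \<delta> * real N"

text \<open>
  The output is a nonnegative rational number: numerator in register 0, positive denominator in
  register 1. Halting configurations are fixed by \<^const>\<open>step\<close>, so this says that \<open>P\<close> started in
  \<open>s\<close> executes at most \<open>T\<close> instructions.
\<close>

definition outputs_approximation ::
    "program \<Rightarrow> config \<Rightarrow> real \<Rightarrow> real \<Rightarrow> nat \<Rightarrow> bool" where
  "outputs_approximation P s T \<delta> N \<longleftrightarrow>
     (\<exists>t s'. real t \<le> T \<and> s' = (step P ^^ t) s \<and> halted P s' \<and> 0 < regs s' 1 \<and>
        approximates \<delta> (real (regs s' 0) / real (regs s' 1)) N)"

text \<open>
  \<open>2\<^bsup>O(k log log k)\<^esup> / (\<delta> - 1)\<^bsup>O(log k)\<^esup> |E| log |V| + (\<delta> - 1)\<^bsup>-O(k / log k)\<^esup>\<close>, one constant for each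
  \<open>O\<close>. The formula is meaningless for \<open>k = 1\<close>, so \<open>log k\<close> and \<open>log log k\<close> are cut off below at 1;
  for \<open>k \<ge> 2\<close> this only changes the constants. The factor \<open>c\<^sub>0\<close> is needed since the unscaled
  formula is 1 for \<open>\<delta> = 2\<close> and an edgeless graph.
\<close>

definition log1 :: "nat \<Rightarrow> real" where
  "log1 k = max 1 (log 2 (real k))"

definition loglog1 :: "nat \<Rightarrow> real" where
  "loglog1 k = max 1 (log 2 (log1 k))"

definition time_bound ::
    "real \<Rightarrow> real \<Rightarrow> real \<Rightarrow> real \<Rightarrow> real \<Rightarrow> nat \<Rightarrow> nat \<Rightarrow> nat \<Rightarrow> real" where
  "time_bound c\<^sub>0 c\<^sub>1 c\<^sub>2 c\<^sub>3 \<delta> k nV nE =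
     c\<^sub>0 * (2 powr (c\<^sub>1 * (real k * loglog1 k)) / (\<delta> - 1) powr (c\<^sub>2 * log1 k)
             * real nE * log 2 (real nV)
           + (\<delta> - 1) powr (- (c\<^sub>3 * (real k / log1 k))))"

end

theory Submission
  imports Defs "HOL-Number_Theory.Number_Theory" "HOL-Computational_Algebra.Polynomial"
    "HOL-Library.FuncSet" "HOL-Real_Asymp.Real_Asymp"
begin

text \<open>
  The proof is by derandomized colour coding. For colourings with \<open>K\<close> colours of the vertices, the
  colourful walks with \<open>k\<close> vertices are counted by inclusion and exclusion over the sets of at most
  \<open>k\<close> colours, each term being a number of walks. These counts are added up over a family of
  colourings which is balanced: up to a factor \<open>1 \<plusminus> \<epsilon>/8\<close>, every \<open>k\<close>-set of vertices is coloured
  injectively by equally many members. Their number \<open>T\<close> is found by running the same algorithm on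
  one path with \<open>k\<close> vertices, whose colourful walks are the injective colourings.

  The family has two levels. The first one consists of \<open>q\<^sup>2 d\<close> linear functions from \<open>q\<^sup>d \<ge> |V|\<close>
  vectors to the field with \<open>q\<close> elements, chosen greedily such that all but a fraction \<open>O(k\<^sup>2/q)\<close> of
  them is injective on any given \<open>k\<close>-set. The second one colours the field. For large \<open>k\<close> it consists
  of all polynomials of degree below \<open>O(k/log k)\<close>, reduced modulo \<open>K = O(k log k)\<close>. As a sieve which
  alternates after few terms decides injectivity, their limited independence suffices. For the
  finitely many remaining \<open>k\<close> a suitable family exists by averaging and is stored in the program.
\<close>


text \<open>The number K of colours trades two costs. The sieve runs through at most (3 K / k)^k
  colour sets, so K = O(k log k) costs only 2^O(k log log k); in exchange a random colouring is
  injective on a k-set with probability at least exp(-O(k / log k)), instead of exp(-O(k)) for K =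
  O(k). Independence of order O(k / log k) makes the truncation error small against that, and since
  q is polynomial in k the family has q^O(k / log k) = 2^O(k) members. The error must also beat
  \<epsilon> = \<delta> - 1, which it does once k is large in terms of \<epsilon>. For the other k
  the stored families have size 2^O(k) times a fixed power of 1 / \<epsilon>, so the constants stay
  absolute although the program depends on \<delta>. The number of vertices enters only through the
  q^2 d rounds, d being O(log |V|). A round has to be linear in |E|, including the choice of its
  hash function on all q^d vectors; therefore isolated vertices are dropped by the renumbering,
  which gives q^d = O(q |E|). As the machine has neither multiplication nor division, all tables are
  filled by additive recurrences.\<close>

section \<open>A prime between B and 8 B^2, from lower bounds on lcm(1, ..., n)\<close>

text \<open>The numbers m C(n, m) are the denominators of Leibniz's harmonic triangle: 1 / ((m+1)
  C(n, m+1)) = 1 / (m C(n-1, m)) - 1 / (m C(n, m)). A common multiple that clears both fractions on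
  the right clears the left one; \<open>x\<close> and \<open>y\<close> are the two resulting
  integers and \<open>x - y\<close> is the new cofactor.\<close>

lemma binomial_dvd_Lcm:
  fixes m n :: nat
  assumes "1 \<le> m" "m \<le> n"
  shows "m * (n choose m) dvd Lcm {1..n}"
  using assms
proof (induction m arbitrary: n rule: dec_induct)
  case base
  then show ?case by (simp add: dvd_Lcm)
next
  case (step m)
  define L where "L = Lcm {1..n}"
  define c where "c = (n - 1) choose m"
  have mn: "m \<le> n - 1" "0 < n" using step.prems step.hyps by auto
  have "m * c dvd Lcm {1..n-1}" unfolding c_def using step.IH[OF mn(1)] .
  moreover have "Lcm {1..n-1} dvd L" unfolding L_def by (rule Lcm_subset) auto
  ultimately obtain x where x: "L = m * c * x" by (meson dvdE dvd_trans)
  obtain y where y: "L = m * (n choose m) * y"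
    using step.IH[of n] step.prems unfolding L_def by (auto elim: dvdE)
  have c0: "0 < c" using mn by (simp add: c_def)
  have e1: "(n choose m) * (n - m) = n * c"
    using binomial_absorb_comp[of n m] mn by (simp add: c_def mult.commute)
  have e2: "Suc m * (n choose Suc m) = n * c"
    using Suc_times_binomial_eq[of "n - 1" m] mn by (simp add: c_def mult.commute)
  have "m * c * (x * (n - m)) = L * (n - m)" using x by simp
  also have "\<dots> = m * y * ((n choose m) * (n - m))" using y by simp
  also have "\<dots> = m * c * (y * n)" using e1 by simp
  finally have yx: "x * (n - m) = y * n" using c0 step.hyps by simp
  have "y \<le> x"
  proof (rule ccontr)
    assume "\<not> y \<le> x"
    then have "x * n < y * n" using mn by simp
    also have "\<dots> \<le> x * n" using yx by (metis diff_le_self mult_le_mono2)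
    finally show False by simp
  qed
  have "n * c * (x - y) = c * (x * n - y * n)" by (simp add: diff_mult_distrib2 algebra_simps)
  also have "\<dots> = c * (x * n - x * (n - m))" using yx by simp
  also have "\<dots> = c * (x * m)" using step.prems by (simp add: diff_mult_distrib2)
  also have "\<dots> = L" using x by simp
  finally show ?case using e2 unfolding L_def by (metis dvd_triv_left)
qed

text \<open>The multiplicity in a least common multiple is the maximum of the multiplicities, so the
  prime power already divides one of the numbers 1, ..., n.\<close>

lemma multiplicity_Lcm_le:
  assumes "prime (p::nat)" "1 \<le> n"
  shows "p ^ multiplicity p (Lcm {1..n}) \<le> n"
  using assms(2)
proof (induction n rule: dec_induct)
  case base
  then show ?case by simp
next
  case (step n)
  have "{1..Suc n} = insert (Suc n) {1..n}" by auto
  then have "multiplicity p (Lcm {1..Suc n}) = max (multiplicity p (Suc n)) (multiplicity p (Lcm {1..n}))"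
    using assms by (simp add: multiplicity_lcm)
  moreover have "p ^ multiplicity p (Suc n) \<le> Suc n"
    by (intro dvd_imp_le multiplicity_dvd) simp
  ultimately show ?case using step by (auto simp: max_def split: if_splits)
qed

lemma Lcm_le_power_primes:
  assumes "1 \<le> (n::nat)"
  shows "Lcm {1..n} \<le> n ^ card {p. prime p \<and> p \<le> n}"
proof -
  let ?L = "Lcm {1..n} :: nat"
  have L0: "?L \<noteq> 0" by (simp add: Lcm_0_iff)
  have fin: "finite {p::nat. prime p \<and> p \<le> n}" by (rule finite_subset[of _ "{..n}"]) auto
  have sub: "prime_factors ?L \<subseteq> {p. prime p \<and> p \<le> n}"
  proof
    fix p assume p: "p \<in> prime_factors ?L"
    then have "prime p" "p dvd ?L" by auto
    then have "multiplicity p ?L \<ge> 1" using p by (simp add: prime_factors_multiplicity Suc_le_eq)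
    then have "p \<le> p ^ multiplicity p ?L" using \<open>prime p\<close> self_le_power prime_ge_1_nat by (metis less_le_trans zero_less_one)
    then show "p \<in> {p. prime p \<and> p \<le> n}" using \<open>prime p\<close> multiplicity_Lcm_le[OF \<open>prime p\<close> assms] by auto
  qed
  have "?L = (\<Prod>p\<in>prime_factors ?L. p ^ multiplicity p ?L)"
    by (rule prime_factorization_nat) (use L0 in blast)
  also have "\<dots> \<le> (\<Prod>p\<in>prime_factors ?L. n)"
    by (intro prod_mono) (use multiplicity_Lcm_le assms in auto)
  also have "\<dots> = n ^ card (prime_factors ?L)" by simp
  also have "\<dots> \<le> n ^ card {p. prime p \<and> p \<le> n}"
    using card_mono[OF fin sub] assms by (intro power_increasing) auto
  finally show ?thesis .
qed

text \<open>Otherwise there are at most B primes up to 2 n = 8 B^2, and lcm(1, ..., 2n) is at most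
  (2n)^B. But it is a multiple of n C(2n, n), which is at least 4^n / 2; comparing exponents of 2
  gives 8 B^2 \<le> 1 + (3 + 2 B) B, which is false. A quadratic gap costs only a constant factor in
  the later exponents.\<close>

lemma prime_between:
  assumes "1 \<le> (B::nat)"
  shows "\<exists>p. prime p \<and> B \<le> p \<and> p \<le> 8 * B\<^sup>2"
proof (rule ccontr)
  assume *: "\<not> ?thesis"
  define n where "n = 4 * B\<^sup>2"
  have n1: "1 \<le> n" using assms by (simp add: n_def)
  have "p < B" if "prime p" "p \<le> 2 * n" for p
  proof (rule ccontr)
    assume "\<not> p < B"
    then show False using * that by (simp add: n_def)
  qed
  then have "{p. prime p \<and> p \<le> 2 * n} \<subseteq> {..<B}" by blast
  then have cd: "card {p. prime p \<and> p \<le> 2 * n} \<le> B" using card_mono[of "{..<B}"] by fastforce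
  have "real n * (4 ^ n / (2 * real n)) \<le> real n * real ((2*n) choose n)"
    by (intro mult_left_mono central_binomial_lower_bound) (use n1 in auto)
  then have "4 ^ n / 2 \<le> real (n * ((2*n) choose n))" using n1 by simp
  also have "n * ((2*n) choose n) \<le> Lcm {1..2*n}"
    using n1 binomial_dvd_Lcm[of n "2 * n"] by (intro dvd_imp_le) (simp_all add: Lcm_0_iff zero_less_iff_neq_zero)
  also have "Lcm {1..2*n} \<le> (2*n) ^ card {p. prime p \<and> p \<le> 2 * n}"
    by (intro Lcm_le_power_primes) (use n1 in auto)
  also have "\<dots> \<le> (2*n) ^ B" using cd n1 by (intro power_increasing) auto
  also have "2 * n \<le> 2 ^ (3 + 2 * B)"
  proof -
    have "B\<^sup>2 \<le> (2 ^ B)\<^sup>2" by (intro power_mono) (auto intro: less_imp_le[OF less_exp])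
    then show ?thesis by (simp add: n_def power_add power_mult[symmetric] mult.commute)
  qed
  then have "real ((2*n) ^ B) \<le> 2 ^ ((3 + 2 * B) * B)"
    by (metis of_nat_le_iff of_nat_numeral of_nat_power power_mono power_mult zero_le)
  finally have "(4::real) ^ n \<le> 2 * 2 ^ ((3 + 2 * B) * B)" by simp
  then have "(2::real) ^ (2 * n) \<le> 2 ^ (1 + (3 + 2 * B) * B)" by (simp add: power_mult)
  then have "2 * n \<le> 1 + (3 + 2 * B) * B" by (rule power_le_imp_le_exp[rotated]) simp
  then have "8 * (B * B) \<le> 1 + 3 * B + 2 * (B * B)" by (simp add: n_def power2_eq_square algebra_simps)
  moreover have "B \<le> B * B" using assms by simp
  ultimately show False using assms by linarith
qed

section \<open>Base-q digits and linear hash functions\<close>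

definition digit :: "nat \<Rightarrow> nat \<Rightarrow> nat \<Rightarrow> nat" where
  "digit q x j = x div q ^ j mod q"

text \<open>The number \<open>x\<close> stands for the vector of its base-q digits, and
  \<open>a\<close> for the coefficients of a linear form. Vectors are numbers so that the programs
  can use them as array indices.\<close>

definition lin :: "nat \<Rightarrow> nat \<Rightarrow> (nat \<Rightarrow> nat) \<Rightarrow> nat \<Rightarrow> nat" where
  "lin q d a x = (\<Sum>j<d. digit q x j * a j) mod q"

lemma digit_less: "0 < q \<Longrightarrow> digit q x j < q"
  by (simp add: digit_def)

lemma digit_Suc: "digit q x (Suc j) = digit q (x div q) j"
  by (simp add: digit_def div_mult2_eq)

lemma digits_inj:
  assumes "x < q ^ d" "y < q ^ d" "\<And>j. j < d \<Longrightarrow> digit q x j = digit q y j"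
  shows "x = y"
  using assms
proof (induction d arbitrary: x y)
  case (Suc d)
  have "x div q = y div q"
  proof (rule Suc.IH)
    show "x div q < q ^ d" "y div q < q ^ d"
      using Suc.prems by (simp_all add: less_mult_imp_div_less mult.commute)
    show "digit q (x div q) j = digit q (y div q) j" if "j < d" for j
      using Suc.prems(3)[of "Suc j"] that by (simp add: digit_Suc)
  qed
  moreover have "x mod q = y mod q" using Suc.prems(3)[of 0] by (simp add: digit_def)
  ultimately show ?case by (metis div_mult_mod_eq)
qed simp

lemma digits_surj:
  assumes "\<And>j. f j < q"
  shows "\<exists>x<q ^ d. \<forall>j<d. digit q x j = f j"
  using assms
proof (induction d arbitrary: f)
  case 0
  then show ?case by auto
next
  case (Suc d)
  obtain x where x: "x < q ^ d" "\<And>j. j < d \<Longrightarrow> digit q x j = f (Suc j)"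
    using Suc.IH[of "\<lambda>j. f (Suc j)"] Suc.prems by blast
  let ?x = "f 0 + q * x"
  have f0: "f 0 < q" by (rule Suc.prems)
  have "?x < q * (x + 1)" using f0 by simp
  also have "\<dots> \<le> q * q ^ d" using x(1) by (intro mult_le_mono2) simp
  finally have "?x < q ^ Suc d" by simp
  moreover have "digit q ?x j = f j" if "j < Suc d" for j
  proof (cases j)
    case 0
    then show ?thesis using f0 by (simp add: digit_def)
  next
    case (Suc i)
    then show ?thesis using f0 x(2)[of i] that by (simp add: digit_Suc)
  qed
  ultimately show ?case by blast
qed

lemma lin_less: "0 < q \<Longrightarrow> lin q d a x < q"
  by (simp add: lin_def)

lemma lin_0 [simp]: "lin q d a 0 = 0"
  by (simp add: lin_def digit_def)

lemma digit_0_above: "x < q ^ j \<Longrightarrow> j \<le> i \<Longrightarrow> digit q x i = 0"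
proof -
  assume a: "x < q ^ j" "j \<le> i"
  show ?thesis
  proof (cases "q = 0")
    case True
    then show ?thesis using a by (simp add: digit_def power_0_left split: if_splits)
  next
    case False
    then have "q ^ j \<le> q ^ i" using a by (intro power_increasing) auto
    then show ?thesis using a by (simp add: digit_def)
  qed
qed

lemma lin_cong:
  assumes "x < q ^ j" "\<And>i. i < j \<Longrightarrow> a i = b i"
  shows "lin q d a x = lin q d b x"
proof -
  have "(\<Sum>i<d. digit q x i * a i) = (\<Sum>i<d. digit q x i * b i)"
  proof (rule sum.cong)
    fix i
    show "digit q x i * a i = digit q x i * b i"
      using assms(2)[of i] digit_0_above[OF assms(1), of i] by (cases "i < j") auto
  qed simp
  then show ?thesis by (simp add: lin_def)
qed

text \<open>Subtracting q^j lowers the leading digit of \<open>x\<close> by one and leaves the other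
  digits alone. This is the recurrence by which the programs tabulate linear forms (and polynomials)
  block by block: one addition modulo q per entry and no digit extraction.\<close>

lemma lin_step:
  assumes q: "2 \<le> q" and j: "j < d" and x: "q ^ j \<le> x" "x < q ^ Suc j"
  shows "lin q d a x = (lin q d a (x - q ^ j) + a j) mod q"
proof -
  have dj: "digit q x j = Suc (digit q (x - q ^ j) j)"
  proof -
    have "x div q ^ j < q" using x by (simp add: less_mult_imp_div_less)
    moreover have "x div q ^ j = Suc ((x - q ^ j) div q ^ j)"
      using x q by (intro le_div_geq) auto
    ultimately show ?thesis by (simp add: digit_def)
  qed
  have di: "digit q x i = digit q (x - q ^ j) i" if "i \<noteq> j" for i
  proof (cases "i < j")
    case True
    define y where "y = x - q ^ j"
    have "x = y + q ^ (j - i) * q ^ i" using x(1) True by (simp add: y_def power_add[symmetric])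
    then have "x div q ^ i = y div q ^ i + q ^ (j - i)" using q by simp
    moreover have "q dvd q ^ (j - i)" using True by simp
    ultimately show ?thesis by (simp add: digit_def y_def[symmetric] mod_add_right_eq[symmetric])
  next
    case False
    then show ?thesis using that x digit_0_above[of x q "Suc j" i] digit_0_above[of "x - q ^ j" q "Suc j" i]
      by (simp add: less_imp_diff_less)
  qed
  have "(\<Sum>i<d. digit q x i * a i) = digit q x j * a j + (\<Sum>i\<in>{..<d} - {j}. digit q x i * a i)"
    using j by (subst sum.remove[of _ j]) auto
  also have "(\<Sum>i\<in>{..<d} - {j}. digit q x i * a i) = (\<Sum>i\<in>{..<d} - {j}. digit q (x - q ^ j) i * a i)"
    by (rule sum.cong) (auto simp: di)
  also have "digit q x j * a j = a j + digit q (x - q ^ j) j * a j" by (simp add: dj)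
  also have "a j + digit q (x - q ^ j) j * a j + (\<Sum>i\<in>{..<d} - {j}. digit q (x - q ^ j) i * a i) =
      (\<Sum>i<d. digit q (x - q ^ j) i * a i) + a j"
    using j by (subst (2) sum.remove[of _ j]) auto
  finally show ?thesis by (simp add: lin_def mod_add_left_eq)
qed

text \<open>Collisions of a linear hash function are zeros at the digitwise difference.\<close>

lemma lin_difference:
  assumes q: "2 \<le> q" and uv: "u < q ^ d" "v < q ^ d" "u \<noteq> v"
  shows "\<exists>z. 1 \<le> z \<and> z < q ^ d \<and> (\<forall>a. lin q d a u = lin q d a v \<longleftrightarrow> lin q d a z = 0)"
proof -
  let ?f = "\<lambda>j. (digit q u j + (q - digit q v j)) mod q"
  obtain z where z: "z < q ^ d" "\<And>j. j < d \<Longrightarrow> digit q z j = ?f j"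
    using digits_surj[of ?f q d] q by auto
  have dl: "digit q u j < q" "digit q v j < q" for j using q by (simp_all add: digit_less)
  have "z \<noteq> 0"
  proof
    assume "z = 0"
    have "digit q u j = digit q v j" if "j < d" for j
    proof -
      have "?f j = 0" using z(2)[OF that] \<open>z = 0\<close> by (simp add: digit_def)
      then have "q dvd digit q u j + (q - digit q v j)" by (simp add: mod_eq_0_iff_dvd)
      then obtain c where c: "digit q u j + (q - digit q v j) = q * c" by (elim dvdE)
      have "0 < q * c" "q * c < q * 2" using c dl[of j] by linarith+
      then have "c = 1" by simp
      then show ?thesis using c dl[of j] by simp
    qed
    then show False using digits_inj uv by blast
  qed
  moreover have "lin q d a u = lin q d a v \<longleftrightarrow> lin q d a z = 0" for a
  proof -
    let ?U = "\<Sum>j<d. digit q u j * a j" and ?W = "\<Sum>j<d. digit q v j * a j"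
    let ?Z = "\<Sum>j<d. digit q z j * a j"
    have "[digit q z j * a j + digit q v j * a j = digit q u j * a j] (mod q)" if "j < d" for j
    proof -
      have "[digit q z j + digit q v j = digit q u j + (q - digit q v j) + digit q v j] (mod q)"
        unfolding z(2)[OF that] by (intro cong_add) (simp_all add: unique_euclidean_semiring_class.cong_def)
      also have "digit q u j + (q - digit q v j) + digit q v j = digit q u j + q" using dl[of j] by simp
      also have "[digit q u j + q = digit q u j] (mod q)" by (simp add: unique_euclidean_semiring_class.cong_def)
      finally have "[(digit q z j + digit q v j) * a j = digit q u j * a j] (mod q)"
        by (rule cong_scalar_right)
      then show ?thesis by (simp add: distrib_right)
    qed
    then have "[(\<Sum>j<d. digit q z j * a j + digit q v j * a j) = ?U] (mod q)"
      by (intro cong_sum) auto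
    then have c: "[?Z + ?W = ?U] (mod q)" by (simp add: sum.distrib)
    show ?thesis
    proof
      assume "lin q d a u = lin q d a v"
      then have "[?Z + ?W = 0 + ?W] (mod q)" using c by (simp add: lin_def unique_euclidean_semiring_class.cong_def)
      then have "[?Z = 0] (mod q)" by (simp only: cong_add_rcancel_nat)
      then show "lin q d a z = 0" by (simp add: lin_def unique_euclidean_semiring_class.cong_def)
    next
      assume "lin q d a z = 0"
      then have "[?Z + ?W = 0 + ?W] (mod q)" by (intro cong_add) (simp_all add: lin_def unique_euclidean_semiring_class.cong_def)
      then have "[?U = ?W] (mod q)" using c by (simp add: unique_euclidean_semiring_class.cong_def)
      then show "lin q d a u = lin q d a v" by (simp add: lin_def unique_euclidean_semiring_class.cong_def)
    qed
  qed
  ultimately show ?thesis using z(1) by (intro exI[of _ z]) auto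
qed

text \<open>The leading digit of \<open>z\<close> sits at position \<open>j\<close> and is
  invertible modulo the prime \<open>q\<close>, so the value at \<open>z\<close> is an injective
  affine function of the coefficient at \<open>j\<close>.\<close>

lemma lin_zero_unique:
  assumes q: "prime q" and j: "j < d" and z: "q ^ j \<le> z" "z < q ^ Suc j"
    and c: "c < q" "c' < q" "lin q d (a(j := c)) z = 0" "lin q d (a(j := c')) z = 0"
  shows "c = c'"
proof -
  let ?R = "\<Sum>i\<in>{..<d} - {j}. digit q z i * a i"
  have l: "lin q d (a(j := b)) z = (digit q z j * b + ?R) mod q" for b
  proof -
    have "(\<Sum>i<d. digit q z i * (a(j := b)) i) = digit q z j * b + (\<Sum>i\<in>{..<d} - {j}. digit q z i * (a(j := b)) i)"
      using j by (subst sum.remove[of _ j]) auto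
    also have "(\<Sum>i\<in>{..<d} - {j}. digit q z i * (a(j := b)) i) = ?R" by (rule sum.cong) auto
    finally show ?thesis by (simp add: lin_def)
  qed
  have q0: "0 < q" using q prime_gt_0_nat by blast
  have "z div q ^ j < q" using z by (simp add: less_mult_imp_div_less)
  moreover have "z div q ^ j > 0" using z(1) q0 by (simp add: div_greater_zero_iff)
  ultimately have dz: "0 < digit q z j" "digit q z j < q" by (simp_all add: digit_def)
  have "[digit q z j * c + ?R = digit q z j * c' + ?R] (mod q)"
    using c l by (simp add: unique_euclidean_semiring_class.cong_def)
  then have "[digit q z j * c = digit q z j * c'] (mod q)" by (simp only: cong_add_rcancel_nat)
  moreover have "coprime (digit q z j) q"
    using dz q by (metis coprime_commute prime_imp_coprime nat_dvd_not_less)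
  ultimately have "[c = c'] (mod q)" by (simp only: cong_mult_lcancel_nat)
  then show ?thesis using c by (simp add: unique_euclidean_semiring_class.cong_def)
qed

subsection \<open>Polynomials over a prime field\<close>

text \<open>The bound on the number of roots over the field with p elements, phrased by divisibility
  of integers because p is a variable of the proof and not part of a type. A root \<open>r\<close>
  is split off by synthetic division; the remainder \<open>poly f r\<close> vanishes modulo p
  only.\<close>

lemma poly_zero_mod_prime:
  fixes f :: "int poly"
  assumes "prime p" "finite A" "degree f < card A"
    and "\<And>x. x \<in> A \<Longrightarrow> int p dvd poly f x"
    and "\<And>x y. x \<in> A \<Longrightarrow> y \<in> A \<Longrightarrow> int p dvd x - y \<Longrightarrow> x = y"
  shows "int p dvd coeff f i"
  using assms(2-)
proof (induction "card A" arbitrary: A f i)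
  case 0
  then show ?case by simp
next
  case (Suc n)
  then obtain r where r: "r \<in> A" by fastforce
  define g where "g = synthetic_div f r"
  have fg: "f = [:-r, 1:] * g + [:poly f r:]"
    using synthetic_div_correct'[of r f] by (simp add: g_def)
  have "int p dvd coeff g i" for i
  proof (cases "n = 0")
    case True
    then have "degree f = 0" using Suc by simp
    then have "g = 0" by (simp add: g_def synthetic_div_eq_0_iff)
    then show ?thesis by simp
  next
    case False
    show ?thesis
    proof (rule Suc.hyps(1)[of "A - {r}"])
      show "n = card (A - {r})" "finite (A - {r})" using Suc r by auto
      show "degree g < card (A - {r})"
        using Suc r False by (simp add: g_def degree_synthetic_div)
      show "int p dvd poly g x" if x: "x \<in> A - {r}" for x
      proof -
        have "poly f x = (x - r) * poly g x + poly f r"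
          by (subst fg) (simp add: algebra_simps)
        then have "int p dvd (x - r) * poly g x"
          using Suc.prems(3)[of x] Suc.prems(3)[OF r] x by (metis DiffD1 add_diff_cancel_right' dvd_diff)
        then have "int p dvd x - r \<or> int p dvd poly g x"
          using \<open>prime p\<close> prime_dvd_mult_iff[of "int p"] by auto
        then show ?thesis using Suc.prems(4)[of x r] x r by auto
      qed
      show "x = y" if "x \<in> A - {r}" "y \<in> A - {r}" "int p dvd x - y" for x y
        using Suc.prems(4) that by blast
    qed
  qed
  then have "int p dvd coeff ([:-r, 1:] * g) i"
    by (simp add: coeff_pCons dvd_diff split: nat.split)
  moreover have "int p dvd coeff [:poly f r:] i"
    using Suc.prems(3)[OF r] by (simp add: coeff_pCons split: nat.split)
  ultimately show ?case by (subst fg) (simp only: coeff_add dvd_add)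
qed

text \<open>The digits of \<open>N\<close> are the coefficients of a polynomial. Its value at
  \<open>x\<close> is a linear form with the powers of \<open>x\<close> as coefficients, so the
  facts about \<open>lin\<close> apply to polynomials as well.\<close>

definition pval :: "nat \<Rightarrow> nat \<Rightarrow> nat \<Rightarrow> nat \<Rightarrow> nat" where
  "pval q D N x = lin q D (\<lambda>j. x ^ j) N"

text \<open>The polynomial of the digit differences has degree below D and D incongruent roots, so
  all its coefficients vanish modulo q; digits lie below q and hence agree.\<close>

lemma pval_inj:
  assumes q: "prime q" and A: "A \<subseteq> {..<q}" "card A = D" and N: "N < q ^ D" "N' < q ^ D"
    and eq: "\<And>x. x \<in> A \<Longrightarrow> pval q D N x = pval q D N' x"
  shows "N = N'"
proof (cases "D = 0")
  case True
  then show ?thesis using N by simp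
next
  case False
  define f where "f = (\<Sum>j<D. monom (int (digit q N j) - int (digit q N' j)) j)"
  have cf: "coeff f i = (if i < D then int (digit q N i) - int (digit q N' i) else 0)" for i
    by (simp add: f_def coeff_sum)
  have "degree f \<le> D - 1" by (rule degree_le) (use cf in auto)
  then have df: "degree f < card (int ` A)" using A False by (simp add: card_image)
  have "int q dvd coeff f i" for i
  proof (rule poly_zero_mod_prime[OF q _ df])
    show "finite (int ` A)" using A finite_subset by blast
    show "int q dvd poly f x" if x: "x \<in> int ` A" for x
    proof -
      obtain y where y: "y \<in> A" "x = int y" using x by blast
      have "[int (\<Sum>j<D. digit q N j * y ^ j) = int (\<Sum>j<D. digit q N' j * y ^ j)] (mod int q)"
        using eq[OF y(1)] unfolding cong_int_iff by (simp add: pval_def lin_def unique_euclidean_semiring_class.cong_def)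
      then have "int q dvd int (\<Sum>j<D. digit q N j * y ^ j) - int (\<Sum>j<D. digit q N' j * y ^ j)"
        by (simp only: cong_iff_dvd_diff)
      also have "int (\<Sum>j<D. digit q N j * y ^ j) - int (\<Sum>j<D. digit q N' j * y ^ j) = poly f x"
        by (simp add: f_def poly_sum poly_monom y(2) sum_subtractf left_diff_distrib)
      finally show ?thesis .
    qed
    show "x = y" if xy: "x \<in> int ` A" "y \<in> int ` A" "int q dvd x - y" for x y
    proof -
      obtain x' y' where "x = int x'" "y = int y'" "x' \<in> A" "y' \<in> A" using xy(1,2) by blast
      moreover from this have "x' < q" "y' < q" using A(1) by auto
      ultimately show ?thesis using xy(3) by (auto simp: cong_iff_dvd_diff[symmetric] cong_int_iff unique_euclidean_semiring_class.cong_def)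
    qed
  qed
  have "digit q N j = digit q N' j" if "j < D" for j
  proof -
    have "int q dvd int (digit q N j) - int (digit q N' j)" using \<open>int q dvd coeff f j\<close> cf that by simp
    then show ?thesis using q prime_gt_0_nat[of q] digit_less[of q]
      by (auto simp: cong_iff_dvd_diff[symmetric] cong_int_iff unique_euclidean_semiring_class.cong_def)
  qed
  then show ?thesis using digits_inj N by blast
qed

text \<open>Interpolation by counting. For D points the evaluation map is injective between two sets
  of size q^D, hence bijective. For fewer points another point \<open>b\<close> is added and the
  counts for its q possible values are summed.\<close>

lemma pval_independent:
  assumes q: "prime q" and A: "A \<subseteq> {..<q}" "card A \<le> D" and D: "D \<le> q"
    and y: "\<And>x. x \<in> A \<Longrightarrow> y x < q"
  shows "card {N. N < q ^ D \<and> (\<forall>x\<in>A. pval q D N x = y x)} = q ^ (D - card A)"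
  using assms(2,3,5)
proof (induction "D - card A" arbitrary: A y)
  case 0
  then have cA: "card A = D" by simp
  have finA: "finite A" using 0 finite_subset by blast
  let ?m = "\<lambda>N. restrict (pval q D N) A"
  have inj: "inj_on ?m {..<q ^ D}"
  proof (rule inj_onI)
    fix N N' assume N: "N \<in> {..<q ^ D}" "N' \<in> {..<q ^ D}" "?m N = ?m N'"
    then have "pval q D N x = pval q D N' x" if "x \<in> A" for x
      using that by (metis restrict_apply')
    then show "N = N'" using pval_inj[OF q 0(2) cA] N by blast
  qed
  have "?m ` {..<q ^ D} = A \<rightarrow>\<^sub>E {..<q}"
  proof (rule card_subset_eq)
    show "finite (A \<rightarrow>\<^sub>E {..<q})" using finA by (simp add: finite_PiE)
    show "?m ` {..<q ^ D} \<subseteq> A \<rightarrow>\<^sub>E {..<q}"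
      using lin_less prime_gt_0_nat[OF q] by (auto simp: pval_def)
    show "card (?m ` {..<q ^ D}) = card (A \<rightarrow>\<^sub>E {..<q})"
      using finA cA by (simp add: card_image[OF inj] card_PiE)
  qed
  moreover have "restrict y A \<in> A \<rightarrow>\<^sub>E {..<q}" using 0 by auto
  ultimately obtain N where N: "N < q ^ D" "?m N = restrict y A" by (metis (no_types, lifting) imageE lessThan_iff)
  have "{N. N < q ^ D \<and> (\<forall>x\<in>A. pval q D N x = y x)} = {N}"
  proof (intro equalityI subsetI)
    fix N' assume N': "N' \<in> {N. N < q ^ D \<and> (\<forall>x\<in>A. pval q D N x = y x)}"
    then have "?m N' = ?m N" using N(2) by (auto simp: restrict_def)
    then show "N' \<in> {N}" using inj N(1) N' by (auto dest: inj_onD)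
  next
    fix N' assume "N' \<in> {N}"
    then show "N' \<in> {N. N < q ^ D \<and> (\<forall>x\<in>A. pval q D N x = y x)}"
      using N by (auto simp: restrict_def fun_eq_iff) metis
  qed
  then show ?case using cA by simp
next
  case (Suc n)
  have finA: "finite A" using Suc finite_subset by blast
  have "card A < card {..<q}" using Suc(2) D by simp
  then obtain b where b: "b < q" "b \<notin> A"
    using Suc.prems(1) finA by (metis card_mono linorder_not_less lessThan_iff subsetI)
  let ?B = "insert b A"
  have cB: "card ?B = Suc (card A)" using b finA by simp
  have "card {N. N < q ^ D \<and> (\<forall>x\<in>?B. pval q D N x = (y(b := v)) x)} = q ^ n" if "v < q" for v
  proof -
    have "n = D - card ?B" "?B \<subseteq> {..<q}" "card ?B \<le> D" using Suc cB b by auto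
    moreover have "(y(b := v)) x < q" if "x \<in> ?B" for x using that \<open>v < q\<close> Suc.prems(3) by auto
    ultimately show ?thesis using Suc.hyps(1)[of ?B "y(b := v)"] by blast
  qed
  then have "(\<Sum>v<q. card {N. N < q ^ D \<and> (\<forall>x\<in>?B. pval q D N x = (y(b := v)) x)}) = q * q ^ n"
    by simp
  moreover have "{N. N < q ^ D \<and> (\<forall>x\<in>A. pval q D N x = y x)} =
      (\<Union>v<q. {N. N < q ^ D \<and> (\<forall>x\<in>?B. pval q D N x = (y(b := v)) x)})"
    using b lin_less prime_gt_0_nat[OF q] by (auto simp: pval_def)
  moreover have "card (\<Union>v<q. {N. N < q ^ D \<and> (\<forall>x\<in>?B. pval q D N x = (y(b := v)) x)}) =
      (\<Sum>v<q. card {N. N < q ^ D \<and> (\<forall>x\<in>?B. pval q D N x = (y(b := v)) x)})"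
    by (subst card_UN_disjoint) auto
  ultimately show ?case using Suc(2) by (metis power_Suc)
qed

subsection \<open>Truncated sieve for injectivity\<close>

definition prior :: "(nat \<Rightarrow> nat) \<Rightarrow> (nat \<Rightarrow> nat) \<Rightarrow> nat \<Rightarrow> nat" where
  "prior c y i = card {i'. i' < i \<and> c (y i') = c (y i)}"

text \<open>
  At \<open>t = -1\<close> the product \<open>\<Prod>(1 + a\<^sub>i t)\<close>, with \<open>a\<^sub>i\<close> the number of earlier points of the colour of
  the \<open>i\<close>-th one, is the indicator of injectivity: the second point of a colour has \<open>a\<^sub>i = 1\<close>. The
  factor \<open>1 + t\<close> which it contributes also makes the truncations alternate.
\<close>

definition inj_sieve :: "(nat \<Rightarrow> nat) \<Rightarrow> (nat \<Rightarrow> nat) \<Rightarrow> nat \<Rightarrow> int poly" where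
  "inj_sieve c y k = (\<Prod>i<k. [:1, int (prior c y i):])"

text \<open>The value at -1 of the truncation of \<open>p\<close> after degree
  \<open>J\<close>.\<close>

definition alt_sum :: "int poly \<Rightarrow> nat \<Rightarrow> int" where
  "alt_sum p J = (\<Sum>j\<le>J. (-1) ^ j * coeff p j)"

lemma prior_eq_0_iff: "prior c y i = 0 \<longleftrightarrow> (\<forall>i'<i. c (y i') \<noteq> c (y i))"
  by (auto simp: prior_def card_eq_0_iff)

lemma inj_sieve_Suc: "inj_sieve c y (Suc k) = inj_sieve c y k * [:1, int (prior c y k):]"
  by (simp add: inj_sieve_def)

lemma sieve_inj: "inj_on (c \<circ> y) {..<k} \<Longrightarrow> inj_sieve c y k = 1"
proof (induction k)
  case 0
  then show ?case by (simp add: inj_sieve_def)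
next
  case (Suc k)
  have "prior c y k = 0"
    using Suc.prems by (auto simp: prior_eq_0_iff inj_on_def)
  moreover have "inj_on (c \<circ> y) {..<k}" using Suc.prems by (rule inj_on_subset) auto
  ultimately show ?case using Suc.IH by (simp add: inj_sieve_Suc comp_def)
qed

lemma coeff_mult_linear:
  "coeff (p * [:1, a:]) (Suc j) = coeff p (Suc j) + a * coeff p j" for p :: "int poly"
  by simp

lemma sieve_nonneg: "0 \<le> coeff (inj_sieve c y k) j"
proof (induction k arbitrary: j)
  case 0
  then show ?case by (simp add: inj_sieve_def coeff_1)
next
  case (Suc k)
  then show ?case by (cases j) (simp_all add: inj_sieve_Suc)
qed

text \<open>The first point at which injectivity breaks has exactly one earlier point of its colour,
  because the points before it have distinct colours. Its factor is 1 + t, and the other factors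
  have nonnegative coefficients.\<close>

lemma sieve_not_inj:
  assumes "\<not> inj_on (c \<circ> y) {..<k}"
  shows "\<exists>p. (\<forall>j. 0 \<le> coeff p j) \<and> inj_sieve c y k = [:1, 1:] * p"
  using assms
proof (induction k)
  case 0
  then show ?case by simp
next
  case (Suc k)
  show ?case
  proof (cases "inj_on (c \<circ> y) {..<k}")
    case True
    have "\<not> inj_on (c \<circ> y) (insert k {..<k})" using Suc.prems unfolding lessThan_Suc .
    then have "(c \<circ> y) k \<in> (c \<circ> y) ` ({..<k} - {k})" using True unfolding inj_on_insert by blast
    then obtain i where i: "i < k" "c (y i) = c (y k)" by (elim imageE) auto
    have "{i'. i' < k \<and> c (y i') = c (y k)} = {i}"
      using i True by (auto simp: inj_on_def)
    then have "prior c y k = 1" by (simp add: prior_def)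
    then have "inj_sieve c y (Suc k) = [:1, 1:] * 1" by (simp add: inj_sieve_Suc sieve_inj[OF True])
    then show ?thesis by (intro exI[of _ 1]) (simp add: coeff_1)
  next
    case False
    then obtain p where p: "\<And>j. 0 \<le> coeff p j" "inj_sieve c y k = [:1, 1:] * p" using Suc.IH by blast
    let ?a = "[:1, int (prior c y k):]"
    have "inj_sieve c y (Suc k) = [:1, 1:] * (p * ?a)" by (simp only: inj_sieve_Suc p(2) mult.assoc)
    moreover have "0 \<le> coeff (p * ?a) j" for j
      using p(1) by (cases j) simp_all
    ultimately show ?thesis by blast
  qed
qed

text \<open>The alternating sum of the coefficients of (1 + t) p telescopes.\<close>

lemma alt_sum_linear_factor: "alt_sum ([:1, 1:] * p) J = (-1) ^ J * coeff p J"
  by (induction J) (simp_all add: alt_sum_def algebra_simps)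

text \<open>Without injectivity the truncation is, up to sign, a single coefficient of the
  nonnegative cofactor \<open>p\<close>, and the next coefficient of (1 + t) p dominates it. With
  injectivity the sieve is the polynomial 1 and every truncation is exact.\<close>

lemma sieve_truncated:
  "\<bar>of_bool (inj_on (c \<circ> y) {..<k}) - alt_sum (inj_sieve c y k) J\<bar> \<le> coeff (inj_sieve c y k) (Suc J)"
proof (cases "inj_on (c \<circ> y) {..<k}")
  case True
  have "alt_sum (1 :: int poly) J = 1"
    by (simp add: alt_sum_def coeff_1 if_distrib[of "(*) _"] cong: if_cong)
  then show ?thesis using True sieve_inj[OF True] by (simp add: coeff_1)
next
  case False
  then obtain p where p: "\<And>j. 0 \<le> coeff p j" "inj_sieve c y k = [:1, 1:] * p" using sieve_not_inj by blast
  have "\<bar>alt_sum (inj_sieve c y k) J\<bar> = coeff p J"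
    using p(1)[of J] by (simp only: p(2) alt_sum_linear_factor) (simp add: abs_mult power_abs)
  moreover have "coeff (inj_sieve c y k) (Suc J) = coeff p (Suc J) + coeff p J" using p(2) by simp
  ultimately show ?thesis using False p(1)[of "Suc J"] by simp
qed

subsection \<open>Functions of few coordinates\<close>

text \<open>Sums of functions that each look at no more than \<open>d\<close> of the first
  \<open>k\<close> coordinates. These are functions whose mean is already determined by
  \<open>d\<close>-wise independence; the inductive form lets that be proved summand by
  summand.\<close>

inductive low :: "nat \<Rightarrow> nat \<Rightarrow> ((nat \<Rightarrow> nat) \<Rightarrow> int) \<Rightarrow> bool" for k d where
  low_base: "U \<subseteq> {..<k} \<Longrightarrow> card U \<le> d \<Longrightarrow> (\<And>y y'. (\<And>i. i \<in> U \<Longrightarrow> y i = y' i) \<Longrightarrow> f y = f y') \<Longrightarrow> low k d f"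
| low_add: "low k d f \<Longrightarrow> low k d g \<Longrightarrow> low k d (\<lambda>y. f y + g y)"

lemma low_const: "low k d (\<lambda>_. c)"
  by (rule low_base[of "{}"]) auto

lemma low_mono: "low k d f \<Longrightarrow> d \<le> d' \<Longrightarrow> low k d' f"
proof (induction rule: low.induct)
  case (low_base U f)
  show ?case
  proof (rule low.low_base[of U])
    show "f y = f y'" if "\<And>i. i \<in> U \<Longrightarrow> y i = y' i" for y y' using that by (rule low_base(3))
  qed (use low_base(1,2,4) in simp_all)
qed (auto intro: low_add)

lemma low_sum: "finite I \<Longrightarrow> (\<And>i. i \<in> I \<Longrightarrow> low k d (f i)) \<Longrightarrow> low k d (\<lambda>y. \<Sum>i\<in>I. f i y)"
  by (induction I rule: finite_induct) (auto intro: low_const low_add)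

lemma low_mult_base:
  assumes "low k d f" "W \<subseteq> {..<k}" "card W \<le> e" "\<And>y y'. (\<And>i. i \<in> W \<Longrightarrow> y i = y' i) \<Longrightarrow> g y = g y'"
  shows "low k (d + e) (\<lambda>y. g y * f y)"
  using assms(1)
proof (induction rule: low.induct)
  case (low_base U f)
  have "card (U \<union> W) \<le> d + e" using card_Un_le[of U W] low_base assms(3) by linarith
  show ?case
  proof (rule low.low_base[of "U \<union> W"])
    show "U \<union> W \<subseteq> {..<k}" using low_base(1) assms(2) by blast
    fix y y' :: "nat \<Rightarrow> nat" assume e: "\<And>i. i \<in> U \<union> W \<Longrightarrow> y i = y' i"
    have "f y = f y'" by (rule low_base(3)) (use e in blast)
    moreover have "g y = g y'" by (rule assms(4)) (use e in blast)
    ultimately show "g y * f y = g y' * f y'" by simp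
  qed fact
next
  case (low_add f g')
  then show ?case using low.low_add[of k "d + e" "\<lambda>y. g y * f y" "\<lambda>y. g y * g' y"]
    by (simp add: distrib_left)
qed

text \<open>Coefficient \<open>j\<close> is a sum of products of \<open>j\<close> indicators of
  equal colours, each of which looks at two coordinates.\<close>

lemma low_sieve:
  assumes "kk \<le> k"
  shows "low k (2 * j) (\<lambda>y. coeff (inj_sieve c y kk) j)"
  using assms
proof (induction kk arbitrary: j)
  case 0
  then show ?case by (simp add: inj_sieve_def low_const)
next
  case (Suc kk)
  show ?case
  proof (cases j)
    case 0
    then show ?thesis using Suc.IH[of 0] Suc.prems by (simp add: inj_sieve_Suc)
  next
    case (Suc i)
    have "prior c y kk = (\<Sum>i'<kk. of_bool (c (y i') = c (y kk)))" for y
      by (simp add: prior_def Int_def lessThan_def)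
    then have e: "coeff (inj_sieve c y (Suc kk)) j =
       coeff (inj_sieve c y kk) j + (\<Sum>i'<kk. of_bool (c (y i') = c (y kk)) * coeff (inj_sieve c y kk) i)" for y
      unfolding Suc inj_sieve_Suc coeff_mult_linear by (simp add: sum_distrib_right)
    have l: "low k (2 * i + 2) (\<lambda>y. of_bool (c (y i') = c (y kk)) * coeff (inj_sieve c y kk) i)" if "i' < kk" for i'
      by (rule low_mult_base[of _ _ _ "{i', kk}"])
        (use Suc.IH[of i] Suc.prems that in \<open>auto simp: card_insert_if\<close>)
    have "2 * j = 2 * i + 2" using Suc by simp
    then show ?thesis unfolding e using l Suc.IH[of j] Suc.prems
      by (intro low_add low_sum) auto
  qed
qed

lemma card_PiE_fixed:
  assumes "U \<subseteq> {..<k}" "\<And>i. i \<in> U \<Longrightarrow> w i < (q::nat)"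
  shows "card {y \<in> {..<k} \<rightarrow>\<^sub>E {..<q}. \<forall>i\<in>U. y i = w i} = q ^ (k - card U)"
proof -
  have "{y \<in> {..<k} \<rightarrow>\<^sub>E {..<q}. \<forall>i\<in>U. y i = w i} = Pi\<^sub>E {..<k} (\<lambda>i. if i \<in> U then {w i} else {..<q})"
  proof (rule Set.set_eqI)
    fix y
    have 1: "y i \<in> (if i \<in> U then {w i} else {..<q}) \<longleftrightarrow> y i \<in> {..<q} \<and> (i \<in> U \<longrightarrow> y i = w i)" for i
      using assms(2)[of i] by auto
    have 2: "(\<forall>i\<in>{..<k}. i \<in> U \<longrightarrow> y i = w i) \<longleftrightarrow> (\<forall>i\<in>U. y i = w i)" using assms(1) by auto
    show "y \<in> {y \<in> {..<k} \<rightarrow>\<^sub>E {..<q}. \<forall>i\<in>U. y i = w i} \<longleftrightarrow>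
        y \<in> Pi\<^sub>E {..<k} (\<lambda>i. if i \<in> U then {w i} else {..<q})"
      unfolding mem_Collect_eq PiE_iff 1 2[symmetric] by blast
  qed
  then have "card {y \<in> {..<k} \<rightarrow>\<^sub>E {..<q}. \<forall>i\<in>U. y i = w i} =
      (\<Prod>i<k. card (if i \<in> U then {w i} else {..<q}))"
    by (simp only: card_PiE finite_lessThan)
  also have "\<dots> = (\<Prod>i<k. if i \<in> U then 1 else q)"
    by (rule prod.cong) auto
  also have "\<dots> = (\<Prod>i\<in>{..<k} - U. q)"
    by (rule prod.mono_neutral_cong_right) auto
  also have "\<dots> = q ^ (k - card U)" using assms(1) by (simp add: card_Diff_subset finite_subset)
  finally show ?thesis .
qed

text \<open>On a summand that depends on coordinates in \<open>U\<close> both sides group by the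
  restriction to \<open>U\<close>, and every restriction occurs equally often: q^(D - |U|) times
  among the polynomials and q^(k - |U|) times among all functions. The two means are
  cross-multiplied in order to stay in the integers.\<close>

lemma low_average:
  assumes q: "prime q" and D: "D \<le> q" and f: "low k d f" "d \<le> D"
    and \<sigma>: "inj_on \<sigma> {..<k}" "\<sigma> ` {..<k} \<subseteq> {..<q}"
  shows "int (q ^ k) * (\<Sum>N<q ^ D. f (\<lambda>i. pval q D N (\<sigma> i))) =
     int (q ^ D) * (\<Sum>y\<in>{..<k} \<rightarrow>\<^sub>E {..<q}. f y)"
  using f
proof (induction rule: low.induct)
  case (low_base U f)
  have q0: "0 < q" using q prime_gt_0_nat by blast
  have finU: "finite U" using low_base(1) finite_subset by blast
  have UD: "card U \<le> D" "card U \<le> k" using low_base card_mono[of "{..<k}" U] by auto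
  have pv: "pval q D N x < q" for N x using q0 by (simp add: pval_def lin_less)
  have injU: "inj_on \<sigma> U" using \<sigma>(1) low_base(1) inj_on_subset by blast
  let ?W = "U \<rightarrow>\<^sub>E {..<q}"
  have finW: "finite ?W" using finU by (simp add: finite_PiE)
  have 1: "(\<Sum>N<q ^ D. f (\<lambda>i. pval q D N (\<sigma> i))) = (\<Sum>w\<in>?W. int (q ^ (D - card U)) * f w)"
  proof -
    have "(\<Sum>N<q ^ D. f (\<lambda>i. pval q D N (\<sigma> i))) =
       (\<Sum>w\<in>?W. \<Sum>N\<in>{N\<in>{..<q ^ D}. restrict (\<lambda>i. pval q D N (\<sigma> i)) U = w}. f (\<lambda>i. pval q D N (\<sigma> i)))"
      by (rule sum.group[symmetric]) (use finW pv in auto)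
    also have "\<dots> = (\<Sum>w\<in>?W. \<Sum>N\<in>{N\<in>{..<q ^ D}. restrict (\<lambda>i. pval q D N (\<sigma> i)) U = w}. f w)"
      by (intro sum.cong refl low_base(3)) auto
    also have "\<dots> = (\<Sum>w\<in>?W. int (q ^ (D - card U)) * f w)"
    proof (rule sum.cong[OF refl])
      fix w assume w: "w \<in> ?W"
      have "{N\<in>{..<q ^ D}. restrict (\<lambda>i. pval q D N (\<sigma> i)) U = w} =
          {N. N < q ^ D \<and> (\<forall>x\<in>\<sigma> ` U. pval q D N x = w (inv_into U \<sigma> x))}"
        using w injU by (auto simp: fun_eq_iff PiE_def extensional_def)
      moreover have "card {N. N < q ^ D \<and> (\<forall>x\<in>\<sigma> ` U. pval q D N x = w (inv_into U \<sigma> x))} =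
          q ^ (D - card (\<sigma> ` U))"
        by (rule pval_independent[OF q])
          (use low_base(1) \<sigma> UD D w injU in \<open>auto simp: card_image inv_into_into Pi_def PiE_def\<close>)
      ultimately show "(\<Sum>N\<in>{N\<in>{..<q ^ D}. restrict (\<lambda>i. pval q D N (\<sigma> i)) U = w}. f w) =
          int (q ^ (D - card U)) * f w"
        using injU by (simp add: card_image)
    qed
    finally show ?thesis .
  qed
  have 2: "(\<Sum>y\<in>{..<k} \<rightarrow>\<^sub>E {..<q}. f y) = (\<Sum>w\<in>?W. int (q ^ (k - card U)) * f w)"
  proof -
    have "(\<Sum>y\<in>{..<k} \<rightarrow>\<^sub>E {..<q}. f y) =
       (\<Sum>w\<in>?W. \<Sum>y\<in>{y\<in>{..<k} \<rightarrow>\<^sub>E {..<q}. restrict y U = w}. f y)"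
      by (rule sum.group[symmetric]) (use finW low_base(1) in \<open>auto simp: finite_PiE\<close>)
    also have "\<dots> = (\<Sum>w\<in>?W. \<Sum>y\<in>{y\<in>{..<k} \<rightarrow>\<^sub>E {..<q}. restrict y U = w}. f w)"
      by (intro sum.cong refl low_base(3)) auto
    also have "\<dots> = (\<Sum>w\<in>?W. int (q ^ (k - card U)) * f w)"
    proof (rule sum.cong[OF refl])
      fix w assume w: "w \<in> ?W"
      have "{y\<in>{..<k} \<rightarrow>\<^sub>E {..<q}. restrict y U = w} = {y\<in>{..<k} \<rightarrow>\<^sub>E {..<q}. \<forall>i\<in>U. y i = w i}"
        using w by (auto simp: fun_eq_iff PiE_def extensional_def)
      moreover have "card {y\<in>{..<k} \<rightarrow>\<^sub>E {..<q}. \<forall>i\<in>U. y i = w i} = q ^ (k - card U)"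
        by (rule card_PiE_fixed) (use low_base(1) w in auto)
      ultimately show "(\<Sum>y\<in>{y\<in>{..<k} \<rightarrow>\<^sub>E {..<q}. restrict y U = w}. f w) = int (q ^ (k - card U)) * f w"
        by simp
    qed
    finally show ?thesis .
  qed
  have "int (q ^ k) * int (q ^ (D - card U)) = int (q ^ D) * int (q ^ (k - card U))"
    using UD by (simp add: power_add[symmetric] add.commute)
  then show ?case unfolding 1 2 sum_distrib_left[symmetric] by (metis mult.assoc)
next
  case (low_add f g)
  then show ?case by (simp add: sum.distrib distrib_left)
qed

subsection \<open>Fully independent colours\<close>

lemma PiE_lessThan_Suc_sum:
  fixes F :: "(nat \<Rightarrow> nat) \<Rightarrow> 'a::comm_monoid_add"
  shows "(\<Sum>y\<in>{..<Suc k} \<rightarrow>\<^sub>E {..<q}. F y) = (\<Sum>y\<in>{..<k} \<rightarrow>\<^sub>E {..<q}. \<Sum>v<q. F (y(k := v)))"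
proof -
  have "{..<Suc k} \<rightarrow>\<^sub>E {..<q} = (\<lambda>(v, y). y(k := v)) ` ({..<q} \<times> ({..<k} \<rightarrow>\<^sub>E {..<q}))"
    using PiE_insert_eq[of k "{..<k}" "\<lambda>_. {..<q}"] by (simp add: lessThan_Suc)
  moreover have "inj_on (\<lambda>(v, y). y(k := v)) ({..<q} \<times> ({..<k} \<rightarrow>\<^sub>E {..<q}))"
    using inj_combinator[of k "{..<k}" "\<lambda>_. {..<q}"] by simp
  ultimately have "(\<Sum>y\<in>{..<Suc k} \<rightarrow>\<^sub>E {..<q}. F y) =
      sum (F \<circ> (\<lambda>(v, y). y(k := v))) ({..<q} \<times> ({..<k} \<rightarrow>\<^sub>E {..<q}))"
    by (metis sum.reindex)
  also have "\<dots> = (\<Sum>(v, y)\<in>{..<q} \<times> ({..<k} \<rightarrow>\<^sub>E {..<q}). F (y(k := v)))"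
    by (simp add: comp_def case_prod_beta)
  also have "\<dots> = (\<Sum>v<q. \<Sum>y\<in>{..<k} \<rightarrow>\<^sub>E {..<q}. F (y(k := v)))"
    by (simp add: sum.cartesian_product)
  finally show ?thesis by (subst (asm) sum.swap)
qed

lemma prior_upd: "i < k \<Longrightarrow> prior c (y(k := v)) i = prior c y i"
  unfolding prior_def by (rule arg_cong[where f = card]) auto

lemma sieve_upd: "inj_sieve c (y(k := v)) k = inj_sieve c y k"
  unfolding inj_sieve_def by (rule prod.cong) (auto simp: prior_upd)

text \<open>Double counting: each earlier point shares its colour with no more than \<open>M\<close>
  of the values that the new point can take.\<close>

lemma sum_prior_le:
  assumes M: "\<And>v. v < q \<Longrightarrow> card {u. u < q \<and> c u = c v} \<le> M" and y: "y \<in> {..<k} \<rightarrow>\<^sub>E {..<q}"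
  shows "(\<Sum>v<q. prior c (y(k := v)) k) \<le> k * M"
proof -
  have "prior c (y(k := v)) k = (\<Sum>i<k. of_bool (c (y i) = c v))" for v
  proof -
    have "{i'. i' < k \<and> c ((y(k := v)) i') = c ((y(k := v)) k)} = {i. i < k \<and> c (y i) = c v}" by auto
    then show ?thesis by (simp add: prior_def Int_def lessThan_def)
  qed
  then have "(\<Sum>v<q. prior c (y(k := v)) k) = (\<Sum>v<q. \<Sum>i<k. of_bool (c (y i) = c v))" by simp
  also have "\<dots> = (\<Sum>i<k. \<Sum>v<q. of_bool (c (y i) = c v))" by (rule sum.swap)
  also have "\<dots> \<le> (\<Sum>i<k. M)"
  proof (rule sum_mono)
    fix i assume "i \<in> {..<k}"
    then have "y i < q" using y by auto
    moreover have "{..<q} \<inter> {v. c (y i) = c v} = {u. u < q \<and> c u = c (y i)}" by auto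
    ultimately show "(\<Sum>v<q. of_bool (c (y i) = c v)) \<le> M" using M by simp
  qed
  finally show ?thesis by simp
qed

text \<open>The mean of coefficient J is at most C(kk, J) (k M / q)^J, by Pascal's rule: a new point
  either leaves the degree alone or raises it by one with a factor of mean at most k M / q. The
  bound keeps \<open>k\<close> fixed while \<open>kk\<close> grows, and is multiplied by q^J to
  avoid division.\<close>

lemma full_sieve_le:
  assumes M: "\<And>v. v < q \<Longrightarrow> card {u. u < q \<and> c u = c v} \<le> M" and "kk \<le> k"
  shows "int (q ^ J) * (\<Sum>y\<in>{..<kk} \<rightarrow>\<^sub>E {..<q}. coeff (inj_sieve c y kk) J) \<le>
    int ((kk choose J) * (k * M) ^ J * q ^ kk)"
  using assms(2)
proof (induction kk arbitrary: J)
  case 0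
  then show ?case by (cases J) (simp_all add: inj_sieve_def coeff_1)
next
  case (Suc kk)
  let ?E = "\<lambda>J. \<Sum>y\<in>{..<kk} \<rightarrow>\<^sub>E {..<q}. coeff (inj_sieve c y kk) J"
  show ?case
  proof (cases J)
    case 0
    have "coeff (inj_sieve c y kk) 0 = 1" for y kk by (induction kk) (simp_all add: inj_sieve_def)
    then show ?thesis unfolding 0 by (simp add: card_PiE)
  next
    case (Suc j)
    have "(\<Sum>y\<in>{..<Suc kk} \<rightarrow>\<^sub>E {..<q}. coeff (inj_sieve c y (Suc kk)) J) =
       (\<Sum>y\<in>{..<kk} \<rightarrow>\<^sub>E {..<q}. \<Sum>v<q. coeff (inj_sieve c y kk) J + int (prior c (y(kk := v)) kk) * coeff (inj_sieve c y kk) j)"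
      unfolding Suc PiE_lessThan_Suc_sum inj_sieve_Suc coeff_mult_linear sieve_upd by simp
    also have "\<dots> = (\<Sum>y\<in>{..<kk} \<rightarrow>\<^sub>E {..<q}. int q * coeff (inj_sieve c y kk) J +
        int (\<Sum>v<q. prior c (y(kk := v)) kk) * coeff (inj_sieve c y kk) j)"
      by (simp add: sum.distrib sum_distrib_right)
    also have "\<dots> \<le> (\<Sum>y\<in>{..<kk} \<rightarrow>\<^sub>E {..<q}. int q * coeff (inj_sieve c y kk) J +
        int (k * M) * coeff (inj_sieve c y kk) j)"
    proof (intro sum_mono add_left_mono mult_right_mono sieve_nonneg)
      fix y assume "y \<in> {..<kk} \<rightarrow>\<^sub>E {..<q}"
      then have "(\<Sum>v<q. prior c (y(kk := v)) kk) \<le> kk * M" by (intro sum_prior_le M)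
      also have "\<dots> \<le> k * M" using Suc.prems by simp
      finally show "int (\<Sum>v<q. prior c (y(kk := v)) kk) \<le> int (k * M)" by (simp only: of_nat_le_iff)
    qed
    also have "\<dots> = int q * ?E J + int (k * M) * ?E j" by (simp add: sum.distrib sum_distrib_left)
    finally have "int (q ^ J) * (\<Sum>y\<in>{..<Suc kk} \<rightarrow>\<^sub>E {..<q}. coeff (inj_sieve c y (Suc kk)) J)
        \<le> int (q ^ J) * (int q * ?E J + int (k * M) * ?E j)"
      by (rule mult_left_mono) simp
    also have "\<dots> = int q * (int (q ^ J) * ?E J) + int (k * M * q) * (int (q ^ j) * ?E j)"
      by (simp add: Suc algebra_simps)
    also have "\<dots> \<le> int q * int ((kk choose J) * (k * M) ^ J * q ^ kk) +
        int (k * M * q) * int ((kk choose j) * (k * M) ^ j * q ^ kk)"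
      using Suc.IH Suc.prems by (intro add_mono mult_left_mono) auto
    also have "\<dots> = int ((Suc kk choose J) * (k * M) ^ J * q ^ Suc kk)"
      by (simp add: Suc algebra_simps)
    finally show ?thesis .
  qed
qed

text \<open>Points are chosen one at a time; the colours used so far forbid at most k M of the q
  values.\<close>

lemma full_inj_ge:
  assumes M: "\<And>v. v < q \<Longrightarrow> card {u. u < q \<and> c u = c v} \<le> M" and "kk \<le> k"
  shows "(q - k * M) ^ kk \<le> card {y \<in> {..<kk} \<rightarrow>\<^sub>E {..<q}. inj_on (c \<circ> y) {..<kk}}"
  using assms(2)
proof (induction kk)
  case 0
  then show ?case by simp
next
  case (Suc kk)
  let ?I = "\<lambda>y. inj_on (c \<circ> y) {..<kk}"
  have ext: "inj_on (c \<circ> y(kk := v)) {..<Suc kk} \<longleftrightarrow> ?I y \<and> (\<forall>i<kk. c (y i) \<noteq> c v)" for y v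
  proof -
    have "inj_on (c \<circ> y(kk := v)) {..<kk} \<longleftrightarrow> ?I y" by (rule inj_on_cong) auto
    moreover have "(c \<circ> y(kk := v)) ` ({..<kk} - {kk}) = (\<lambda>i. c (y i)) ` {..<kk}" by (rule image_cong) auto
    moreover have "c v \<notin> (\<lambda>i. c (y i)) ` {..<kk} \<longleftrightarrow> (\<forall>i<kk. c (y i) \<noteq> c v)"
      by (simp add: image_iff Ball_def eq_commute[of "c v"])
    ultimately show ?thesis unfolding lessThan_Suc inj_on_insert by simp
  qed
  have "(q - k * M) ^ Suc kk \<le> card {y \<in> {..<kk} \<rightarrow>\<^sub>E {..<q}. ?I y} * (q - k * M)"
    unfolding power_Suc2 by (rule mult_right_mono[OF Suc.IH]) (use Suc.prems in simp_all)
  also have "\<dots> = (\<Sum>y\<in>{..<kk} \<rightarrow>\<^sub>E {..<q}. of_bool (?I y) * (q - k * M))"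
    by (simp add: sum_distrib_right[symmetric] finite_PiE Int_def)
  also have "\<dots> \<le> (\<Sum>y\<in>{..<kk} \<rightarrow>\<^sub>E {..<q}. \<Sum>v<q. of_bool (inj_on (c \<circ> y(kk := v)) {..<Suc kk}))"
  proof (rule sum_mono)
    fix y assume y: "y \<in> {..<kk} \<rightarrow>\<^sub>E {..<q}"
    have "q - k * M \<le> card ({..<q} - (\<Union>i<kk. {u. u < q \<and> c u = c (y i)}))"
    proof -
      have "card (\<Union>i<kk. {u. u < q \<and> c u = c (y i)}) \<le> (\<Sum>i<kk. card {u. u < q \<and> c u = c (y i)})"
        by (rule card_UN_le) simp
      also have "\<dots> \<le> (\<Sum>i<kk. M)" using y M by (intro sum_mono) auto
      also have "\<dots> \<le> k * M" using Suc.prems by simp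
      finally show ?thesis
        using diff_card_le_card_Diff[of "\<Union>i<kk. {u. u < q \<and> c u = c (y i)}" "{..<q}"] by auto
    qed
    also have "{..<q} - (\<Union>i<kk. {u. u < q \<and> c u = c (y i)}) = {..<q} \<inter> {v. \<forall>i<kk. c (y i) \<noteq> c v}"
      by auto
    finally show "of_bool (?I y) * (q - k * M) \<le> (\<Sum>v<q. of_bool (inj_on (c \<circ> y(kk := v)) {..<Suc kk}))"
      unfolding ext by simp
  qed
  also have "\<dots> = (\<Sum>y\<in>{..<Suc kk} \<rightarrow>\<^sub>E {..<q}. of_bool (inj_on (c \<circ> y) {..<Suc kk}))"
    by (rule PiE_lessThan_Suc_sum[symmetric])
  also have "\<dots> = card {y \<in> {..<Suc kk} \<rightarrow>\<^sub>E {..<q}. inj_on (c \<circ> y) {..<Suc kk}}"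
    by (simp add: finite_PiE Int_def)
  finally show ?case .
qed

text \<open>The indicator of injectivity is compared with its truncated sieve twice, over the
  polynomials and over all functions. The truncation and the error coefficient, of degree J + 1,
  depend on sums of at most 2 (J + 1) \<le> D coordinates, so their means agree on both sides and
  the two indicators differ in the mean by at most twice the mean error.\<close>

lemma poly_family_inj:
  fixes q D k J M :: nat and c :: "nat \<Rightarrow> nat"
  defines "I \<equiv> card {y \<in> {..<k} \<rightarrow>\<^sub>E {..<q}. inj_on (c \<circ> y) {..<k}}"
  assumes q: "prime q" and D: "D \<le> q" "2 * Suc J \<le> D"
    and M: "\<And>v. v < q \<Longrightarrow> card {u. u < q \<and> c u = c v} \<le> M"
    and S: "S \<subseteq> {..<q}" "card S = k"
  shows "\<bar>real (card {N. N < q ^ D \<and> inj_on (\<lambda>x. c (pval q D N x)) S}) / real q ^ D - real I / real q ^ k\<bar>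
     \<le> 2 * real (k choose Suc J) * (real k * real M / real q) ^ Suc J"
proof -
  have q0: "0 < q" using q prime_gt_0_nat by blast
  have finS: "finite S" using S finite_subset by blast
  obtain \<sigma> where \<sigma>: "bij_betw \<sigma> {..<k} S"
    using ex_bij_betw_nat_finite[OF finS] S(2) by (auto simp: atLeast0LessThan)
  then have \<sigma>': "inj_on \<sigma> {..<k}" "\<sigma> ` {..<k} \<subseteq> {..<q}" using S by (auto simp: bij_betw_def)
  let ?Y = "{..<k} \<rightarrow>\<^sub>E {..<q}"
  let ?y = "\<lambda>N i. pval q D N (\<sigma> i)"
  let ?P = "\<Sum>N<q ^ D. of_bool (inj_on (c \<circ> ?y N) {..<k}) :: int"
  let ?F = "\<Sum>y\<in>?Y. of_bool (inj_on (c \<circ> y) {..<k}) :: int"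
  let ?e = "\<lambda>y. coeff (inj_sieve c y k) (Suc J)"
  let ?a = "\<lambda>y. alt_sum (inj_sieve c y k) J"
  have la: "low k D ?a"
    unfolding alt_sum_def
  proof (rule low_sum)
    fix j assume "j \<in> {..J}"
    have "low k (2 * j + 0) (\<lambda>y. (-1) ^ j * coeff (inj_sieve c y k) j)"
      by (rule low_mult_base[OF low_sieve, of _ _ "{}"]) auto
    then show "low k D (\<lambda>y. (-1) ^ j * coeff (inj_sieve c y k) j)"
      using D \<open>j \<in> {..J}\<close> by (auto elim: low_mono)
  qed simp
  have le: "low k D ?e" using low_mono[OF low_sieve D(2)] by blast
  have "\<bar>int (q ^ k) * ?P - int (q ^ k) * (\<Sum>N<q ^ D. ?a (?y N))\<bar> \<le> int (q ^ k) * (\<Sum>N<q ^ D. ?e (?y N))"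
  proof -
    have "\<bar>?P - (\<Sum>N<q ^ D. ?a (?y N))\<bar> \<le> (\<Sum>N<q ^ D. ?e (?y N))"
      unfolding sum_subtractf[symmetric] by (rule order_trans[OF sum_abs sum_mono]) (rule sieve_truncated)
    then have "int (q ^ k) * \<bar>?P - (\<Sum>N<q ^ D. ?a (?y N))\<bar> \<le> int (q ^ k) * (\<Sum>N<q ^ D. ?e (?y N))"
      by (rule mult_left_mono) simp
    then show ?thesis by (simp add: abs_mult right_diff_distrib[symmetric])
  qed
  moreover have "\<bar>int (q ^ D) * ?F - int (q ^ D) * (\<Sum>y\<in>?Y. ?a y)\<bar> \<le> int (q ^ D) * (\<Sum>y\<in>?Y. ?e y)"
  proof -
    have "\<bar>?F - (\<Sum>y\<in>?Y. ?a y)\<bar> \<le> (\<Sum>y\<in>?Y. ?e y)"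
      unfolding sum_subtractf[symmetric] by (rule order_trans[OF sum_abs sum_mono]) (rule sieve_truncated)
    then have "int (q ^ D) * \<bar>?F - (\<Sum>y\<in>?Y. ?a y)\<bar> \<le> int (q ^ D) * (\<Sum>y\<in>?Y. ?e y)"
      by (rule mult_left_mono) simp
    then show ?thesis by (simp add: abs_mult right_diff_distrib[symmetric])
  qed
  moreover note low_average[OF q D(1) la order_refl \<sigma>'] low_average[OF q D(1) le order_refl \<sigma>']
  ultimately have main: "\<bar>int (q ^ k) * ?P - int (q ^ D) * ?F\<bar> \<le> 2 * (int (q ^ D) * (\<Sum>y\<in>?Y. ?e y))"
    by linarith
  have "inj_on (c \<circ> ?y N) {..<k} \<longleftrightarrow> inj_on (\<lambda>x. c (pval q D N x)) S" for N
  proof -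
    have "inj_on (\<lambda>x. c (pval q D N x)) (\<sigma> ` {..<k}) \<longleftrightarrow> inj_on ((\<lambda>x. c (pval q D N x)) \<circ> \<sigma>) {..<k}"
      using comp_inj_on_iff[OF \<sigma>'(1)] by blast
    then show ?thesis using \<sigma> by (simp add: comp_def bij_betw_def)
  qed
  then have P: "?P = int (card {N. N < q ^ D \<and> inj_on (\<lambda>x. c (pval q D N x)) S})"
    by (simp add: Int_def lessThan_def)
  have F: "?F = int I" by (simp add: I_def finite_PiE Int_def)
  let ?p = "card {N. N < q ^ D \<and> inj_on (\<lambda>x. c (pval q D N x)) S}"
  let ?E = "real_of_int (\<Sum>y\<in>?Y. ?e y)"
  have "\<bar>real_of_int (int (q ^ k) * ?P - int (q ^ D) * ?F)\<bar> \<le> real_of_int (2 * (int (q ^ D) * (\<Sum>y\<in>?Y. ?e y)))"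
    using main by (simp only: of_int_abs[symmetric] of_int_le_iff)
  then have m: "\<bar>real q ^ k * real ?p - real q ^ D * real I\<bar> \<le> 2 * real q ^ D * ?E"
    unfolding P F by simp
  have "real_of_int (int (q ^ Suc J) * (\<Sum>y\<in>?Y. ?e y)) \<le> real_of_int (int ((k choose Suc J) * (k * M) ^ Suc J * q ^ k))"
    using full_sieve_le[OF M order_refl, where J = "Suc J"] by (simp only: of_int_le_iff)
  then have E: "real q ^ Suc J * ?E \<le> real (k choose Suc J) * (real k * real M) ^ Suc J * real q ^ k"
    by (simp only: of_int_mult of_int_power of_int_of_nat_eq of_nat_mult of_nat_power)
  have "real ?p / real q ^ D - real I / real q ^ k =
      (real q ^ k * real ?p - real q ^ D * real I) / (real q ^ k * real q ^ D)"
    using q0 by (simp add: field_simps)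
  then have "\<bar>real ?p / real q ^ D - real I / real q ^ k\<bar> =
      \<bar>real q ^ k * real ?p - real q ^ D * real I\<bar> / (real q ^ k * real q ^ D)"
    by (simp add: abs_divide)
  also have "\<dots> \<le> 2 * real q ^ D * ?E / (real q ^ k * real q ^ D)"
    using m by (rule divide_right_mono) simp
  also have "\<dots> = 2 * (real q ^ Suc J * ?E) / (real q ^ k * real q ^ Suc J)"
    using q0 by (simp add: field_simps)
  also have "\<dots> \<le> 2 * (real (k choose Suc J) * (real k * real M) ^ Suc J * real q ^ k) / (real q ^ k * real q ^ Suc J)"
    using E by (intro divide_right_mono mult_left_mono) auto
  also have "\<dots> = 2 * real (k choose Suc J) * (real k * real M / real q) ^ Suc J"
    using q0 by (simp add: power_divide)
  finally show ?thesis .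
qed

subsection \<open>Balanced families\<close>

definition inj_count :: "nat \<Rightarrow> (nat \<Rightarrow> nat \<Rightarrow> nat) \<Rightarrow> nat set \<Rightarrow> nat" where
  "inj_count F tb S = card {i. i < F \<and> inj_on (tb i) S}"

text \<open>The counts are compared with the count of the particular set \<open>{..<k}\<close>,
  because this is the number the program measures on a path. The condition 12 k^2 \<le> \<epsilon> q
  keeps the hash functions that are not injective on a k-set, at most 3 k^2 q d of q^2 d, below a
  fraction \<epsilon>/4.\<close>

definition balanced_family ::
    "real \<Rightarrow> nat \<Rightarrow> nat \<Rightarrow> nat \<Rightarrow> nat \<Rightarrow> (nat \<Rightarrow> nat \<Rightarrow> nat) \<Rightarrow> bool" where
  "balanced_family \<epsilon> k q K F tb \<longleftrightarrow> prime q \<and> k \<le> q \<and> 12 * real k ^ 2 \<le> \<epsilon> * real q \<and>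
     k \<le> K \<and> (\<forall>i<F. \<forall>x<q. tb i x < K) \<and> 0 < inj_count F tb {..<k} \<and>
     (\<forall>S. S \<subseteq> {..<q} \<longrightarrow> card S = k \<longrightarrow>
        (1 - \<epsilon> / 8) * real (inj_count F tb {..<k}) \<le> real (inj_count F tb S) \<and>
        real (inj_count F tb S) \<le> (1 + \<epsilon> / 8) * real (inj_count F tb {..<k}))"

text \<open>The count of \<open>{..<k}\<close> is itself only within \<epsilon>/24 of
  \<open>p\<close>; the loss in replacing \<open>p\<close> by it turns \<epsilon>/24 into
  \<epsilon>/8.\<close>

lemma balanced_familyI:
  assumes "prime q" "k \<le> q" "12 * real k ^ 2 \<le> \<epsilon> * real q" "k \<le> K" "\<And>i x. i < F \<Longrightarrow> x < q \<Longrightarrow> tb i x < K"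
    and \<epsilon>: "0 < \<epsilon>" "\<epsilon> \<le> 1" and p: "0 < p"
    and S: "\<And>S. S \<subseteq> {..<q} \<Longrightarrow> card S = k \<Longrightarrow>
       (1 - \<epsilon> / 24) * p \<le> real (inj_count F tb S) \<and> real (inj_count F tb S) \<le> (1 + \<epsilon> / 24) * p"
  shows "balanced_family \<epsilon> k q K F tb"
proof -
  let ?T = "real (inj_count F tb {..<k})"
  have T: "(1 - \<epsilon> / 24) * p \<le> ?T" "?T \<le> (1 + \<epsilon> / 24) * p"
    using S[of "{..<k}"] assms(2) by auto
  have T0: "0 < ?T" using T(1) mult_pos_pos[of "1 - \<epsilon> / 24" p] p \<epsilon> by linarith
  have up: "(1 + \<epsilon> / 24) * p \<le> (1 + \<epsilon> / 8) * ?T"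
  proof -
    have "\<epsilon> * \<epsilon> \<le> \<epsilon>" using \<epsilon> by (simp add: mult_left_le)
    then have "1 + \<epsilon> / 24 \<le> (1 + \<epsilon> / 8) * (1 - \<epsilon> / 24)" using \<epsilon> by (simp add: field_simps)
    then have "(1 + \<epsilon> / 24) * p \<le> (1 + \<epsilon> / 8) * (1 - \<epsilon> / 24) * p" using p by (intro mult_right_mono) auto
    also have "\<dots> \<le> (1 + \<epsilon> / 8) * ?T" unfolding mult.assoc using T(1) \<epsilon> by (intro mult_left_mono) auto
    finally show ?thesis .
  qed
  have lo: "(1 - \<epsilon> / 8) * ?T \<le> (1 - \<epsilon> / 24) * p"
  proof -
    have "(1 - \<epsilon> / 8) * ?T \<le> (1 - \<epsilon> / 8) * ((1 + \<epsilon> / 24) * p)" using T(2) \<epsilon> by (intro mult_left_mono) auto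
    also have "\<dots> = (1 - \<epsilon> / 8) * (1 + \<epsilon> / 24) * p" by simp
    also have "\<dots> \<le> (1 - \<epsilon> / 24) * p"
    proof (rule mult_right_mono)
      have "0 \<le> \<epsilon> * \<epsilon>" using \<epsilon> by simp
      then show "(1 - \<epsilon> / 8) * (1 + \<epsilon> / 24) \<le> 1 - \<epsilon> / 24" using \<epsilon> by (simp add: field_simps)
    qed (use p in simp)
    finally show ?thesis .
  qed
  show ?thesis
    unfolding balanced_family_def
    using assms(1-5) T0 S up lo by (auto intro: order_trans)
qed

subsection \<open>Existence by averaging\<close>

text \<open>
  The functions are chosen one after the other so that the sum over all \<open>s\<close> of the two exponential
  moments never exceeds its initial value.
\<close>

lemma exists_balanced_list:
  fixes X :: "'s \<Rightarrow> 'f \<Rightarrow> bool" and p \<eta> :: real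
  assumes fin: "finite \<Omega>" "\<Omega> \<noteq> {}" "finite \<S>"
    and card: "\<And>s. s \<in> \<S> \<Longrightarrow> real (card {f \<in> \<Omega>. X s f}) = p * real (card \<Omega>)"
    and p: "0 < p" "p \<le> 1" and \<eta>: "0 < \<eta>" "\<eta> \<le> 1 / 2"
  shows "\<exists>fs. length fs = F \<and> set fs \<subseteq> \<Omega> \<and>
    (\<Sum>s\<in>\<S>. (1 + \<eta>) ^ length (filter (X s) fs) / (1 + \<eta> * p) ^ F +
            (1 - \<eta>) ^ length (filter (X s) fs) / (1 - \<eta> * p) ^ F) \<le> 2 * real (card \<S>)"
proof (induction F)
  case 0
  then show ?case by (intro exI[of _ "[]"]) simp
next
  case (Suc F)
  then obtain fs where fs: "length fs = F" "set fs \<subseteq> \<Omega>"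
    "(\<Sum>s\<in>\<S>. (1 + \<eta>) ^ length (filter (X s) fs) / (1 + \<eta> * p) ^ F +
            (1 - \<eta>) ^ length (filter (X s) fs) / (1 - \<eta> * p) ^ F) \<le> 2 * real (card \<S>)" by blast
  have \<eta>p: "0 < 1 + \<eta> * p" "0 < 1 - \<eta> * p"
    using p \<eta> mult_mono[of \<eta> "1/2" p 1] by (auto intro: add_pos_pos)
  \<comment> \<open>The mean over \<open>f\<close> multiplies the numerator by exactly 1 + t p,
    which the longer denominator cancels. The two moments are the cases t = \<eta> and t =
    -\<eta>.\<close>
  have one: "(\<Sum>f\<in>\<Omega>. (1 + t) ^ length (filter (X s) (f # fs)) / (1 + t * p) ^ Suc F) =
      real (card \<Omega>) * ((1 + t) ^ length (filter (X s) fs) / (1 + t * p) ^ F)"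
    if s: "s \<in> \<S>" and t: "0 < 1 + t * p" for s t
  proof -
    have "(\<Sum>f\<in>\<Omega>. (1 + t) ^ length (filter (X s) (f # fs))) =
       (\<Sum>f\<in>\<Omega>. (1 + t) ^ length (filter (X s) fs) * (1 + t * of_bool (X s f)))"
      by (rule sum.cong) auto
    also have "\<dots> = (1 + t) ^ length (filter (X s) fs) * (real (card \<Omega>) + t * (\<Sum>f\<in>\<Omega>. of_bool (X s f)))"
      by (simp add: sum_distrib_left[symmetric] sum.distrib)
    also have "(\<Sum>f\<in>\<Omega>. of_bool (X s f)) = p * real (card \<Omega>)"
      using card[OF s] fin by (simp add: Int_def)
    finally have "(\<Sum>f\<in>\<Omega>. (1 + t) ^ length (filter (X s) (f # fs))) =
       (1 + t) ^ length (filter (X s) fs) * (real (card \<Omega>) * (1 + t * p))"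
      by (simp add: algebra_simps)
    then have "(\<Sum>f\<in>\<Omega>. (1 + t) ^ length (filter (X s) (f # fs)) / (1 + t * p) ^ Suc F) =
        (1 + t) ^ length (filter (X s) fs) * (real (card \<Omega>) * (1 + t * p)) / ((1 + t * p) ^ F * (1 + t * p))"
      unfolding sum_divide_distrib[symmetric] power_Suc2 by (rule arg_cong)
    also have "\<dots> = real (card \<Omega>) * ((1 + t) ^ length (filter (X s) fs) / (1 + t * p) ^ F)"
      using t by simp
    finally show ?thesis .
  qed
  let ?\<Phi> = "\<lambda>f. \<Sum>s\<in>\<S>. (1 + \<eta>) ^ length (filter (X s) (f # fs)) / (1 + \<eta> * p) ^ Suc F +
            (1 - \<eta>) ^ length (filter (X s) (f # fs)) / (1 - \<eta> * p) ^ Suc F"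
  have "(\<Sum>f\<in>\<Omega>. ?\<Phi> f) = (\<Sum>s\<in>\<S>. (\<Sum>f\<in>\<Omega>. (1 + \<eta>) ^ length (filter (X s) (f # fs)) / (1 + \<eta> * p) ^ Suc F) +
      (\<Sum>f\<in>\<Omega>. (1 - \<eta>) ^ length (filter (X s) (f # fs)) / (1 - \<eta> * p) ^ Suc F))"
    by (subst sum.swap) (simp only: sum.distrib)
  also have "\<dots> = (\<Sum>s\<in>\<S>. real (card \<Omega>) * ((1 + \<eta>) ^ length (filter (X s) fs) / (1 + \<eta> * p) ^ F) +
      real (card \<Omega>) * ((1 - \<eta>) ^ length (filter (X s) fs) / (1 - \<eta> * p) ^ F))"
    using one[of _ \<eta>] one[of _ "- \<eta>"] \<eta>p by (intro sum.cong refl) simp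
  also have "\<dots> = real (card \<Omega>) * (\<Sum>s\<in>\<S>. (1 + \<eta>) ^ length (filter (X s) fs) / (1 + \<eta> * p) ^ F +
            (1 - \<eta>) ^ length (filter (X s) fs) / (1 - \<eta> * p) ^ F)"
    by (simp only: sum_distrib_left distrib_left)
  also have "\<dots> \<le> real (card \<Omega>) * (2 * real (card \<S>))"
    using fs(3) by (rule mult_left_mono) simp
  finally have le: "(\<Sum>f\<in>\<Omega>. ?\<Phi> f) \<le> (\<Sum>f\<in>\<Omega>. 2 * real (card \<S>))" by simp
  obtain f where f: "f \<in> \<Omega>" "?\<Phi> f \<le> 2 * real (card \<S>)"
  proof (rule ccontr)
    assume "\<not> thesis"
    then have "\<And>f. f \<in> \<Omega> \<Longrightarrow> 2 * real (card \<S>) < ?\<Phi> f" using that not_le by blast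
    then have "(\<Sum>f\<in>\<Omega>. 2 * real (card \<S>)) < (\<Sum>f\<in>\<Omega>. ?\<Phi> f)"
      by (intro sum_strict_mono fin)
    then show False using le by linarith
  qed
  then show ?case using fs by (intro exI[of _ "f # fs"]) auto
qed

text \<open>A single moment is at most the whole potential 2 |S|. Taking logarithms, with \<eta> -
  \<eta>^2 \<le> ln (1 + \<eta>), - \<eta> - 2 \<eta>^2 \<le> ln (1 - \<eta>) and ln (1 + x) \<le>
  x, and dividing by \<eta> leaves the stated two-sided bounds.\<close>

lemma chernoff_list:
  fixes X :: "'s \<Rightarrow> 'f \<Rightarrow> bool" and p \<eta> :: real
  assumes fin: "finite \<Omega>" "\<Omega> \<noteq> {}" "finite \<S>"
    and card: "\<And>s. s \<in> \<S> \<Longrightarrow> real (card {f \<in> \<Omega>. X s f}) = p * real (card \<Omega>)"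
    and p: "0 < p" "p \<le> 1" and \<eta>: "0 < \<eta>" "\<eta> \<le> 1 / 2"
    and F: "ln (2 * real (card \<S>)) \<le> real F * p * \<eta>\<^sup>2"
  shows "\<exists>fs. length fs = F \<and> set fs \<subseteq> \<Omega> \<and> (\<forall>s\<in>\<S>.
     (1 - \<eta>) * (real F * p) \<le> (1 + 2 * \<eta>) * real (length (filter (X s) fs)) \<and>
     (1 - \<eta>) * real (length (filter (X s) fs)) \<le> (1 + \<eta>) * (real F * p))"
proof -
  obtain fs where fs: "length fs = F" "set fs \<subseteq> \<Omega>"
    "(\<Sum>s\<in>\<S>. (1 + \<eta>) ^ length (filter (X s) fs) / (1 + \<eta> * p) ^ F +
            (1 - \<eta>) ^ length (filter (X s) fs) / (1 - \<eta> * p) ^ F) \<le> 2 * real (card \<S>)"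
    using exists_balanced_list[where X = X, OF fin card p \<eta>] by blast
  have \<eta>p: "0 < 1 + \<eta> * p" "0 < 1 - \<eta> * p"
    using p \<eta> mult_mono[of \<eta> "1/2" p 1] by (auto intro: add_pos_pos)
  have ln1: "\<eta> - \<eta>\<^sup>2 \<le> ln (1 + \<eta>)" using \<eta> by (intro ln_one_plus_pos_lower_bound) auto
  have ln3: "- \<eta> - 2 * \<eta>\<^sup>2 \<le> ln (1 - \<eta>)" using \<eta> by (intro ln_one_minus_pos_lower_bound) auto
  show ?thesis
  proof (intro exI[of _ fs] conjI ballI fs(1,2))
    fix s assume s: "s \<in> \<S>"
    let ?c = "length (filter (X s) fs)"
    let ?u = "(1 + \<eta>) ^ ?c / (1 + \<eta> * p) ^ F" and ?l = "(1 - \<eta>) ^ ?c / (1 - \<eta> * p) ^ F"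
    have c0: "0 < 2 * real (card \<S>)" using s fin(3) by (auto simp: card_gt_0_iff)
    have "?u + ?l \<le> (\<Sum>s\<in>\<S>. (1 + \<eta>) ^ length (filter (X s) fs) / (1 + \<eta> * p) ^ F +
            (1 - \<eta>) ^ length (filter (X s) fs) / (1 - \<eta> * p) ^ F)"
      using s fin(3) \<eta>p \<eta>
      by (intro member_le_sum[of s \<S> "\<lambda>s. (1 + \<eta>) ^ length (filter (X s) fs) / (1 + \<eta> * p) ^ F +
            (1 - \<eta>) ^ length (filter (X s) fs) / (1 - \<eta> * p) ^ F"]) auto
    then have ul: "?u + ?l \<le> 2 * real (card \<S>)" using fs(3) by linarith
    have pos: "0 < ?u" "0 < ?l" using \<eta>p \<eta> by auto
    have "ln ?u \<le> ln (2 * real (card \<S>))" using ul pos by (intro ln_mono) auto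
    then have u: "real ?c * ln (1 + \<eta>) - real F * ln (1 + \<eta> * p) \<le> real F * p * \<eta>\<^sup>2"
      using F \<eta> \<eta>p by (simp add: ln_div ln_realpow)
    have "ln ?l \<le> ln (2 * real (card \<S>))" using ul pos by (intro ln_mono) auto
    then have l: "real ?c * ln (1 - \<eta>) - real F * ln (1 - \<eta> * p) \<le> real F * p * \<eta>\<^sup>2"
      using F \<eta> \<eta>p by (simp add: ln_div ln_realpow)
    have "real ?c * (\<eta> - \<eta>\<^sup>2) \<le> real ?c * ln (1 + \<eta>)" using ln1 by (rule mult_left_mono) simp
    moreover have "real F * ln (1 + \<eta> * p) \<le> real F * (\<eta> * p)"
      using ln_add_one_self_le_self[of "\<eta> * p"] p \<eta> by (intro mult_left_mono) auto
    ultimately have "real ?c * (\<eta> - \<eta>\<^sup>2) \<le> real F * p * \<eta>\<^sup>2 + real F * (\<eta> * p)" using u by linarith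
    then have "\<eta> * ((1 - \<eta>) * real ?c) \<le> \<eta> * ((1 + \<eta>) * (real F * p))"
      by (simp add: algebra_simps power2_eq_square)
    then show "(1 - \<eta>) * real ?c \<le> (1 + \<eta>) * (real F * p)" using \<eta> by simp
    have "real ?c * (- ln (1 - \<eta>)) \<le> real ?c * (\<eta> + 2 * \<eta>\<^sup>2)" using ln3 by (intro mult_left_mono) auto
    moreover have "real F * ln (1 - \<eta> * p) \<le> real F * (- (\<eta> * p))"
      using ln_add_one_self_le_self2[of "- (\<eta> * p)"] \<eta>p by (intro mult_left_mono) auto
    ultimately have "real F * (\<eta> * p) - real F * p * \<eta>\<^sup>2 \<le> real ?c * (\<eta> + 2 * \<eta>\<^sup>2)" using l by linarith
    then have "\<eta> * ((1 - \<eta>) * (real F * p)) \<le> \<eta> * ((1 + 2 * \<eta>) * real ?c)"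
      by (simp add: algebra_simps power2_eq_square)
    then show "(1 - \<eta>) * (real F * p) \<le> (1 + 2 * \<eta>) * real ?c" using \<eta> by simp
  qed
qed

text \<open>The count depends on |S| only: along an enumeration \<open>\<sigma>\<close> of S the
  function becomes an injective sequence \<open>y\<close>, and outside S it is free.\<close>

lemma card_inj_functions:
  assumes S: "S \<subseteq> {..<q}" "card S = k"
  shows "card {f \<in> {..<q} \<rightarrow>\<^sub>E {..<K}. inj_on f S} =
    card {y \<in> {..<k} \<rightarrow>\<^sub>E {..<K}. inj_on y {..<k}} * K ^ (q - k)"
proof -
  have finS: "finite S" using S finite_subset by blast
  obtain \<sigma> where \<sigma>: "bij_betw \<sigma> {..<k} S"
    using ex_bij_betw_nat_finite[OF finS] S(2) by (auto simp: atLeast0LessThan)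
  then have inj: "inj_on \<sigma> {..<k}" and im: "\<sigma> ` {..<k} = S" by (auto simp: bij_betw_def)
  let ?Y = "{y \<in> {..<k} \<rightarrow>\<^sub>E {..<K}. inj_on y {..<k}}"
  let ?A = "\<lambda>y. {f \<in> {..<q} \<rightarrow>\<^sub>E {..<K}. \<forall>s\<in>S. f s = y (inv_into {..<k} \<sigma> s)}"
  have finY: "finite ?Y" by (rule finite_subset[of _ "{..<k} \<rightarrow>\<^sub>E {..<K}"]) (auto simp: finite_PiE)
  have A: "card (?A y) = K ^ (q - k)" if "y \<in> ?Y" for y
  proof -
    have "inv_into {..<k} \<sigma> s < k" if "s \<in> S" for s using that im inv_into_into[of s \<sigma> "{..<k}"] by simp
    then have "card (?A y) = K ^ (q - card S)" using that by (intro card_PiE_fixed S) auto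
    then show ?thesis using S by simp
  qed
  have iff: "f \<in> ?A y \<longleftrightarrow> f \<in> {..<q} \<rightarrow>\<^sub>E {..<K} \<and> y = restrict (f \<circ> \<sigma>) {..<k}" if "y \<in> ?Y" for f y
  proof -
    have "(\<forall>s\<in>S. f s = y (inv_into {..<k} \<sigma> s)) \<longleftrightarrow> (\<forall>i<k. f (\<sigma> i) = y i)"
    proof (intro iffI allI impI ballI)
      fix i assume "\<forall>s\<in>S. f s = y (inv_into {..<k} \<sigma> s)" "i < k"
      then show "f (\<sigma> i) = y i" using im inj by (metis imageI inv_into_f_f lessThan_iff)
    next
      fix s assume a: "\<forall>i<k. f (\<sigma> i) = y i" "s \<in> S"
      then have "inv_into {..<k} \<sigma> s < k" "\<sigma> (inv_into {..<k} \<sigma> s) = s"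
        using im inv_into_into[of s \<sigma> "{..<k}"] f_inv_into_f[of s \<sigma> "{..<k}"] by auto
      then show "f s = y (inv_into {..<k} \<sigma> s)" using a(1) by metis
    qed
    also have "\<dots> \<longleftrightarrow> y = restrict (f \<circ> \<sigma>) {..<k}"
    proof -
      have "y i = undefined" if "\<not> i < k" for i using \<open>y \<in> ?Y\<close> that by (auto dest: PiE_arb)
      then show ?thesis by (auto simp: fun_eq_iff)
    qed
    finally show ?thesis by blast
  qed
  have "{f \<in> {..<q} \<rightarrow>\<^sub>E {..<K}. inj_on f S} = (\<Union>y\<in>?Y. ?A y)"
  proof (intro equalityI subsetI)
    fix f assume f: "f \<in> {f \<in> {..<q} \<rightarrow>\<^sub>E {..<K}. inj_on f S}"
    let ?y = "restrict (f \<circ> \<sigma>) {..<k}"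
    have "\<sigma> i < q" if "i < k" for i using that im S by auto
    moreover have "inj_on (f \<circ> \<sigma>) {..<k}" using f im inj comp_inj_on by auto
    moreover have "inj_on ?y {..<k} \<longleftrightarrow> inj_on (f \<circ> \<sigma>) {..<k}" by (rule inj_on_cong) simp
    ultimately have y: "?y \<in> ?Y" using f by auto
    have "f \<in> ?A ?y" using iff[OF y, of f] f by simp
    then show "f \<in> (\<Union>y\<in>?Y. ?A y)" by (rule UN_I[OF y])
  next
    fix f assume "f \<in> (\<Union>y\<in>?Y. ?A y)"
    then obtain y where y: "y \<in> ?Y" "f \<in> ?A y" by blast
    have "y = restrict (f \<circ> \<sigma>) {..<k}" using iff[OF y(1)] y(2) by blast
    moreover have "inj_on (restrict (f \<circ> \<sigma>) {..<k}) {..<k} \<longleftrightarrow> inj_on (f \<circ> \<sigma>) {..<k}"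
      by (rule inj_on_cong) simp
    ultimately have "inj_on (f \<circ> \<sigma>) {..<k}" using y(1) by simp
    then have "inj_on f S" using im inj comp_inj_on_iff by blast
    then show "f \<in> {f \<in> {..<q} \<rightarrow>\<^sub>E {..<K}. inj_on f S}" using y by blast
  qed
  moreover have "card (\<Union>y\<in>?Y. ?A y) = (\<Sum>y\<in>?Y. card (?A y))"
  proof (rule card_UN_disjoint[OF finY])
    show "\<forall>y\<in>?Y. finite (?A y)" by (auto simp: finite_PiE)
    show "\<forall>y\<in>?Y. \<forall>y'\<in>?Y. y \<noteq> y' \<longrightarrow> ?A y \<inter> ?A y' = {}"
    proof (intro ballI impI, rule ccontr)
      fix y y' assume y: "y \<in> ?Y" "y' \<in> ?Y" "y \<noteq> y'" and "?A y \<inter> ?A y' \<noteq> {}"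
      then obtain f where "f \<in> ?A y" "f \<in> ?A y'" by (auto simp only: disjoint_iff)
      then have "y = restrict (f \<circ> \<sigma>) {..<k}" "y' = restrict (f \<circ> \<sigma>) {..<k}"
        using iff[OF y(1), of f] iff[OF y(2), of f] by blast+
      then show False using y(3) by simp
    qed
  qed
  ultimately show ?thesis using A by simp
qed

text \<open>With 2 k colours a random function is injective on a k-set with probability p \<ge> k^k
  / (2k)^k = 2^(-k). The size F is chosen such that F p \<eta>^2 \<ge> (k + 1) q, which generously
  exceeds the logarithm of twice the number of k-sets.\<close>

lemma balanced_family_exists:
  assumes \<epsilon>: "0 < \<epsilon>" "\<epsilon> \<le> 1" and k: "1 \<le> k"
  shows "\<exists>q F tb. balanced_family \<epsilon> k q (2 * k) F tb \<and> real q \<le> 2000 * (real k ^ 2 / \<epsilon>)\<^sup>2 \<and>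
     real F \<le> 2 ^ k * (real k + 1) * real q * (100 / \<epsilon>)\<^sup>2"
proof -
  \<comment> \<open>The prime then satisfies 12 k^2 \<le> \<epsilon> q by the first summand and k
    \<le> q by the second.\<close>
  define B where "B = nat \<lceil>12 * real k ^ 2 / \<epsilon>\<rceil> + k"
  have "k \<le> k ^ 2" using k by (simp add: power2_eq_square)
  then have kk: "real k \<le> real k ^ 2 / \<epsilon>" "1 \<le> real k ^ 2 / \<epsilon>"
  proof -
    have "real k \<le> real (k ^ 2)" using \<open>k \<le> k ^ 2\<close> by (simp only: of_nat_le_iff)
    then have "real k \<le> real k ^ 2" by simp
    moreover have "real k ^ 2 \<le> real k ^ 2 / \<epsilon>" using \<epsilon> by (simp add: le_divide_eq mult_left_le)
    moreover have "1 \<le> real k" using k by simp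
    ultimately show "real k \<le> real k ^ 2 / \<epsilon>" "1 \<le> real k ^ 2 / \<epsilon>" by linarith+
  qed
  have B1: "12 * real k ^ 2 / \<epsilon> \<le> real B" "k \<le> B" "1 \<le> B" using k unfolding B_def by linarith+
  have B2: "real B \<le> 14 * (real k ^ 2 / \<epsilon>)"
  proof -
    have "12 * real k ^ 2 / \<epsilon> = 12 * (real k ^ 2 / \<epsilon>)" by simp
    then show ?thesis using kk unfolding B_def by linarith
  qed
  obtain q where q: "prime q" "B \<le> q" "q \<le> 8 * B\<^sup>2" using prime_between[OF B1(3)] by blast
  have "real q \<le> 8 * real B ^ 2" 
  proof -
    have "real q \<le> real (8 * B\<^sup>2)" using q(3) by (simp only: of_nat_le_iff)
    then show ?thesis by simp
  qed
  also have "\<dots> \<le> 8 * (14 * (real k ^ 2 / \<epsilon>))\<^sup>2" using B2 by (intro mult_left_mono power_mono) auto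
  also have "\<dots> = 1568 * (real k ^ 2 / \<epsilon>)\<^sup>2" by (simp add: power2_eq_square)
  also have "\<dots> \<le> 2000 * (real k ^ 2 / \<epsilon>)\<^sup>2" by (intro mult_right_mono) auto
  finally have q2: "real q \<le> 2000 * (real k ^ 2 / \<epsilon>)\<^sup>2" .
  have q3: "k \<le> q" "12 * real k ^ 2 \<le> \<epsilon> * real q"
  proof -
    show "k \<le> q" using B1 q by linarith
    have "12 * real k ^ 2 / \<epsilon> \<le> real q" using B1 q(2) by linarith
    then show "12 * real k ^ 2 \<le> \<epsilon> * real q" using \<epsilon> by (simp add: field_simps)
  qed
  have q0: "2 \<le> q" using q(1) prime_ge_2_nat by blast
  define Y where "Y = card {y \<in> {..<k} \<rightarrow>\<^sub>E {..<2 * k}. inj_on y {..<k}}"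
  define p where "p = real Y / real (2 * k) ^ k"
  have "(2 * k - k * 1) ^ k \<le> card {y \<in> {..<k} \<rightarrow>\<^sub>E {..<2 * k}. inj_on (id \<circ> y) {..<k}}"
  proof (rule full_inj_ge)
    fix v
    have "{u. u < 2 * k \<and> id u = id v} \<subseteq> {v}" by auto
    then show "card {u. u < 2 * k \<and> id u = id v} \<le> 1" using card_mono[of "{v}"] by force
  qed simp
  then have Y1: "k ^ k \<le> Y" by (simp add: Y_def)
  have "Y \<le> card ({..<k} \<rightarrow>\<^sub>E {..<2 * k})" unfolding Y_def by (intro card_mono) (auto simp: finite_PiE)
  then have Y2: "Y \<le> (2 * k) ^ k" by (simp add: card_PiE)
  have p1: "1 / 2 ^ k \<le> p"
  proof -
    have "real (k ^ k) \<le> real Y" using Y1 by (simp only: of_nat_le_iff)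
    then have "real k ^ k / real (2 * k) ^ k \<le> p" unfolding p_def by (intro divide_right_mono) auto
    moreover have "real k ^ k / real (2 * k) ^ k = 1 / 2 ^ k" using k by (simp add: power_mult_distrib)
    ultimately show ?thesis by simp
  qed
  then have p0: "0 < p" by (smt (verit) divide_pos_pos zero_less_power)
  have "real Y \<le> real ((2 * k) ^ k)" using Y2 by (simp only: of_nat_le_iff)
  then have p2: "p \<le> 1" using k by (simp add: p_def)
  let ?\<Omega> = "{..<q} \<rightarrow>\<^sub>E {..<2 * k}" and ?\<S> = "{S. S \<subseteq> {..<q} \<and> card S = k}"
  \<comment> \<open>\<eta> is the reciprocal of an integer so that F is an integer. The deviations
    permitted by the moments add up to about 3 \<eta>, and 99 \<eta> \<le> \<epsilon> puts them
    below \<epsilon>/24.\<close>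
  define E where "E = nat \<lceil>99 / \<epsilon>\<rceil>"
  define \<eta> where "\<eta> = 1 / real E"
  define F where "F = 2 ^ k * (k + 1) * q * E\<^sup>2"
  have E1: "99 / \<epsilon> \<le> real E" "real E \<le> 100 / \<epsilon>" "99 \<le> real E"
  proof -
    have "99 \<le> 99 / \<epsilon>" "1 \<le> 1 / \<epsilon>" using \<epsilon> by (auto simp: field_simps)
    moreover have "100 / \<epsilon> = 99 / \<epsilon> + 1 / \<epsilon>" by (simp add: add_divide_distrib[symmetric])
    ultimately show "99 / \<epsilon> \<le> real E" "real E \<le> 100 / \<epsilon>" "99 \<le> real E" unfolding E_def by linarith+
  qed
  have \<eta>: "0 < \<eta>" "\<eta> \<le> 1 / 2" using E1 by (auto simp: \<eta>_def field_simps)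
  have \<eta>\<epsilon>: "99 * \<eta> \<le> \<epsilon>" using E1 \<epsilon> by (simp add: \<eta>_def field_simps)
  have fin: "finite ?\<Omega>" "?\<Omega> \<noteq> {}" "finite ?\<S>"
    using k by (auto simp: finite_PiE PiE_eq_empty_iff lessThan_empty_iff)
  have c: "real (card {f \<in> ?\<Omega>. inj_on f S}) = p * real (card ?\<Omega>)" if S: "S \<in> ?\<S>" for S
  proof -
    have "card {f \<in> ?\<Omega>. inj_on f S} = Y * (2 * k) ^ (q - k)"
      unfolding Y_def using S by (intro card_inj_functions) auto
    moreover have "real (2 * k) ^ q = real (2 * k) ^ k * real (2 * k) ^ (q - k)"
      using q3(1) by (simp only: power_add[symmetric] le_add_diff_inverse)
    ultimately show ?thesis using k by (simp add: p_def card_PiE)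
  qed
  have F1: "ln (2 * real (card ?\<S>)) \<le> real F * p * \<eta>\<^sup>2"
  proof -
    have "card ?\<S> = q choose k" using n_subsets[of "{..<q}" k] by simp
    also have "\<dots> \<le> q ^ k" by (rule binomial_le_pow) (use q3 in simp)
    finally have "real (card ?\<S>) \<le> real q ^ k" by (metis of_nat_le_iff of_nat_power)
    moreover have "0 < card ?\<S>"
    proof -
      have "card {{..<k}} \<le> card ?\<S>"
        by (rule card_mono[OF fin(3)]) (use q3 in simp)
      then show ?thesis by simp
    qed
    ultimately have "ln (2 * real (card ?\<S>)) \<le> ln (2 * real q ^ k)" by (intro ln_mono) auto
    also have "\<dots> = ln 2 + real k * ln (real q)" using q0 by (simp add: ln_mult ln_realpow)
    also have "\<dots> \<le> real q + real k * real q"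
    proof -
      have "ln 2 \<le> real q" using ln_2_less_1 q0 by linarith
      moreover have "ln (real q) \<le> real q" using ln_less_self[of "real q"] q0 by linarith
      ultimately show ?thesis using mult_left_mono[of "ln (real q)" "real q" "real k"] by linarith
    qed
    also have "\<dots> = (real k + 1) * real q" by (simp add: algebra_simps)
    also have "\<dots> \<le> (real k + 1) * real q * (2 ^ k * p)"
    proof -
      have "1 \<le> 2 ^ k * p" using p1 by (simp add: field_simps)
      then show ?thesis using mult_left_mono[of 1 "2 ^ k * p" "(real k + 1) * real q"] by simp
    qed
    also have "\<dots> = real F * p * \<eta>\<^sup>2" using E1(3) by (simp add: F_def \<eta>_def power2_eq_square field_simps)
    finally show ?thesis .
  qed
  have "\<exists>fs. length fs = F \<and> set fs \<subseteq> ?\<Omega> \<and> (\<forall>S\<in>?\<S>.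
     (1 - \<eta>) * (real F * p) \<le> (1 + 2 * \<eta>) * real (length (filter (\<lambda>f. inj_on f S) fs)) \<and>
     (1 - \<eta>) * real (length (filter (\<lambda>f. inj_on f S) fs)) \<le> (1 + \<eta>) * (real F * p))"
    by (rule chernoff_list[where X = "\<lambda>S f. inj_on f S", OF fin _ p0 p2 \<eta> F1]) (erule c)
  then obtain fs where fs: "length fs = F" "set fs \<subseteq> ?\<Omega>" "\<forall>S\<in>?\<S>.
     (1 - \<eta>) * (real F * p) \<le> (1 + 2 * \<eta>) * real (length (filter (\<lambda>f. inj_on f S) fs)) \<and>
     (1 - \<eta>) * real (length (filter (\<lambda>f. inj_on f S) fs)) \<le> (1 + \<eta>) * (real F * p)"
    by (elim exE conjE) (rule that; assumption)
  have "balanced_family \<epsilon> k q (2 * k) F (\<lambda>i. fs ! i)"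
  proof (rule balanced_familyI[OF q(1) q3])
    show "k \<le> 2 * k" by simp
    show "(fs ! i) x < 2 * k" if "i < F" "x < q" for i x
    proof -
      have "fs ! i \<in> ?\<Omega>" using fs that by (metis nth_mem subsetD)
      then show ?thesis using that by auto
    qed
    show "0 < \<epsilon>" "\<epsilon> \<le> 1" by (rule \<epsilon>)+
    have "0 < F" using q0 E1 by (auto simp: F_def)
    then show Fp: "0 < real F * p" using p0 by simp
    fix S assume S: "S \<subseteq> {..<q}" "card S = k"
    have len: "length (filter (\<lambda>f. inj_on f S) fs) = inj_count F ((!) fs) S"
      using fs(1) by (simp add: length_filter_conv_card inj_count_def)
    let ?c = "real (inj_count F ((!) fs) S)" and ?P = "real F * p"
    have 1: "(1 - \<eta>) * ?P \<le> (1 + 2 * \<eta>) * ?c" "(1 - \<eta>) * ?c \<le> (1 + \<eta>) * ?P"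
    proof -
      have "S \<in> ?\<S>" using S by simp
      from bspec[OF fs(3) this, unfolded len] show "(1 - \<eta>) * ?P \<le> (1 + 2 * \<eta>) * ?c" "(1 - \<eta>) * ?c \<le> (1 + \<eta>) * ?P"
        by simp_all
    qed
    show "(1 - \<epsilon> / 24) * ?P \<le> ?c \<and> ?c \<le> (1 + \<epsilon> / 24) * ?P"
    proof
      have "(1 + 2 * \<eta>) * ((1 - \<epsilon> / 24) * ?P) = ((1 + 2 * \<eta>) * (1 - \<epsilon> / 24)) * ?P" by simp
      also have "\<dots> \<le> (1 - \<eta>) * ?P"
      proof (rule mult_right_mono)
        have "0 \<le> \<eta> * \<epsilon>" using \<eta> \<epsilon> by simp
        moreover have "(1 + 2 * \<eta>) * (1 - \<epsilon> / 24) = 1 + 2 * \<eta> - \<epsilon> / 24 - \<eta> * \<epsilon> / 12"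
          by (simp add: field_simps)
        ultimately show "(1 + 2 * \<eta>) * (1 - \<epsilon> / 24) \<le> 1 - \<eta>" using \<eta>\<epsilon> \<eta> by linarith
      qed (use Fp in simp)
      also have "\<dots> \<le> (1 + 2 * \<eta>) * ?c" by (rule 1)
      finally show "(1 - \<epsilon> / 24) * ?P \<le> ?c" using \<eta> by (simp only: mult_le_cancel_left_pos)
      have "(1 - \<eta>) * ?c \<le> (1 + \<eta>) * ?P" by (rule 1)
      also have "\<dots> \<le> ((1 - \<eta>) * (1 + \<epsilon> / 24)) * ?P"
      proof (rule mult_right_mono)
        have "\<eta> * \<epsilon> \<le> \<eta>" using \<eta> \<epsilon> by (simp add: mult_left_le)
        moreover have "(1 - \<eta>) * (1 + \<epsilon> / 24) = 1 - \<eta> + \<epsilon> / 24 - \<eta> * \<epsilon> / 24"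
          by (simp add: field_simps)
        ultimately show "1 + \<eta> \<le> (1 - \<eta>) * (1 + \<epsilon> / 24)" using \<eta>\<epsilon> \<eta> by linarith
      qed (use Fp in simp)
      finally show "?c \<le> (1 + \<epsilon> / 24) * ?P" using \<eta> by (simp only: mult.assoc mult_le_cancel_left_pos)
    qed
  qed
  moreover have "real F \<le> 2 ^ k * (real k + 1) * real q * (100 / \<epsilon>)\<^sup>2"
  proof -
    have "real F = 2 ^ k * (real k + 1) * real q * (real E)\<^sup>2" by (simp add: F_def algebra_simps)
    moreover have "(real E)\<^sup>2 \<le> (100 / \<epsilon>)\<^sup>2" using E1 by (intro power_mono) auto
    ultimately show ?thesis by (simp add: mult_left_mono)
  qed
  ultimately show ?thesis using q2 by blast
qed

subsection \<open>Polynomial families\<close>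

text \<open>Used for C(k, n) \<le> (3 k / n)^n; the step from n to n + 1 is (1 + 1/n)^n \<le> e
  \<le> 3.\<close>

lemma power_self_le_fact: "real n ^ n \<le> 3 ^ n * fact n"
proof (induction n)
  case (Suc n)
  show ?case
  proof (cases "n = 0")
    case False
    have "real (Suc n) ^ n = (1 + 1 / real n) ^ n * real n ^ n"
      using False by (simp add: power_mult_distrib[symmetric] field_simps)
    also have "\<dots> \<le> 3 * real n ^ n"
    proof (rule mult_right_mono)
      have "(1 + 1 / real n) ^ n \<le> exp 1"
        using exp_ge_one_plus_x_over_n_power_n[of n 1] False by simp
      also have "\<dots> \<le> 3" by (rule exp_le)
      finally show "(1 + 1 / real n) ^ n \<le> 3" .
    qed simp
    also have "\<dots> \<le> 3 * (3 ^ n * fact n)" using Suc by simp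
    finally have "real (Suc n) * real (Suc n) ^ n \<le> real (Suc n) * (3 * (3 ^ n * fact n))"
      by (intro mult_left_mono) auto
    then show ?thesis by (simp add: algebra_simps)
  qed simp
qed simp

lemma card_mod_class:
  assumes "0 < (K::nat)"
  shows "card {u. u < q \<and> u mod K = r} \<le> q div K + 1"
proof -
  have "{u. u < q \<and> u mod K = r} \<subseteq> (\<lambda>j. j * K + r) ` {..q div K}"
  proof
    fix u assume u: "u \<in> {u. u < q \<and> u mod K = r}"
    then have "u = u div K * K + r" "u div K \<le> q div K"
      using div_mult_mod_eq[of u K] by (auto intro: div_le_mono)
    then show "u \<in> (\<lambda>j. j * K + r) ` {..q div K}" by blast
  qed
  then have "card {u. u < q \<and> u mod K = r} \<le> card ((\<lambda>j. j * K + r) ` {..q div K})"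
    by (rule card_mono[rotated]) simp
  also have "\<dots> \<le> card {..q div K}" by (rule card_image_le) simp
  finally show ?thesis by simp
qed

text \<open>A colour class has M \<le> 2 q / K elements, so x = k M / q \<le> 1/L and the
  probability p of injectivity is at least exp(-2k/L). The factor 128 in D gives J + 1 \<ge> 63 k/L
  for the degree n = J + 1 of the sieve error. Hence C(k, n) x^n \<le> (3 k / (L n))^n \<le>
  (1/21)^n \<le> exp(-2n) \<le> exp(-3k/L), and the factor exp(-k/L) that is left beyond p is at
  most \<epsilon>/48.\<close>

lemma polynomial_family_balanced:
  assumes \<epsilon>: "0 < \<epsilon>" "\<epsilon> \<le> 1" and k: "8 \<le> k" "48 / \<epsilon> \<le> exp (real k / real L)" "12 \<le> \<epsilon> * real k"
    and L: "2 \<le> L" "L \<le> k" and kL: "k \<le> 2 ^ L" and q: "prime q" "16 ^ L \<le> q"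
    and D: "128 * k \<le> D * L" "D \<le> 128 * k + 1"
  shows "balanced_family \<epsilon> k q (2 * k * L) (q ^ D) (\<lambda>N x. pval q D N x mod (2 * k * L))"
proof -
  define K where "K = 2 * k * L"
  define M where "M = q div K + 1"
  define I where "I = card {y \<in> {..<k} \<rightarrow>\<^sub>E {..<q}. inj_on ((\<lambda>u. u mod K) \<circ> y) {..<k}}"
  \<comment> \<open>The largest J with 2 (J + 1) \<le> D, as the error coefficient has degree J +
    1.\<close>
  define J where "J = D div 2 - 1"
  define x where "x = real k * real M / real q"
  define p where "p = real I / real q ^ k"
  have K0: "0 < K" "k \<le> K" using k L by (auto simp: K_def)
  \<comment> \<open>The base 16 is chosen for k^4 \<le> 16^L \<le> q: this single bound makes q
    large enough for D, for 2 K and for 12 k^2 / \<epsilon>.\<close>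
  have "k ^ 4 \<le> (2 ^ L) ^ 4" using kL by (rule power_mono) simp
  also have "(2 ^ L) ^ 4 = ((2::nat) ^ 4) ^ L" by (simp only: power_mult[symmetric] mult.commute)
  also have "\<dots> = 16 ^ L" by simp
  finally have qk: "k ^ 4 \<le> q" using q by simp
  have k4: "k ^ 4 = k * k * (k * k)" by (simp add: power4_eq_xxxx)
  have kk: "8 * k \<le> k * k" using k by simp
  have kkk: "8 * (8 * (8 * k)) \<le> k * k * (k * k)"
  proof -
    have "8 * 8 * (8 * k) \<le> k * k * (k * k)" using k kk by (intro mult_le_mono) auto
    then show ?thesis by simp
  qed
  have Dq: "D \<le> q" using D(2) qk k4 kkk k by linarith
  have q0: "0 < q" using q prime_gt_0_nat by blast
  have kq: "k \<le> q" using qk k4 kkk by linarith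
  have "2 * K \<le> q"
  proof -
    have "2 * K = 4 * k * L" by (simp add: K_def)
    also have "\<dots> \<le> k * k * (k * k)"
    proof (intro mult_le_mono)
      show "L \<le> k * k" using L kk by linarith
    qed (use k in auto)
    finally show ?thesis using qk k4 by linarith
  qed
  then have M: "real M \<le> 2 * real q / real K"
  proof -
    have "real (q div K) \<le> real q / real K" by (rule of_nat_div_le_of_nat)
    moreover have "1 \<le> real q / real K" using \<open>2 * K \<le> q\<close> K0 by (simp add: le_divide_eq)
    ultimately show ?thesis by (simp add: M_def)
  qed
  have x: "0 \<le> x" "x \<le> 1 / real L"
  proof -
    have "x \<le> real k * (2 * real q / real K) / real q"
      unfolding x_def using M by (intro divide_right_mono mult_left_mono) auto
    also have "\<dots> = 1 / real L" using q0 k L by (simp add: K_def)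
    finally show "x \<le> 1 / real L" .
  qed (simp add: x_def)
  moreover have "1 / real L \<le> 1 / 2" using L by (simp add: field_simps)
  ultimately have x2: "x \<le> 1 / 2" by linarith
  have Mc: "card {u. u < q \<and> u mod K = v mod K} \<le> M" for v
    unfolding M_def by (rule card_mod_class[OF K0(1)])
  have p_ge: "exp (- 2 * real k / real L) \<le> p"
  proof -
    have "(q - k * M) ^ k \<le> I"
      unfolding I_def by (rule full_inj_ge[OF Mc order_refl])
    then have "real ((q - k * M) ^ k) \<le> real I" by (simp only: of_nat_le_iff)
    then have "real (q - k * M) ^ k \<le> real I" by (simp only: of_nat_power)
    moreover have "real q - real k * real M \<le> real (q - k * M)"
    proof -
      have "q \<le> (q - k * M) + k * M" by simp
      then have "real q \<le> real ((q - k * M) + k * M)" by (simp only: of_nat_le_iff)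
      then show ?thesis by simp
    qed
    moreover have "0 \<le> real q - real k * real M" using x2 q0 by (simp add: x_def field_simps)
    ultimately have "(real q - real k * real M) ^ k \<le> real I"
      using power_mono[of "real q - real k * real M" "real (q - k * M)" k] by linarith
    then have "((real q - real k * real M) / real q) ^ k \<le> p"
      unfolding p_def power_divide by (rule divide_right_mono) simp
    moreover have "(real q - real k * real M) / real q = 1 - x" using q0 by (simp add: x_def field_simps)
    ultimately have "(1 - x) ^ k \<le> p" by simp
    \<comment> \<open>Valid for x \<le> 1/2, which is where 2 \<le> L enters.\<close>
    moreover have "exp (- 2 * x) \<le> 1 - x"
    proof -
      have "x * (2 * x) \<le> x * 1" using x x2 by (intro mult_left_mono) auto
      then have "1 \<le> (1 - x) * (1 + 2 * x)" by (simp add: algebra_simps)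
      also have "\<dots> \<le> (1 - x) * exp (2 * x)"
        using exp_ge_add_one_self[of "2 * x"] x2 by (intro mult_left_mono) auto
      finally show ?thesis by (simp add: exp_minus field_simps)
    qed
    then have "exp (- 2 * x) ^ k \<le> (1 - x) ^ k" by (rule power_mono) simp
    moreover have "exp (- 2 * real k / real L) \<le> exp (- 2 * x) ^ k"
    proof -
      have "real k * x \<le> real k * (1 / real L)" using x by (intro mult_left_mono) auto
      then show ?thesis by (simp add: exp_of_nat_mult[symmetric])
    qed
    ultimately show ?thesis by linarith
  qed
  have p0: "0 < p" using p_ge exp_gt_zero by (rule less_le_trans[rotated])
  have kL1: "1 \<le> real k / real L" using L by simp
  have DL: "128 * (real k / real L) \<le> real D"
  proof -
    have "real (128 * k) \<le> real (D * L)" using D(1) by (simp only: of_nat_le_iff)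
    then show ?thesis using L by (simp add: field_simps)
  qed
  then have D2: "128 \<le> real D" using kL1 by linarith
  have J: "2 * Suc J \<le> D" "63 * (real k / real L) \<le> real (Suc J)"
  proof -
    have "128 \<le> D" using D2 by linarith
    then have "Suc J = D div 2" by (simp add: J_def)
    then show "2 * Suc J \<le> D" by simp
    have "real D \<le> 2 * real (D div 2) + 1" by linarith
    then show "63 * (real k / real L) \<le> real (Suc J)" using DL kL1 \<open>Suc J = D div 2\<close> by linarith
  qed
  have err: "2 * real (k choose Suc J) * x ^ Suc J \<le> \<epsilon> / 24 * p"
  proof -
    let ?n = "Suc J"
    have "real ((k choose ?n) * fact ?n) \<le> real (k ^ ?n)"
      using binomial_fact_pow[of k ?n] by (simp only: of_nat_le_iff)
    then have "real (k choose ?n) * fact ?n \<le> real k ^ ?n"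
      by (simp only: of_nat_mult of_nat_power of_nat_fact)
    then have "3 ^ ?n * (real (k choose ?n) * fact ?n) \<le> 3 ^ ?n * real k ^ ?n"
      by (rule mult_left_mono) simp
    moreover have "real (k choose ?n) * real ?n ^ ?n \<le> real (k choose ?n) * (3 ^ ?n * fact ?n)"
      by (intro mult_left_mono power_self_le_fact) simp
    ultimately have "real (k choose ?n) * real ?n ^ ?n \<le> 3 ^ ?n * real k ^ ?n"
      unfolding mult.left_commute[of "real (k choose ?n)"] by (rule order_trans[rotated])
    moreover have "(0::real) < real ?n ^ ?n" by (rule zero_less_power) simp
    ultimately have "real (k choose ?n) \<le> (3 ^ ?n * real k ^ ?n) / real ?n ^ ?n"
      by (simp only: pos_le_divide_eq)
    then have "real (k choose ?n) \<le> (3 * real k / real ?n) ^ ?n"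
      by (simp only: power_divide power_mult_distrib)
    then have "real (k choose ?n) * x ^ ?n \<le> (3 * real k / real ?n) ^ ?n * (1 / real L) ^ ?n"
      using x by (intro mult_mono power_mono) auto
    also have "\<dots> = (3 * (real k / real L) / real ?n) ^ ?n"
      unfolding power_mult_distrib[symmetric] by (simp add: mult.commute)
    also have "\<dots> \<le> (1 / 21) ^ ?n"
    proof (rule power_mono)
      have "3 * z \<le> 1 / 21 * n" if "63 * z \<le> n" for z n :: real using that by simp
      note this[OF J(2)]
      then show "3 * (real k / real L) / real ?n \<le> 1 / 21"
        by (simp only: pos_divide_le_eq of_nat_0_less_iff zero_less_Suc)
    qed simp
    also have "\<dots> \<le> exp (- 2) ^ ?n"
    proof (rule power_mono)
      have "exp (2::real) = exp 1 ^ 2" by (simp add: exp_of_nat_mult[symmetric])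
      also have "\<dots> \<le> 3 ^ 2" by (intro power_mono exp_le) simp
      finally show "1 / 21 \<le> exp (- 2 :: real)" by (simp add: exp_minus field_simps)
    qed simp
    also have "\<dots> = exp (- (2 * real ?n))" by (simp add: exp_of_nat_mult[symmetric] del: of_nat_Suc power_Suc)
    also have "\<dots> \<le> exp (- 3 * (real k / real L))"
    proof -
      have "- (2 * n) \<le> - 3 * z" if "63 * z \<le> n" "1 \<le> z" for z n :: real using that by linarith
      from this[OF J(2) kL1] show ?thesis by (simp only: exp_le_cancel_iff)
    qed
    also have "\<dots> = exp (- 2 * real k / real L) * exp (- (real k / real L))"
      by (simp add: exp_add[symmetric])
    also have "\<dots> \<le> p * (\<epsilon> / 48)"
    proof (rule mult_mono[OF p_ge])
      show "exp (- (real k / real L)) \<le> \<epsilon> / 48" using k(2) \<epsilon> by (simp add: exp_minus field_simps)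
    qed (use p0 \<epsilon> in auto)
    finally show ?thesis by (simp add: mult_ac)
  qed
  show ?thesis
    unfolding K_def[symmetric]
  proof (rule balanced_familyI[OF q(1) kq _ K0(2) _ \<epsilon>])
    have "12 * real k \<le> \<epsilon> * real k * real k" using k(3) by (intro mult_right_mono) auto
    have "12 * real k ^ 2 \<le> \<epsilon> * real k * real k ^ 2" using k(3) by (intro mult_right_mono) auto
    also have "\<dots> = \<epsilon> * real (k ^ 3)" by (simp add: power3_eq_cube power2_eq_square)
    also have "\<dots> \<le> \<epsilon> * real (k ^ 4)" using \<epsilon> k by (intro mult_left_mono of_nat_mono power_increasing) auto
    also have "\<dots> \<le> \<epsilon> * real q" using \<epsilon> qk by (intro mult_left_mono of_nat_mono) auto
    finally show "12 * real k ^ 2 \<le> \<epsilon> * real q" .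
    show "pval q D N x mod K < K" for N x using K0 by simp
    have Fp: "0 < real (q ^ D)" using q0 by simp
    then show "0 < real (q ^ D) * p" using p0 by simp
    fix S assume S: "S \<subseteq> {..<q}" "card S = k"
    let ?c = "real (inj_count (q ^ D) (\<lambda>N x. pval q D N x mod K) S)"
    have "\<bar>?c / real q ^ D - p\<bar> \<le> 2 * real (k choose Suc J) * x ^ Suc J"
      unfolding inj_count_def p_def x_def I_def
      by (rule poly_family_inj[OF q(1) Dq J(1) _ S]) (rule Mc)
    also note err
    finally have c: "\<bar>?c / real q ^ D - p\<bar> \<le> \<epsilon> / 24 * p" .
    have Q: "0 < real q ^ D" using q0 by simp
    have "?c / real q ^ D - p = (?c - p * real q ^ D) / real q ^ D"
      using Q by (simp add: diff_divide_distrib)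
    then have "\<bar>?c - p * real q ^ D\<bar> / real q ^ D \<le> \<epsilon> / 24 * p"
      using c by (simp only: abs_divide abs_of_pos[OF Q])
    then have "\<bar>?c - p * real q ^ D\<bar> \<le> \<epsilon> / 24 * p * real q ^ D"
      using Q by (simp only: pos_divide_le_eq)
    moreover have "(1 - \<epsilon> / 24) * (real (q ^ D) * p) = p * real q ^ D - \<epsilon> / 24 * p * real q ^ D"
      "(1 + \<epsilon> / 24) * (real (q ^ D) * p) = p * real q ^ D + \<epsilon> / 24 * p * real q ^ D"
      by (simp_all add: algebra_simps)
    ultimately show "(1 - \<epsilon> / 24) * (real (q ^ D) * p) \<le> ?c \<and> ?c \<le> (1 + \<epsilon> / 24) * (real (q ^ D) * p)"
      by linarith
  qed
qed

text \<open>k / log k tends to infinity. The quantifier over \<open>L\<close> is meant for the least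
  L \<ge> 1 with k \<le> 2^L, which the program computes.\<close>

lemma eventually_large:
  assumes "0 < \<epsilon>"
  shows "\<exists>K0. \<forall>k\<ge>K0. 8 \<le> k \<and> 12 \<le> \<epsilon> * real k \<and>
    (\<forall>L. real L \<le> log 2 (real k) + 1 \<longrightarrow> 0 < L \<longrightarrow> 48 / \<epsilon> \<le> exp (real k / real L))"
proof -
  have "filterlim (\<lambda>k. exp (real k / (log 2 (real k) + 1))) at_top sequentially" by real_asymp
  then have "eventually (\<lambda>k. 48 / \<epsilon> \<le> exp (real k / (log 2 (real k) + 1))) sequentially"
    by (simp add: filterlim_at_top)
  moreover have "filterlim (\<lambda>k. \<epsilon> * real k) at_top sequentially" using assms by real_asymp
  then have "eventually (\<lambda>k. 12 \<le> \<epsilon> * real k) sequentially" by (simp add: filterlim_at_top)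
  moreover have "eventually (\<lambda>k::nat. 8 \<le> k) sequentially" by (rule eventually_ge_at_top)
  ultimately have "eventually (\<lambda>k. 8 \<le> k \<and> 12 \<le> \<epsilon> * real k \<and>
    (\<forall>L. real L \<le> log 2 (real k) + 1 \<longrightarrow> 0 < L \<longrightarrow> 48 / \<epsilon> \<le> exp (real k / real L))) sequentially"
  proof eventually_elim
    case (elim k)
    have "48 / \<epsilon> \<le> exp (real k / real L)" if "real L \<le> log 2 (real k) + 1" "0 < L" for L
    proof -
      have "real k / (log 2 (real k) + 1) \<le> real k / real L" using that by (intro divide_left_mono) auto
      then show ?thesis using elim(1) by (meson exp_le_cancel_iff order_trans)
    qed
    then show ?case using elim by blast
  qed
  then show ?thesis by (simp add: eventually_at_top_linorder)
qed

subsection \<open>Walks and colourful walks\<close>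

text \<open>Walks are written from their last vertex to their first one.\<close>

fun rwalk :: "(nat \<times> nat) set \<Rightarrow> nat list \<Rightarrow> bool" where
  "rwalk E (v # u # p) \<longleftrightarrow> (u, v) \<in> E \<and> rwalk E (u # p)"
| "rwalk E p \<longleftrightarrow> True"

definition walks :: "(nat \<times> nat) set \<Rightarrow> nat \<Rightarrow> (nat \<Rightarrow> bool) \<Rightarrow> nat list set" where
  "walks E k ok = {p. length p = k \<and> rwalk E p \<and> (\<forall>x\<in>set p. ok x)}"

text \<open>The index counts edges, so \<open>walk_count es ok j v\<close> concerns walks with j + 1
  vertices that end in \<open>v\<close>. The form is that of the dynamic program: one pass over the
  edge list per step.\<close>

fun walk_count :: "(nat \<times> nat) list \<Rightarrow> (nat \<Rightarrow> bool) \<Rightarrow> nat \<Rightarrow> nat \<Rightarrow> nat" where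
  "walk_count es ok 0 v = of_bool (ok v)"
| "walk_count es ok (Suc j) v =
     (if ok v then \<Sum>(u, w)\<leftarrow>es. if w = v then walk_count es ok j u else 0 else 0)"

lemma finite_walks:
  assumes "\<And>v. ok v \<Longrightarrow> v < nv"
  shows "finite (walks E k ok)"
  by (rule finite_subset[OF _ finite_lists_length_eq[of "{..<nv}" k]])
    (use assms in \<open>auto simp: walks_def\<close>)

lemma walk_count_card:
  assumes "distinct es" and ok: "\<And>v. ok v \<Longrightarrow> v < nv"
  shows "walk_count es ok j v = card {p \<in> walks (set es) (Suc j) ok. hd p = v}"
proof (induction j arbitrary: v)
  case 0
  have "{p \<in> walks (set es) (Suc 0) ok. hd p = v} = (if ok v then {[v]} else {})"
    by (auto simp: walks_def length_Suc_conv)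
  then show ?case by simp
next
  case (Suc j)
  let ?P = "\<lambda>j v. {p \<in> walks (set es) (Suc j) ok. hd p = v}"
  show ?case
  proof (cases "ok v")
    case False
    have "?P (Suc j) v = {}" using False by (auto simp: walks_def length_Suc_conv)
    then have "card (?P (Suc j) v) = 0" by (simp only: card.empty)
    then show ?thesis using False by simp
  next
    case True
    let ?U = "{u. (u, v) \<in> set es}"
    have finU: "finite ?U"
      by (rule finite_subset[of _ "fst ` set es"]) (auto intro: rev_image_eqI)
    have "?P (Suc j) v = (\<Union>u\<in>?U. (#) v ` ?P j u)"
    proof (intro equalityI subsetI)
      fix p assume p: "p \<in> ?P (Suc j) v"
      then obtain u r where "p = v # u # r" by (auto simp: walks_def length_Suc_conv)
      then show "p \<in> (\<Union>u\<in>?U. (#) v ` ?P j u)" using p by (auto simp: walks_def)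
    next
      fix p assume "p \<in> (\<Union>u\<in>?U. (#) v ` ?P j u)"
      then obtain u r where "(u, v) \<in> set es" "r \<in> ?P j u" "p = v # r" by auto
      then show "p \<in> ?P (Suc j) v" using True by (cases r) (auto simp: walks_def)
    qed
    moreover have "card (\<Union>u\<in>?U. (#) v ` ?P j u) = (\<Sum>u\<in>?U. card ((#) v ` ?P j u))"
      by (rule card_UN_disjoint[OF finU]) (use finite_walks[OF ok] in auto)
    moreover have "card ((#) v ` ?P j u) = walk_count es ok j u" for u
      unfolding Suc.IH by (rule card_image) (simp add: inj_on_def)
    ultimately have "card (?P (Suc j) v) = (\<Sum>u\<in>?U. walk_count es ok j u)" by simp
    also have "\<dots> = (\<Sum>(u, w)\<in>{e \<in> set es. snd e = v}. walk_count es ok j u)"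
      by (rule sum.reindex_bij_witness[of _ fst "\<lambda>u. (u, v)"]) auto
    also have "\<dots> = (\<Sum>e\<in>set es. if snd e = v then walk_count es ok j (fst e) else 0)"
      by (rule sum.mono_neutral_cong_left) auto
    also have "\<dots> = (\<Sum>e\<leftarrow>es. if snd e = v then walk_count es ok j (fst e) else 0)"
      using assms(1) by (simp add: sum_list_distinct_conv_sum_set)
    also have "\<dots> = walk_count es ok (Suc j) v" using True by (simp add: split_def)
    finally show ?thesis by simp
  qed
qed

lemma walk_count_total:
  assumes "distinct es" and ok: "\<And>v. ok v \<Longrightarrow> v < nv" and k: "1 \<le> k"
  shows "(\<Sum>v<nv. walk_count es ok (k - 1) v) = card (walks (set es) k ok)"
proof -
  have sk: "Suc (k - 1) = k" using k by simp
  have "walks (set es) k ok = (\<Union>v<nv. {p \<in> walks (set es) k ok. hd p = v})"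
  proof -
    have "hd p < nv" if "p \<in> walks (set es) k ok" for p
      using that k ok by (cases p) (auto simp: walks_def)
    then show ?thesis by auto
  qed
  then have "card (walks (set es) k ok) = card (\<Union>v<nv. {p \<in> walks (set es) k ok. hd p = v})"
    by (rule arg_cong)
  also have "\<dots> = (\<Sum>v<nv. card {p \<in> walks (set es) k ok. hd p = v})"
    by (rule card_UN_disjoint) (use finite_walks[OF ok] in auto)
  also have "\<dots> = (\<Sum>v<nv. walk_count es ok (k - 1) v)"
    by (intro sum.cong refl) (rule walk_count_card[OF assms(1) ok, where j = "k - 1", unfolded sk, symmetric])
  finally show ?thesis by simp
qed

definition colourful :: "(nat \<times> nat) set \<Rightarrow> nat \<Rightarrow> nat \<Rightarrow> (nat \<Rightarrow> nat) \<Rightarrow> nat" where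
  "colourful E nv k c = card {p \<in> walks E k (\<lambda>v. v < nv). distinct (map c p)}"

lemma sum_Pow_power:
  fixes x :: "'a :: comm_semiring_1"
  assumes "finite A"
  shows "(\<Sum>X\<in>Pow A. x ^ card X) = (1 + x) ^ card A"
  using prod_add[OF assms, of "\<lambda>_. x" "\<lambda>_. 1"] by (simp add: add.commute)

lemma sum_Pow_alternating:
  assumes "finite A"
  shows "(\<Sum>Y\<in>Pow A. (-1) ^ card Y) = (of_bool (A = {}) :: int)"
  using assms by (auto simp: sum_Pow_power power_0_left)

lemma card_supersets:
  assumes "finite A" "X \<subseteq> A" "card X \<le> k"
  shows "card {T. X \<subseteq> T \<and> T \<subseteq> A \<and> card T = k} = (card A - card X) choose (k - card X)"
proof -
  have finX: "finite X" using assms finite_subset by blast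
  have "bij_betw (\<lambda>T. T - X) {T. X \<subseteq> T \<and> T \<subseteq> A \<and> card T = k} {Y. Y \<subseteq> A - X \<and> card Y = k - card X}"
  proof (rule bij_betw_byWitness[where f' = "\<lambda>Y. Y \<union> X"])
    show "(\<lambda>T. T - X) ` {T. X \<subseteq> T \<and> T \<subseteq> A \<and> card T = k} \<subseteq> {Y. Y \<subseteq> A - X \<and> card Y = k - card X}"
      using finX by (auto simp: card_Diff_subset)
    show "(\<lambda>Y. Y \<union> X) ` {Y. Y \<subseteq> A - X \<and> card Y = k - card X} \<subseteq> {T. X \<subseteq> T \<and> T \<subseteq> A \<and> card T = k}"
    proof
      fix T assume "T \<in> (\<lambda>Y. Y \<union> X) ` {Y. Y \<subseteq> A - X \<and> card Y = k - card X}"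
      then obtain Y where Y: "T = Y \<union> X" "Y \<subseteq> A - X" "card Y = k - card X" by blast
      then have "finite Y" using assms finite_subset by blast
      then have "card T = card Y + card X" using Y finX by (simp add: card_Un_disjoint disjoint_iff subset_iff)
      then show "T \<in> {T. X \<subseteq> T \<and> T \<subseteq> A \<and> card T = k}" using Y assms by auto
    qed
  qed auto
  then have "card {T. X \<subseteq> T \<and> T \<subseteq> A \<and> card T = k} = card {Y. Y \<subseteq> A - X \<and> card Y = k - card X}"
    by (rule bij_betw_same_card)
  also have "\<dots> = card (A - X) choose (k - card X)" using assms by (intro n_subsets) auto
  finally show ?thesis using assms finX by (simp add: card_Diff_subset)
qed

text \<open>The binomial coefficient is the number of k-sets T between X and A. After exchanging the
  sums, every T carries an ordinary alternating sum over the sets between W and T, which vanishes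
  unless T = W. So sets of size at most k decide whether W has exactly k elements.\<close>

lemma sieve_supersets:
  assumes "finite A" "W \<subseteq> A" "card W \<le> k"
  shows "(\<Sum>X | W \<subseteq> X \<and> X \<subseteq> A \<and> card X \<le> k.
      (-1) ^ (k - card X) * int ((card A - card X) choose (k - card X))) = of_bool (card W = k)"
proof -
  let ?\<T> = "{T. W \<subseteq> T \<and> T \<subseteq> A \<and> card T = k}"
  let ?\<X> = "{X. W \<subseteq> X \<and> X \<subseteq> A \<and> card X \<le> k}"
  have finX: "finite ?\<X>" "finite ?\<T>"
    by (rule finite_subset[of _ "Pow A"]; use assms in auto)+
  have "(\<Sum>X\<in>?\<X>. (-1) ^ (k - card X) * int ((card A - card X) choose (k - card X))) =
     (\<Sum>X\<in>?\<X>. \<Sum>T | T \<in> ?\<T> \<and> X \<subseteq> T. (-1) ^ (k - card X))"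
  proof (rule sum.cong[OF refl])
    fix X assume X: "X \<in> ?\<X>"
    then have "{T. T \<in> ?\<T> \<and> X \<subseteq> T} = {T. X \<subseteq> T \<and> T \<subseteq> A \<and> card T = k}" by auto
    then show "(-1) ^ (k - card X) * int ((card A - card X) choose (k - card X)) =
        (\<Sum>T | T \<in> ?\<T> \<and> X \<subseteq> T. (-1) ^ (k - card X))"
      using card_supersets[OF assms(1), of X k] X by simp
  qed
  also have "\<dots> = (\<Sum>T\<in>?\<T>. \<Sum>X | X \<in> ?\<X> \<and> X \<subseteq> T. (-1) ^ (k - card X))"
    by (rule sum.swap_restrict[OF finX])
  also have "\<dots> = (\<Sum>T\<in>?\<T>. of_bool (T = W))"
  proof (rule sum.cong[OF refl])
    fix T assume T: "T \<in> ?\<T>"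
    then have finT: "finite T" using assms finite_subset by blast
    have "(\<Sum>X | X \<in> ?\<X> \<and> X \<subseteq> T. (-1) ^ (k - card X)) = (\<Sum>Y\<in>Pow (T - W). (-1) ^ card Y :: int)"
    proof (rule sum.reindex_bij_witness[of _ "\<lambda>Y. T - Y" "\<lambda>X. T - X"])
      fix X assume X: "X \<in> {X. X \<in> ?\<X> \<and> X \<subseteq> T}"
      then have "X \<subseteq> T" "finite X" using finT finite_subset by auto
      then have "card (T - X) = k - card X" using T by (simp add: card_Diff_subset)
      then show "(-1) ^ card (T - X) = ((-1) ^ (k - card X) :: int)" by simp
      show "T - (T - X) = X" "T - X \<in> Pow (T - W)" using X by auto
    next
      fix Y assume Y: "Y \<in> Pow (T - W)"
      have "card (T - Y) \<le> k" using T finT card_mono[OF finT, of "T - Y"] by auto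
      then show "T - Y \<in> {X. X \<in> ?\<X> \<and> X \<subseteq> T}" using Y T by auto
      show "T - (T - Y) = Y" using Y by auto
    qed
    also have "\<dots> = of_bool (T - W = {})" using finT by (intro sum_Pow_alternating) simp
    also have "T - W = {} \<longleftrightarrow> T = W" using T by auto
    finally show "(\<Sum>X | X \<in> ?\<X> \<and> X \<subseteq> T. (-1) ^ (k - card X)) = (of_bool (T = W) :: int)" .
  qed
  also have "\<dots> = of_bool (W \<in> ?\<T>)" using finX(2) by (simp add: sum.delta of_bool_def)
  also have "W \<in> ?\<T> \<longleftrightarrow> card W = k" using assms by auto
  finally show ?thesis .
qed

text \<open>A walk with k vertices is colourful iff its set of colours has k elements, and this set
  is never empty as k \<ge> 1. Each term only counts walks inside a vertex set, which needs no
  memory of the colours already visited.\<close>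

lemma colourful_sieve:
  assumes k: "1 \<le> k" "k \<le> K" and c: "\<And>v. v < nv \<Longrightarrow> c v < K"
  shows "int (colourful E nv k c) = (\<Sum>X | X \<subseteq> {..<K} \<and> X \<noteq> {} \<and> card X \<le> k.
      (-1) ^ (k - card X) * int (((K - card X) choose (k - card X)) *
        card (walks E k (\<lambda>v. v < nv \<and> c v \<in> X))))"
proof -
  let ?R = "walks E k (\<lambda>v. v < nv)"
  let ?\<X> = "{X. X \<subseteq> {..<K} \<and> X \<noteq> {} \<and> card X \<le> k}"
  let ?w = "\<lambda>X. (-1) ^ (k - card X) * int ((K - card X) choose (k - card X))"
  have finR: "finite ?R" by (rule finite_walks) simp
  have finX: "finite ?\<X>" by (rule finite_subset[of _ "Pow {..<K}"]) auto
  have "(\<Sum>X\<in>?\<X>. ?w X * int (card (walks E k (\<lambda>v. v < nv \<and> c v \<in> X)))) =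
      (\<Sum>X\<in>?\<X>. \<Sum>p | p \<in> ?R \<and> c ` set p \<subseteq> X. ?w X)"
  proof (rule sum.cong[OF refl])
    fix X
    have "walks E k (\<lambda>v. v < nv \<and> c v \<in> X) = {p. p \<in> ?R \<and> c ` set p \<subseteq> X}"
      by (auto simp: walks_def)
    then show "?w X * int (card (walks E k (\<lambda>v. v < nv \<and> c v \<in> X))) =
        (\<Sum>p | p \<in> ?R \<and> c ` set p \<subseteq> X. ?w X)" by simp
  qed
  also have "\<dots> = (\<Sum>p\<in>?R. \<Sum>X | X \<in> ?\<X> \<and> c ` set p \<subseteq> X. ?w X)"
    by (rule sum.swap_restrict[OF finX finR])
  also have "\<dots> = (\<Sum>p\<in>?R. of_bool (distinct (map c p)))"
  proof (rule sum.cong[OF refl])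
    fix p assume p: "p \<in> ?R"
    let ?W = "c ` set p"
    have len: "length (map c p) = k" using p by (simp add: walks_def)
    have W: "?W \<subseteq> {..<K}" using p c by (auto simp: walks_def)
    have cW: "card ?W \<le> k" using card_length[of "map c p"] len by simp
    have W0: "?W \<noteq> {}" using len k by auto
    have "{X. X \<in> ?\<X> \<and> ?W \<subseteq> X} = {X. ?W \<subseteq> X \<and> X \<subseteq> {..<K} \<and> card X \<le> k}" using W0 by auto
    then have "(\<Sum>X | X \<in> ?\<X> \<and> ?W \<subseteq> X. ?w X) = of_bool (card ?W = k)"
      using sieve_supersets[of "{..<K}" ?W k] W cW by simp
    also have "card ?W = k \<longleftrightarrow> distinct (map c p)"
      using len distinct_card[of "map c p"] card_distinct[of "map c p"] by auto
    finally show "(\<Sum>X | X \<in> ?\<X> \<and> ?W \<subseteq> X. ?w X) = of_bool (distinct (map c p))" .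
  qed
  also have "\<dots> = int (colourful E nv k c)"
    using finR by (simp add: colourful_def Int_def)
  finally show ?thesis by (simp add: mult.assoc)
qed

section \<open>A small imperative language with costs\<close>

type_synonym vars = "nat \<Rightarrow> nat"
type_synonym arrays = "nat \<Rightarrow> nat \<Rightarrow> nat"

datatype exp =
    N nat
  | V nat
  | Plus exp exp (infixl "+." 65)
  | Minus exp exp (infixl "-." 65)
  | Ar nat exp

fun ev :: "exp \<Rightarrow> vars \<Rightarrow> arrays \<Rightarrow> nat" where
  "ev (N n) v a = n"
| "ev (V x) v a = v x"
| "ev (e1 +. e2) v a = ev e1 v a + ev e2 v a"
| "ev (e1 -. e2) v a = ev e1 v a - ev e2 v a"
| "ev (Ar i e) v a = a i (ev e v a)"

text \<open>The input has a command of its own because the semantics must check the bound: past its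
  end the memory belongs to the other arrays.\<close>

datatype com =
    Skip
  | Asn nat exp (infix "::=" 61)
  | Upd nat exp exp
  | Inp nat exp
  | Seq com com (infixr ";;" 60)
  | Ite exp com com
  | Wh exp com

text \<open>
  Array 0 is the read-only input; its length is kept in the ghost cell \<open>a 1 0\<close>. Neither array may
  be mentioned by an expression.
\<close>

inductive run :: "com \<Rightarrow> vars \<times> arrays \<Rightarrow> nat \<Rightarrow> vars \<times> arrays \<Rightarrow> bool" where
  run_Skip: "run Skip s 0 s"
| run_Asn: "run (x ::= e) (v, a) 1 (v(x := ev e v a), a)"
| run_Upd: "run (Upd i e1 e2) (v, a) 1 (v, a(i := (a i)(ev e1 v a := ev e2 v a)))"
| run_Inp: "ev e v a < a 1 0 \<Longrightarrow> run (Inp x e) (v, a) 1 (v(x := a 0 (ev e v a)), a)"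
| run_Seq: "run c1 s t1 s1 \<Longrightarrow> run c2 s1 t2 s2 \<Longrightarrow> run (c1 ;; c2) s (t1 + t2) s2"
| run_Ite: "run (if ev b v a \<noteq> 0 then c1 else c2) (v, a) t s \<Longrightarrow> run (Ite b c1 c2) (v, a) (Suc t) s"
| run_Wh0: "ev b v a = 0 \<Longrightarrow> run (Wh b c) (v, a) 1 (v, a)"
| run_Wh1: "ev b v a \<noteq> 0 \<Longrightarrow> run c (v, a) t1 s1 \<Longrightarrow> run (Wh b c) s1 t2 s2 \<Longrightarrow>
    run (Wh b c) (v, a) (Suc (t1 + t2)) s2"

inductive_cases run_SkipE: "run Skip s t s'"
inductive_cases run_AsnE: "run (x ::= e) s t s'"
inductive_cases run_UpdE: "run (Upd i e1 e2) s t s'"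
inductive_cases run_InpE: "run (Inp x e) s t s'"
inductive_cases run_SeqE: "run (c1 ;; c2) s t s'"
inductive_cases run_IteE: "run (Ite b c1 c2) s t s'"
inductive_cases run_WhE: "run (Wh b c) s t s'"

subsection \<open>Weakest preconditions with a clock\<close>

text \<open>Total correctness. The last argument is the time spent so far and is passed on to the
  postcondition, so that bounds on the running time are ordinary assertions.\<close>

definition wp :: "com \<Rightarrow> (vars \<Rightarrow> arrays \<Rightarrow> nat \<Rightarrow> bool) \<Rightarrow> vars \<Rightarrow> arrays \<Rightarrow> nat \<Rightarrow> bool" where
  "wp c Q v a t \<longleftrightarrow> (\<exists>v' a' t'. run c (v, a) t' (v', a') \<and> Q v' a' (t + t'))"

lemma wp_Skip [simp]: "wp Skip Q v a t = Q v a t"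
  unfolding wp_def by (force elim: run_SkipE intro: run_Skip)

lemma wp_Asn [simp]: "wp (x ::= e) Q v a t = Q (v(x := ev e v a)) a (Suc t)"
proof
  assume "wp (x ::= e) Q v a t" then show "Q (v(x := ev e v a)) a (Suc t)"
    unfolding wp_def by (auto elim!: run_AsnE)
next
  assume "Q (v(x := ev e v a)) a (Suc t)" then show "wp (x ::= e) Q v a t"
    unfolding wp_def using run_Asn[of x e v a] by fastforce
qed

lemma wp_Upd [simp]:
  "wp (Upd i e1 e2) Q v a t = Q v (a(i := (a i)(ev e1 v a := ev e2 v a))) (Suc t)"
proof
  assume "wp (Upd i e1 e2) Q v a t" then show "Q v (a(i := (a i)(ev e1 v a := ev e2 v a))) (Suc t)"
    unfolding wp_def by (auto elim!: run_UpdE)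
next
  assume "Q v (a(i := (a i)(ev e1 v a := ev e2 v a))) (Suc t)" then show "wp (Upd i e1 e2) Q v a t"
    unfolding wp_def using run_Upd[of i e1 e2 v a] by fastforce
qed

lemma wp_Inp [simp]:
  "wp (Inp x e) Q v a t \<longleftrightarrow> ev e v a < a 1 0 \<and> Q (v(x := a 0 (ev e v a))) a (Suc t)"
proof
  assume "wp (Inp x e) Q v a t"
  then show "ev e v a < a 1 0 \<and> Q (v(x := a 0 (ev e v a))) a (Suc t)"
    unfolding wp_def by (auto elim!: run_InpE)
next
  assume "ev e v a < a 1 0 \<and> Q (v(x := a 0 (ev e v a))) a (Suc t)"
  then show "wp (Inp x e) Q v a t"
    unfolding wp_def using run_Inp[of e v a x] by fastforce
qed

lemma wp_Seq [simp]: "wp (c1 ;; c2) Q v a t = wp c1 (wp c2 Q) v a t"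
proof
  assume "wp (c1 ;; c2) Q v a t"
  then obtain v' a' t1 t2 s1 where r: "run c1 (v, a) t1 s1" "run c2 s1 t2 (v', a')" "Q v' a' (t + (t1 + t2))"
    unfolding wp_def by (auto elim!: run_SeqE)
  then show "wp c1 (wp c2 Q) v a t"
    unfolding wp_def by (cases s1) (metis add.assoc)
next
  assume "wp c1 (wp c2 Q) v a t"
  then show "wp (c1 ;; c2) Q v a t"
    unfolding wp_def by (metis add.assoc run_Seq)
qed

lemma wp_Seq_fun [simp]: "wp (c1 ;; c2) Q = wp c1 (wp c2 Q)"
  by (simp add: fun_eq_iff)

lemma wp_Ite [simp]:
  "wp (Ite b c1 c2) Q v a t = (if ev b v a \<noteq> 0 then wp c1 Q v a (Suc t) else wp c2 Q v a (Suc t))"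
proof
  assume "wp (Ite b c1 c2) Q v a t"
  then show "if ev b v a \<noteq> 0 then wp c1 Q v a (Suc t) else wp c2 Q v a (Suc t)"
    unfolding wp_def by (auto elim!: run_IteE split: if_splits) blast+
next
  assume "if ev b v a \<noteq> 0 then wp c1 Q v a (Suc t) else wp c2 Q v a (Suc t)"
  then obtain v' a' t' where "run (if ev b v a \<noteq> 0 then c1 else c2) (v, a) t' (v', a')" "Q v' a' (Suc t + t')"
    unfolding wp_def by (auto split: if_splits)
  then show "wp (Ite b c1 c2) Q v a t"
    unfolding wp_def using run_Ite by fastforce
qed

lemma wp_Wh:
  "wp (Wh b c) Q v a t =
     (if ev b v a = 0 then Q v a (Suc t) else wp c (wp (Wh b c) Q) v a (Suc t))"
proof
  assume "wp (Wh b c) Q v a t"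
  then obtain v' a' t' where r: "run (Wh b c) (v, a) t' (v', a')" "Q v' a' (t + t')"
    unfolding wp_def by blast
  from r(1) have "ev b v a = 0 \<and> v' = v \<and> a' = a \<and> t' = 1 \<or>
      ev b v a \<noteq> 0 \<and> (\<exists>t1 v1 a1 t2. run c (v, a) t1 (v1, a1) \<and> run (Wh b c) (v1, a1) t2 (v', a') \<and> t' = Suc (t1 + t2))"
    by (rule run_WhE) auto
  then show "if ev b v a = 0 then Q v a (Suc t) else wp c (wp (Wh b c) Q) v a (Suc t)"
    using r(2) unfolding wp_def by (auto simp: add.assoc) (metis add_Suc_right add.assoc)
next
  assume *: "if ev b v a = 0 then Q v a (Suc t) else wp c (wp (Wh b c) Q) v a (Suc t)"
  show "wp (Wh b c) Q v a t"
  proof (cases "ev b v a = 0")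
    case True
    then show ?thesis using * run_Wh0[of b v a c] unfolding wp_def by fastforce
  next
    case False
    with * obtain v1 a1 t1 v2 a2 t2 where
      "run c (v, a) t1 (v1, a1)" "run (Wh b c) (v1, a1) t2 (v2, a2)" "Q v2 a2 (Suc t + t1 + t2)"
      unfolding wp_def by auto
    then show ?thesis using run_Wh1[OF False, of c t1 "(v1,a1)" t2 "(v2,a2)"] unfolding wp_def
      by (metis add_Suc add_Suc_right add.assoc)
  qed
qed

lemma wp_mono: "wp c Q v a t \<Longrightarrow> (\<And>v a t. Q v a t \<Longrightarrow> Q' v a t) \<Longrightarrow> wp c Q' v a t"
  unfolding wp_def by blast

fun wv :: "com \<Rightarrow> nat set" where
  "wv Skip = {}"
| "wv (x ::= e) = {x}"
| "wv (Upd i e1 e2) = {}"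
| "wv (Inp x e) = {x}"
| "wv (c1 ;; c2) = wv c1 \<union> wv c2"
| "wv (Ite b c1 c2) = wv c1 \<union> wv c2"
| "wv (Wh b c) = wv c"

fun wa :: "com \<Rightarrow> nat set" where
  "wa Skip = {}"
| "wa (x ::= e) = {}"
| "wa (Upd i e1 e2) = {i}"
| "wa (Inp x e) = {}"
| "wa (c1 ;; c2) = wa c1 \<union> wa c2"
| "wa (Ite b c1 c2) = wa c1 \<union> wa c2"
| "wa (Wh b c) = wa c"

text \<open>Frame conditions: \<open>X\<close> is a set of variables or of arrays that may have been
  written, as collected by \<open>wv\<close> and \<open>wa\<close>.\<close>

definition eqx :: "nat set \<Rightarrow> (nat \<Rightarrow> 'a) \<Rightarrow> (nat \<Rightarrow> 'a) \<Rightarrow> bool" where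
  "eqx X v v' \<longleftrightarrow> (\<forall>x. x \<notin> X \<longrightarrow> v' x = v x)"

lemma eqxD: "eqx X v v' \<Longrightarrow> x \<notin> X \<Longrightarrow> v' x = v x"
  by (simp add: eqx_def)

lemma eqx_refl [simp]: "eqx X v v"
  by (simp add: eqx_def)

lemma eqx_trans: "eqx X u v \<Longrightarrow> eqx X v w \<Longrightarrow> eqx X u w"
  by (simp add: eqx_def)

lemma run_frame:
  "run c s t s' \<Longrightarrow> eqx (wv c) (fst s) (fst s') \<and> eqx (wa c) (snd s) (snd s')"
proof (induction rule: run.induct)
  case (run_Ite b v a c1 c2 t s)
  then show ?case by (auto simp: eqx_def split: if_splits)
qed (auto simp: eqx_def)

text \<open>Lets each loop invariant mention only what changes; all that the body does not write is
  supplied by \<open>run_frame\<close>.\<close>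

lemma wp_frame:
  "wp c (\<lambda>v' a' t'. eqx (wv c) v v' \<longrightarrow> eqx (wa c) a a' \<longrightarrow> Q v' a' t') v a t \<Longrightarrow> wp c Q v a t"
  unfolding wp_def using run_frame by fastforce

text \<open>The invariant of a loop cannot mention the clock; turn \<open>i\<close> of the body costs at most \<open>B i\<close>.\<close>

lemma wp_Wh_sum:
  assumes init: "I 0 vi ai"
    and step: "\<And>i v a t. i < n \<Longrightarrow> I i v a \<Longrightarrow> eqx (wv c) vi v \<Longrightarrow> eqx (wa c) ai a \<Longrightarrow>
        ev b v a \<noteq> 0 \<and> wp c (\<lambda>v' a' t'. I (Suc i) v' a' \<and> t' \<le> t + B i) v a t"
    and stop: "\<And>v a. I n v a \<Longrightarrow> eqx (wv c) vi v \<Longrightarrow> eqx (wa c) ai a \<Longrightarrow> ev b v a = 0"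
    and post: "\<And>v a t. I n v a \<Longrightarrow> eqx (wv c) vi v \<Longrightarrow> eqx (wa c) ai a \<Longrightarrow>
        t \<le> ti + (\<Sum>i<n. B i + 1) + 1 \<Longrightarrow> Q v a t"
  shows "wp (Wh b c) Q vi ai ti"
proof -
  have "wp (Wh b c) Q v a t"
    if "j \<le> n" "I (n - j) v a" "eqx (wv c) vi v" "eqx (wa c) ai a" "t \<le> ti + (\<Sum>i<n - j. B i + 1)" for j v a t
    using that
  proof (induction j arbitrary: v a t)
    case 0
    then have "ev b v a = 0" using stop by simp
    moreover have "Q v a (Suc t)" using 0 post[of v a "Suc t"] by simp
    ultimately show ?case by (simp add: wp_Wh)
  next
    case (Suc j)
    define i where "i = n - Suc j"
    have i: "i < n" "n - j = Suc i" using Suc.prems(1) by (auto simp: i_def)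
    have b: "ev b v a \<noteq> 0"
      and w: "wp c (\<lambda>v' a' t'. I (Suc i) v' a' \<and> t' \<le> Suc t + B i) v a (Suc t)"
      using step[OF i(1) Suc.prems(2)[folded i_def] Suc.prems(3,4), of "Suc t"] by simp_all
    have "wp c (wp (Wh b c) Q) v a (Suc t)"
    proof (rule wp_frame, rule wp_mono[OF w], intro impI)
      fix v' a' t'
      assume h: "I (Suc i) v' a' \<and> t' \<le> Suc t + B i" "eqx (wv c) v v'" "eqx (wa c) a a'"
      show "wp (Wh b c) Q v' a' t'"
      proof (rule Suc.IH)
        show "j \<le> n" "I (n - j) v' a'" using Suc.prems(1) h i by auto
        show "eqx (wv c) vi v'" "eqx (wa c) ai a'" using h Suc.prems eqx_trans by blast+
        show "t' \<le> ti + (\<Sum>i<n - j. B i + 1)" unfolding i(2) using h(1) Suc.prems(5)[folded i_def] by simp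
      qed
    qed
    then show ?case using b by (simp add: wp_Wh)
  qed
  from this[of n vi ai ti] show ?thesis using init by simp
qed

lemma wp_Wh_count:
  assumes init: "I 0 vi ai"
    and step: "\<And>i v a t. i < n \<Longrightarrow> I i v a \<Longrightarrow> eqx (wv c) vi v \<Longrightarrow> eqx (wa c) ai a \<Longrightarrow>
        ev b v a \<noteq> 0 \<and> wp c (\<lambda>v' a' t'. I (Suc i) v' a' \<and> t' \<le> t + B) v a t"
    and stop: "\<And>v a. I n v a \<Longrightarrow> eqx (wv c) vi v \<Longrightarrow> eqx (wa c) ai a \<Longrightarrow> ev b v a = 0"
    and post: "\<And>v a t. I n v a \<Longrightarrow> eqx (wv c) vi v \<Longrightarrow> eqx (wa c) ai a \<Longrightarrow>
        t \<le> ti + n * (B + 1) + 1 \<Longrightarrow> Q v a t"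
  shows "wp (Wh b c) Q vi ai ti"
  by (rule wp_Wh_sum[where I = I and B = "\<lambda>_. B" and n = n, OF init step stop post]) simp_all

subsection \<open>Compilation\<close>

text \<open>
  Variable \<open>x\<close> lives in register \<open>2 x\<close>, the \<open>d\<close>-th temporary in register \<open>2 d + 5\<close>, and register 3
  holds the size \<open>B\<close> of the input; cell \<open>j\<close> of array \<open>i\<close> has address \<open>B + 32 j + i\<close>, so that
  all arrays are unbounded.
\<close>

definition tmp :: "nat \<Rightarrow> nat" where "tmp d = 2 * d + 5"

text \<open>Five doublings multiply the index by 32.\<close>

definition addr_code :: "nat \<Rightarrow> nat \<Rightarrow> instr list" where
  "addr_code d i = [Add (tmp d) (tmp d) (tmp d), Add (tmp d) (tmp d) (tmp d), Add (tmp d) (tmp d) (tmp d),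
     Add (tmp d) (tmp d) (tmp d), Add (tmp d) (tmp d) (tmp d), Add (tmp d) (tmp d) 3,
     Const (tmp (Suc d)) i, Add (tmp d) (tmp d) (tmp (Suc d))]"

fun exp_code :: "nat \<Rightarrow> exp \<Rightarrow> instr list" where
  "exp_code d (N n) = [Const (tmp d) n]"
| "exp_code d (V x) = [Const (tmp d) 0, Add (tmp d) (tmp d) (2 * x)]"
| "exp_code d (e1 +. e2) = exp_code d e1 @ exp_code (Suc d) e2 @ [Add (tmp d) (tmp d) (tmp (Suc d))]"
| "exp_code d (e1 -. e2) = exp_code d e1 @ exp_code (Suc d) e2 @ [Sub (tmp d) (tmp d) (tmp (Suc d))]"
| "exp_code d (Ar i e) = exp_code d e @ addr_code d i @ [Load (tmp d) (tmp d)]"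

text \<open>Jump targets are absolute, hence the parameter \<open>p\<close>: the position at which
  the code will stand.\<close>

fun com_code :: "nat \<Rightarrow> com \<Rightarrow> instr list" where
  "com_code p Skip = []"
| "com_code p (x ::= e) = exp_code 0 e @ [Const (2 * x) 0, Add (2 * x) (2 * x) (tmp 0)]"
| "com_code p (Upd i e1 e2) = exp_code 0 e1 @ addr_code 0 i @ exp_code 1 e2 @ [Store (tmp 0) (tmp 1)]"
| "com_code p (Inp x e) = exp_code 0 e @ [Load (2 * x) (tmp 0)]"
| "com_code p (c1 ;; c2) = com_code p c1 @ com_code (p + length (com_code p c1)) c2"
| "com_code p (Ite b c1 c2) =
     (let cb = exp_code 0 b; p1 = p + length cb + 1; k1 = com_code p1 c1;
          p2 = p1 + length k1 + 1; k2 = com_code p2 c2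
      in cb @ [JumpZero (tmp 0) p2] @ k1 @ [Jump (p2 + length k2)] @ k2)"
| "com_code p (Wh b c) =
     (let cb = exp_code 0 b; p1 = p + length cb + 1; k1 = com_code p1 c
      in cb @ [JumpZero (tmp 0) (p1 + length k1 + 1)] @ k1 @ [Jump p])"

fun exp_len :: "exp \<Rightarrow> nat" where
  "exp_len (N n) = 1"
| "exp_len (V x) = 2"
| "exp_len (e1 +. e2) = exp_len e1 + exp_len e2 + 1"
| "exp_len (e1 -. e2) = exp_len e1 + exp_len e2 + 1"
| "exp_len (Ar i e) = exp_len e + 9"

fun exp_ok :: "exp \<Rightarrow> bool" where
  "exp_ok (N n) = True"
| "exp_ok (V x) = True"
| "exp_ok (e1 +. e2) \<longleftrightarrow> exp_ok e1 \<and> exp_ok e2"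
| "exp_ok (e1 -. e2) \<longleftrightarrow> exp_ok e1 \<and> exp_ok e2"
| "exp_ok (Ar i e) \<longleftrightarrow> 2 \<le> i \<and> i < 32 \<and> exp_ok e"

text \<open>\<open>com_ok \<kappa> c\<close>: every unit of cost of \<open>c\<close> takes at most \<open>\<kappa>\<close> machine steps.\<close>

fun com_ok :: "nat \<Rightarrow> com \<Rightarrow> bool" where
  "com_ok \<kappa> Skip = True"
| "com_ok \<kappa> (x ::= e) \<longleftrightarrow> exp_ok e \<and> exp_len e + 2 \<le> \<kappa>"
| "com_ok \<kappa> (Upd i e1 e2) \<longleftrightarrow> 2 \<le> i \<and> i < 32 \<and> exp_ok e1 \<and> exp_ok e2 \<and> exp_len e1 + exp_len e2 + 9 \<le> \<kappa>"
| "com_ok \<kappa> (Inp x e) \<longleftrightarrow> exp_ok e \<and> exp_len e + 1 \<le> \<kappa>"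
| "com_ok \<kappa> (c1 ;; c2) \<longleftrightarrow> com_ok \<kappa> c1 \<and> com_ok \<kappa> c2"
| "com_ok \<kappa> (Ite b c1 c2) \<longleftrightarrow> exp_ok b \<and> exp_len b + 2 \<le> \<kappa> \<and> com_ok \<kappa> c1 \<and> com_ok \<kappa> c2"
| "com_ok \<kappa> (Wh b c) \<longleftrightarrow> exp_ok b \<and> exp_len b + 2 \<le> \<kappa> \<and> com_ok \<kappa> c"

lemma length_exp_code [simp]: "length (exp_code d e) = exp_len e"
  by (induction e arbitrary: d) (auto simp: addr_code_def)

lemma length_addr_code [simp]: "length (addr_code d i) = 8"
  by (simp add: addr_code_def)

definition code_at :: "program \<Rightarrow> nat \<Rightarrow> instr list \<Rightarrow> bool" where
  "code_at P p xs \<longleftrightarrow> p + length xs \<le> length P \<and> (\<forall>i<length xs. P ! (p + i) = xs ! i)"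

lemma code_at_append [simp]:
  "code_at P p (xs @ ys) \<longleftrightarrow> code_at P p xs \<and> code_at P (p + length xs) ys"
  unfolding code_at_def
  apply (auto simp: nth_append add.assoc)
  by (metis Nat.add_diff_assoc add_diff_cancel_left' less_diff_conv2 not_less add.commute)

lemma code_at_Cons [simp]:
  "code_at P p (x # xs) \<longleftrightarrow> p < length P \<and> P ! p = x \<and> code_at P (Suc p) xs"
  unfolding code_at_def by (auto simp: All_less_Suc2)

lemma code_at_Nil [simp]: "code_at P p [] \<longleftrightarrow> p \<le> length P"
  by (simp add: code_at_def)

definition steps :: "program \<Rightarrow> nat \<Rightarrow> config \<Rightarrow> config \<Rightarrow> bool" where
  "steps P n s s' \<longleftrightarrow> (step P ^^ n) s = s'"

lemma steps_0 [simp]: "steps P 0 s s' \<longleftrightarrow> s' = s"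
  by (auto simp: steps_def)

lemma steps_Suc: "pc s < length P \<Longrightarrow> steps P (Suc n) s s' \<longleftrightarrow> steps P n (exec (P ! pc s) s) s'"
  by (simp add: steps_def funpow_swap1 step_def halted_def del: funpow.simps add: funpow_Suc_right)

lemma steps_two: "pc s < length P \<Longrightarrow> steps P 2 s s' \<longleftrightarrow> steps P 1 (exec (P ! pc s) s) s'"
  using steps_Suc[of s P 1 s'] by (simp add: numeral_2_eq_2)

lemma steps_trans: "steps P m s s1 \<Longrightarrow> steps P n s1 s2 \<Longrightarrow> steps P (m + n) s s2"
  unfolding steps_def by (metis add.commute comp_apply funpow_add)

definition sim :: "vars \<Rightarrow> arrays \<Rightarrow> config \<Rightarrow> bool" where
  "sim v a s \<longleftrightarrow> (\<forall>x. regs s (2 * x) = v x) \<and> regs s 3 = a 1 0 \<and>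
     (\<forall>j<a 1 0. mem s j = a 0 j) \<and>
     (\<forall>i j. 2 \<le> i \<longrightarrow> i < 32 \<longrightarrow> mem s (a 1 0 + 32 * j + i) = a i j)"

lemma tmp_simps [simp]:
  "tmp d \<noteq> 2 * x" "2 * x \<noteq> tmp d" "tmp d \<noteq> 3" "3 \<noteq> tmp d" "tmp d = tmp d' \<longleftrightarrow> d = d'" "2 * x \<noteq> (3::nat)"
  unfolding tmp_def by presburger+

lemma sim_regs_tmp [simp]: "sim v a (s\<lparr>regs := (regs s)(tmp d := n)\<rparr>) \<longleftrightarrow> sim v a s"
  by (auto simp: sim_def)

lemma sim_pc [simp]: "sim v a (s\<lparr>pc := n\<rparr>) \<longleftrightarrow> sim v a s"
  by (auto simp: sim_def)

lemma addr_code_steps: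
  assumes "code_at P (pc s) (addr_code d i)" "regs s (tmp d) = j" "regs s 3 = B"
  shows "\<exists>x. steps P 8 s (s\<lparr>pc := pc s + 8, regs := (regs s)(tmp d := B + 32 * j + i, tmp (Suc d) := x)\<rparr>)"
proof -
  have 8: "8 = Suc (Suc (Suc (Suc (Suc (Suc (Suc (Suc 0)))))))" by simp
  show ?thesis
    using assms unfolding addr_code_def 8
    by (intro exI[of _ i]) (simp add: steps_Suc fun_upd_twist[of "tmp (Suc d)" "tmp d"] mult_2[symmetric] add.commute)
qed

lemma exp_code_steps:
  assumes "code_at P (pc s) (exp_code d e)" "exp_ok e" "sim v a s"
  shows "\<exists>s'. steps P (exp_len e) s s' \<and> pc s' = pc s + exp_len e \<and> regs s' (tmp d) = ev e v a \<and>
     sim v a s' \<and> (\<forall>d'<d. regs s' (tmp d') = regs s (tmp d')) \<and> mem s' = mem s"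
  using assms
proof (induction e arbitrary: d s)
  case (N n)
  show ?case
    by (rule exI[of _ "s\<lparr>pc := pc s + 1, regs := (regs s)(tmp d := n)\<rparr>"])
      (use N in \<open>auto simp: steps_Suc sim_def\<close>)
next
  case (V x)
  then show ?case
    by (intro exI[of _ "s\<lparr>pc := pc s + 2, regs := (regs s)(tmp d := v x)\<rparr>"])
      (auto simp: steps_two steps_Suc sim_def)
next
  case (Plus e1 e2)
  obtain s1 where s1: "steps P (exp_len e1) s s1" "pc s1 = pc s + exp_len e1" "regs s1 (tmp d) = ev e1 v a"
     "sim v a s1" "\<forall>d'<d. regs s1 (tmp d') = regs s (tmp d')" "mem s1 = mem s"
    using Plus.IH(1)[of s d] Plus.prems by auto
  obtain s2 where s2: "steps P (exp_len e2) s1 s2" "pc s2 = pc s1 + exp_len e2" "regs s2 (tmp (Suc d)) = ev e2 v a"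
     "sim v a s2" "\<forall>d'<Suc d. regs s2 (tmp d') = regs s1 (tmp d')" "mem s2 = mem s1"
    using Plus.IH(2)[of s1 "Suc d"] Plus.prems s1 by auto
  let ?s = "s2\<lparr>pc := pc s2 + 1, regs := (regs s2)(tmp d := ev e1 v a + ev e2 v a)\<rparr>"
  have "steps P 1 s2 ?s"
    using Plus.prems s1 s2 by (auto simp: steps_Suc add.assoc)
  from steps_trans[OF steps_trans[OF s1(1) s2(1)] this] show ?case
    using s1 s2 by (intro exI[of _ ?s]) (auto simp: sim_def)
next
  case (Minus e1 e2)
  obtain s1 where s1: "steps P (exp_len e1) s s1" "pc s1 = pc s + exp_len e1" "regs s1 (tmp d) = ev e1 v a"
     "sim v a s1" "\<forall>d'<d. regs s1 (tmp d') = regs s (tmp d')" "mem s1 = mem s"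
    using Minus.IH(1)[of s d] Minus.prems by auto
  obtain s2 where s2: "steps P (exp_len e2) s1 s2" "pc s2 = pc s1 + exp_len e2" "regs s2 (tmp (Suc d)) = ev e2 v a"
     "sim v a s2" "\<forall>d'<Suc d. regs s2 (tmp d') = regs s1 (tmp d')" "mem s2 = mem s1"
    using Minus.IH(2)[of s1 "Suc d"] Minus.prems s1 by auto
  let ?s = "s2\<lparr>pc := pc s2 + 1, regs := (regs s2)(tmp d := ev e1 v a - ev e2 v a)\<rparr>"
  have "steps P 1 s2 ?s"
    using Minus.prems s1 s2 by (auto simp: steps_Suc add.assoc)
  from steps_trans[OF steps_trans[OF s1(1) s2(1)] this] show ?case
    using s1 s2 by (intro exI[of _ ?s]) (auto simp: sim_def)
next
  case (Ar i e)
  obtain s1 where s1: "steps P (exp_len e) s s1" "pc s1 = pc s + exp_len e" "regs s1 (tmp d) = ev e v a"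
     "sim v a s1" "\<forall>d'<d. regs s1 (tmp d') = regs s (tmp d')" "mem s1 = mem s"
    using Ar.IH[of s d] Ar.prems by auto
  have c: "code_at P (pc s1) (addr_code d i)" using Ar.prems s1 by simp
  have b: "regs s1 3 = a 1 0" using s1 by (simp add: sim_def)
  obtain x where x: "steps P 8 s1 (s1\<lparr>pc := pc s1 + 8, regs := (regs s1)(tmp d := a 1 0 + 32 * ev e v a + i, tmp (Suc d) := x)\<rparr>)"
    using addr_code_steps[OF c s1(3) b] by blast
  let ?s2 = "s1\<lparr>pc := pc s1 + 8, regs := (regs s1)(tmp d := a 1 0 + 32 * ev e v a + i, tmp (Suc d) := x)\<rparr>"
  let ?s = "?s2\<lparr>pc := pc s1 + 9, regs := (regs ?s2)(tmp d := a i (ev e v a))\<rparr>"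
  have "mem s1 (a 1 0 + 32 * ev e v a + i) = a i (ev e v a)"
    using s1(4) Ar.prems(2) by (simp add: sim_def)
  moreover have "P ! (pc s1 + 8) = Load (tmp d) (tmp d)" "pc s1 + 8 < length P"
    using Ar.prems(1) s1(2) by simp_all
  ultimately have "steps P 1 ?s2 ?s"
    by (simp add: steps_Suc)
  from steps_trans[OF s1(1) steps_trans[OF x this]] show ?case
    using s1 by (intro exI[of _ ?s]) (auto simp: sim_def)
qed

lemma addr_inj:
  fixes i j :: nat
  assumes "i < 32" "i' < 32"
  shows "32 * j + i = 32 * j' + i' \<longleftrightarrow> i = i' \<and> j = j'"
proof
  assume "32 * j + i = 32 * j' + i'"
  then have "(32 * j + i) mod 32 = (32 * j' + i') mod 32" by simp
  then have "i = i'" using assms by simp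
  then show "i = i' \<and> j = j'" using \<open>32 * j + i = 32 * j' + i'\<close> by simp
qed simp

text \<open>The only recursion that is not structural is the loop: its body ends with a jump to
  \<open>pc s\<close>, where the same code stands, so the hypothesis for the remaining turns
  applies. The test and this jump are paid by the unit of cost of the turn.\<close>

lemma com_code_steps:
  assumes "run c (v, a) t (v', a')" "code_at P (pc s) (com_code (pc s) c)" "com_ok \<kappa> c" "sim v a s"
  shows "\<exists>s' n. steps P n s s' \<and> n \<le> \<kappa> * t \<and> pc s' = pc s + length (com_code (pc s) c) \<and> sim v' a' s'"
  using assms
proof (induction c "(v, a)" t "(v', a')" arbitrary: v a v' a' s rule: run.induct)
  case run_Skip
  then show ?case by (auto intro!: exI[of _ s] exI[of _ 0])
next
  case (run_Asn x e v a)
  obtain s1 where s1: "steps P (exp_len e) s s1" "pc s1 = pc s + exp_len e" "regs s1 (tmp 0) = ev e v a" "sim v a s1"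
    using exp_code_steps[of P s 0 e v a] run_Asn by auto
  let ?s = "s1\<lparr>pc := pc s1 + 2, regs := (regs s1)(2 * x := ev e v a)\<rparr>"
  have "steps P 2 s1 ?s"
    using run_Asn s1 by (auto simp: steps_two steps_Suc)
  from steps_trans[OF s1(1) this] show ?case
    using s1 run_Asn by (intro exI[of _ ?s] exI[of _ "exp_len e + 2"]) (auto simp: sim_def)
next
  case (run_Upd i e1 e2 v a)
  obtain s1 where s1: "steps P (exp_len e1) s s1" "pc s1 = pc s + exp_len e1" "regs s1 (tmp 0) = ev e1 v a"
     "sim v a s1"
    using exp_code_steps[of P s 0 e1 v a] run_Upd by auto
  have c: "code_at P (pc s1) (addr_code 0 i)" using run_Upd s1 by simp
  have b: "regs s1 3 = a 1 0" using s1 by (simp add: sim_def)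
  obtain x where x: "steps P 8 s1 (s1\<lparr>pc := pc s1 + 8, regs := (regs s1)(tmp 0 := a 1 0 + 32 * ev e1 v a + i, tmp (Suc 0) := x)\<rparr>)"
    using addr_code_steps[OF c s1(3) b] by blast
  let ?s2 = "s1\<lparr>pc := pc s1 + 8, regs := (regs s1)(tmp 0 := a 1 0 + 32 * ev e1 v a + i, tmp (Suc 0) := x)\<rparr>"
  have sim2: "sim v a ?s2" using s1(4) by (auto simp: sim_def)
  obtain s3 where s3: "steps P (exp_len e2) ?s2 s3" "pc s3 = pc ?s2 + exp_len e2" "regs s3 (tmp 1) = ev e2 v a"
     "sim v a s3" "regs s3 (tmp 0) = a 1 0 + 32 * ev e1 v a + i" "mem s3 = mem ?s2"
    using exp_code_steps[of P ?s2 1 e2 v a] run_Upd sim2 s1 by (auto simp: add.assoc)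
  let ?s = "s3\<lparr>pc := pc s3 + 1, mem := (mem s3)(a 1 0 + 32 * ev e1 v a + i := ev e2 v a)\<rparr>"
  have "steps P 1 s3 ?s"
    using run_Upd s3 s1 by (auto simp: steps_Suc add.assoc)
  note st = steps_trans[OF s1(1) steps_trans[OF x steps_trans[OF s3(1) this]]]
  have i: "2 \<le> i" "i < 32" using run_Upd by auto
  have "sim v (a(i := (a i)(ev e1 v a := ev e2 v a))) ?s"
    using s3(4) i addr_inj unfolding sim_def by (auto simp: add.assoc)
  then show ?case
    using st s1 s3 run_Upd
    by (intro exI[of _ ?s] exI[of _ "exp_len e1 + (8 + (exp_len e2 + 1))"]) auto
next
  case (run_Inp e v a x)
  obtain s1 where s1: "steps P (exp_len e) s s1" "pc s1 = pc s + exp_len e" "regs s1 (tmp 0) = ev e v a" "sim v a s1"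
    using exp_code_steps[of P s 0 e v a] run_Inp by auto
  let ?s = "s1\<lparr>pc := pc s1 + 1, regs := (regs s1)(2 * x := a 0 (ev e v a))\<rparr>"
  have "mem s1 (ev e v a) = a 0 (ev e v a)" using s1(4) run_Inp.hyps unfolding sim_def by blast
  then have "steps P 1 s1 ?s"
    using run_Inp s1 by (auto simp: steps_Suc)
  from steps_trans[OF s1(1) this] show ?case
    using s1 run_Inp by (intro exI[of _ ?s] exI[of _ "exp_len e + 1"]) (auto simp: sim_def)
next
  case (run_Seq c1 t1 s1 c2 t2)
  obtain v1 a1 where s1: "s1 = (v1, a1)" by force
  obtain s2 n2 where 2: "steps P n2 s s2" "n2 \<le> \<kappa> * t1" "pc s2 = pc s + length (com_code (pc s) c1)" "sim v1 a1 s2"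
    using run_Seq.hyps(2)[OF s1, of s] run_Seq.prems by auto
  obtain s3 n3 where 3: "steps P n3 s2 s3" "n3 \<le> \<kappa> * t2" "pc s3 = pc s2 + length (com_code (pc s2) c2)" "sim v' a' s3"
    using run_Seq.hyps(4)[OF s1, of s2] run_Seq.prems 2 by auto
  have n: "n2 + n3 \<le> \<kappa> * (t1 + t2)" using 2 3 by (simp add: distrib_left)
  show ?case
    by (rule exI[of _ s3], rule exI[of _ "n2 + n3"]) (use steps_trans[OF 2(1) 3(1)] 2 3 n in simp)
next
  case (run_Ite b v a c1 c2 t)
  let ?p1 = "pc s + exp_len b + 1"
  let ?k1 = "com_code ?p1 c1"
  let ?p2 = "?p1 + length ?k1 + 1"
  let ?k2 = "com_code ?p2 c2"
  have cd: "code_at P (pc s) (exp_code 0 b)" "pc s + exp_len b < length P"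
      "P ! (pc s + exp_len b) = JumpZero (tmp 0) ?p2" "code_at P ?p1 ?k1"
      "?p1 + length ?k1 < length P" "P ! (?p1 + length ?k1) = Jump (?p2 + length ?k2)"
      "code_at P ?p2 ?k2"
    using run_Ite.prems(1) by (auto simp: Let_def add_ac)
  have len: "pc s + length (com_code (pc s) (Ite b c1 c2)) = ?p2 + length ?k2"
    by (simp add: Let_def)
  obtain s1 where s1: "steps P (exp_len b) s s1" "pc s1 = pc s + exp_len b" "regs s1 (tmp 0) = ev b v a" "sim v a s1"
    using exp_code_steps[OF cd(1), of v a] run_Ite by auto
  show ?case
  proof (cases "ev b v a = 0")
    case True
    have 2: "steps P 1 s1 (s1\<lparr>pc := ?p2\<rparr>)" using s1 cd True by (simp add: steps_Suc)
    obtain s3 n3 where 3: "steps P n3 (s1\<lparr>pc := ?p2\<rparr>) s3" "n3 \<le> \<kappa> * t" "pc s3 = ?p2 + length ?k2" "sim v' a' s3"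
      using run_Ite.hyps(2)[of "s1\<lparr>pc := ?p2\<rparr>"] True cd(7) run_Ite.prems s1(4) by auto
    have n: "exp_len b + (1 + n3) \<le> \<kappa> * Suc t" using 3(2) run_Ite.prems by simp
    show ?thesis
      by (rule exI[of _ s3], rule exI[of _ "exp_len b + (1 + n3)"])
        (use steps_trans[OF s1(1) steps_trans[OF 2 3(1)]] 3 n len in \<open>simp del: com_code.simps\<close>)
  next
    case False
    have 2: "steps P 1 s1 (s1\<lparr>pc := ?p1\<rparr>)" using s1 cd False by (simp add: steps_Suc)
    obtain s3 n3 where 3: "steps P n3 (s1\<lparr>pc := ?p1\<rparr>) s3" "n3 \<le> \<kappa> * t" "pc s3 = ?p1 + length ?k1" "sim v' a' s3"
      using run_Ite.hyps(2)[of "s1\<lparr>pc := ?p1\<rparr>"] False cd(4) run_Ite.prems s1(4) by auto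
    have 4: "steps P 1 s3 (s3\<lparr>pc := ?p2 + length ?k2\<rparr>)" using 3(3) cd(5,6) by (simp add: steps_Suc)
    have n: "exp_len b + (1 + (n3 + 1)) \<le> \<kappa> * Suc t" using 3(2) run_Ite.prems by simp
    show ?thesis
      by (rule exI[of _ "s3\<lparr>pc := ?p2 + length ?k2\<rparr>"], rule exI[of _ "exp_len b + (1 + (n3 + 1))"])
        (use steps_trans[OF s1(1) steps_trans[OF 2 steps_trans[OF 3(1) 4]]] 3 n len in \<open>simp del: com_code.simps\<close>)
  qed
next
  case (run_Wh0 b v a c)
  let ?p1 = "pc s + exp_len b + 1"
  let ?k1 = "com_code ?p1 c"
  have cd: "code_at P (pc s) (exp_code 0 b)" "pc s + exp_len b < length P"
      "P ! (pc s + exp_len b) = JumpZero (tmp 0) (?p1 + length ?k1 + 1)"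
    using run_Wh0.prems(1) by (auto simp: Let_def add_ac)
  have len: "pc s + length (com_code (pc s) (Wh b c)) = ?p1 + length ?k1 + 1"
    by (simp add: Let_def)
  obtain s1 where s1: "steps P (exp_len b) s s1" "pc s1 = pc s + exp_len b" "regs s1 (tmp 0) = ev b v a" "sim v a s1"
    using exp_code_steps[OF cd(1), of v a] run_Wh0 by auto
  have 2: "steps P 1 s1 (s1\<lparr>pc := ?p1 + length ?k1 + 1\<rparr>)" using s1 cd run_Wh0.hyps by (simp add: steps_Suc)
  have n: "exp_len b + 1 \<le> \<kappa> * 1" using run_Wh0.prems by simp
  show ?case
    by (rule exI[of _ "s1\<lparr>pc := ?p1 + length ?k1 + 1\<rparr>"], rule exI[of _ "exp_len b + 1"])
      (use steps_trans[OF s1(1) 2] n len s1(4) in \<open>simp del: com_code.simps\<close>)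
next
  case (run_Wh1 b v a c t1 s1' t2)
  let ?p1 = "pc s + exp_len b + 1"
  let ?k1 = "com_code ?p1 c"
  obtain v1 a1 where s1': "s1' = (v1, a1)" by force
  have cd: "code_at P (pc s) (exp_code 0 b)" "pc s + exp_len b < length P"
      "P ! (pc s + exp_len b) = JumpZero (tmp 0) (?p1 + length ?k1 + 1)"
      "code_at P ?p1 ?k1" "?p1 + length ?k1 < length P" "P ! (?p1 + length ?k1) = Jump (pc s)"
    using run_Wh1.prems(1) by (auto simp: Let_def add_ac)
  obtain s1 where s1: "steps P (exp_len b) s s1" "pc s1 = pc s + exp_len b" "regs s1 (tmp 0) = ev b v a" "sim v a s1"
    using exp_code_steps[OF cd(1), of v a] run_Wh1 by auto
  have 2: "steps P 1 s1 (s1\<lparr>pc := ?p1\<rparr>)" using s1 cd run_Wh1.hyps by (simp add: steps_Suc)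
  obtain s3 n3 where 3: "steps P n3 (s1\<lparr>pc := ?p1\<rparr>) s3" "n3 \<le> \<kappa> * t1" "pc s3 = ?p1 + length ?k1" "sim v1 a1 s3"
    using run_Wh1.hyps(3)[OF s1', of "s1\<lparr>pc := ?p1\<rparr>"] cd(4) run_Wh1.prems s1(4) by auto
  have 4: "steps P 1 s3 (s3\<lparr>pc := pc s\<rparr>)" using 3(3) cd(5,6) by (simp add: steps_Suc)
  obtain s5 n5 where 5: "steps P n5 (s3\<lparr>pc := pc s\<rparr>) s5" "n5 \<le> \<kappa> * t2"
      "pc s5 = pc s + length (com_code (pc s) (Wh b c))" "sim v' a' s5"
    using run_Wh1.hyps(5)[OF s1', of "s3\<lparr>pc := pc s\<rparr>"] run_Wh1.prems 3 by auto
  have n: "exp_len b + (1 + (n3 + (1 + n5))) \<le> \<kappa> * Suc (t1 + t2)"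
    using 3(2) 5(2) run_Wh1.prems by (simp add: distrib_left)
  show ?case
    by (rule exI[of _ s5], rule exI[of _ "exp_len b + (1 + (n3 + (1 + n5)))"])
      (use steps_trans[OF s1(1) steps_trans[OF 2 steps_trans[OF 3(1) steps_trans[OF 4 5(1)]]]] 5 n
        in \<open>simp del: com_code.simps\<close>)
qed

text \<open>The prologue moves \<open>k\<close> and \<open>|E|\<close> to the variables 2 and 1; the results are expected in 0 and 1.\<close>

definition assemble :: "com \<Rightarrow> program" where
  "assemble c = (let k = com_code 2 c in [Add 4 1 5, Add 3 2 2] @ k @ [Const 1 0, Add 1 1 2])"

definition input_array :: "(nat \<times> nat) list \<Rightarrow> arrays" where
  "input_array es = (\<lambda>_ _. 0)(0 := (\<lambda>j. if even j then fst (es ! (j div 2)) else snd (es ! (j div 2))),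
     1 := (\<lambda>_. 2 * length es))"

definition input_vars :: "nat \<Rightarrow> nat \<Rightarrow> nat \<Rightarrow> vars" where
  "input_vars n m k = (\<lambda>_. 0)(0 := n, 1 := m, 2 := k)"

lemma assemble_outputs:
  assumes "wp c (\<lambda>v a t. real (\<kappa> * t + 4) \<le> T' \<and> 0 < v 1 \<and> approximates \<delta> (real (v 0) / real (v 1)) M)
      (input_vars n (length es) k) (input_array es) 0"
    and ok: "com_ok \<kappa> c"
  shows "outputs_approximation (assemble c) (input_config n k es) T' \<delta> M"
proof -
  let ?P = "assemble c" and ?init = "input_config n k es"
  let ?k = "com_code 2 c"
  obtain v a t where r: "run c (input_vars n (length es) k, input_array es) t (v, a)" "real (\<kappa> * t + 4) \<le> T'"
     "0 < v 1" "approximates \<delta> (real (v 0) / real (v 1)) M"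
    using assms(1) unfolding wp_def by auto
  have P: "?P ! 0 = Add 4 1 5" "?P ! 1 = Add 3 2 2" "length ?P = length ?k + 4"
    by (auto simp: assemble_def Let_def)
  have cd: "code_at ?P 0 ([Add 4 1 5, Add 3 2 2] @ ?k @ [Const 1 0, Add 1 1 2])"
    unfolding assemble_def code_at_def by (simp add: Let_def)
  \<comment> \<open>Register 5 is still 0, so the first instruction copies k into register 4, which
    is variable 2. Variable 1 is register 2 and already holds |E|; its double is the input size, put
    into register 3.\<close>
  let ?s1 = "?init\<lparr>pc := 2, regs := (regs ?init)(4 := k, 3 := 2 * length es)\<rparr>"
  have 1: "steps ?P 2 ?init ?s1"
    using P by (simp add: steps_two steps_Suc input_config_def mult_2)
  have "sim (input_vars n (length es) k) (input_array es) ?s1"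
    unfolding sim_def
  proof (intro conjI allI impI)
    fix x :: nat
    have "2 * x = 4 \<longleftrightarrow> x = 2" "2 * x = 2 \<longleftrightarrow> x = 1" "2 * x \<noteq> 1" "2 * x \<noteq> 3" by presburger+
    then show "regs ?s1 (2 * x) = input_vars n (length es) k x"
      by (auto simp: input_config_def input_vars_def)
  next
    fix j assume "j < input_array es 1 0"
    then show "mem ?s1 j = input_array es 0 j"
      by (auto simp: input_config_def input_array_def)
  qed (auto simp: input_config_def input_array_def)
  moreover have "code_at ?P (pc ?s1) (com_code (pc ?s1) c)" using cd by (simp add: numeral_2_eq_2)
  ultimately obtain s2 n2 where 2: "steps ?P n2 ?s1 s2" "n2 \<le> \<kappa> * t" "pc s2 = 2 + length ?k" "sim v a s2"
    using com_code_steps[OF r(1), of ?P ?s1 \<kappa>] ok by auto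
  let ?s = "s2\<lparr>pc := pc s2 + 2, regs := (regs s2)(1 := v 1)\<rparr>"
  have r2: "regs s2 2 = v 1" "regs s2 0 = v 0"
    using 2(4) unfolding sim_def by (metis mult.right_neutral, metis mult_0_right)
  have "steps ?P 2 s2 ?s"
    using cd 2 r2 by (auto simp: steps_two steps_Suc)
  from steps_trans[OF 1 steps_trans[OF 2(1) this]]
  have st: "steps ?P (2 + (n2 + 2)) ?init ?s" .
  have "2 + (n2 + 2) \<le> \<kappa> * t + 4" using 2(2) by simp
  then have "real (2 + (n2 + 2)) \<le> T'" using r(2) of_nat_mono order_trans by blast
  moreover have "halted ?P ?s" using 2(3) P(3) by (simp add: halted_def)
  ultimately show ?thesis
    unfolding outputs_approximation_def
    using st[unfolded steps_def] r r2
    by (intro exI[of _ "2 + (n2 + 2)"] exI[of _ ?s]) simp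
qed

subsection \<open>Counting loops\<close>

text \<open>
  The programs below share their variables: 0, 1, 2 hold the input, 3 the prime \<open>q\<close>, 4 the number of
  colours, 5 the number of colourings, 6 and 7 the numbers of vertices and edges, 27 and 28 the
  number \<open>q ^ d\<close> and \<open>d\<close>, 31 the number of hash functions, 33 and 34 the sums which become the output
  fraction, 35 the number of colourings which are injective on a fixed \<open>k\<close>-set. Array 2 is the table
  of the colourings, arrays 3 and 4 are the tails and heads of the edges, 5 is the current hash
  function, 6 the current colouring of the vertices, 13 the weights of the greedy choice, 14 the
  renumbering of the vertices.
\<close>

definition FOR :: "nat \<Rightarrow> exp \<Rightarrow> com \<Rightarrow> com" where
  "FOR i e c = (i ::= N 0 ;; Wh (e -. V i) (c ;; i ::= V i +. N 1))"

lemma wv_FOR [simp]: "wv (FOR i e c) = insert i (wv c)"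
  by (auto simp: FOR_def)

lemma wa_FOR [simp]: "wa (FOR i e c) = wa c"
  by (auto simp: FOR_def)

lemma com_ok_FOR [simp]: "com_ok \<kappa> (FOR i e c) \<longleftrightarrow> exp_ok e \<and> exp_len e + 5 \<le> \<kappa> \<and> 6 \<le> \<kappa> \<and> com_ok \<kappa> c"
  by (auto simp: FOR_def)

text \<open>The bound \<open>e\<close> is evaluated anew in every turn, so it has to keep the value
  \<open>n\<close>. A turn costs 2 beyond its body, for the test and the increment.\<close>

lemma wp_FOR:
  assumes i: "i \<notin> wv c"
    and init: "I 0 (v0(i := 0)) a0"
    and bound: "\<And>j v a. j \<le> n \<Longrightarrow> I j v a \<Longrightarrow> v i = j \<Longrightarrow> eqx (insert i (wv c)) v0 v \<Longrightarrow> eqx (wa c) a0 a \<Longrightarrow>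
        ev e v a = n"
    and step: "\<And>j v a t. j < n \<Longrightarrow> I j v a \<Longrightarrow> v i = j \<Longrightarrow> eqx (insert i (wv c)) v0 v \<Longrightarrow> eqx (wa c) a0 a \<Longrightarrow>
        wp c (\<lambda>v' a' t'. I (Suc j) (v'(i := Suc j)) a' \<and> t' \<le> t + B) v a t"
    and post: "\<And>v a t. I n v a \<Longrightarrow> v i = n \<Longrightarrow> eqx (insert i (wv c)) v0 v \<Longrightarrow> eqx (wa c) a0 a \<Longrightarrow>
        t \<le> t0 + n * (B + 2) + 2 \<Longrightarrow> Q v a t"
  shows "wp (FOR i e c) Q v0 a0 t0"
  unfolding FOR_def wp_Seq wp_Asn
proof (rule wp_Wh_count[where I = "\<lambda>j v a. I j v a \<and> v i = j" and n = n and B = "B + 1"])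
  show "I 0 (v0(i := ev (N 0) v0 a0)) a0 \<and> (v0(i := ev (N 0) v0 a0)) i = 0" using init by simp
next
  fix j v a t
  assume j: "j < n" and I: "I j v a \<and> v i = j"
    and fr: "eqx (wv (c ;; i ::= V i +. N 1)) (v0(i := ev (N 0) v0 a0)) v" "eqx (wa (c ;; i ::= V i +. N 1)) a0 a"
  have fr': "eqx (insert i (wv c)) v0 v" "eqx (wa c) a0 a" using fr by (auto simp: eqx_def)
  have "wp c (wp (i ::= V i +. N 1) (\<lambda>v' a' t'. (I (Suc j) v' a' \<and> v' i = Suc j) \<and> t' \<le> t + (B + 1))) v a t"
  proof (rule wp_frame, rule wp_mono[OF step[OF j]], (use I fr' in simp_all)[4], intro impI)
    fix v' a' t'
    assume "I (Suc j) (v'(i := Suc j)) a' \<and> t' \<le> t + B" "eqx (wv c) v v'"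
    moreover from this have "v' i = j" using i I by (simp add: eqxD)
    ultimately show "wp (i ::= V i +. N 1) (\<lambda>v' a' t'. (I (Suc j) v' a' \<and> v' i = Suc j) \<and> t' \<le> t + (B + 1)) v' a' t'"
      by simp
  qed
  moreover have "ev (e -. V i) v a \<noteq> 0" using bound[of j v a] j I fr' by simp
  ultimately show "ev (e -. V i) v a \<noteq> 0 \<and>
      wp (c ;; i ::= V i +. N 1) (\<lambda>v' a' t'. (I (Suc j) v' a' \<and> v' i = Suc j) \<and> t' \<le> t + (B + 1)) v a t"
    by (simp del: wp_Asn)
next
  fix v a
  assume "I n v a \<and> v i = n"
    and "eqx (wv (c ;; i ::= V i +. N 1)) (v0(i := ev (N 0) v0 a0)) v" "eqx (wa (c ;; i ::= V i +. N 1)) a0 a"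
  then show "ev (e -. V i) v a = 0" using bound[of n v a] by (simp add: eqx_def)
next
  fix v a t
  assume "I n v a \<and> v i = n" "t \<le> Suc t0 + n * (B + 1 + 1) + 1"
    and "eqx (wv (c ;; i ::= V i +. N 1)) (v0(i := ev (N 0) v0 a0)) v" "eqx (wa (c ;; i ::= V i +. N 1)) a0 a"
  then show "Q v a t" by (intro post) (auto simp: eqx_def)
qed

subsection \<open>Counting walks\<close>

text \<open>Arrays 10 and 11 hold the old and the new counts, array 7 is the indicator of the colour
  set. Every edge pushes the count of its tail to its head, so the edges may come in any
  order.\<close>

definition WALK_ROUND :: com where
  "WALK_ROUND =
     FOR 9 (V 6) (Upd 11 (V 9) (N 0)) ;;
     FOR 9 (V 7) (Upd 11 (Ar 4 (V 9)) (Ar 11 (Ar 4 (V 9)) +. Ar 10 (Ar 3 (V 9)))) ;;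
     FOR 9 (V 6) (Ite (Ar 7 (Ar 6 (V 9))) (Upd 10 (V 9) (Ar 11 (V 9))) (Upd 10 (V 9) (N 0)))"

definition WALK :: com where
  "WALK =
     FOR 9 (V 6) (Upd 10 (V 9) (Ar 7 (Ar 6 (V 9)))) ;;
     FOR 10 (V 2 -. N 1) WALK_ROUND ;;
     11 ::= N 0 ;;
     FOR 9 (V 6) (11 ::= V 11 +. Ar 10 (V 9))"

lemma WALK_ROUND_frame [simp]: "wv WALK_ROUND = {9}" "wa WALK_ROUND = {10, 11}"
  by (auto simp: WALK_ROUND_def)

lemma WALK_frame [simp]: "wv WALK = {9, 10, 11}" "wa WALK = {10, 11}"
  by (auto simp: WALK_def)

lemma sum_list_edges:
  "(\<Sum>(u, w)\<leftarrow>map (\<lambda>e. (f e, g e)) [0..<n]. F u w) = (\<Sum>e<n. F (f e) (g e))"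
  by (simp add: comp_def interv_sum_list_conv_sum_set_nat atLeast0LessThan)

lemma walk_count_edges:
  "walk_count (map (\<lambda>e. (f e, g e)) [0..<n]) ok (Suc j) v =
    (if ok v then \<Sum>e<n. if g e = v then walk_count (map (\<lambda>e. (f e, g e)) [0..<n]) ok j (f e) else 0 else 0)"
  by (simp only: walk_count.simps sum_list_edges)

lemma WALK_ROUND_spec:
  assumes edges: "\<And>e. e < v 7 \<Longrightarrow> a 3 e < v 6 \<and> a 4 e < v 6"
    and cur: "\<And>u. u < v 6 \<Longrightarrow> a 10 u = walk_count (map (\<lambda>e. (a 3 e, a 4 e)) [0..<v 7]) (\<lambda>u. u < v 6 \<and> a 7 (a 6 u) \<noteq> 0) j u"
    and post: "\<And>v' a' t'. eqx {9} v v' \<Longrightarrow> eqx {10, 11} a a' \<Longrightarrow>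
      (\<And>u. u < v 6 \<Longrightarrow> a' 10 u = walk_count (map (\<lambda>e. (a 3 e, a 4 e)) [0..<v 7]) (\<lambda>u. u < v 6 \<and> a 7 (a 6 u) \<noteq> 0) (Suc j) u) \<Longrightarrow>
      t' \<le> t + (7 * v 6 + 3 * v 7 + 6) \<Longrightarrow> Q v' a' t'"
  shows "wp WALK_ROUND Q v a t"
proof -
  let ?wc = "walk_count (map (\<lambda>e. (a 3 e, a 4 e)) [0..<v 7]) (\<lambda>u. u < v 6 \<and> a 7 (a 6 u) \<noteq> 0)"
  show ?thesis
    unfolding WALK_ROUND_def wp_Seq
  proof (rule wp_FOR[where I = "\<lambda>j v' a'. \<forall>u<j. a' 11 u = 0" and n = "v 6" and B = 1])
    fix v1 a1 t1
    assume z: "\<forall>u<v 6. a1 11 u = 0" and f1: "eqx (insert 9 (wv (Upd 11 (V 9) (N 0)))) v v1"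
      "eqx (wa (Upd 11 (V 9) (N 0))) a a1" and t1: "t1 \<le> t + v 6 * (1 + 2) + 2"
    note [simp] = eqxD[OF f1(1)] eqxD[OF f1(2)]
    show "wp (FOR 9 (V 7) (Upd 11 (Ar 4 (V 9)) (Ar 11 (Ar 4 (V 9)) +. Ar 10 (Ar 3 (V 9)))))
       (wp (FOR 9 (V 6) (Ite (Ar 7 (Ar 6 (V 9))) (Upd 10 (V 9) (Ar 11 (V 9))) (Upd 10 (V 9) (N 0)))) Q) v1 a1 t1"
    proof (rule wp_FOR[where n = "v 7" and B = 1 and
          I = "\<lambda>n v' a'. \<forall>u<v 6. a' 11 u = (\<Sum>e<n. if a 4 e = u then ?wc j (a 3 e) else 0)"])
      fix v2 a2 t2
      assume s: "\<forall>u<v 6. a2 11 u = (\<Sum>e<v 7. if a 4 e = u then ?wc j (a 3 e) else 0)"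
        and f2: "eqx (insert 9 (wv (Upd 11 (Ar 4 (V 9)) (Ar 11 (Ar 4 (V 9)) +. Ar 10 (Ar 3 (V 9)))))) v1 v2"
          "eqx (wa (Upd 11 (Ar 4 (V 9)) (Ar 11 (Ar 4 (V 9)) +. Ar 10 (Ar 3 (V 9))))) a1 a2"
        and t2: "t2 \<le> t1 + v 7 * (1 + 2) + 2"
      note [simp] = eqxD[OF f2(1)] eqxD[OF f2(2)]
      show "wp (FOR 9 (V 6) (Ite (Ar 7 (Ar 6 (V 9))) (Upd 10 (V 9) (Ar 11 (V 9))) (Upd 10 (V 9) (N 0)))) Q v2 a2 t2"
      proof (rule wp_FOR[where n = "v 6" and B = 2 and I = "\<lambda>n v' a'. \<forall>u<n. a' 10 u = ?wc (Suc j) u"])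
        fix v3 a3 t3
        assume I: "\<forall>u<v 6. a3 10 u = ?wc (Suc j) u"
          and f3: "eqx (insert 9 (wv (Ite (Ar 7 (Ar 6 (V 9))) (Upd 10 (V 9) (Ar 11 (V 9))) (Upd 10 (V 9) (N 0))))) v2 v3"
          "eqx (wa (Ite (Ar 7 (Ar 6 (V 9))) (Upd 10 (V 9) (Ar 11 (V 9))) (Upd 10 (V 9) (N 0)))) a2 a3"
          and t3: "t3 \<le> t2 + v 6 * (2 + 2) + 2"
        show "Q v3 a3 t3"
        proof (rule post)
          show "eqx {9} v v3" "eqx {10, 11} a a3" using f1 f2 f3 by (auto simp: eqx_def)
          show "t3 \<le> t + (7 * v 6 + 3 * v 7 + 6)" using t1 t2 t3 by simp
        qed (use I in simp)
      next
        fix n v3 a3 t3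
        assume n: "n < v 6" and I: "\<forall>u<n. a3 10 u = ?wc (Suc j) u" and "v3 9 = n"
          and f3: "eqx (insert 9 (wv (Ite (Ar 7 (Ar 6 (V 9))) (Upd 10 (V 9) (Ar 11 (V 9))) (Upd 10 (V 9) (N 0))))) v2 v3"
          "eqx (wa (Ite (Ar 7 (Ar 6 (V 9))) (Upd 10 (V 9) (Ar 11 (V 9))) (Upd 10 (V 9) (N 0)))) a2 a3"
        note [simp] = eqxD[OF f3(1)] eqxD[OF f3(2)]
        have "?wc (Suc j) n = (if a 7 (a 6 n) \<noteq> 0 then a2 11 n else 0)"
          using s n by (simp add: walk_count_edges del: walk_count.simps neq0_conv)
        then show "wp (Ite (Ar 7 (Ar 6 (V 9))) (Upd 10 (V 9) (Ar 11 (V 9))) (Upd 10 (V 9) (N 0)))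
          (\<lambda>v' a' t'. (\<forall>u<Suc n. a' 10 u = ?wc (Suc j) u) \<and> t' \<le> t3 + 2) v3 a3 t3"
          using I \<open>v3 9 = n\<close> by (simp add: less_Suc_eq del: walk_count.simps)
      qed (auto simp: eqxD)
    next
      fix n v2 a2 t2
      assume n: "n < v 7" and s: "\<forall>u<v 6. a2 11 u = (\<Sum>e<n. if a 4 e = u then ?wc j (a 3 e) else 0)" and "v2 9 = n"
        and f2: "eqx (insert 9 (wv (Upd 11 (Ar 4 (V 9)) (Ar 11 (Ar 4 (V 9)) +. Ar 10 (Ar 3 (V 9)))))) v1 v2"
          "eqx (wa (Upd 11 (Ar 4 (V 9)) (Ar 11 (Ar 4 (V 9)) +. Ar 10 (Ar 3 (V 9))))) a1 a2"
      note [simp] = eqxD[OF f2(1)] eqxD[OF f2(2)]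
      show "wp (Upd 11 (Ar 4 (V 9)) (Ar 11 (Ar 4 (V 9)) +. Ar 10 (Ar 3 (V 9))))
         (\<lambda>v' a' t'. (\<forall>u<v 6. a' 11 u = (\<Sum>e<Suc n. if a 4 e = u then ?wc j (a 3 e) else 0)) \<and> t' \<le> t2 + 1) v2 a2 t2"
        using s \<open>v2 9 = n\<close> edges[OF n] cur by simp
    qed (use z in \<open>auto simp: eqxD\<close>)
  qed (auto simp: eqxD less_Suc_eq)
qed

lemma WALK_spec:
  assumes inx: "\<And>x. a 7 x \<le> 1" and k: "1 \<le> v 2"
    and edges: "\<And>e. e < v 7 \<Longrightarrow> a 3 e < v 6 \<and> a 4 e < v 6"
    and post: "\<And>v' a' t'. v' 11 = (\<Sum>u<v 6. walk_count (map (\<lambda>e. (a 3 e, a 4 e)) [0..<v 7])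
        (\<lambda>u. u < v 6 \<and> a 7 (a 6 u) \<noteq> 0) (v 2 - 1) u) \<Longrightarrow>
      eqx {9, 10, 11} v v' \<Longrightarrow> eqx {10, 11} a a' \<Longrightarrow> t' \<le> t + 20 * (v 2 * (v 6 + v 7 + 1)) \<Longrightarrow> Q v' a' t'"
  shows "wp WALK Q v a t"
proof -
  let ?wc = "walk_count (map (\<lambda>e. (a 3 e, a 4 e)) [0..<v 7]) (\<lambda>u. u < v 6 \<and> a 7 (a 6 u) \<noteq> 0)"
  let ?c1 = "Upd 10 (V 9) (Ar 7 (Ar 6 (V 9)))"
  let ?c3 = "11 ::= V 11 +. Ar 10 (V 9)"
  show ?thesis
    unfolding WALK_def wp_Seq
  proof (rule wp_FOR[where I = "\<lambda>j v' a'. \<forall>u<j. a' 10 u = ?wc 0 u" and n = "v 6" and B = 1])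
    fix v1 a1 t1
    assume z: "\<forall>u<v 6. a1 10 u = ?wc 0 u" and f1: "eqx (insert 9 (wv ?c1)) v v1" "eqx (wa ?c1) a a1"
      and t1: "t1 \<le> t + v 6 * (1 + 2) + 2"
    note [simp] = eqxD[OF f1(1)] eqxD[OF f1(2)]
    show "wp (FOR 10 (V 2 -. N 1) WALK_ROUND) (wp (11 ::= N 0) (wp (FOR 9 (V 6) ?c3) Q)) v1 a1 t1"
    proof (rule wp_FOR[where n = "v 2 - 1" and B = "7 * v 6 + 3 * v 7 + 6" and
          I = "\<lambda>j v' a'. \<forall>u<v 6. a' 10 u = ?wc j u"])
      fix v2 a2 t2
      assume I2: "\<forall>u<v 6. a2 10 u = ?wc (v 2 - 1) u"
        and f2: "eqx (insert 10 (wv WALK_ROUND)) v1 v2" "eqx (wa WALK_ROUND) a1 a2"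
        and t2: "t2 \<le> t1 + (v 2 - 1) * (7 * v 6 + 3 * v 7 + 6 + 2) + 2"
      note [simp] = eqxD[OF f2(1)] eqxD[OF f2(2)]
      have "wp (FOR 9 (V 6) ?c3) Q (v2(11 := 0)) a2 (Suc t2)"
      proof (rule wp_FOR[where n = "v 6" and B = 1 and I = "\<lambda>j v' a'. v' 11 = (\<Sum>u<j. ?wc (v 2 - 1) u)"])
        fix v3 a3 t3
        assume I: "v3 11 = (\<Sum>u<v 6. ?wc (v 2 - 1) u)" and f3: "eqx (insert 9 (wv ?c3)) (v2(11 := 0)) v3"
          "eqx (wa ?c3) a2 a3" and t3: "t3 \<le> Suc t2 + v 6 * (1 + 2) + 2"
        show "Q v3 a3 t3"
        proof (rule post)
          show "v3 11 = (\<Sum>u<v 6. ?wc (v 2 - 1) u)" by (rule I)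
          show "eqx {9, 10, 11} v v3" "eqx {10, 11} a a3" using f1 f2 f3 by (auto simp: eqx_def)
          obtain k' where k': "v 2 = Suc k'" using k by (cases "v 2") auto
          have "t3 \<le> t + (6 * v 6 + 7 + k' * (7 * v 6 + 3 * v 7 + 8))" using t1 t2 t3 k' by (simp add: algebra_simps)
          also have "\<dots> \<le> t + 20 * (v 2 * (v 6 + v 7 + 1))" unfolding k' by (simp add: algebra_simps)
          finally show "t3 \<le> t + 20 * (v 2 * (v 6 + v 7 + 1))" .
        qed
      next
        fix n v3 a3 t3
        assume n: "n < v 6" and I: "v3 11 = (\<Sum>u<n. ?wc (v 2 - 1) u)" "v3 9 = n"
          and f3: "eqx (insert 9 (wv ?c3)) (v2(11 := 0)) v3" "eqx (wa ?c3) a2 a3"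
        note [simp] = eqxD[OF f3(1)] eqxD[OF f3(2)]
        show "wp ?c3 (\<lambda>v' a' t'. (v'(9 := Suc n)) 11 = (\<Sum>u<Suc n. ?wc (v 2 - 1) u) \<and> t' \<le> t3 + 1) v3 a3 t3"
          using I I2 n by (simp del: walk_count.simps)
      qed (auto simp: eqxD)
      then show "wp (11 ::= N 0) (wp (FOR 9 (V 6) ?c3) Q) v2 a2 t2" by simp
    next
      fix n v2 a2 t2
      assume I2: "\<forall>u<v 6. a2 10 u = ?wc n u"
        and f2: "eqx (insert 10 (wv WALK_ROUND)) v1 v2" "eqx (wa WALK_ROUND) a1 a2"
      note [simp] = eqxD[OF f2(1)] eqxD[OF f2(2)]
      show "wp WALK_ROUND (\<lambda>v' a' t'. (\<forall>u<v 6. a' 10 u = ?wc (Suc n) u) \<and> t' \<le> t2 + (7 * v 6 + 3 * v 7 + 6)) v2 a2 t2"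
        by (rule WALK_ROUND_spec[where j = n]) (use edges I2 in \<open>simp_all del: walk_count.simps\<close>)
    qed (use z in \<open>auto simp: eqxD simp del: walk_count.simps\<close>)
  next
    fix n v1 a1 t1
    assume z: "n < v 6" "\<forall>u<n. a1 10 u = ?wc 0 u" "v1 9 = n" and f1: "eqx (insert 9 (wv ?c1)) v v1" "eqx (wa ?c1) a a1"
    note [simp] = eqxD[OF f1(1)] eqxD[OF f1(2)]
    have "?wc 0 n = a 7 (a 6 n)" using z(1) inx[of "a 6 n"] by (cases "a 7 (a 6 n)") auto
    then show "wp ?c1 (\<lambda>v' a' t'. (\<forall>u<Suc n. a' 10 u = ?wc 0 u) \<and> t' \<le> t1 + 1) v1 a1 t1"
      using z by (simp add: less_Suc_eq del: walk_count.simps)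
  qed (auto simp: eqxD)
qed

subsection \<open>Enumerating the colour sets\<close>

text \<open>The sets that the search still visits while its stack is \<open>X\<close>, the next
  candidate is \<open>c\<close> and \<open>r\<close> places are free. \<open>X\<close> itself is
  left out (\<open>Y \<noteq> {}\<close>) as it was visited when its last colour was pushed.\<close>

definition extensions :: "nat \<Rightarrow> nat set \<Rightarrow> nat \<Rightarrow> nat \<Rightarrow> nat set set" where
  "extensions K X r c = {X \<union> Y | Y. Y \<subseteq> {c..<K} \<and> Y \<noteq> {} \<and> card Y \<le> r}"

lemma finite_extensions: "finite (extensions K X r c)"
  by (rule finite_subset[of _ "(\<lambda>Y. X \<union> Y) ` Pow {c..<K}"]) (auto simp: extensions_def)

lemma extensions_empty: "K \<le> c \<or> r = 0 \<Longrightarrow> extensions K X r c = {}"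
proof -
  have "card Y = 0 \<longrightarrow> Y = {}" if "Y \<subseteq> {c..<K}" for Y using that finite_subset by fastforce
  then show "K \<le> c \<or> r = 0 \<Longrightarrow> extensions K X r c = {}" by (auto simp: extensions_def)
qed

text \<open>The recursion of the search: \<open>c\<close> is pushed and the extensions of the larger
  set are visited, then \<open>c\<close> is popped and the search goes on with
  \<open>Suc c\<close>.\<close>

lemma extensions_step:
  assumes c: "c < K" and X: "X \<subseteq> {..<c}"
  shows "extensions K X (Suc r) c =
    insert (insert c X) (extensions K (insert c X) r (Suc c) \<union> extensions K X (Suc r) (Suc c))"
    (is "?L = ?R")
proof (intro equalityI subsetI)
  fix Z assume "Z \<in> ?L"
  then obtain Y where Y: "Z = X \<union> Y" "Y \<subseteq> {c..<K}" "Y \<noteq> {}" "card Y \<le> Suc r" by (auto simp: extensions_def)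
  have finY: "finite Y" using Y finite_subset by blast
  show "Z \<in> ?R"
  proof (cases "c \<in> Y")
    case False
    then have "Y \<subseteq> {Suc c..<K}" using Y(2) by (force simp: Suc_le_eq le_less)
    then show ?thesis using Y by (auto simp: extensions_def)
  next
    case True
    let ?Y = "Y - {c}"
    have Z: "Z = insert c X \<union> ?Y" using True Y(1) by blast
    show ?thesis
    proof (cases "?Y = {}")
      case True
      then show ?thesis using Z by auto
    next
      case False
      have "?Y \<subseteq> {Suc c..<K}" using Y(2) by (force simp: Suc_le_eq le_less)
      moreover have "card ?Y \<le> r" using Y(4) True finY by simp
      ultimately show ?thesis using False Z by (auto simp: extensions_def)
    qed
  qed
next
  fix Z assume "Z \<in> ?R"
  then consider "Z = insert c X" | "Z \<in> extensions K (insert c X) r (Suc c)" | "Z \<in> extensions K X (Suc r) (Suc c)"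
    by blast
  then show "Z \<in> ?L"
  proof cases
    case 1
    then show ?thesis using c by (auto simp: extensions_def intro!: exI[of _ "{c}"])
  next
    case 2
    then obtain Y where Y: "Z = insert c X \<union> Y" "Y \<subseteq> {Suc c..<K}" "card Y \<le> r" by (auto simp: extensions_def)
    have "finite Y" using Y finite_subset by blast
    then have "card (insert c Y) \<le> Suc r" using Y(3) by (simp add: card_insert_if)
    moreover have "Z = X \<union> insert c Y" "insert c Y \<subseteq> {c..<K}" using Y c by auto
    ultimately show ?thesis unfolding extensions_def by blast
  next
    case 3
    then obtain Y where "Z = X \<union> Y" "Y \<subseteq> {Suc c..<K}" "Y \<noteq> {}" "card Y \<le> Suc r" by (auto simp: extensions_def)
    moreover from this have "Y \<subseteq> {c..<K}" by force
    ultimately show ?thesis unfolding extensions_def by blast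
  qed
qed

lemma extensions_step_disjoint:
  assumes X: "X \<subseteq> {..<c}"
  shows "insert c X \<notin> extensions K (insert c X) r (Suc c) \<union> extensions K X r' (Suc c)"
    and "extensions K (insert c X) r (Suc c) \<inter> extensions K X r' (Suc c) = {}"
proof -
  have c: "c \<notin> Z" if "Z \<in> extensions K X r' (Suc c)" for Z using that X by (force simp: extensions_def)
  have "insert c X \<notin> extensions K (insert c X) r (Suc c)"
  proof
    assume "insert c X \<in> extensions K (insert c X) r (Suc c)"
    then obtain Y where Y: "insert c X = insert c X \<union> Y" "Y \<subseteq> {Suc c..<K}" "Y \<noteq> {}" by (auto simp: extensions_def)
    then obtain y where "y \<in> Y" by blast
    then have "y \<in> insert c X" "Suc c \<le> y" using Y by auto
    then show False using X by auto
  qed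
  then show "insert c X \<notin> extensions K (insert c X) r (Suc c) \<union> extensions K X r' (Suc c)" using c by blast
  have "c \<in> Z" if "Z \<in> extensions K (insert c X) r (Suc c)" for Z using that by (auto simp: extensions_def)
  then show "extensions K (insert c X) r (Suc c) \<inter> extensions K X r' (Suc c) = {}" using c by blast
qed

lemma sum_extensions_step:
  fixes g :: "nat set \<Rightarrow> nat"
  assumes c: "c < K" and X: "X \<subseteq> {..<c}"
  shows "(\<Sum>Z\<in>extensions K X (Suc r) c. g Z) = g (insert c X) +
    (\<Sum>Z\<in>extensions K (insert c X) r (Suc c). g Z) + (\<Sum>Z\<in>extensions K X (Suc r) (Suc c). g Z)"
  unfolding extensions_step[OF assms]
  using extensions_step_disjoint[OF X] by (simp add: finite_extensions sum.union_disjoint add.assoc)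

text \<open>For the set X on the stack, of size \<open>V 12\<close>, the walk count is multiplied by
  the weight C(K - |X|, k - |X|) through repeated addition, and goes to the cell of array 17 given
  by the parity of k - |X|.\<close>

definition NODE :: com where
  "NODE = WALK ;; 19 ::= Ar 12 (V 2 -. V 12) ;; 15 ::= Ar 9 (V 2 -. V 12) ;;
     FOR 14 (V 19) (Upd 17 (V 15) (Ar 17 (V 15) +. V 11))"

definition PUSH :: com where
  "PUSH = Upd 8 (V 12) (V 13) ;; 12 ::= V 12 +. N 1 ;; Upd 7 (V 13) (N 1) ;; 13 ::= V 13 +. N 1 ;; NODE"

definition POP :: com where
  "POP = 12 ::= V 12 -. N 1 ;; 13 ::= Ar 8 (V 12) ;; Upd 7 (V 13) (N 0) ;; 13 ::= V 13 +. N 1"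

text \<open>Depth-first search through the increasing sequences of at most k colours: array 8 is the
  stack, \<open>V 12\<close> its height, \<open>V 13\<close> the next candidate. It pushes while
  there is a candidate and a free place and otherwise pops, resuming after the popped
  colour.\<close>

definition DFS_LOOP :: com where
  "DFS_LOOP = Wh (V 12 +. (V 4 -. V 13)) (Ite (V 4 -. V 13) (Ite (V 2 -. V 12) PUSH POP) POP)"

definition DFS :: com where
  "DFS = 12 ::= N 0 ;; 13 ::= N 0 ;; DFS_LOOP"

lemma NODE_frame [simp]: "wv NODE = {9, 10, 11, 14, 15, 19}" "wa NODE = {10, 11, 17}"
  by (auto simp: NODE_def)

lemma DFS_frame [simp]: "wv DFS = {9, 10, 11, 12, 13, 14, 15, 19}" "wa DFS = {7, 8, 10, 11, 17}"
  by (auto simp: DFS_def DFS_LOOP_def PUSH_def POP_def)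

definition set_walks :: "vars \<Rightarrow> arrays \<Rightarrow> nat set \<Rightarrow> nat" where
  "set_walks v a X = (\<Sum>u<v 6. walk_count (map (\<lambda>e. (a 3 e, a 4 e)) [0..<v 7])
     (\<lambda>u. u < v 6 \<and> a 6 u \<in> X) (v 2 - 1) u)"

lemma NODE_spec:
  assumes inx: "\<And>x. a 7 x = of_bool (x \<in> X)" and k: "1 \<le> v 2"
    and edges: "\<And>e. e < v 7 \<Longrightarrow> a 3 e < v 6 \<and> a 4 e < v 6"
    and bin: "a 12 (v 2 - v 12) \<le> M"
    and post: "\<And>v' a' t'. eqx {9, 10, 11, 14, 15, 19} v v' \<Longrightarrow> eqx {10, 11, 17} a a' \<Longrightarrow>
      (\<And>b. a' 17 b = a 17 b + (if b = a 9 (v 2 - v 12) then a 12 (v 2 - v 12) * set_walks v a X else 0)) \<Longrightarrow>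
      t' \<le> t + 20 * (v 2 * (v 6 + v 7 + 1)) + 3 * M + 4 \<Longrightarrow> Q v' a' t'"
  shows "wp NODE Q v a t"
  unfolding NODE_def wp_Seq
proof (rule WALK_spec[where a = a])
  show "a 7 x \<le> 1" for x using inx[of x] by simp
  fix v1 a1 t1
  assume w: "v1 11 = (\<Sum>u<v 6. walk_count (map (\<lambda>e. (a 3 e, a 4 e)) [0..<v 7])
        (\<lambda>u. u < v 6 \<and> a 7 (a 6 u) \<noteq> 0) (v 2 - 1) u)"
    and f1: "eqx {9, 10, 11} v v1" "eqx {10, 11} a a1" and t1: "t1 \<le> t + 20 * (v 2 * (v 6 + v 7 + 1))"
  have w': "v1 11 = set_walks v a X" unfolding w set_walks_def inx by simp
  note [simp] = eqxD[OF f1(1)] eqxD[OF f1(2)]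
  let ?b = "a 9 (v 2 - v 12)" and ?n = "a 12 (v 2 - v 12)" and ?c = "Upd 17 (V 15) (Ar 17 (V 15) +. V 11)"
  have "wp (FOR 14 (V 19) ?c) Q (v1(19 := ?n, 15 := ?b)) a1 (Suc (Suc t1))"
  proof (rule wp_FOR[where n = ?n and B = 1 and
        I = "\<lambda>j v' a'. \<forall>b. a' 17 b = a 17 b + (if b = ?b then j * set_walks v a X else 0)"])
    fix v2 a2 t2
    assume I: "\<forall>b. a2 17 b = a 17 b + (if b = ?b then ?n * set_walks v a X else 0)"
      and f2: "eqx (insert 14 (wv ?c)) (v1(19 := ?n, 15 := ?b)) v2" "eqx (wa ?c) a1 a2"
      and t2: "t2 \<le> Suc (Suc t1) + ?n * (1 + 2) + 2"
    show "Q v2 a2 t2"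
    proof (rule post)
      show "eqx {9, 10, 11, 14, 15, 19} v v2" "eqx {10, 11, 17} a a2" using f1 f2 by (auto simp: eqx_def)
      show "t2 \<le> t + 20 * (v 2 * (v 6 + v 7 + 1)) + 3 * M + 4" using t1 t2 bin by simp
    qed (use I in simp)
  next
    fix j v2 a2 t2
    assume I: "\<forall>b. a2 17 b = a 17 b + (if b = ?b then j * set_walks v a X else 0)"
      and f2: "eqx (insert 14 (wv ?c)) (v1(19 := ?n, 15 := ?b)) v2" "eqx (wa ?c) a1 a2"
    note [simp] = eqxD[OF f2(1)] eqxD[OF f2(2)]
    show "wp ?c (\<lambda>v' a' t'. (\<forall>b. a' 17 b = a 17 b + (if b = ?b then Suc j * set_walks v a X else 0)) \<and> t' \<le> t2 + 1) v2 a2 t2"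
      using I w' by simp
  qed (auto simp: eqxD)
  then show "wp (19 ::= Ar 12 (V 2 -. V 12)) (wp (15 ::= Ar 9 (V 2 -. V 12)) (wp (FOR 14 (V 19) ?c) Q)) v1 a1 t1"
    by simp
qed (use k edges in auto)

text \<open>The invariant at the head of the search: the stack is \<open>cs\<close>, the next candidate is \<open>c\<close>.\<close>

definition dfs_state :: "vars \<Rightarrow> arrays \<Rightarrow> nat list \<Rightarrow> nat \<Rightarrow> (nat \<Rightarrow> nat) \<Rightarrow> vars \<Rightarrow> arrays \<Rightarrow> bool" where
  "dfs_state v0 a0 cs c p v a \<longleftrightarrow> v 12 = length cs \<and> v 13 = c \<and> (\<forall>i<length cs. a 8 i = cs ! i) \<and>
     (\<forall>x. a 7 x = of_bool (x \<in> set cs)) \<and> (\<forall>b. a 17 b = p b) \<and>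
     eqx {9, 10, 11, 12, 13, 14, 15, 19} v0 v \<and> eqx {7, 8, 10, 11, 17} a0 a"

definition node_value :: "vars \<Rightarrow> arrays \<Rightarrow> nat \<Rightarrow> nat set \<Rightarrow> nat" where
  "node_value v a b X = (if b = a 9 (v 2 - card X) then a 12 (v 2 - card X) * set_walks v a X else 0)"

lemma set_walks_cong: "eqx {9, 10, 11, 12, 13, 14, 15, 19} v v' \<Longrightarrow> eqx {7, 8, 10, 11, 17} a a' \<Longrightarrow>
    set_walks v' a' X = set_walks v a X"
  by (simp add: set_walks_def eqxD)

text \<open>One loop realizes the recursion, so the claim has continuation form: from the given
  state the loop reaches a state with the same stack and all extensions accounted for, and by
  \<open>cont\<close> it succeeds from there. The induction is on the number of candidates left, and
  is used for the pushed stack and again after the pop. A node is charged 18 beyond the walk count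
  and the weight: 11 when it is pushed, 7 when it is popped.\<close>

lemma DFS_LOOP_spec:
  assumes k: "1 \<le> vi 2" and edges: "\<And>e. e < vi 7 \<Longrightarrow> ai 3 e < vi 6 \<and> ai 4 e < vi 6"
    and bin: "\<And>i. i \<le> vi 2 \<Longrightarrow> ai 12 i \<le> M"
    and st: "dfs_state vi ai cs c p v a" "c \<le> vi 4" "set cs \<subseteq> {..<c}" "distinct cs" "length cs \<le> vi 2"
    and cont: "\<And>c' v' a' t'. c' = vi 4 \<or> length cs = vi 2 \<Longrightarrow> c \<le> c' \<Longrightarrow> c' \<le> vi 4 \<Longrightarrow>
      dfs_state vi ai cs c' (\<lambda>b. p b + (\<Sum>X\<in>extensions (vi 4) (set cs) (vi 2 - length cs) c. node_value vi ai b X)) v' a' \<Longrightarrow>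
      t' \<le> t + card (extensions (vi 4) (set cs) (vi 2 - length cs) c) * (20 * (vi 2 * (vi 6 + vi 7 + 1)) + 3 * M + 18) \<Longrightarrow>
      wp DFS_LOOP Q v' a' t'"
  shows "wp DFS_LOOP Q v a t"
  using st cont
proof (induction "vi 4 - c" arbitrary: cs c p v a t rule: less_induct)
  case less
  let ?K = "vi 4" and ?k = "vi 2"
  let ?C = "20 * (?k * (vi 6 + vi 7 + 1)) + 3 * M"
  let ?E = "extensions ?K"
  show ?case
  proof (cases "c < ?K \<and> length cs < ?k")
    case False
    then have e: "?E (set cs) (?k - length cs) c = {}" using less.prems by (intro extensions_empty) auto
    show ?thesis by (rule less.prems(6)[of c]) (use False less.prems e in auto)
  next
    case True
    define r where "r = ?k - length cs - 1"
    have r: "?k - length cs = Suc r" "?k - length (cs @ [c]) = r" using True by (auto simp: r_def)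
    let ?N = "\<lambda>b. node_value vi ai b (insert c (set cs))"
    let ?S1 = "\<lambda>b. \<Sum>X\<in>?E (insert c (set cs)) r (Suc c). node_value vi ai b X"
    let ?S2 = "\<lambda>b. \<Sum>X\<in>?E (set cs) (Suc r) (Suc c). node_value vi ai b X"
    have cardc: "card (insert c (set cs)) = Suc (length cs)"
      using less.prems(3,4) by (subst card_insert_disjoint) (auto simp: distinct_card)
    have split: "(\<Sum>X\<in>?E (set cs) (Suc r) c. g X) = g (insert c (set cs)) +
       (\<Sum>X\<in>?E (insert c (set cs)) r (Suc c). g X) + (\<Sum>X\<in>?E (set cs) (Suc r) (Suc c). g X)" for g :: "nat set \<Rightarrow> nat"
      by (rule sum_extensions_step) (use True less.prems in auto)
    have sc: "card (?E (set cs) (Suc r) c) = 1 + card (?E (insert c (set cs)) r (Suc c)) + card (?E (set cs) (Suc r) (Suc c))"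
      using split[of "\<lambda>_. 1"] by simp
    note st = less.prems(1)[unfolded dfs_state_def]
    have fr: "eqx {9, 10, 11, 12, 13, 14, 15, 19} vi v" "eqx {7, 8, 10, 11, 17} ai a" using st by auto
    have vars: "v 2 = ?k" "v 4 = ?K" "v 6 = vi 6" "v 7 = vi 7" "v 12 = length cs" "v 13 = c"
      using st fr(1) by (auto simp: eqxD)
    have "wp PUSH (wp DFS_LOOP Q) v a (t + 3)"
    proof -
      let ?v = "v(12 := Suc (length cs), 13 := Suc c)"
      let ?a = "a(8 := (a 8)(length cs := c), 7 := (a 7)(c := 1))"
      have frv: "eqx {9, 10, 11, 12, 13, 14, 15, 19} vi ?v" "eqx {7, 8, 10, 11, 17} ai ?a"
        using fr by (auto simp: eqx_def)
      have "wp NODE (wp DFS_LOOP Q) ?v ?a (t + 7)"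
      proof (rule NODE_spec[where X = "insert c (set cs)" and M = M])
        show "?a 7 x = of_bool (x \<in> insert c (set cs))" for x using st by auto
        show "1 \<le> ?v 2" using k vars by simp
        show "?a 3 e < ?v 6 \<and> ?a 4 e < ?v 6" if "e < ?v 7" for e
          using edges[of e] that vars fr(2) by (simp add: eqxD)
        show "?a 12 (?v 2 - ?v 12) \<le> M" using bin vars fr(2) by (simp add: eqxD)
        fix v1 a1 t1
        assume f1: "eqx {9, 10, 11, 14, 15, 19} ?v v1" "eqx {10, 11, 17} ?a a1"
          and p1: "\<And>b. a1 17 b = ?a 17 b + (if b = ?a 9 (?v 2 - ?v 12)
              then ?a 12 (?v 2 - ?v 12) * set_walks ?v ?a (insert c (set cs)) else 0)"
          and t1: "t1 \<le> t + 7 + 20 * (?v 2 * (?v 6 + ?v 7 + 1)) + 3 * M + 4"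
        have p1': "a1 17 b = p b + ?N b" for b
        proof -
          have "?a 17 b = p b" using st by simp
          moreover have "?v 2 - ?v 12 = ?k - Suc (length cs)" using vars by simp
          moreover have "?a 9 = ai 9" "?a 12 = ai 12" using eqxD[OF fr(2), of 9] eqxD[OF fr(2), of 12] by simp_all
          ultimately show ?thesis using p1[of b] unfolding set_walks_cong[OF frv] node_value_def cardc by simp
        qed
        have d1: "dfs_state vi ai (cs @ [c]) (Suc c) (\<lambda>b. p b + ?N b) v1 a1"
          unfolding dfs_state_def
        proof (intro conjI allI impI)
          show "v1 12 = length (cs @ [c])" "v1 13 = Suc c" using eqxD[OF f1(1)] by auto
          show "a1 8 i = (cs @ [c]) ! i" if "i < length (cs @ [c])" for i
            using that st eqxD[OF f1(2), of 8] by (auto simp: nth_append less_Suc_eq)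
          show "a1 7 x = of_bool (x \<in> set (cs @ [c]))" for x using st eqxD[OF f1(2), of 7] by auto
          show "eqx {9, 10, 11, 12, 13, 14, 15, 19} vi v1" "eqx {7, 8, 10, 11, 17} ai a1"
            using frv f1 by (auto simp: eqx_def)
        qed (rule p1')
        have t1': "t1 \<le> t + ?C + 11" using t1 vars by simp
        show "wp DFS_LOOP Q v1 a1 t1"
        proof (rule less.hyps[OF _ d1])
          show "?K - Suc c < ?K - c" "Suc c \<le> ?K" "set (cs @ [c]) \<subseteq> {..<Suc c}" "distinct (cs @ [c])"
            "length (cs @ [c]) \<le> ?k"
            using True less.prems(3,4) by auto
          fix c2 v2 a2 t2
          assume c2: "c2 = ?K \<or> length (cs @ [c]) = ?k"
            and d2: "dfs_state vi ai (cs @ [c]) c2 (\<lambda>b. p b + ?N b +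
               (\<Sum>X\<in>?E (set (cs @ [c])) (?k - length (cs @ [c])) (Suc c). node_value vi ai b X)) v2 a2"
            and t2: "t2 \<le> t1 + card (?E (set (cs @ [c])) (?k - length (cs @ [c])) (Suc c)) * (?C + 18)"
          note st2 = d2[unfolded dfs_state_def r(2)]
          have fr2: "eqx {9, 10, 11, 12, 13, 14, 15, 19} vi v2" "eqx {7, 8, 10, 11, 17} ai a2" using st2 by auto
          have vars2: "v2 2 = ?k" "v2 4 = ?K" "v2 12 = Suc (length cs)" "v2 13 = c2" "a2 8 (length cs) = c"
            using st2 fr2(1) by (auto simp: eqxD nth_append)
          let ?v2 = "v2(12 := length cs, 13 := Suc c)" and ?a2 = "a2(7 := (a2 7)(c := 0))"
          have "wp DFS_LOOP Q ?v2 ?a2 t3" if t3: "t3 \<le> t2 + 7" for t3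
          proof (rule less.hyps[of "Suc c" cs "\<lambda>b. p b + ?N b + ?S1 b"])
            show "dfs_state vi ai cs (Suc c) (\<lambda>b. p b + ?N b + ?S1 b) ?v2 ?a2"
              unfolding dfs_state_def
            proof (intro conjI allI impI)
              show "?a2 8 i = cs ! i" if "i < length cs" for i using st2 that by (auto simp: nth_append)
              show "?a2 7 x = of_bool (x \<in> set cs)" for x using st2 less.prems(3) by auto
              show "?a2 17 b = p b + ?N b + ?S1 b" for b using st2 by simp
              show "eqx {9, 10, 11, 12, 13, 14, 15, 19} vi ?v2" "eqx {7, 8, 10, 11, 17} ai ?a2"
                using fr2 by (auto simp: eqx_def)
            qed auto
            show "?K - Suc c < ?K - c" "Suc c \<le> ?K" "set cs \<subseteq> {..<Suc c}" "distinct cs" "length cs \<le> ?k"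
              using True less.prems by auto
            fix c3 v3 a3 t4
            assume c3: "c3 = ?K \<or> length cs = ?k" "Suc c \<le> c3" "c3 \<le> ?K"
              and d3: "dfs_state vi ai cs c3 (\<lambda>b. p b + ?N b + ?S1 b +
                (\<Sum>X\<in>?E (set cs) (?k - length cs) (Suc c). node_value vi ai b X)) v3 a3"
              and t4: "t4 \<le> t3 + card (?E (set cs) (?k - length cs) (Suc c)) * (?C + 18)"
            show "wp DFS_LOOP Q v3 a3 t4"
            proof (rule less.prems(6)[of c3])
              show "dfs_state vi ai cs c3 (\<lambda>b. p b + (\<Sum>X\<in>?E (set cs) (?k - length cs) c. node_value vi ai b X)) v3 a3"
                using d3 unfolding r(1) split by (simp add: add.assoc)
              have "t4 \<le> t + (?C + 11) + card (?E (insert c (set cs)) r (Suc c)) * (?C + 18) + 7 +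
                  card (?E (set cs) (Suc r) (Suc c)) * (?C + 18)"
                using t1' t2 t3 t4 unfolding r by simp
              also have "\<dots> = t + card (?E (set cs) (Suc r) c) * (?C + 18)" 
              proof -
                have "t + (C + 11) + x * (C + 18) + 7 + y * (C + 18) = t + (1 + x + y) * (C + 18)" for C x y :: nat
                  by (simp add: algebra_simps)
                then show ?thesis unfolding sc .
              qed
              finally show "t4 \<le> t + card (?E (set cs) (?k - length cs) c) * (?C + 18)" unfolding r(1) .
            qed (use c3 in auto)
          qed
          \<comment> \<open>The pop is reached after two tests if the candidates are used up and
            after three if the stack is full.\<close>
          then have "wp DFS_LOOP Q ?v2 ?a2 (t2 + 6)" "wp DFS_LOOP Q ?v2 ?a2 (t2 + 7)" by auto
          then have "wp POP (wp DFS_LOOP Q) v2 a2 (t2 + 2)" "wp POP (wp DFS_LOOP Q) v2 a2 (t2 + 3)"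
            using vars2 by (simp_all add: POP_def fun_upd_twist eval_nat_numeral)
          then show "wp DFS_LOOP Q v2 a2 t2"
            unfolding DFS_LOOP_def by (subst wp_Wh) (use vars2 c2 in \<open>auto simp: eval_nat_numeral\<close>)
        qed
      qed
      then show ?thesis using vars by (simp add: PUSH_def eval_nat_numeral)
    qed
    then show ?thesis
      unfolding DFS_LOOP_def by (subst wp_Wh) (use vars True in \<open>simp add: eval_nat_numeral\<close>)
  qed
qed

lemma DFS_spec:
  assumes k: "1 \<le> v 2" and edges: "\<And>e. e < v 7 \<Longrightarrow> a 3 e < v 6 \<and> a 4 e < v 6"
    and bin: "\<And>i. i \<le> v 2 \<Longrightarrow> a 12 i \<le> M" and inx: "\<And>x. a 7 x = 0"
    and post: "\<And>v' a' t'. eqx {9, 10, 11, 12, 13, 14, 15, 19} v v' \<Longrightarrow> eqx {7, 8, 10, 11, 17} a a' \<Longrightarrow>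
      (\<And>x. a' 7 x = 0) \<Longrightarrow>
      (\<And>b. a' 17 b = a 17 b + (\<Sum>X\<in>extensions (v 4) {} (v 2) 0. node_value v a b X)) \<Longrightarrow>
      t' \<le> t + card (extensions (v 4) {} (v 2) 0) * (20 * (v 2 * (v 6 + v 7 + 1)) + 3 * M + 18) + 3 \<Longrightarrow> Q v' a' t'"
  shows "wp DFS Q v a t"
proof -
  have "wp DFS_LOOP Q (v(12 := 0, 13 := 0)) a (t + 2)"
  proof (rule DFS_LOOP_spec[where vi = v and ai = a and cs = "[]" and c = 0 and p = "a 17" and M = M])
    show "1 \<le> v 2" by (rule k)
    show "a 3 e < v 6 \<and> a 4 e < v 6" if "e < v 7" for e by (rule edges[OF that])
    show "a 12 i \<le> M" if "i \<le> v 2" for i by (rule bin[OF that])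
    show "dfs_state v a [] 0 (a 17) (v(12 := 0, 13 := 0)) a"
      using inx by (auto simp: dfs_state_def eqx_def)
    fix c' v' a' t'
    assume c': "c' = v 4 \<or> length [] = v 2" and
      d: "dfs_state v a [] c' (\<lambda>b. a 17 b + (\<Sum>X\<in>extensions (v 4) (set []) (v 2 - length []) 0. node_value v a b X)) v' a'"
      and t': "t' \<le> t + 2 + card (extensions (v 4) (set []) (v 2 - length []) 0) * (20 * (v 2 * (v 6 + v 7 + 1)) + 3 * M + 18)"
    note st = d[unfolded dfs_state_def]
    have "v' 12 = 0" "v' 13 = v 4" "v' 4 = v 4" using st c' k by (auto simp: eqxD)
    moreover have "Q v' a' (Suc t')"
      by (rule post) (use st t' in auto)
    ultimately show "wp DFS_LOOP Q v' a' t'"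
      unfolding DFS_LOOP_def by (subst wp_Wh) simp
  qed auto
  then show ?thesis by (simp add: DFS_def)
qed

subsection \<open>Counting colourful walks\<close>

text \<open>Subtraction is truncated, so positive and negative terms of the sieve are summed in
  separate cells; their difference is a number of walks and hence nonnegative. \<open>V 16\<close>
  is the offset of the current colouring in array 2.\<close>

definition CNT_BODY :: com where
  "CNT_BODY =
     FOR 9 (V 6) (Upd 6 (V 9) (Ar 2 (V 16 +. Ar 5 (V 9)))) ;;
     Upd 17 (N 0) (N 0) ;; Upd 17 (N 1) (N 0) ;; DFS ;;
     8 ::= V 8 +. (Ar 17 (N 0) -. Ar 17 (N 1)) ;; 16 ::= V 16 +. V 3"

definition CNT :: com where
  "CNT = 8 ::= N 0 ;; 16 ::= N 0 ;; FOR 18 (V 5) CNT_BODY"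

lemma CNT_BODY_frame [simp]:
  "wv CNT_BODY = {8, 9, 10, 11, 12, 13, 14, 15, 16, 19}" "wa CNT_BODY = {6, 7, 8, 10, 11, 17}"
  by (auto simp: CNT_BODY_def)

lemma CNT_frame [simp]:
  "wv CNT = {8, 9, 10, 11, 12, 13, 14, 15, 16, 18, 19}" "wa CNT = {6, 7, 8, 10, 11, 17}"
  by (auto simp: CNT_def)

definition set_count :: "nat \<Rightarrow> nat \<Rightarrow> nat" where
  "set_count K k = card {X. X \<subseteq> {..<K} \<and> X \<noteq> {} \<and> card X \<le> k}"

definition node_cost :: "nat \<Rightarrow> nat \<Rightarrow> nat \<Rightarrow> nat \<Rightarrow> nat" where
  "node_cost K k n m = set_count K k * (20 * (k * (n + m + 1)) + 3 * (K choose k) + 18) + 3 * n + 10"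

lemma extensions_all: "extensions K {} k 0 = {X. X \<subseteq> {..<K} \<and> X \<noteq> {} \<and> card X \<le> k}"
  by (auto simp: extensions_def)

text \<open>The tables prepared for the sieve: parities in array 9, binomial coefficients in array 12.\<close>

definition sieve_tables :: "vars \<Rightarrow> arrays \<Rightarrow> bool" where
  "sieve_tables v a \<longleftrightarrow> 1 \<le> v 2 \<and> v 2 \<le> v 4 \<and> (\<forall>x. a 7 x = 0) \<and>
     (\<forall>t\<le>v 2. a 9 t = t mod 2 \<and> a 12 t = (v 4 - v 2 + t) choose t)"

definition graph_tables :: "vars \<Rightarrow> arrays \<Rightarrow> (nat \<times> nat) list \<Rightarrow> bool" where
  "graph_tables v a es \<longleftrightarrow> es = map (\<lambda>e. (a 3 e, a 4 e)) [0..<v 7] \<and> distinct es \<and>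
     (\<forall>e<v 7. a 3 e < v 6 \<and> a 4 e < v 6) \<and> (\<forall>u<v 6. a 5 u < v 3)"

text \<open>Bounds the repeated additions by which a node multiplies with its weight.\<close>

lemma binomial_le_top: "t \<le> k \<Longrightarrow> k \<le> K \<Longrightarrow> (K - k + t) choose t \<le> K choose k"
proof -
  assume "t \<le> k" "k \<le> K"
  then have "(K - k + t) choose t = (K - k + t) choose (K - k)" using binomial_symmetric[of t "K - k + t"] by simp
  also have "\<dots> \<le> K choose (K - k)" using \<open>t \<le> k\<close> \<open>k \<le> K\<close> by (intro binomial_right_mono) simp
  also have "\<dots> = K choose k" using \<open>k \<le> K\<close> by (simp add: binomial_symmetric[symmetric])
  finally show ?thesis .
qed

lemma set_walks_card:
  assumes "distinct (map (\<lambda>e. (a 3 e, a 4 e)) [0..<v 7])" "1 \<le> v 2"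
  shows "set_walks v a X =
    card (walks (set (map (\<lambda>e. (a 3 e, a 4 e)) [0..<v 7])) (v 2) (\<lambda>u. u < v 6 \<and> a 6 u \<in> X))"
  unfolding set_walks_def by (rule walk_count_total[OF assms(1) _ assms(2)]) simp

lemma CNT_BODY_spec:
  assumes st: "sieve_tables v a" and gt: "graph_tables v a es"
    and c: "\<And>y. y < v 3 \<Longrightarrow> a 2 (v 16 + y) = c y" "\<And>y. y < v 3 \<Longrightarrow> c y < v 4"
    and post: "\<And>v' a' t'. eqx {8, 9, 10, 11, 12, 13, 14, 15, 16, 19} v v' \<Longrightarrow> eqx {6, 7, 8, 10, 11, 17} a a' \<Longrightarrow>
      (\<And>x. a' 7 x = 0) \<Longrightarrow> v' 16 = v 16 + v 3 \<Longrightarrow>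
      v' 8 = v 8 + colourful (set es) (v 6) (v 2) (\<lambda>u. c (a 5 u)) \<Longrightarrow>
      t' \<le> t + node_cost (v 4) (v 2) (v 6) (v 7) \<Longrightarrow> Q v' a' t'"
  shows "wp CNT_BODY Q v a t"
  unfolding CNT_BODY_def wp_Seq
proof (rule wp_FOR[where n = "v 6" and B = 1 and I = "\<lambda>j v' a'. \<forall>u<j. a' 6 u = c (a 5 u)"])
  let ?c = "Upd 6 (V 9) (Ar 2 (V 16 +. Ar 5 (V 9)))"
  fix v1 a1 t1
  assume I1: "\<forall>u<v 6. a1 6 u = c (a 5 u)" and f1: "eqx (insert 9 (wv ?c)) v v1" "eqx (wa ?c) a a1"
    and t1: "t1 \<le> t + v 6 * (1 + 2) + 2"
  note [simp] = eqxD[OF f1(1)] eqxD[OF f1(2)]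
  let ?a = "a1(17 := (a1 17)(0 := 0, 1 := 0))"
  have k: "1 \<le> v 2" "v 2 \<le> v 4" using st by (auto simp: sieve_tables_def)
  have es: "es = map (\<lambda>e. (a 3 e, a 4 e)) [0..<v 7]" "distinct es" using gt by (auto simp: graph_tables_def)
  let ?C = "\<lambda>u. c (a 5 u)"
  let ?\<X> = "{X. X \<subseteq> {..<v 4} \<and> X \<noteq> {} \<and> card X \<le> v 2}"
  have cK: "?C u < v 4" if "u < v 6" for u using c(2) gt that by (auto simp: graph_tables_def)
  have sw: "set_walks v1 ?a X = card (walks (set es) (v 2) (\<lambda>u. u < v 6 \<and> ?C u \<in> X))" for X
  proof -
    have "set_walks v1 ?a X = card (walks (set es) (v 2) (\<lambda>u. u < v 6 \<and> a1 6 u \<in> X))"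
      using set_walks_card[of ?a v1 X] es k by simp
    also have "(\<lambda>u. u < v 6 \<and> a1 6 u \<in> X) = (\<lambda>u. u < v 6 \<and> ?C u \<in> X)" using I1 by auto
    finally show ?thesis .
  qed
  let ?g = "\<lambda>X. ((v 4 - card X) choose (v 2 - card X)) * card (walks (set es) (v 2) (\<lambda>u. u < v 6 \<and> ?C u \<in> X))"
  have nv: "node_value v1 ?a b X = (if b = (v 2 - card X) mod 2 then ?g X else 0)" if "X \<in> ?\<X>" for b X
  proof -
    have "v 4 - v 2 + (v 2 - card X) = v 4 - card X" using that k by auto
    then show ?thesis unfolding node_value_def sw using st that by (simp add: sieve_tables_def)
  qed
  have "wp DFS (wp (8 ::= V 8 +. (Ar 17 (N 0) -. Ar 17 (N 1))) (wp (16 ::= V 16 +. V 3) Q)) v1 ?a (t1 + 2)"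
  proof (rule DFS_spec[where M = "v 4 choose v 2"])
    show "1 \<le> v1 2" using k by simp
    show "?a 3 e < v1 6 \<and> ?a 4 e < v1 6" if "e < v1 7" for e using gt that by (simp add: graph_tables_def)
    show "?a 12 i \<le> v 4 choose v 2" if "i \<le> v1 2" for i
      using st that binomial_le_top[of i "v 2" "v 4"] k by (simp add: sieve_tables_def)
    show "?a 7 x = 0" for x using st by (simp add: sieve_tables_def)
    fix v2 a2 t2
    assume f2: "eqx {9, 10, 11, 12, 13, 14, 15, 19} v1 v2" "eqx {7, 8, 10, 11, 17} ?a a2" and z: "\<And>x. a2 7 x = 0"
      and p: "\<And>b. a2 17 b = ?a 17 b + (\<Sum>X\<in>extensions (v1 4) {} (v1 2) 0. node_value v1 ?a b X)"
      and t2: "t2 \<le> t1 + 2 + card (extensions (v1 4) {} (v1 2) 0) * (20 * (v1 2 * (v1 6 + v1 7 + 1)) + 3 * (v 4 choose v 2) + 18) + 3"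
    note [simp] = eqxD[OF f2(1)]
    have P: "a2 17 b = (\<Sum>X\<in>?\<X>. if b = (v 2 - card X) mod 2 then ?g X else 0)" if "b < 2" for b
    proof -
      have "?a 17 b = 0" using that by (auto simp: less_2_cases_iff)
      then have "a2 17 b = (\<Sum>X\<in>?\<X>. node_value v1 ?a b X)" using p[of b] by (simp add: extensions_all)
      also have "\<dots> = (\<Sum>X\<in>?\<X>. if b = (v 2 - card X) mod 2 then ?g X else 0)"
        by (rule sum.cong[OF refl nv])
      finally show ?thesis .
    qed
    have "int (a2 17 0) - int (a2 17 1) = (\<Sum>X\<in>?\<X>. int (if 0 = (v 2 - card X) mod 2 then ?g X else 0) -
        int (if 1 = (v 2 - card X) mod 2 then ?g X else 0))"
      by (simp add: P sum_subtractf)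
    also have "\<dots> = (\<Sum>X\<in>?\<X>. (-1) ^ (v 2 - card X) * int (?g X))"
    proof (rule sum.cong[OF refl])
      fix X
      show "int (if 0 = (v 2 - card X) mod 2 then ?g X else 0) - int (if 1 = (v 2 - card X) mod 2 then ?g X else 0) =
        (-1) ^ (v 2 - card X) * int (?g X)"
        by (cases "even (v 2 - card X)") (auto simp: even_iff_mod_2_eq_zero odd_iff_mod_2_eq_one simp del: of_nat_mult)
    qed
    also have "\<dots> = int (colourful (set es) (v 6) (v 2) ?C)"
      by (rule colourful_sieve[OF k cK, symmetric])
    finally have "a2 17 0 - a2 17 1 = colourful (set es) (v 6) (v 2) ?C" by linarith
    then have val: "v2 8 + (a2 17 0 - a2 17 1) = v 8 + colourful (set es) (v 6) (v 2) ?C" by simp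
    have "Q (v2(8 := v 8 + colourful (set es) (v 6) (v 2) ?C, 16 := v 16 + v 3)) a2 (t2 + 2)"
    proof (rule post)
      show "eqx {8, 9, 10, 11, 12, 13, 14, 15, 16, 19} v (v2(8 := v 8 + colourful (set es) (v 6) (v 2) ?C, 16 := v 16 + v 3))"
        "eqx {6, 7, 8, 10, 11, 17} a a2" using f1 f2 by (auto simp: eqx_def)
      show "t2 + 2 \<le> t + node_cost (v 4) (v 2) (v 6) (v 7)"
        using t1 t2 by (simp add: node_cost_def set_count_def extensions_all)
    qed (use z in auto)
    then show "wp (8 ::= V 8 +. (Ar 17 (N 0) -. Ar 17 (N 1))) (wp (16 ::= V 16 +. V 3) Q) v2 a2 t2"
      using val by (simp add: eval_nat_numeral)
  qed
  then show "wp (Upd 17 (N 0) (N 0)) (wp (Upd 17 (N 1) (N 0)) (wp DFS (wp (8 ::= V 8 +. (Ar 17 (N 0) -. Ar 17 (N 1)))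
      (wp (16 ::= V 16 +. V 3) Q)))) v1 a1 t1"
    by (simp add: eval_nat_numeral)
next
  let ?c = "Upd 6 (V 9) (Ar 2 (V 16 +. Ar 5 (V 9)))"
  fix j t1 and v1 :: vars and a1 :: arrays
  assume j: "j < v 6" and I1: "\<forall>u<j. a1 6 u = c (a 5 u)" "v1 9 = j" and f1: "eqx (insert 9 (wv ?c)) v v1" "eqx (wa ?c) a a1"
  note [simp] = eqxD[OF f1(1)] eqxD[OF f1(2)]
  have "a 2 (v 16 + a 5 j) = c (a 5 j)" using c(1) gt j by (simp add: graph_tables_def)
  then show "wp ?c (\<lambda>v' a' t'. (\<forall>u<Suc j. a' 6 u = c (a 5 u)) \<and> t' \<le> t1 + 1) v1 a1 t1"
    using I1 by (simp add: less_Suc_eq)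
next
  let ?c = "Upd 6 (V 9) (Ar 2 (V 16 +. Ar 5 (V 9)))"
  fix j and v1 :: vars and a1 :: arrays
  assume f1: "eqx (insert 9 (wv ?c)) v v1"
  show "ev (V 6) v1 a1 = v 6" using eqxD[OF f1, of 6] by simp
qed auto

lemma CNT_spec:
  assumes st: "sieve_tables v a" and gt: "graph_tables v a es"
    and tb: "\<And>i y. i < v 5 \<Longrightarrow> y < v 3 \<Longrightarrow> a 2 (i * v 3 + y) = tb i y \<and> tb i y < v 4"
    and post: "\<And>v' a' t'. eqx {8, 9, 10, 11, 12, 13, 14, 15, 16, 18, 19} v v' \<Longrightarrow> eqx {6, 7, 8, 10, 11, 17} a a' \<Longrightarrow>
      (\<And>x. a' 7 x = 0) \<Longrightarrow>
      v' 8 = (\<Sum>i<v 5. colourful (set es) (v 6) (v 2) (\<lambda>u. tb i (a 5 u))) \<Longrightarrow>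
      t' \<le> t + v 5 * (node_cost (v 4) (v 2) (v 6) (v 7) + 2) + 4 \<Longrightarrow> Q v' a' t'"
  shows "wp CNT Q v a t"
proof -
  let ?cf = "\<lambda>i. colourful (set es) (v 6) (v 2) (\<lambda>u. tb i (a 5 u))"
  have "wp (FOR 18 (V 5) CNT_BODY) Q (v(8 := 0, 16 := 0)) a (Suc (Suc t))"
  proof (rule wp_FOR[where n = "v 5" and B = "node_cost (v 4) (v 2) (v 6) (v 7)" and
        I = "\<lambda>j v' a'. v' 16 = j * v 3 \<and> (\<forall>x. a' 7 x = 0) \<and> v' 8 = (\<Sum>i<j. ?cf i)"])
    fix v1 a1 t1
    assume I: "v1 16 = v 5 * v 3 \<and> (\<forall>x. a1 7 x = 0) \<and> v1 8 = (\<Sum>i<v 5. ?cf i)"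
      and f1: "eqx (insert 18 (wv CNT_BODY)) (v(8 := 0, 16 := 0)) v1" "eqx (wa CNT_BODY) a a1"
      and t1: "t1 \<le> Suc (Suc t) + v 5 * (node_cost (v 4) (v 2) (v 6) (v 7) + 2) + 2"
    show "Q v1 a1 t1"
    proof (rule post)
      show "eqx {8, 9, 10, 11, 12, 13, 14, 15, 16, 18, 19} v v1" "eqx {6, 7, 8, 10, 11, 17} a a1"
        using f1 by (auto simp: eqx_def)
    qed (use I t1 in auto)
  next
    fix j t1 and v1 :: vars and a1 :: arrays
    assume j: "j < v 5" and I: "v1 16 = j * v 3 \<and> (\<forall>x. a1 7 x = 0) \<and> v1 8 = (\<Sum>i<j. ?cf i)"
      and f1: "eqx (insert 18 (wv CNT_BODY)) (v(8 := 0, 16 := 0)) v1" "eqx (wa CNT_BODY) a a1"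
    note [simp] = eqxD[OF f1(1)] eqxD[OF f1(2)]
    show "wp CNT_BODY (\<lambda>v' a' t'. ((v'(18 := Suc j)) 16 = Suc j * v 3 \<and> (\<forall>x. a' 7 x = 0) \<and>
        (v'(18 := Suc j)) 8 = (\<Sum>i<Suc j. ?cf i)) \<and> t' \<le> t1 + node_cost (v 4) (v 2) (v 6) (v 7)) v1 a1 t1"
    proof (rule CNT_BODY_spec[where es = es and c = "tb j"])
      show "sieve_tables v1 a1" using st I by (simp add: sieve_tables_def)
      show "graph_tables v1 a1 es" using gt unfolding graph_tables_def by auto
      show "a1 2 (v1 16 + y) = tb j y" "tb j y < v1 4" if "y < v1 3" for y using tb[OF j, of y] I that by simp_all
    qed (use I in \<open>auto simp: add.commute\<close>)
  next
    show "(\<lambda>j v' a'. v' 16 = j * v 3 \<and> (\<forall>x. a' 7 x = 0) \<and> v' 8 = (\<Sum>i<j. ?cf i)) 0 ((v(8 := 0, 16 := 0))(18 := 0)) a"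
      using st by (simp add: sieve_tables_def)
  next
    fix j and v1 :: vars and a1 :: arrays
    assume f1: "eqx (insert 18 (wv CNT_BODY)) (v(8 := 0, 16 := 0)) v1"
    show "ev (V 5) v1 a1 = v 5" using eqxD[OF f1, of 5] by simp
  qed simp
  then show ?thesis by (simp add: CNT_def)
qed

text \<open>Pascal's rule in place: if cell x holds C(j + x, x), then adding to each cell, in
  ascending order, its already updated predecessor turns all of them into C(j + 1 + x, x).\<close>

definition TABLES :: com where
  "TABLES =
     FOR 9 (V 2 +. N 1) (Upd 12 (V 9) (N 1)) ;;
     Upd 9 (N 0) (N 0) ;;
     FOR 9 (V 2) (Upd 9 (V 9 +. N 1) (N 1 -. Ar 9 (V 9))) ;;
     FOR 10 (V 4 -. V 2) (FOR 9 (V 2) (Upd 12 (V 9 +. N 1) (Ar 12 (V 9 +. N 1) +. Ar 12 (V 9))))"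

lemma TABLES_frame [simp]: "wv TABLES = {9, 10}" "wa TABLES = {9, 12}"
  by (auto simp: TABLES_def)

lemma TABLES_spec:
  assumes k: "1 \<le> v 2" "v 2 \<le> v 4" and inx: "\<And>x. a 7 x = 0"
    and post: "\<And>v' a' t'. eqx {9, 10} v v' \<Longrightarrow> eqx {9, 12} a a' \<Longrightarrow> sieve_tables v' a' \<Longrightarrow>
      t' \<le> t + 20 * (v 4 * v 2) \<Longrightarrow> Q v' a' t'"
  shows "wp TABLES Q v a t"
proof -
  let ?c1 = "Upd 12 (V 9) (N 1)"
  let ?c2 = "Upd 9 (V 9 +. N 1) (N 1 -. Ar 9 (V 9))"
  let ?c3 = "Upd 12 (V 9 +. N 1) (Ar 12 (V 9 +. N 1) +. Ar 12 (V 9))"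
  show ?thesis
    unfolding TABLES_def wp_Seq
  proof (rule wp_FOR[where n = "v 2 + 1" and B = 1 and I = "\<lambda>j v' a'. \<forall>x<j. a' 12 x = 1"])
    fix v1 a1 t1
    assume I1: "\<forall>x<v 2 + 1. a1 12 x = 1" and f1: "eqx (insert 9 (wv ?c1)) v v1" "eqx (wa ?c1) a a1"
      and t1: "t1 \<le> t + (v 2 + 1) * (1 + 2) + 2"
    note [simp] = eqxD[OF f1(1)] eqxD[OF f1(2)]
    let ?a = "a1(9 := (a1 9)(0 := 0))"
    have "wp (FOR 9 (V 2) ?c2) (wp (FOR 10 (V 4 -. V 2) (FOR 9 (V 2) ?c3)) Q) v1 ?a (Suc t1)"
    proof (rule wp_FOR[where n = "v 2" and B = 1 and I = "\<lambda>j v' a'. \<forall>x\<le>j. a' 9 x = x mod 2"])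
      fix v2 a2 t2
      assume I2: "\<forall>x\<le>v 2. a2 9 x = x mod 2" and f2: "eqx (insert 9 (wv ?c2)) v1 v2" "eqx (wa ?c2) ?a a2"
        and t2: "t2 \<le> Suc t1 + v 2 * (1 + 2) + 2"
      note [simp] = eqxD[OF f2(1)] eqxD[OF f2(2)]
      show "wp (FOR 10 (V 4 -. V 2) (FOR 9 (V 2) ?c3)) Q v2 a2 t2"
      proof (rule wp_FOR[where n = "v 4 - v 2" and B = "3 * v 2 + 2" and I = "\<lambda>j v' a'. \<forall>x\<le>v 2. a' 12 x = (j + x) choose x"])
        fix v3 a3 t3
        assume I3: "\<forall>x\<le>v 2. a3 12 x = (v 4 - v 2 + x) choose x" and
          f3: "eqx (insert 10 (wv (FOR 9 (V 2) ?c3))) v2 v3" "eqx (wa (FOR 9 (V 2) ?c3)) a2 a3"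
          and t3: "t3 \<le> t2 + (v 4 - v 2) * (3 * v 2 + 2 + 2) + 2"
        note [simp] = eqxD[OF f3(1)] eqxD[OF f3(2)]
        show "Q v3 a3 t3"
        proof (rule post)
          show "eqx {9, 10} v v3" "eqx {9, 12} a a3" using f1 f2 f3 by (auto simp: eqx_def)
          show "sieve_tables v3 a3" using I2 I3 k inx by (simp add: sieve_tables_def)
          obtain d where d: "v 4 = v 2 + d" using k by (metis le_iff_add)
          obtain r where r: "v 2 = Suc r" using k by (cases "v 2") auto
          have "t3 \<le> t + (6 * v 2 + 10 + d * (3 * v 2 + 4))" using t1 t2 t3 d by (simp add: algebra_simps)
          also have "\<dots> \<le> t + 20 * (v 4 * v 2)" unfolding d r by (simp add: algebra_simps)
          finally show "t3 \<le> t + 20 * (v 4 * v 2)" .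
        qed
      next
        fix j t3 and v3 :: vars and a3 :: arrays
        assume I3: "\<forall>x\<le>v 2. a3 12 x = (j + x) choose x" and
          f3: "eqx (insert 10 (wv (FOR 9 (V 2) ?c3))) v2 v3" "eqx (wa (FOR 9 (V 2) ?c3)) a2 a3"
        note [simp] = eqxD[OF f3(1)] eqxD[OF f3(2)]
        show "wp (FOR 9 (V 2) ?c3) (\<lambda>v' a' t'. (\<forall>x\<le>v 2. a' 12 x = (Suc j + x) choose x) \<and> t' \<le> t3 + (3 * v 2 + 2)) v3 a3 t3"
        proof (rule wp_FOR[where n = "v 2" and B = 1 and
            I = "\<lambda>i v' a'. \<forall>x\<le>v 2. a' 12 x = (if x \<le> i then (Suc j + x) choose x else (j + x) choose x)"])
          fix i t4 and v4 :: vars and a4 :: arrays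
          assume i: "i < v 2" "v4 9 = i" and I4: "\<forall>x\<le>v 2. a4 12 x = (if x \<le> i then (Suc j + x) choose x else (j + x) choose x)"
          show "wp ?c3 (\<lambda>v' a' t'. (\<forall>x\<le>v 2. a' 12 x = (if x \<le> Suc i then (Suc j + x) choose x else (j + x) choose x)) \<and> t' \<le> t4 + 1) v4 a4 t4"
            using i I4 by (auto simp: le_Suc_eq)
        next
          fix i and v4 :: vars and a4 :: arrays
          assume f4: "eqx (insert 9 (wv ?c3)) v3 v4"
          show "ev (V 2) v4 a4 = v 2" using eqxD[OF f4, of 2] by simp
        qed (use I3 in auto)
      next
        fix j and v3 :: vars and a3 :: arrays
        assume f3: "eqx (insert 10 (wv (FOR 9 (V 2) ?c3))) v2 v3"
        show "ev (V 4 -. V 2) v3 a3 = v 4 - v 2" using eqxD[OF f3, of 2] eqxD[OF f3, of 4] by simp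
      qed (use I1 in auto)
    next
      fix j t2 and v2 :: vars and a2 :: arrays
      assume "j < v 2" "v2 9 = j" and I2: "\<forall>x\<le>j. a2 9 x = x mod 2"
      moreover have "1 - j mod 2 = Suc j mod 2" by presburger
      ultimately show "wp ?c2 (\<lambda>v' a' t'. (\<forall>x\<le>Suc j. a' 9 x = x mod 2) \<and> t' \<le> t2 + 1) v2 a2 t2"
        by (auto simp: le_Suc_eq)
    next
      fix j and v2 :: vars and a2 :: arrays
      assume f2: "eqx (insert 9 (wv ?c2)) v1 v2"
      show "ev (V 2) v2 a2 = v 2" using eqxD[OF f2, of 2] by simp
    qed auto
    then show "wp (Upd 9 (N 0) (N 0)) (wp (FOR 9 (V 2) ?c2) (wp (FOR 10 (V 4 -. V 2) (FOR 9 (V 2) ?c3)) Q)) v1 a1 t1"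
      by simp
  next
    fix j and v1 :: vars and a1 :: arrays
    assume f1: "eqx (insert 9 (wv ?c1)) v v1"
    show "ev (V 2 +. N 1) v1 a1 = v 2 + 1" using eqxD[OF f1, of 2] by simp
  qed (auto simp: less_Suc_eq)
qed

subsection \<open>The reference path\<close>

text \<open>The path 0, 1, ..., k - 1. Array 5 becomes the identity, so the vertices take the place
  of their own hash values.\<close>

definition REF :: com where
  "REF = 6 ::= V 2 ;; 7 ::= V 2 -. N 1 ;;
     FOR 9 (V 2) (Upd 3 (V 9) (V 9) ;; Upd 4 (V 9) (V 9 +. N 1) ;; Upd 5 (V 9) (V 9))"

lemma REF_frame [simp]: "wv REF = {6, 7, 9}" "wa REF = {3, 4, 5}"
  by (auto simp: REF_def)

definition path_edges :: "nat \<Rightarrow> (nat \<times> nat) list" where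
  "path_edges k = map (\<lambda>i. (i, Suc i)) [0..<k - 1]"

lemma REF_spec:
  assumes k: "v 2 \<le> v 3"
    and post: "\<And>v' a' t'. eqx {6, 7, 9} v v' \<Longrightarrow> eqx {3, 4, 5} a a' \<Longrightarrow> graph_tables v' a' (path_edges (v 2)) \<Longrightarrow>
      v' 6 = v 2 \<Longrightarrow> v' 7 = v 2 - 1 \<Longrightarrow> (\<And>u. u < v 2 \<Longrightarrow> a' 5 u = u) \<Longrightarrow> t' \<le> t + 5 * v 2 + 4 \<Longrightarrow> Q v' a' t'"
  shows "wp REF Q v a t"
proof -
  let ?c = "Upd 3 (V 9) (V 9) ;; Upd 4 (V 9) (V 9 +. N 1) ;; Upd 5 (V 9) (V 9)"
  have "wp (FOR 9 (V 2) ?c) Q (v(6 := v 2, 7 := v 2 - 1)) a (t + 2)"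
  proof (rule wp_FOR[where n = "v 2" and B = 3 and I = "\<lambda>j v' a'. \<forall>x<j. a' 3 x = x \<and> a' 4 x = Suc x \<and> a' 5 x = x"])
    fix v1 a1 t1
    assume I: "\<forall>x<v 2. a1 3 x = x \<and> a1 4 x = Suc x \<and> a1 5 x = x"
      and f1: "eqx (insert 9 (wv ?c)) (v(6 := v 2, 7 := v 2 - 1)) v1" "eqx (wa ?c) a a1"
      and t1: "t1 \<le> t + 2 + v 2 * (3 + 2) + 2"
    note [simp] = eqxD[OF f1(1)] eqxD[OF f1(2)]
    show "Q v1 a1 t1"
    proof (rule post)
      show "eqx {6, 7, 9} v v1" "eqx {3, 4, 5} a a1" using f1 by (auto simp: eqx_def)
      show "graph_tables v1 a1 (path_edges (v 2))"
        unfolding graph_tables_def path_edges_def using I k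
        by (auto simp: distinct_map inj_on_def)
    qed (use I t1 in auto)
  next
    fix j t1 and v1 :: vars and a1 :: arrays
    assume "j < v 2" "v1 9 = j" and I: "\<forall>x<j. a1 3 x = x \<and> a1 4 x = Suc x \<and> a1 5 x = x"
    then show "wp ?c (\<lambda>v' a' t'. (\<forall>x<Suc j. a' 3 x = x \<and> a' 4 x = Suc x \<and> a' 5 x = x) \<and> t' \<le> t1 + 3) v1 a1 t1"
      by (auto simp: less_Suc_eq)
  next
    fix j and v1 :: vars and a1 :: arrays
    assume f1: "eqx (insert 9 (wv ?c)) (v(6 := v 2, 7 := v 2 - 1)) v1"
    show "ev (V 2) v1 a1 = v 2" using eqxD[OF f1, of 2] by simp
  qed auto
  then show ?thesis by (simp add: REF_def)
qed

text \<open>Stated for the infinite path, where no end disturbs the induction: a walk is an interval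
  read backwards.\<close>

lemma rwalk_path:
  "rwalk {(i, Suc i) |i. True} p \<Longrightarrow> p \<noteq> [] \<Longrightarrow> length p \<le> Suc (hd p) \<and> p = rev [Suc (hd p) - length p..<Suc (hd p)]"
proof (induction p rule: induct_list012)
  case (3 v u p)
  have r: "rwalk {(i, Suc i) |i. True} (u # p)" "v = Suc u" using "3.prems"(1) by simp_all
  define i where "i = Suc u - length (u # p)"
  have h: "length (u # p) \<le> Suc u \<and> u # p = rev [i..<Suc u]"
    using "3.IH"(2)[OF r(1)] unfolding list.sel(1) i_def by blast
  have "rev [i..<Suc (Suc u)] = Suc u # rev [i..<Suc u]" by (simp add: i_def)
  also have "rev [i..<Suc u] = u # p" by (rule conjunct2[OF h, symmetric])
  finally have "v # u # p = rev [i..<Suc v]" using r(2) by metis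
  moreover have "Suc v - length (v # u # p) = i" using r(2) by (simp add: i_def)
  moreover have "length (v # u # p) \<le> Suc v" using conjunct1[OF h] r(2) by simp
  ultimately show ?case unfolding list.sel(1) by metis
qed auto

lemma rwalk_mono: "rwalk E p \<Longrightarrow> E \<subseteq> E' \<Longrightarrow> rwalk E' p"
  by (induction p rule: induct_list012) auto

lemma walks_path_edges:
  assumes "1 \<le> k"
  shows "walks (set (path_edges k)) k (\<lambda>v. v < k) = {rev [0..<k]}"
proof (intro equalityI subsetI)
  fix p assume p: "p \<in> walks (set (path_edges k)) k (\<lambda>v. v < k)"
  then have "rwalk (set (path_edges k)) p" by (simp add: walks_def)
  then have w: "rwalk {(i, Suc i) |i. True} p" by (rule rwalk_mono) (auto simp: path_edges_def)
  have p0: "p \<noteq> []" "length p = k" using p assms by (auto simp: walks_def)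
  have h: "k \<le> Suc (hd p) \<and> p = rev [Suc (hd p) - k..<Suc (hd p)]"
    using rwalk_path[OF w p0(1)] unfolding p0(2) .
  have "hd p < k" using p p0(1) by (simp add: walks_def)
  then have "Suc (hd p) = k" using conjunct1[OF h] by linarith
  then have "p = rev [0..<k]" using conjunct2[OF h] by simp
  then show "p \<in> {rev [0..<k]}" by (rule ssubst) simp
next
  fix p assume "p \<in> {rev [0..<k]}"
  moreover have "rwalk (set (path_edges k)) (rev [0..<j])" if "j \<le> k" for j
    using that
  proof (induction j)
    case (Suc j)
    then show ?case by (cases j) (auto simp: path_edges_def)
  qed simp
  ultimately show "p \<in> walks (set (path_edges k)) k (\<lambda>v. v < k)" by (auto simp: walks_def)
qed

text \<open>The whole path is the only walk with k vertices. Summed over the family this counts the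
  colourings that are injective on \<open>{..<k}\<close>.\<close>

lemma colourful_path:
  assumes "1 \<le> k"
  shows "colourful (set (path_edges k)) k k c = of_bool (inj_on c {..<k})"
proof -
  have "distinct (map c (rev [0..<k])) \<longleftrightarrow> inj_on c {..<k}"
    by (simp add: distinct_map atLeast0LessThan)
  then have "{p \<in> walks (set (path_edges k)) k (\<lambda>v. v < k). distinct (map c p)} =
      (if inj_on c {..<k} then {rev [0..<k]} else {})"
    unfolding walks_path_edges[OF assms] by auto
  then show ?thesis by (simp add: colourful_def)
qed

subsection \<open>Greedy linear hash functions\<close>

definition zero_count :: "(nat \<Rightarrow> nat) list \<Rightarrow> nat \<Rightarrow> nat" where
  "zero_count hs z = length (filter (\<lambda>h. h z = 0) hs)"

text \<open>One term of the potential is at most the whole, and the whole is at most (1 + 1/q)^(q q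
  d) q^d \<le> 4^(q d) 2^(q d) = 2^(3 q d). The length q^2 d makes 3 q d a fraction 3/q of the
  list.\<close>

lemma zero_count_bound:
  assumes q: "2 \<le> q" and hs: "length hs = q * q * d"
    and pot: "q ^ length hs * (\<Sum>x\<in>{1..<q ^ d}. 2 ^ zero_count hs x) \<le> (q + 1) ^ length hs * q ^ d"
    and z: "1 \<le> z" "z < q ^ d"
  shows "zero_count hs z \<le> 3 * (q * d)"
proof -
  have q0: "0 < real q" using q by simp
  have "2 ^ zero_count hs z \<le> (\<Sum>x\<in>{1..<q ^ d}. 2 ^ zero_count hs x :: nat)"
    using z by (intro member_le_sum[of z "{1..<q ^ d}" "\<lambda>x. 2 ^ zero_count hs x"]) auto
  then have "q ^ length hs * 2 ^ zero_count hs z \<le> (q + 1) ^ length hs * q ^ d"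
    using pot by (meson le_trans mult_le_mono2)
  then have "real (q ^ length hs * 2 ^ zero_count hs z) \<le> real ((q + 1) ^ length hs * q ^ d)"
    by (simp only: of_nat_le_iff)
  then have "real q ^ length hs * 2 ^ zero_count hs z \<le> (real q + 1) ^ length hs * real q ^ d"
    by (simp add: add.commute)
  then have "2 ^ zero_count hs z \<le> (real q + 1) ^ length hs * real q ^ d / real q ^ length hs"
    using q0 by (simp add: pos_le_divide_eq mult.commute)
  also have "\<dots> = (1 + 1 / real q) ^ length hs * real q ^ d"
  proof -
    have "real q + 1 = (1 + 1 / real q) * real q" using q0 by (simp add: field_simps)
    then have "(real q + 1) ^ length hs = (1 + 1 / real q) ^ length hs * real q ^ length hs"
      by (metis power_mult_distrib)
    then show ?thesis using q0 by simp
  qed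
  also have "(1 + 1 / real q) ^ length hs = ((1 + 1 / real q) ^ q) ^ (q * d)"
    unfolding hs by (simp add: power_mult[symmetric] mult.assoc)
  also have "((1 + 1 / real q) ^ q) ^ (q * d) * real q ^ d \<le> 4 ^ (q * d) * 2 ^ (q * d)"
  proof (rule mult_mono)
    have "(1 + 1 / real q) ^ q \<le> exp 1"
      using exp_ge_one_plus_x_over_n_power_n[of q 1] q by simp
    also have "\<dots> \<le> 4" using exp_le by linarith
    finally show "((1 + 1 / real q) ^ q) ^ (q * d) \<le> 4 ^ (q * d)" by (rule power_mono) simp
    have "real q \<le> 2 ^ q" using of_nat_less_two_power[of q, where 'a = real] by simp
    then have "real q ^ d \<le> (2 ^ q) ^ d" by (rule power_mono) simp
    then show "real q ^ d \<le> 2 ^ (q * d)" by (simp add: power_mult)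
  qed auto
  also have "\<dots> = (2 ^ 3) ^ (q * d)" by (simp add: power_mult_distrib[symmetric])
  also have "\<dots> = 2 ^ (3 * (q * d))" by (simp only: power_mult[symmetric])
  finally show ?thesis by (simp only: power_increasing_iff one_less_numeral_iff semiring_norm)
qed

text \<open>A union bound over the ordered pairs of points in S; by linearity the functions that
  identify a pair are those that vanish at one nonzero vector.\<close>

lemma linear_hash_collisions:
  assumes q: "2 \<le> q" and lin: "\<And>h. h \<in> set hs \<Longrightarrow> \<exists>c. h = lin q d c"
    and zc: "\<And>z. 1 \<le> z \<Longrightarrow> z < q ^ d \<Longrightarrow> zero_count hs z \<le> M"
    and S: "finite S" "S \<subseteq> {..<q ^ d}"
  shows "length (filter (\<lambda>h. \<not> inj_on h S) hs) \<le> card S * card S * M"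
proof -
  let ?P = "{(u, v) \<in> S \<times> S. u \<noteq> v}"
  have finP: "finite ?P" by (rule finite_subset[of _ "S \<times> S"]) (use S in auto)
  have pair: "length (filter (\<lambda>h. h u = h v) hs) \<le> M" if uv: "(u, v) \<in> ?P" for u v
  proof -
    have "u < q ^ d" "v < q ^ d" "u \<noteq> v" using uv S by auto
    then obtain z where z: "1 \<le> z" "z < q ^ d" "\<And>a. lin q d a u = lin q d a v \<longleftrightarrow> lin q d a z = 0"
      using lin_difference[OF q] by blast
    have "filter (\<lambda>h. h u = h v) hs = filter (\<lambda>h. h z = 0) hs"
    proof (rule filter_cong[OF refl])
      fix h assume "h \<in> set hs"
      then obtain c where "h = lin q d c" using lin by blast
      then show "h u = h v \<longleftrightarrow> h z = 0" using z(3) by simp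
    qed
    then show ?thesis using zc[OF z(1,2)] by (simp add: zero_count_def)
  qed
  have "length (filter (\<lambda>h. \<not> inj_on h S) hs) \<le> (\<Sum>(u, v)\<in>?P. length (filter (\<lambda>h. h u = h v) hs))"
  proof (induction hs)
    case (Cons h hs)
    have "of_bool (\<not> inj_on h S) \<le> (\<Sum>(u, v)\<in>?P. of_bool (h u = h v) :: nat)"
    proof (cases "inj_on h S")
      case False
      then obtain u v where uv: "(u, v) \<in> ?P" "h u = h v" by (auto simp: inj_on_def)
      have "(1::nat) = (\<lambda>(u, v). of_bool (h u = h v)) (u, v)" using uv by simp
      also have "\<dots> \<le> (\<Sum>(u, v)\<in>?P. of_bool (h u = h v))"
        by (rule member_le_sum[OF uv(1)]) (use finP in auto)
      finally show ?thesis using False by simp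
    qed simp
    moreover have "(\<Sum>(u, v)\<in>?P. length (filter (\<lambda>h. h u = h v) (h # hs))) =
       (\<Sum>(u, v)\<in>?P. of_bool (h u = h v)) + (\<Sum>(u, v)\<in>?P. length (filter (\<lambda>h. h u = h v) hs))"
      unfolding sum.distrib[symmetric] by (rule sum.cong) auto
    moreover have "length (filter (\<lambda>h. \<not> inj_on h S) (h # hs)) =
        of_bool (\<not> inj_on h S) + length (filter (\<lambda>h. \<not> inj_on h S) hs)" by simp
    ultimately show ?case using Cons by linarith
  qed simp
  also have "\<dots> \<le> (\<Sum>p\<in>?P. M)" using pair by (intro sum_mono) (auto simp: case_prod_beta)
  also have "\<dots> = card ?P * M" by simp
  also have "\<dots> \<le> card (S \<times> S) * M" using S by (intro mult_right_mono card_mono) auto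
  finally show ?thesis by (simp add: card_cartesian_product)
qed

lemma colourful_cong:
  assumes "\<And>u. u < nv \<Longrightarrow> c u = c' u"
  shows "colourful E nv k c = colourful E nv k c'"
proof -
  have "map c p = map c' p" if "p \<in> walks E k (\<lambda>v. v < nv)" for p
    using that assms by (auto simp: walks_def)
  then have "{p \<in> walks E k (\<lambda>v. v < nv). distinct (map c p)} = {p \<in> walks E k (\<lambda>v. v < nv). distinct (map c' p)}"
    by (metis (no_types, lifting))
  then show ?thesis by (simp add: colourful_def)
qed

text \<open>Exchanging the sums, every simple walk contributes the number of pairs of a hash
  function and a colouring that make it colourful, and other walks contribute nothing. If
  \<open>h\<close> is injective on the walk, its image is a k-set of the field, where the family is
  balanced. The functions failing this number at most k^2 3 q d \<le> (\<epsilon>/4) q^2 d.\<close>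

lemma estimate_bounds:
  fixes E :: "(nat \<times> nat) set" and nv k F :: nat and tb :: "nat \<Rightarrow> nat \<Rightarrow> nat" and hs :: "(nat \<Rightarrow> nat) list"
  assumes bal: "balanced_family \<epsilon> k q K F tb" and \<epsilon>: "0 < \<epsilon>" "\<epsilon> \<le> 1"
    and hs: "length hs = q * q * d" and lin: "\<And>h. h \<in> set hs \<Longrightarrow> \<exists>c. h = lin q d c"
    and zc: "\<And>z. 1 \<le> z \<Longrightarrow> z < q ^ d \<Longrightarrow> zero_count hs z \<le> 3 * (q * d)" and nv: "nv \<le> q ^ d"
  defines "T \<equiv> inj_count F tb {..<k}"
    and "R \<equiv> {p \<in> walks E k (\<lambda>v. v < nv). distinct p}"
    and "num \<equiv> (\<Sum>h\<leftarrow>hs. \<Sum>i<F. colourful E nv k (\<lambda>u. tb i (h u)))"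
  shows "(1 - \<epsilon> / 8) * (1 - \<epsilon> / 4) * (real (card R) * (real (length hs) * real T)) \<le> real num"
    and "real num \<le> (1 + \<epsilon> / 8) * (real (card R) * (real (length hs) * real T))"
proof -
  have q: "prime q" "12 * real k ^ 2 \<le> \<epsilon> * real q" using bal by (auto simp: balanced_family_def)
  then have q2: "2 \<le> q" using prime_ge_2_nat by blast
  let ?W = "walks E k (\<lambda>v. v < nv)"
  have finW: "finite ?W" by (rule finite_walks) simp
  have finR: "finite R" using finW by (simp add: R_def)
  let ?c = "\<lambda>h p. card {i. i < F \<and> distinct (map (\<lambda>u. tb i (h u)) p)}"
  have one: "(\<Sum>i<F. colourful E nv k (\<lambda>u. tb i (h u))) = (\<Sum>p\<in>R. ?c h p)" for h
  proof -
    have "(\<Sum>i<F. colourful E nv k (\<lambda>u. tb i (h u))) =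
        (\<Sum>i<F. \<Sum>p\<in>?W. of_bool (distinct (map (\<lambda>u. tb i (h u)) p)))"
      using finW by (simp add: colourful_def Int_def)
    also have "\<dots> = (\<Sum>p\<in>?W. \<Sum>i<F. of_bool (distinct (map (\<lambda>u. tb i (h u)) p)))" by (rule sum.swap)
    also have "\<dots> = (\<Sum>p\<in>?W. ?c h p)" by (simp add: Int_def lessThan_def)
    also have "\<dots> = (\<Sum>p\<in>R. ?c h p)"
      unfolding R_def by (rule sum.mono_neutral_right) (use finW in \<open>auto simp: distinct_map\<close>)
    finally show ?thesis .
  qed
  have num: "num = (\<Sum>p\<in>R. \<Sum>h\<leftarrow>hs. ?c h p)"
    unfolding num_def one by (induction hs) (simp_all add: sum.distrib)
  let ?A = "(1 - \<epsilon> / 8) * (1 - \<epsilon> / 4) * (real (length hs) * real T)"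
  let ?B = "(1 + \<epsilon> / 8) * (real (length hs) * real T)"
  have p: "?A \<le> real (\<Sum>h\<leftarrow>hs. ?c h p) \<and> real (\<Sum>h\<leftarrow>hs. ?c h p) \<le> ?B" if p: "p \<in> R" for p
  proof -
    let ?S = "set p"
    have S: "?S \<subseteq> {..<q ^ d}" "card ?S = k" "distinct p"
      using p nv by (auto simp: R_def walks_def distinct_card)
    have c: "?c h p = (if inj_on h ?S then inj_count F tb (h ` ?S) else 0)" for h
    proof -
      have "distinct (map (\<lambda>u. tb i (h u)) p) \<longleftrightarrow> inj_on h ?S \<and> inj_on (tb i) (h ` ?S)" for i
        using S(3) comp_inj_on_iff[of h ?S "tb i"] inj_on_imageI2[of "tb i" h ?S]
        by (auto simp: distinct_map comp_def)
      then show ?thesis by (simp add: inj_count_def)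
    qed
    have ic: "(1 - \<epsilon> / 8) * real T \<le> real (inj_count F tb (h ` ?S))"
      "real (inj_count F tb (h ` ?S)) \<le> (1 + \<epsilon> / 8) * real T" if "h \<in> set hs" "inj_on h ?S" for h
    proof -
      obtain c where "h = lin q d c" using lin \<open>h \<in> set hs\<close> by blast
      then have "h ` ?S \<subseteq> {..<q}" using q2 by (auto simp: lin_less)
      moreover have "card (h ` ?S) = k" using S(2) that(2) by (simp add: card_image)
      ultimately show "(1 - \<epsilon> / 8) * real T \<le> real (inj_count F tb (h ` ?S))"
        "real (inj_count F tb (h ` ?S)) \<le> (1 + \<epsilon> / 8) * real T"
        using bal by (auto simp: balanced_family_def T_def)
    qed
    have up: "real (\<Sum>h\<leftarrow>hs'. ?c h p) \<le> real (length hs') * ((1 + \<epsilon> / 8) * real T)" if "set hs' \<subseteq> set hs" for hs'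
      using that
    proof (induction hs')
      case (Cons h hs')
      have "real (?c h p) \<le> (1 + \<epsilon> / 8) * real T"
        unfolding c using ic[of h] Cons.prems \<epsilon> by (auto simp: zero_le_mult_iff)
      then show ?case using Cons by (simp add: distrib_right)
    qed simp
    have lo: "real (length (filter (\<lambda>h. inj_on h ?S) hs')) * ((1 - \<epsilon> / 8) * real T) \<le> real (\<Sum>h\<leftarrow>hs'. ?c h p)"
      if "set hs' \<subseteq> set hs" for hs'
      using that
    proof (induction hs')
      case (Cons h hs')
      have "real (of_bool (inj_on h ?S)) * ((1 - \<epsilon> / 8) * real T) \<le> real (?c h p)"
        unfolding c using ic[of h] Cons.prems by auto
      then show ?case using Cons by (cases "inj_on h ?S") (simp_all add: distrib_right)
    qed simp
    have "length (filter (\<lambda>h. \<not> inj_on h ?S) hs) \<le> k * k * (3 * (q * d))"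
      using linear_hash_collisions[OF q2 lin zc, of ?S] S by simp
    then have "real (length (filter (\<lambda>h. \<not> inj_on h ?S) hs)) \<le> real (k * k * (3 * (q * d)))" by (simp only: of_nat_le_iff)
    also have "\<dots> = 12 * real k ^ 2 * (real q * real d / 4)" by (simp add: power2_eq_square)
    also have "\<dots> \<le> \<epsilon> * real q * (real q * real d / 4)" using q(2) by (intro mult_right_mono) auto
    also have "\<dots> = \<epsilon> / 4 * real (length hs)" by (simp add: hs)
    finally have "(1 - \<epsilon> / 4) * real (length hs) \<le> real (length (filter (\<lambda>h. inj_on h ?S) hs))"
      using sum_length_filter_compl[of "\<lambda>h. inj_on h ?S" hs] by (simp add: algebra_simps)
    then have "(1 - \<epsilon> / 4) * real (length hs) * ((1 - \<epsilon> / 8) * real T) \<le>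
        real (length (filter (\<lambda>h. inj_on h ?S) hs)) * ((1 - \<epsilon> / 8) * real T)"
      using \<epsilon> by (intro mult_right_mono) auto
    also have "\<dots> \<le> real (\<Sum>h\<leftarrow>hs. ?c h p)" by (rule lo) simp
    finally show ?thesis using up[of hs] by (simp add: mult_ac)
  qed
  have "real num = (\<Sum>p\<in>R. real (\<Sum>h\<leftarrow>hs. ?c h p))" by (simp add: num)
  moreover have "(\<Sum>p\<in>R. ?A) \<le> (\<Sum>p\<in>R. real (\<Sum>h\<leftarrow>hs. ?c h p))" using p by (intro sum_mono) blast
  moreover have "(\<Sum>p\<in>R. real (\<Sum>h\<leftarrow>hs. ?c h p)) \<le> (\<Sum>p\<in>R. ?B)" using p by (intro sum_mono) blast
  ultimately show "(1 - \<epsilon> / 8) * (1 - \<epsilon> / 4) * (real (card R) * (real (length hs) * real T)) \<le> real num"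
    "real num \<le> (1 + \<epsilon> / 8) * (real (card R) * (real (length hs) * real T))"
    by (simp_all add: mult_ac)
qed

section \<open>Greedy choice of the linear hash functions\<close>

text \<open>Extends the values of a linear form from [0, q^j) to [0, q^(j+1)) for the candidate
  coefficient \<open>V 26\<close>: the value at q^j + i is the value at i plus the candidate, modulo
  q. \<open>V 23\<close> adds up the weights of the new zeros.\<close>

definition FILL :: com where
  "FILL = 23 ::= N 0 ;; FOR 9 (V 22 -. V 21)
     (10 ::= V 21 +. V 9 ;; 14 ::= Ar 5 (V 9) +. V 26 ;;
      Ite (V 3 -. V 14) Skip (14 ::= V 14 -. V 3) ;; Upd 5 (V 10) (V 14) ;;
      Ite (V 14) Skip (23 ::= V 23 +. Ar 13 (V 10)))"

text \<open>All q candidates for one coefficient are tried. The summand \<open>N 1 -. V 26\<close>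
  makes candidate 0 accepted unconditionally, which initializes the best choice in
  \<open>V 24\<close> and \<open>V 25\<close>. The block is then filled once more with the
  winner.\<close>

definition BLOCK :: com where
  "BLOCK = 22 ::= N 0 ;; FOR 9 (V 3) (22 ::= V 22 +. V 21) ;;
     FOR 26 (V 3) (FILL ;; Ite ((N 1 -. V 26) +. (V 25 -. V 23)) (24 ::= V 26 ;; 25 ::= V 23) Skip) ;;
     26 ::= V 24 ;; FILL ;; 21 ::= V 22"

definition HASH :: com where
  "HASH = 21 ::= N 1 ;; Upd 5 (N 0) (N 0) ;; Wh (V 27 -. V 21) BLOCK"

lemma FILL_frame [simp]: "wv FILL = {9, 10, 14, 23}" "wa FILL = {5}"
  by (auto simp: FILL_def)

lemma BLOCK_frame [simp]: "wv BLOCK = {9, 10, 14, 21, 22, 23, 24, 25, 26}" "wa BLOCK = {5}"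
  by (auto simp: BLOCK_def)

lemma HASH_frame [simp]: "wv HASH = {9, 10, 14, 21, 22, 23, 24, 25, 26}" "wa HASH = {5}"
  by (auto simp: HASH_def)

definition zero_weight :: "nat \<Rightarrow> nat \<Rightarrow> (nat \<Rightarrow> nat) \<Rightarrow> nat set \<Rightarrow> (nat \<Rightarrow> nat) \<Rightarrow> nat" where
  "zero_weight q d w A c = (\<Sum>x\<in>A. if lin q d c x = 0 then w x else 0)"

lemma FILL_spec:
  assumes q: "2 \<le> v 3" and j: "j < d" and S: "v 21 = v 3 ^ j" "v 22 = v 3 ^ Suc j" and cand: "v 26 < v 3"
    and h: "\<And>x. x < v 21 \<Longrightarrow> a 5 x = lin (v 3) d c x"
    and post: "\<And>v' a' t'. eqx {9, 10, 14, 23} v v' \<Longrightarrow> eqx {5} a a' \<Longrightarrow>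
      (\<And>x. x < v 22 \<Longrightarrow> a' 5 x = lin (v 3) d (c(j := v 26)) x) \<Longrightarrow>
      v' 23 = zero_weight (v 3) d (a 13) {v 21..<v 22} (c(j := v 26)) \<Longrightarrow> t' \<le> t + (9 * v 22 + 3) \<Longrightarrow> Q v' a' t'"
  shows "wp FILL Q v a t"
proof -
  let ?c = "10 ::= V 21 +. V 9 ;; 14 ::= Ar 5 (V 9) +. V 26 ;;
      Ite (V 3 -. V 14) Skip (14 ::= V 14 -. V 3) ;; Upd 5 (V 10) (V 14) ;;
      Ite (V 14) Skip (23 ::= V 23 +. Ar 13 (V 10))"
  let ?l = "lin (v 3) d (c(j := v 26))"
  have le: "v 21 \<le> v 22" using q unfolding S by (intro power_increasing) auto
  have h': "a 5 x = ?l x" if "x < v 21" for x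
    using h[OF that] lin_cong[of x "v 3" j c "c(j := v 26)" d] that S by simp
  have "wp (FOR 9 (V 22 -. V 21) ?c) Q (v(23 := 0)) a (Suc t)"
  proof (rule wp_FOR[where n = "v 22 - v 21" and B = 7 and
        I = "\<lambda>i v' a'. (\<forall>x<v 21 + i. a' 5 x = ?l x) \<and> v' 23 = zero_weight (v 3) d (a 13) {v 21..<v 21 + i} (c(j := v 26))"])
    fix v1 a1 t1
    assume I: "(\<forall>x<v 21 + (v 22 - v 21). a1 5 x = ?l x) \<and>
        v1 23 = zero_weight (v 3) d (a 13) {v 21..<v 21 + (v 22 - v 21)} (c(j := v 26))"
      and f1: "eqx (insert 9 (wv ?c)) (v(23 := 0)) v1" "eqx (wa ?c) a a1"
      and t1: "t1 \<le> Suc t + (v 22 - v 21) * (7 + 2) + 2"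
    show "Q v1 a1 t1"
    proof (rule post)
      show "eqx {9, 10, 14, 23} v v1" "eqx {5} a a1" using f1 by (auto simp: eqx_def)
    qed (use I t1 le in auto)
  next
    fix i t1 and v1 :: vars and a1 :: arrays
    assume i: "i < v 22 - v 21" "v1 9 = i" and I: "(\<forall>x<v 21 + i. a1 5 x = ?l x) \<and>
        v1 23 = zero_weight (v 3) d (a 13) {v 21..<v 21 + i} (c(j := v 26))"
      and f1: "eqx (insert 9 (wv ?c)) (v(23 := 0)) v1" "eqx (wa ?c) a a1"
    note [simp] = eqxD[OF f1(1)] eqxD[OF f1(2)]
    have "v 21 > 0" using q by (simp add: S)
    then have a5: "a1 5 i = ?l i" using I by simp
    have "?l (v 21 + i) = (?l (v 21 + i - v 3 ^ j) + (c(j := v 26)) j) mod v 3"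
      by (rule lin_step[OF q j]) (use i le S in auto)
    then have l: "?l (v 21 + i) = (?l i + v 26) mod v 3" by (simp add: S)
    have li: "?l i < v 3" using q by (simp add: lin_less)
    then have l': "?l (v 21 + i) = (if ?l i + v 26 < v 3 then ?l i + v 26 else ?l i + v 26 - v 3)"
      using cand by (simp add: l mod_if)
    have zw: "zero_weight (v 3) d (a 13) {v 21..<v 21 + Suc i} (c(j := v 26)) =
        zero_weight (v 3) d (a 13) {v 21..<v 21 + i} (c(j := v 26)) + (if ?l (v 21 + i) = 0 then a 13 (v 21 + i) else 0)"
      by (simp add: zero_weight_def)
    have upd: "\<forall>x<v 21 + Suc i. ((a1 5)(v 21 + i := ?l (v 21 + i))) x = ?l x" using I by (auto simp: less_Suc_eq)
    show "wp ?c (\<lambda>v' a' t'. ((\<forall>x<v 21 + Suc i. a' 5 x = ?l x) \<and>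
        (v'(9 := Suc i)) 23 = zero_weight (v 3) d (a 13) {v 21..<v 21 + Suc i} (c(j := v 26))) \<and> t' \<le> t1 + 7) v1 a1 t1"
    proof (cases "?l i + v 26 < v 3")
      case True
      then show ?thesis using upd I i a5 l' zw by (cases "?l i + v 26 = 0") auto
    next
      case False
      then show ?thesis using upd I i a5 l' zw by (cases "?l i + v 26 - v 3 = 0") auto
    qed
  next
    fix i and v1 :: vars and a1 :: arrays
    assume f1: "eqx (insert 9 (wv ?c)) (v(23 := 0)) v1"
    show "ev (V 22 -. V 21) v1 a1 = v 22 - v 21" using eqxD[OF f1, of 22] eqxD[OF f1, of 21] by simp
  qed (use h' in \<open>auto simp: zero_weight_def\<close>)
  then show ?thesis by (simp add: FILL_def)
qed

text \<open>A vector whose leading position is \<open>j\<close> becomes a zero for at most one value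
  of coefficient \<open>j\<close>. The cheapest of the q values therefore costs at most 1/q of the
  weight of the block.\<close>

lemma zero_weight_average:
  assumes q: "prime q" and j: "j < d"
  shows "(\<Sum>b<q. zero_weight q d w {q ^ j..<q ^ Suc j} (c(j := b))) \<le> (\<Sum>x\<in>{q ^ j..<q ^ Suc j}. w x)"
proof -
  have "(\<Sum>b<q. zero_weight q d w {q ^ j..<q ^ Suc j} (c(j := b))) =
      (\<Sum>x\<in>{q ^ j..<q ^ Suc j}. \<Sum>b<q. if lin q d (c(j := b)) x = 0 then w x else 0)"
    unfolding zero_weight_def by (rule sum.swap)
  also have "\<dots> \<le> (\<Sum>x\<in>{q ^ j..<q ^ Suc j}. w x)"
  proof (rule sum_mono)
    fix x assume x: "x \<in> {q ^ j..<q ^ Suc j}"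
    have "card {b. b < q \<and> lin q d (c(j := b)) x = 0} \<le> Suc 0"
    proof (subst card_le_Suc0_iff_eq)
      show "\<forall>b\<in>{b. b < q \<and> lin q d (c(j := b)) x = 0}. \<forall>b'\<in>{b. b < q \<and> lin q d (c(j := b)) x = 0}. b = b'"
        using lin_zero_unique[OF q j, of x _ _ c] x by auto
    qed simp
    moreover have "(\<Sum>b<q. if lin q d (c(j := b)) x = 0 then w x else 0) =
        card {b. b < q \<and> lin q d (c(j := b)) x = 0} * w x"
      by (simp add: sum.If_cases Int_def)
    ultimately show "(\<Sum>b<q. if lin q d (c(j := b)) x = 0 then w x else 0) \<le> w x"
      by (cases "card {b. b < q \<and> lin q d (c(j := b)) x = 0}") auto
  qed
  finally show ?thesis .
qed

lemma BLOCK_spec: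
  assumes q: "prime (v 3)" and j: "j < d" and S: "v 21 = v 3 ^ j"
    and h: "\<And>x. x < v 21 \<Longrightarrow> a 5 x = lin (v 3) d c x"
    and post: "\<And>v' a' t' b. eqx {9, 10, 14, 21, 22, 23, 24, 25, 26} v v' \<Longrightarrow> eqx {5} a a' \<Longrightarrow>
      v' 21 = v 3 ^ Suc j \<Longrightarrow> (\<And>x. x < v 3 ^ Suc j \<Longrightarrow> a' 5 x = lin (v 3) d (c(j := b)) x) \<Longrightarrow>
      v 3 * zero_weight (v 3) d (a 13) {v 3 ^ j..<v 3 ^ Suc j} (c(j := b)) \<le> (\<Sum>x\<in>{v 3 ^ j..<v 3 ^ Suc j}. a 13 x) \<Longrightarrow>
      t' \<le> t + 50 * v 3 * v 3 ^ Suc j \<Longrightarrow> Q v' a' t'"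
  shows "wp BLOCK Q v a t"
proof -
  let ?q = "v 3"
  let ?Q = "?q ^ Suc j"
  let ?c2 = "FILL ;; Ite ((N 1 -. V 26) +. (V 25 -. V 23)) (24 ::= V 26 ;; 25 ::= V 23) Skip"
  let ?cost = "\<lambda>b. zero_weight ?q d (a 13) {?q ^ j..<?Q} (c(j := b))"
  let ?rest = "wp (FOR 26 (V 3) ?c2) (wp (26 ::= V 24) (wp FILL (wp (21 ::= V 22) Q)))"
  have q2: "2 \<le> ?q" using q prime_ge_2_nat by blast
  have "wp (FOR 9 (V 3) (22 ::= V 22 +. V 21)) ?rest (v(22 := 0)) a (Suc t)"
  proof (rule wp_FOR[where n = ?q and B = 1 and I = "\<lambda>i v' a'. v' 22 = i * ?q ^ j"])
    fix v1 a1 t1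
    assume I1: "v1 22 = ?q * ?q ^ j" and f1: "eqx (insert 9 (wv (22 ::= V 22 +. V 21))) (v(22 := 0)) v1"
      "eqx (wa (22 ::= V 22 +. V 21)) a a1" and t1: "t1 \<le> Suc t + ?q * (1 + 2) + 2"
    have a1: "a1 i = a i" for i using eqxD[OF f1(2)] by simp
    note [simp] = eqxD[OF f1(1)]
    show "?rest v1 a1 t1"
    proof (rule wp_FOR[where n = ?q and B = "9 * ?Q + 6" and
          I = "\<lambda>i v' a'. (\<forall>x<?q ^ j. a' 5 x = lin ?q d c x) \<and>
            (0 < i \<longrightarrow> v' 24 < i \<and> v' 25 = ?cost (v' 24) \<and> (\<forall>b<i. v' 25 \<le> ?cost b))"])
      fix v2 a2 t2
      assume I2: "(\<forall>x<?q ^ j. a2 5 x = lin ?q d c x) \<and>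
            (0 < ?q \<longrightarrow> v2 24 < ?q \<and> v2 25 = ?cost (v2 24) \<and> (\<forall>b<?q. v2 25 \<le> ?cost b))"
        and f2: "eqx (insert 26 (wv ?c2)) v1 v2" "eqx (wa ?c2) a1 a2"
        and t2: "t2 \<le> t1 + ?q * (9 * ?Q + 6 + 2) + 2"
      note [simp] = eqxD[OF f2(1)]
      have a2: "a2 13 = a 13" using eqxD[OF f2(2), of 13] a1 by simp
      let ?b = "v2 24"
      have "wp FILL (wp (21 ::= V 22) Q) (v2(26 := ?b)) a2 (Suc t2)"
      proof (rule FILL_spec[where d = d and c = c and j = j])
        fix v3 a3 t3
        assume f3: "eqx {9, 10, 14, 23} (v2(26 := ?b)) v3" "eqx {5} a2 a3"
          and h3: "\<And>x. x < (v2(26 := ?b)) 22 \<Longrightarrow> a3 5 x = lin ((v2(26 := ?b)) 3) d (c(j := (v2(26 := ?b)) 26)) x"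
          and t3: "t3 \<le> Suc t2 + (9 * (v2(26 := ?b)) 22 + 3)"
        note [simp] = eqxD[OF f3(1)]
        have "Q (v3(21 := ?Q)) a3 (Suc t3)"
        proof (rule post[where b = ?b])
          show "eqx {9, 10, 14, 21, 22, 23, 24, 25, 26} v (v3(21 := ?Q))" "eqx {5} a a3"
            using f1 f2 f3 by (auto simp: eqx_def)
          show "a3 5 x = lin ?q d (c(j := ?b)) x" if "x < ?Q" for x using h3[of x] that I1 by simp
          have "?q * ?cost ?b = (\<Sum>b<?q. ?cost ?b)" by simp
          also have "\<dots> \<le> (\<Sum>b<?q. ?cost b)" using I2 q2 by (intro sum_mono) auto
          also have "\<dots> \<le> (\<Sum>x\<in>{?q ^ j..<?Q}. a 13 x)" by (rule zero_weight_average[OF q j])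
          finally show "?q * zero_weight ?q d (a 13) {?q ^ j..<?Q} (c(j := ?b)) \<le> (\<Sum>x\<in>{?q ^ j..<?Q}. a 13 x)" .
          have 1: "1 \<le> ?q" "1 \<le> ?Q" using q2 by auto
          then have 2: "?q \<le> ?q * ?Q" "?Q \<le> ?q * ?Q" "1 \<le> ?q * ?Q" by auto
          have "Suc t3 \<le> t + (3 * ?q + ?q * (9 * ?Q + 8) + 9 * ?Q + 11)" using t1 t2 t3 I1 by (simp add: algebra_simps)
          also have "\<dots> = t + (9 * (?q * ?Q) + 11 * ?q + 9 * ?Q + 11)" by (simp add: distrib_left)
          also have "\<dots> \<le> t + 50 * (?q * ?Q)" using 2 by linarith
          finally show "Suc t3 \<le> t + 50 * ?q * ?Q" by (simp only: mult.assoc)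
        qed simp
        then show "wp (21 ::= V 22) Q v3 a3 t3" using I1 by simp
      qed (use q2 j S I1 I2 in auto)
      then show "wp (26 ::= V 24) (wp FILL (wp (21 ::= V 22) Q)) v2 a2 t2" by simp
    next
      fix i t2 and v2 :: vars and a2 :: arrays
      assume i: "i < ?q" "v2 26 = i" and I2: "(\<forall>x<?q ^ j. a2 5 x = lin ?q d c x) \<and>
            (0 < i \<longrightarrow> v2 24 < i \<and> v2 25 = ?cost (v2 24) \<and> (\<forall>b<i. v2 25 \<le> ?cost b))"
        and f2: "eqx (insert 26 (wv ?c2)) v1 v2" "eqx (wa ?c2) a1 a2"
      note [simp] = eqxD[OF f2(1)]
      have a2: "a2 13 = a 13" using eqxD[OF f2(2), of 13] a1 by simp
      show "wp ?c2 (\<lambda>v' a' t'. ((\<forall>x<?q ^ j. a' 5 x = lin ?q d c x) \<and>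
            (0 < Suc i \<longrightarrow> (v'(26 := Suc i)) 24 < Suc i \<and> (v'(26 := Suc i)) 25 = ?cost ((v'(26 := Suc i)) 24) \<and>
             (\<forall>b<Suc i. (v'(26 := Suc i)) 25 \<le> ?cost b))) \<and> t' \<le> t2 + (9 * ?Q + 6)) v2 a2 t2"
        unfolding wp_Seq
      proof (rule FILL_spec[where d = d and c = c and j = j])
        fix v3 a3 t3
        assume f3: "eqx {9, 10, 14, 23} v2 v3" "eqx {5} a2 a3"
          and h3: "\<And>x. x < v2 22 \<Longrightarrow> a3 5 x = lin (v2 3) d (c(j := v2 26)) x"
          and c3: "v3 23 = zero_weight (v2 3) d (a2 13) {v2 21..<v2 22} (c(j := v2 26))"
          and t3: "t3 \<le> t2 + (9 * v2 22 + 3)"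
        note [simp] = eqxD[OF f3(1)]
        have h3': "a3 5 x = lin ?q d c x" if "x < ?q ^ j" for x
        proof -
          have "?q ^ j \<le> ?Q" using q2 by (intro power_increasing) auto
          then have "x < ?Q" using that by (rule less_le_trans[rotated])
          then show ?thesis using h3[of x] I1 lin_cong[OF that, of "c(j := v2 26)" c d] by simp
        qed
        have c3': "v3 23 = ?cost i" using c3 a2 i S I1 by simp
        show "wp (Ite ((N 1 -. V 26) +. (V 25 -. V 23)) (24 ::= V 26 ;; 25 ::= V 23) Skip)
           (\<lambda>v' a' t'. ((\<forall>x<?q ^ j. a' 5 x = lin ?q d c x) \<and>
            (0 < Suc i \<longrightarrow> (v'(26 := Suc i)) 24 < Suc i \<and> (v'(26 := Suc i)) 25 = ?cost ((v'(26 := Suc i)) 24) \<and>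
             (\<forall>b<Suc i. (v'(26 := Suc i)) 25 \<le> ?cost b))) \<and> t' \<le> t2 + (9 * ?Q + 6)) v3 a3 t3"
        proof (cases "i = 0 \<or> ?cost i < v2 25")
          case True
          have "?cost i \<le> ?cost b" if "b < Suc i" for b
          proof (cases "b = i")
            case False
            then have "b < i" using that by simp
            then have "v2 25 \<le> ?cost b" "?cost i < v2 25" using I2 True by auto
            then show ?thesis by linarith
          qed simp
          moreover have "ev ((N 1 -. V 26) +. (V 25 -. V 23)) v3 a3 \<noteq> 0" using True c3' i by auto
          ultimately show ?thesis using h3' c3' t3 I1 i by (simp del: ev.simps(3,4))
        next
          case False
          then have "v2 25 \<le> ?cost b" if "b < Suc i" for b
            using I2 that by (cases "b = i") auto
          moreover have "ev ((N 1 -. V 26) +. (V 25 -. V 23)) v3 a3 = 0" using False c3' i by auto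
          ultimately show ?thesis using False h3' t3 I1 I2 by (simp del: ev.simps(3,4))
        qed
      qed (use q2 j S I1 I2 i in auto)
    next
      fix i and v2 :: vars and a2 :: arrays
      assume f2: "eqx (insert 26 (wv ?c2)) v1 v2"
      show "ev (V 3) v2 a2 = ?q" using eqxD[OF f2, of 3] by simp
    qed (use h S a1 in auto)
  next
    fix i t1 and v1 :: vars and a1 :: arrays
    assume "v1 22 = i * ?q ^ j" and f1: "eqx (insert 9 (wv (22 ::= V 22 +. V 21))) (v(22 := 0)) v1"
    then show "wp (22 ::= V 22 +. V 21) (\<lambda>v' a' t'. (v'(9 := Suc i)) 22 = Suc i * ?q ^ j \<and> t' \<le> t1 + 1) v1 a1 t1"
      using eqxD[OF f1, of 21] S by simp
  next
    fix i and v1 :: vars and a1 :: arrays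
    assume f1: "eqx (insert 9 (wv (22 ::= V 22 +. V 21))) (v(22 := 0)) v1"
    show "ev (V 3) v1 a1 = ?q" using eqxD[OF f1, of 3] by simp
  qed auto
  then show ?thesis by (simp add: BLOCK_def)
qed

lemma sum_split_powers:
  fixes w :: "nat \<Rightarrow> nat"
  assumes "1 \<le> q"
  shows "(\<Sum>x\<in>{1..<q ^ Suc j}. w x) = (\<Sum>x\<in>{1..<q ^ j}. w x) + (\<Sum>x\<in>{q ^ j..<q ^ Suc j}. w x)"
proof -
  have "1 \<le> q ^ j" "q ^ j \<le> q ^ Suc j" using assms by auto
  then show ?thesis by (simp add: sum.atLeastLessThan_concat)
qed

text \<open>The costs of the blocks grow at least by a factor 2, so they sum to at most twice the
  last one, 100 q q^d; the rest pays for the loop tests.\<close>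

lemma geometric_cost:
  assumes "2 \<le> (q::nat)"
  shows "(\<Sum>j<d. 50 * q * q ^ Suc j + 1) + 1 \<le> 103 * q * q ^ d"
proof (induction d)
  case (Suc d)
  have 1: "1 \<le> q ^ d" using assms by simp
  have "103 * q * q ^ d + 50 * q * q ^ Suc d + 1 \<le> 103 * q * q ^ Suc d"
  proof -
    have "2 * q ^ d \<le> q * q ^ d" using assms by (rule mult_right_mono) simp
    then have "2 * (q * q ^ d) \<le> q * (q * q ^ d)" using mult_left_mono[of "2 * q ^ d" "q * q ^ d" q] by simp
    moreover have "1 \<le> q * (q * q ^ d)" using assms by simp
    ultimately have "103 * (q * q ^ d) + 50 * (q * (q * q ^ d)) + 1 \<le> 103 * (q * (q * q ^ d))" by linarith
    then show ?thesis by (simp add: mult.assoc)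
  qed
  then show ?case using Suc by simp
qed (use assms in simp)

text \<open>Coefficients are fixed one at a time. The zeros in [q^j, q^(j+1)) are settled by
  coefficients 0, ..., j, so every block is decided exactly once, and the bounds of the blocks add
  up to the average over all linear forms.\<close>

lemma HASH_spec:
  assumes q: "prime (v 3)" and SD: "v 27 = v 3 ^ d"
    and post: "\<And>v' a' t' c. eqx {9, 10, 14, 21, 22, 23, 24, 25, 26} v v' \<Longrightarrow> eqx {5} a a' \<Longrightarrow>
      (\<And>x. x < v 3 ^ d \<Longrightarrow> a' 5 x = lin (v 3) d c x) \<Longrightarrow>
      v 3 * zero_weight (v 3) d (a 13) {1..<v 3 ^ d} c \<le> (\<Sum>x\<in>{1..<v 3 ^ d}. a 13 x) \<Longrightarrow>
      t' \<le> t + 103 * v 3 * v 3 ^ d + 2 \<Longrightarrow> Q v' a' t'"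
  shows "wp HASH Q v a t"
proof -
  let ?q = "v 3"
  let ?v = "v(21 := 1)" and ?a = "a(5 := (a 5)(0 := 0))"
  have q2: "2 \<le> ?q" using q prime_ge_2_nat by blast
  have "wp (Wh (V 27 -. V 21) BLOCK) Q ?v ?a (Suc (Suc t))"
  proof (rule wp_Wh_sum[where n = d and B = "\<lambda>j. 50 * ?q * ?q ^ Suc j" and
        I = "\<lambda>j v' a'. v' 21 = ?q ^ j \<and> (\<exists>c. (\<forall>x<?q ^ j. a' 5 x = lin ?q d c x) \<and>
          ?q * zero_weight ?q d (a 13) {1..<?q ^ j} c \<le> (\<Sum>x\<in>{1..<?q ^ j}. a 13 x))"])
    show "?v 21 = ?q ^ 0 \<and> (\<exists>c. (\<forall>x<?q ^ 0. ?a 5 x = lin ?q d c x) \<and>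
          ?q * zero_weight ?q d (a 13) {1..<?q ^ 0} c \<le> (\<Sum>x\<in>{1..<?q ^ 0}. a 13 x))"
      by (simp add: zero_weight_def)
  next
    fix j v1 a1 t1
    assume j: "j < d" and I: "v1 21 = ?q ^ j \<and> (\<exists>c. (\<forall>x<?q ^ j. a1 5 x = lin ?q d c x) \<and>
          ?q * zero_weight ?q d (a 13) {1..<?q ^ j} c \<le> (\<Sum>x\<in>{1..<?q ^ j}. a 13 x))"
      and f1: "eqx (wv BLOCK) ?v v1" "eqx (wa BLOCK) ?a a1"
    note [simp] = eqxD[OF f1(1)] eqxD[OF f1(2)]
    obtain c where c: "\<forall>x<?q ^ j. a1 5 x = lin ?q d c x"
      "?q * zero_weight ?q d (a 13) {1..<?q ^ j} c \<le> (\<Sum>x\<in>{1..<?q ^ j}. a 13 x)" using I by blast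
    have "?q ^ j < ?q ^ d" using q2 j by (intro power_strict_increasing) auto
    then have "ev (V 27 -. V 21) v1 a1 \<noteq> 0" using I SD by simp
    moreover have "wp BLOCK (\<lambda>v' a' t'. (v' 21 = ?q ^ Suc j \<and> (\<exists>c. (\<forall>x<?q ^ Suc j. a' 5 x = lin ?q d c x) \<and>
          ?q * zero_weight ?q d (a 13) {1..<?q ^ Suc j} c \<le> (\<Sum>x\<in>{1..<?q ^ Suc j}. a 13 x))) \<and>
          t' \<le> t1 + 50 * ?q * ?q ^ Suc j) v1 a1 t1"
    proof (rule BLOCK_spec[OF _ j, where c = c])
      fix v2 a2 t2 b
      assume S: "v2 21 = v1 3 ^ Suc j" and h: "\<And>x. x < v1 3 ^ Suc j \<Longrightarrow> a2 5 x = lin (v1 3) d (c(j := b)) x"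
        and w: "v1 3 * zero_weight (v1 3) d (a1 13) {v1 3 ^ j..<v1 3 ^ Suc j} (c(j := b)) \<le> (\<Sum>x\<in>{v1 3 ^ j..<v1 3 ^ Suc j}. a1 13 x)"
        and t2: "t2 \<le> t1 + 50 * v1 3 * v1 3 ^ Suc j"
      have "zero_weight ?q d (a 13) {1..<?q ^ j} (c(j := b)) = zero_weight ?q d (a 13) {1..<?q ^ j} c"
        unfolding zero_weight_def
      proof (rule sum.cong[OF refl])
        fix x assume "x \<in> {1..<?q ^ j}"
        then show "(if lin ?q d (c(j := b)) x = 0 then a 13 x else 0) = (if lin ?q d c x = 0 then a 13 x else 0)"
          using lin_cong[of x ?q j "c(j := b)" c d] by simp
      qed
      moreover have "zero_weight ?q d (a 13) {1..<?q ^ Suc j} (c(j := b)) =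
          zero_weight ?q d (a 13) {1..<?q ^ j} (c(j := b)) + zero_weight ?q d (a 13) {?q ^ j..<?q ^ Suc j} (c(j := b))"
        unfolding zero_weight_def by (rule sum_split_powers) (use q2 in simp)
      moreover have "(\<Sum>x\<in>{1..<?q ^ Suc j}. a 13 x) = (\<Sum>x\<in>{1..<?q ^ j}. a 13 x) + (\<Sum>x\<in>{?q ^ j..<?q ^ Suc j}. a 13 x)"
        by (rule sum_split_powers) (use q2 in simp)
      ultimately have "?q * zero_weight ?q d (a 13) {1..<?q ^ Suc j} (c(j := b)) \<le> (\<Sum>x\<in>{1..<?q ^ Suc j}. a 13 x)"
        using w c(2) by (simp add: distrib_left)
      then show "(v2 21 = ?q ^ Suc j \<and> (\<exists>c. (\<forall>x<?q ^ Suc j. a2 5 x = lin ?q d c x) \<and>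
          ?q * zero_weight ?q d (a 13) {1..<?q ^ Suc j} c \<le> (\<Sum>x\<in>{1..<?q ^ Suc j}. a 13 x))) \<and>
          t2 \<le> t1 + 50 * ?q * ?q ^ Suc j"
        using S h t2 by (intro conjI exI[of _ "c(j := b)"]) auto
    qed (use q I c in auto)
    ultimately show "ev (V 27 -. V 21) v1 a1 \<noteq> 0 \<and> wp BLOCK (\<lambda>v' a' t'. (v' 21 = ?q ^ Suc j \<and> (\<exists>c. (\<forall>x<?q ^ Suc j. a' 5 x = lin ?q d c x) \<and>
          ?q * zero_weight ?q d (a 13) {1..<?q ^ Suc j} c \<le> (\<Sum>x\<in>{1..<?q ^ Suc j}. a 13 x))) \<and>
          t' \<le> t1 + 50 * ?q * ?q ^ Suc j) v1 a1 t1" by blast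
  next
    fix v1 :: vars and a1 :: arrays
    assume I: "v1 21 = ?q ^ d \<and> (\<exists>c. (\<forall>x<?q ^ d. a1 5 x = lin ?q d c x) \<and>
          ?q * zero_weight ?q d (a 13) {1..<?q ^ d} c \<le> (\<Sum>x\<in>{1..<?q ^ d}. a 13 x))"
      and f1: "eqx (wv BLOCK) ?v v1"
    then show "ev (V 27 -. V 21) v1 a1 = 0" using eqxD[OF f1, of 27] SD by simp
  next
    fix v1 a1 t1
    assume I: "v1 21 = ?q ^ d \<and> (\<exists>c. (\<forall>x<?q ^ d. a1 5 x = lin ?q d c x) \<and>
          ?q * zero_weight ?q d (a 13) {1..<?q ^ d} c \<le> (\<Sum>x\<in>{1..<?q ^ d}. a 13 x))"
      and f1: "eqx (wv BLOCK) ?v v1" "eqx (wa BLOCK) ?a a1"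
      and t1: "t1 \<le> Suc (Suc t) + (\<Sum>j<d. 50 * ?q * ?q ^ Suc j + 1) + 1"
    then obtain c where c: "\<forall>x<?q ^ d. a1 5 x = lin ?q d c x"
      "?q * zero_weight ?q d (a 13) {1..<?q ^ d} c \<le> (\<Sum>x\<in>{1..<?q ^ d}. a 13 x)" by blast
    show "Q v1 a1 t1"
    proof (rule post[where c = c])
      show "eqx {9, 10, 14, 21, 22, 23, 24, 25, 26} v v1" "eqx {5} a a1" using f1 by (auto simp: eqx_def)
      show "t1 \<le> t + 103 * ?q * ?q ^ d + 2" using t1 geometric_cost[OF q2, of d] by linarith
    qed (use c in auto)
  qed
  then show ?thesis by (simp add: HASH_def)
qed

text \<open>Starts at entry 1: all linear forms vanish at 0, which is no difference of distinct
  vectors.\<close>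

definition DOUBLE :: com where
  "DOUBLE = FOR 9 (V 27 -. N 1)
     (Ite (Ar 5 (V 9 +. N 1)) Skip (Upd 13 (V 9 +. N 1) (Ar 13 (V 9 +. N 1) +. Ar 13 (V 9 +. N 1))))"

lemma DOUBLE_frame [simp]: "wv DOUBLE = {9}" "wa DOUBLE = {13}"
  by (auto simp: DOUBLE_def)

lemma DOUBLE_spec:
  assumes SD: "1 \<le> v 27"
    and post: "\<And>v' a' t'. eqx {9} v v' \<Longrightarrow> eqx {13} a a' \<Longrightarrow>
      (\<And>x. 1 \<le> x \<Longrightarrow> x < v 27 \<Longrightarrow> a' 13 x = (if a 5 x = 0 then 2 * a 13 x else a 13 x)) \<Longrightarrow>
      t' \<le> t + 4 * v 27 \<Longrightarrow> Q v' a' t'"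
  shows "wp DOUBLE Q v a t"
proof -
  let ?c = "Ite (Ar 5 (V 9 +. N 1)) Skip (Upd 13 (V 9 +. N 1) (Ar 13 (V 9 +. N 1) +. Ar 13 (V 9 +. N 1)))"
  let ?w = "\<lambda>x. if a 5 x = 0 then 2 * a 13 x else a 13 x"
  have "wp (FOR 9 (V 27 -. N 1) ?c) Q v a t"
  proof (rule wp_FOR[where n = "v 27 - 1" and B = 2 and I = "\<lambda>i v' a'. \<forall>x. a' 13 x = (if 1 \<le> x \<and> x < Suc i then ?w x else a 13 x)"])
    fix v1 a1 t1
    assume I: "\<forall>x. a1 13 x = (if 1 \<le> x \<and> x < Suc (v 27 - 1) then ?w x else a 13 x)"
      and f1: "eqx (insert 9 (wv ?c)) v v1" "eqx (wa ?c) a a1" and t1: "t1 \<le> t + (v 27 - 1) * (2 + 2) + 2"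
    show "Q v1 a1 t1"
    proof (rule post)
      show "t1 \<le> t + 4 * v 27" using t1 SD by (cases "v 27") auto
    qed (use f1 I SD in auto)
  next
    fix i t1 and v1 :: vars and a1 :: arrays
    assume i: "v1 9 = i" and I: "\<forall>x. a1 13 x = (if 1 \<le> x \<and> x < Suc i then ?w x else a 13 x)"
      and f1: "eqx (insert 9 (wv ?c)) v v1" "eqx (wa ?c) a a1"
    note [simp] = eqxD[OF f1(1)] eqxD[OF f1(2)]
    show "wp ?c (\<lambda>v' a' t'. (\<forall>x. a' 13 x = (if 1 \<le> x \<and> x < Suc (Suc i) then ?w x else a 13 x)) \<and> t' \<le> t1 + 2) v1 a1 t1"
      using i I by (auto simp: less_Suc_eq)
  next
    fix i and v1 :: vars and a1 :: arrays
    assume f1: "eqx (insert 9 (wv ?c)) v v1"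
    show "ev (V 27 -. N 1) v1 a1 = v 27 - 1" using eqxD[OF f1, of 27] by simp
  qed (auto simp: less_Suc_eq)
  then show ?thesis by (simp add: DOUBLE_def)
qed

text \<open>The condition 1 \<le> d makes the list of q^2 d functions nonempty, so that the final
  denominator is positive. For q = 2 this is the length L, about log k, used for large k.\<close>

definition digits_needed :: "nat \<Rightarrow> nat \<Rightarrow> nat" where
  "digits_needed q n = (LEAST d. 1 \<le> d \<and> n \<le> q ^ d)"

lemma digits_needed:
  assumes "2 \<le> q"
  shows "1 \<le> digits_needed q n" "n \<le> q ^ digits_needed q n"
    and "1 \<le> d \<Longrightarrow> d < digits_needed q n \<Longrightarrow> q ^ d < n"
proof -
  have "n < 2 ^ n" by (rule less_exp)
  also have "(2::nat) ^ n \<le> 2 ^ (n + 1)" by simp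
  also have "\<dots> \<le> q ^ (n + 1)" using assms by (rule power_mono) simp
  finally have "\<exists>d. 1 \<le> d \<and> n \<le> q ^ d" by (intro exI[of _ "n + 1"]) simp
  from LeastI_ex[OF this] show "1 \<le> digits_needed q n" "n \<le> q ^ digits_needed q n"
    by (simp_all add: digits_needed_def)
  show "q ^ d < n" if "1 \<le> d" "d < digits_needed q n"
    using not_less_Least[of d "\<lambda>d. 1 \<le> d \<and> n \<le> q ^ d"] that by (auto simp: digits_needed_def)
qed

definition GROW :: com where
  "GROW = 29 ::= N 0 ;; FOR 9 (V 3) (29 ::= V 29 +. V 27) ;; 27 ::= V 29 ;; 28 ::= V 28 +. N 1"

definition SETUP :: com where
  "SETUP = 27 ::= V 3 ;; 28 ::= N 1 ;; Wh (V 6 -. V 27) GROW ;;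
     30 ::= N 0 ;; FOR 9 (V 3) (30 ::= V 30 +. V 28) ;;
     31 ::= N 0 ;; FOR 9 (V 3) (31 ::= V 31 +. V 30) ;;
     FOR 9 (V 27) (Upd 13 (V 9) (N 1)) ;; 33 ::= N 0 ;; 34 ::= N 0"

lemma GROW_frame [simp]: "wv GROW = {9, 27, 28, 29}" "wa GROW = {}"
  by (auto simp: GROW_def)

lemma SETUP_frame [simp]: "wv SETUP = {9, 27, 28, 29, 30, 31, 33, 34}" "wa SETUP = {13}"
  by (auto simp: SETUP_def)

text \<open>The multiplication of the programs: \<open>y\<close> is added \<open>V z\<close>
  times.\<close>

lemma FOR_mult:
  assumes xy: "distinct [i, x, y, z]"
    and post: "\<And>v' t'. eqx {i, x} v v' \<Longrightarrow> v' x = v x + v z * v y \<Longrightarrow> t' \<le> t + 3 * v z + 2 \<Longrightarrow> Q v' a t'"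
  shows "wp (FOR i (V z) (x ::= V x +. V y)) Q v a t"
proof (rule wp_FOR[where n = "v z" and B = 1 and I = "\<lambda>j v' a'. a' = a \<and> v' x = v x + j * v y"])
  fix j t1 and v1 :: vars and a1 :: arrays
  assume "a1 = a \<and> v1 x = v x + j * v y" "eqx (insert i (wv (x ::= V x +. V y))) v v1"
  then show "wp (x ::= V x +. V y) (\<lambda>v' a' t'. (a' = a \<and> (v'(i := Suc j)) x = v x + Suc j * v y) \<and> t' \<le> t1 + 1) v1 a1 t1"
    using xy by (simp add: eqx_def)
next
  fix v1 a1 t1
  assume "a1 = a \<and> v1 x = v x + v z * v y" "eqx (insert i (wv (x ::= V x +. V y))) v v1" "t1 \<le> t + v z * (1 + 2) + 2"
  then show "Q v1 a1 t1" using post[of v1 t1] by (simp add: insert_commute)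
qed (use xy in \<open>auto simp: eqx_def\<close>)

lemma SETUP_spec:
  assumes q: "2 \<le> v 3"
    and post: "\<And>v' a' t'. eqx {9, 27, 28, 29, 30, 31, 33, 34} v v' \<Longrightarrow> eqx {13} a a' \<Longrightarrow>
      v' 27 = v 3 ^ digits_needed (v 3) (v 6) \<Longrightarrow> v' 31 = v 3 * v 3 * digits_needed (v 3) (v 6) \<Longrightarrow>
      (\<And>x. x < v 3 ^ digits_needed (v 3) (v 6) \<Longrightarrow> a' 13 x = 1) \<Longrightarrow> v' 33 = 0 \<Longrightarrow> v' 34 = 0 \<Longrightarrow>
      t' \<le> t + 20 * v 3 * digits_needed (v 3) (v 6) + 3 * v 3 ^ digits_needed (v 3) (v 6) + 20 \<Longrightarrow> Q v' a' t'"
  shows "wp SETUP Q v a t"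
proof -
  let ?q = "v 3" let ?d = "digits_needed ?q (v 6)"
  note d = digits_needed[OF q, where n = "v 6"]
  let ?v = "v(27 := ?q, 28 := 1)"
  let ?w = "Upd 13 (V 9) (N 1)"
  let ?r4 = "wp (33 ::= N 0) (wp (34 ::= N 0) Q)"
  let ?r3 = "wp (FOR 9 (V 27) ?w) ?r4"
  let ?r2 = "wp (31 ::= N 0) (wp (FOR 9 (V 3) (31 ::= V 31 +. V 30)) ?r3)"
  let ?r1 = "wp (30 ::= N 0) (wp (FOR 9 (V 3) (30 ::= V 30 +. V 28)) ?r2)"
  have "wp (Wh (V 6 -. V 27) GROW) ?r1 ?v a (Suc (Suc t))"
  proof (rule wp_Wh_count[where n = "?d - 1" and B = "3 * ?q + 5" and I = "\<lambda>j v' a'. v' 27 = ?q ^ Suc j \<and> v' 28 = Suc j"])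
    fix j t1 and v1 :: vars and a1 :: arrays
    assume j: "j < ?d - 1" and I: "v1 27 = ?q ^ Suc j \<and> v1 28 = Suc j" and f1: "eqx (wv GROW) ?v v1" "eqx (wa GROW) a a1"
    note [simp] = eqxD[OF f1(1)]
    have "?q ^ Suc j < v 6" using d(3)[where d = "Suc j"] j by simp
    then have "ev (V 6 -. V 27) v1 a1 \<noteq> 0" using I by simp
    moreover have "wp (FOR 9 (V 3) (29 ::= V 29 +. V 27)) (wp (27 ::= V 29) (wp (28 ::= V 28 +. N 1)
        (\<lambda>v' a' t'. (v' 27 = ?q ^ Suc (Suc j) \<and> v' 28 = Suc (Suc j)) \<and> t' \<le> t1 + (3 * ?q + 5)))) (v1(29 := 0)) a1 (Suc t1)"
    proof (rule FOR_mult)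
      fix v2 t2
      assume f2: "eqx {9, 29} (v1(29 := 0)) v2" and I2: "v2 29 = (v1(29 := 0)) 29 + (v1(29 := 0)) 3 * (v1(29 := 0)) 27"
        and t2: "t2 \<le> Suc t1 + 3 * (v1(29 := 0)) 3 + 2"
      show "wp (27 ::= V 29) (wp (28 ::= V 28 +. N 1)
        (\<lambda>v' a' t'. (v' 27 = ?q ^ Suc (Suc j) \<and> v' 28 = Suc (Suc j)) \<and> t' \<le> t1 + (3 * ?q + 5))) v2 a1 t2"
        using I I2 t2 eqxD[OF f2, of 28] by simp
    qed simp
    ultimately show "ev (V 6 -. V 27) v1 a1 \<noteq> 0 \<and>
        wp GROW (\<lambda>v' a' t'. (v' 27 = ?q ^ Suc (Suc j) \<and> v' 28 = Suc (Suc j)) \<and> t' \<le> t1 + (3 * ?q + 5)) v1 a1 t1"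
      by (simp add: GROW_def)
  next
    fix v1 :: vars and a1 :: arrays
    assume I: "v1 27 = ?q ^ Suc (?d - 1) \<and> v1 28 = Suc (?d - 1)" and f1: "eqx (wv GROW) ?v v1"
    then show "ev (V 6 -. V 27) v1 a1 = 0" using d(1,2) eqxD[OF f1, of 6] by simp
  next
    fix v1 t1 and a1 :: arrays
    assume I: "v1 27 = ?q ^ Suc (?d - 1) \<and> v1 28 = Suc (?d - 1)" and f1: "eqx (wv GROW) ?v v1" "eqx (wa GROW) a a1"
      and t1: "t1 \<le> Suc (Suc t) + (?d - 1) * (3 * ?q + 5 + 1) + 1"
    have I': "v1 27 = ?q ^ ?d" "v1 28 = ?d" using I d(1) by simp_all
    have v3: "v1 3 = ?q" "v1 6 = v 6" using eqxD[OF f1(1), of 3] eqxD[OF f1(1), of 6] by simp_all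
    have "wp (FOR 9 (V 3) (30 ::= V 30 +. V 28)) ?r2 (v1(30 := 0)) a1 (Suc t1)"
    proof (rule FOR_mult)
      fix v2 t2
      assume f2: "eqx {9, 30} (v1(30 := 0)) v2" and I2: "v2 30 = (v1(30 := 0)) 30 + (v1(30 := 0)) 3 * (v1(30 := 0)) 28"
        and t2: "t2 \<le> Suc t1 + 3 * (v1(30 := 0)) 3 + 2"
      have v32: "v2 3 = ?q" "v2 27 = ?q ^ ?d" using eqxD[OF f2, of 3] eqxD[OF f2, of 27] v3 I' by simp_all
      have "wp (FOR 9 (V 3) (31 ::= V 31 +. V 30)) ?r3 (v2(31 := 0)) a1 (Suc t2)"
      proof (rule FOR_mult)
        fix v3' t3
        assume f3: "eqx {9, 31} (v2(31 := 0)) v3'" and I3: "v3' 31 = (v2(31 := 0)) 31 + (v2(31 := 0)) 3 * (v2(31 := 0)) 30"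
          and t3: "t3 \<le> Suc t2 + 3 * (v2(31 := 0)) 3 + 2"
        have v27: "v3' 27 = ?q ^ ?d" "v3' 31 = ?q * ?q * ?d" using eqxD[OF f3, of 27] v32 I2 I3 v3 I' by simp_all
        show "?r3 v3' a1 t3"
        proof (rule wp_FOR[where n = "?q ^ ?d" and B = 1 and I = "\<lambda>j v' a'. \<forall>x<j. a' 13 x = 1"])
          fix v4 a4 t4
          assume I4: "\<forall>x<?q ^ ?d. a4 13 x = 1" and f4: "eqx (insert 9 (wv ?w)) v3' v4" "eqx (wa ?w) a1 a4"
            and t4: "t4 \<le> t3 + ?q ^ ?d * (1 + 2) + 2"
          have "Q (v4(33 := 0, 34 := 0)) a4 (Suc (Suc t4))"
          proof (rule post)
            show "eqx {9, 27, 28, 29, 30, 31, 33, 34} v (v4(33 := 0, 34 := 0))" "eqx {13} a a4"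
              using f1 f2 f3 f4 by (auto simp: eqx_def)
            obtain e where e: "?d = Suc e" using d(1) by (cases ?d) auto
            have "t1 \<le> t + (e * (3 * ?q + 6) + 3)" using t1 e by (simp add: algebra_simps)
            moreover have "t2 \<le> t1 + 3 * ?q + 3" "t3 \<le> t2 + 3 * ?q + 3" using t2 t3 v3 v32 by simp_all
            moreover have "Suc (Suc t4) \<le> t3 + 3 * ?q ^ ?d + 4" using t4 by (simp add: mult.commute)
            ultimately have "Suc (Suc t4) \<le> t + (e * (3 * ?q + 6) + 6 * ?q + 3 * ?q ^ ?d + 13)"
              by linarith
            also have "\<dots> \<le> t + (20 * ?q * ?d + 3 * ?q ^ ?d + 20)"
            proof -
              have "e * 1 \<le> e * ?q" using q by (intro mult_le_mono2) simp
              moreover have "e * (3 * ?q + 6) = 3 * (e * ?q) + 6 * e" "20 * ?q * ?d = 20 * (e * ?q) + 20 * ?q"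
                unfolding e by (simp_all add: algebra_simps)
              ultimately show ?thesis by linarith
            qed
            finally show "Suc (Suc t4) \<le> t + 20 * ?q * ?d + 3 * ?q ^ ?d + 20" by (simp only: add.assoc)
            show "(v4(33 := 0, 34 := 0)) 27 = ?q ^ ?d" "(v4(33 := 0, 34 := 0)) 31 = ?q * ?q * ?d"
              using eqxD[OF f4(1), of 27] eqxD[OF f4(1), of 31] v27 by simp_all
          qed (use I4 in auto)
          then show "?r4 v4 a4 t4" by simp
        next
          fix j and v4 :: vars and a4 :: arrays
          assume f4: "eqx (insert 9 (wv ?w)) v3' v4"
          show "ev (V 27) v4 a4 = ?q ^ ?d" using eqxD[OF f4, of 27] v27 by simp
        qed (auto simp: less_Suc_eq)
      qed simp
      then show "?r2 v2 a1 t2" by simp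
    qed simp
    then show "?r1 v1 a1 t1" by simp
  qed simp
  then show ?thesis by (simp add: SETUP_def)
qed

section \<open>The sum over the hash functions\<close>

definition ROUND :: com where
  "ROUND = HASH ;; DOUBLE ;; CNT ;; 33 ::= V 33 +. V 8 ;; 34 ::= V 34 +. V 35"

definition OUTER :: com where
  "OUTER = FOR 32 (V 31) ROUND"

lemma ROUND_frame [simp]:
  "wv ROUND = {8, 9, 10, 11, 12, 13, 14, 15, 16, 18, 19, 21, 22, 23, 24, 25, 26, 33, 34}"
  "wa ROUND = {5, 6, 7, 8, 10, 11, 13, 17}"
  by (auto simp: ROUND_def)

lemma OUTER_frame [simp]:
  "wv OUTER = {8, 9, 10, 11, 12, 13, 14, 15, 16, 18, 19, 21, 22, 23, 24, 25, 26, 32, 33, 34}"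
  "wa OUTER = {5, 6, 7, 8, 10, 11, 13, 17}"
  by (auto simp: OUTER_def)

text \<open>What is known about the graph before a hash function has been put into array 5.\<close>

definition edge_tables :: "vars \<Rightarrow> arrays \<Rightarrow> (nat \<times> nat) list \<Rightarrow> bool" where
  "edge_tables v a es \<longleftrightarrow> es = map (\<lambda>e. (a 3 e, a 4 e)) [0..<v 7] \<and> distinct es \<and>
     (\<forall>e<v 7. a 3 e < v 6 \<and> a 4 e < v 6)"

definition round_cost :: "nat \<Rightarrow> nat \<Rightarrow> nat \<Rightarrow> nat \<Rightarrow> nat \<Rightarrow> nat \<Rightarrow> nat \<Rightarrow> nat" where
  "round_cost q d F K k n m = 107 * q * q ^ d + F * (node_cost K k n m + 2) + 8"

text \<open>
  The next function is chosen greedily for the potential \<open>\<Sum>x. 2 ^ zero_count hs x\<close>, which a random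
  linear function multiplies by \<open>1 + 1/q\<close> on average. So no difference \<open>x\<close> is hashed to \<open>0\<close> by many
  functions of the list.
\<close>

definition greedy_state :: "nat \<Rightarrow> nat \<Rightarrow> (nat \<Rightarrow> nat) list \<Rightarrow> (nat \<Rightarrow> nat) \<Rightarrow> bool" where
  "greedy_state q d hs w \<longleftrightarrow> (\<forall>h\<in>set hs. \<exists>c. h = lin q d c) \<and>
     (\<forall>x. 1 \<le> x \<longrightarrow> x < q ^ d \<longrightarrow> w x = 2 ^ zero_count hs x) \<and>
     q ^ length hs * (\<Sum>x\<in>{1..<q ^ d}. w x) \<le> (q + 1) ^ length hs * q ^ d"

lemma greedy_step:
  assumes gs: "greedy_state q d hs w" and w': "\<And>x. 1 \<le> x \<Longrightarrow> x < q ^ d \<Longrightarrow> w' x = (if lin q d c x = 0 then 2 * w x else w x)"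
    and zw: "q * zero_weight q d w {1..<q ^ d} c \<le> (\<Sum>x\<in>{1..<q ^ d}. w x)"
  shows "greedy_state q d (lin q d c # hs) w'"
proof -
  have "(\<Sum>x\<in>{1..<q ^ d}. w' x) = (\<Sum>x\<in>{1..<q ^ d}. w x + (if lin q d c x = 0 then w x else 0))"
    by (rule sum.cong) (use w' in auto)
  then have "(\<Sum>x\<in>{1..<q ^ d}. w' x) = (\<Sum>x\<in>{1..<q ^ d}. w x) + zero_weight q d w {1..<q ^ d} c"
    by (simp add: sum.distrib zero_weight_def)
  then have "q * (\<Sum>x\<in>{1..<q ^ d}. w' x) \<le> (q + 1) * (\<Sum>x\<in>{1..<q ^ d}. w x)"
    using zw by (simp add: distrib_left)
  then have "q ^ length hs * (q * (\<Sum>x\<in>{1..<q ^ d}. w' x)) \<le> q ^ length hs * ((q + 1) * (\<Sum>x\<in>{1..<q ^ d}. w x))"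
    by (rule mult_left_mono) simp
  also have "\<dots> = (q + 1) * (q ^ length hs * (\<Sum>x\<in>{1..<q ^ d}. w x))" by (rule mult.left_commute)
  also have "\<dots> \<le> (q + 1) * ((q + 1) ^ length hs * q ^ d)"
    using gs by (intro mult_left_mono) (auto simp: greedy_state_def)
  finally have "q ^ length (lin q d c # hs) * (\<Sum>x\<in>{1..<q ^ d}. w' x) \<le> (q + 1) ^ length (lin q d c # hs) * q ^ d"
    by (simp add: algebra_simps)
  then show ?thesis using gs w' unfolding greedy_state_def by (auto simp: zero_count_def)
qed

text \<open>The list \<open>hs\<close> exists only in the proof. The machine keeps the current
  function and the weights, and the weights encode the zero counts of all functions chosen so
  far.\<close>

lemma OUTER_spec:
  assumes q: "prime (v 3)" and SD: "v 27 = v 3 ^ d" "v 6 \<le> v 3 ^ d"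
    and st: "sieve_tables v a" and et: "edge_tables v a es"
    and tb: "\<And>i y. i < v 5 \<Longrightarrow> y < v 3 \<Longrightarrow> a 2 (i * v 3 + y) = tb i y \<and> tb i y < v 4"
    and w: "\<And>x. x < v 3 ^ d \<Longrightarrow> a 13 x = 1" and z: "v 33 = 0" "v 34 = 0"
    and post: "\<And>v' a' t' hs. length hs = v 31 \<Longrightarrow> greedy_state (v 3) d hs (a' 13) \<Longrightarrow>
      v' 33 = (\<Sum>h\<leftarrow>hs. \<Sum>i<v 5. colourful (set es) (v 6) (v 2) (\<lambda>u. tb i (h u))) \<Longrightarrow> v' 34 = v 31 * v 35 \<Longrightarrow>
      t' \<le> t + v 31 * (round_cost (v 3) d (v 5) (v 4) (v 2) (v 6) (v 7) + 2) + 2 \<Longrightarrow> Q v' a' t'"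
  shows "wp OUTER Q v a t"
proof -
  let ?q = "v 3"
  let ?num = "\<lambda>hs. \<Sum>h\<leftarrow>hs. \<Sum>i<v 5. colourful (set es) (v 6) (v 2) (\<lambda>u. tb i (h u))"
  let ?I = "\<lambda>j v' a'. sieve_tables v' a' \<and>
    (\<exists>hs. length hs = j \<and> greedy_state ?q d hs (a' 13) \<and> v' 33 = ?num hs) \<and> v' 34 = j * v 35"
  have q1: "1 \<le> ?q" using q prime_ge_1_nat by blast
  show ?thesis
    unfolding OUTER_def
  proof (rule wp_FOR[where n = "v 31" and B = "round_cost ?q d (v 5) (v 4) (v 2) (v 6) (v 7)" and I = ?I])
    have "(\<Sum>x\<in>{1..<?q ^ d}. a 13 x) = (\<Sum>x\<in>{1..<?q ^ d}. 1)" by (rule sum.cong) (use w in auto)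
    then have "greedy_state ?q d [] (a 13)" using w by (simp add: greedy_state_def zero_count_def)
    then show "?I 0 (v(32 := 0)) a" using st z by (auto simp: sieve_tables_def)
  next
    fix j t1 and v1 :: vars and a1 :: arrays
    assume I: "?I j v1 a1" and f1: "eqx (insert 32 (wv ROUND)) v v1" "eqx (wa ROUND) a a1"
    note [simp] = eqxD[OF f1(1)] eqxD[OF f1(2)]
    obtain hs where hs: "length hs = j" "greedy_state ?q d hs (a1 13)" "v1 33 = ?num hs" using I by blast
    let ?P = "\<lambda>v' a' t'. ?I (Suc j) (v'(32 := Suc j)) a' \<and> t' \<le> t1 + round_cost ?q d (v 5) (v 4) (v 2) (v 6) (v 7)"
    show "wp ROUND ?P v1 a1 t1"
      unfolding ROUND_def wp_Seq
    proof (rule HASH_spec[where d = d])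
      fix v2 a2 t2 c
      assume f2: "eqx {9, 10, 14, 21, 22, 23, 24, 25, 26} v1 v2" "eqx {5} a1 a2"
        and h: "\<And>x. x < v1 3 ^ d \<Longrightarrow> a2 5 x = lin (v1 3) d c x"
        and zw: "v1 3 * zero_weight (v1 3) d (a1 13) {1..<v1 3 ^ d} c \<le> (\<Sum>x\<in>{1..<v1 3 ^ d}. a1 13 x)"
        and t2: "t2 \<le> t1 + 103 * v1 3 * v1 3 ^ d + 2"
      note [simp] = eqxD[OF f2(1)] eqxD[OF f2(2)]
      show "wp DOUBLE (wp CNT (wp (33 ::= V 33 +. V 8) (wp (34 ::= V 34 +. V 35) ?P))) v2 a2 t2"
      proof (rule DOUBLE_spec)
        show "1 \<le> v2 27" using SD q1 by simp
        fix v3' a3 t3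
        assume f3: "eqx {9} v2 v3'" "eqx {13} a2 a3"
          and w3: "\<And>x. 1 \<le> x \<Longrightarrow> x < v2 27 \<Longrightarrow> a3 13 x = (if a2 5 x = 0 then 2 * a2 13 x else a2 13 x)"
          and t3: "t3 \<le> t2 + 4 * v2 27"
        note [simp] = eqxD[OF f3(1)] eqxD[OF f3(2)]
        have gs: "greedy_state ?q d (lin ?q d c # hs) (a3 13)"
          by (rule greedy_step[OF hs(2)]) (use w3 h zw SD in auto)
        show "wp CNT (wp (33 ::= V 33 +. V 8) (wp (34 ::= V 34 +. V 35) ?P)) v3' a3 t3"
        proof (rule CNT_spec[where es = es and tb = tb])
          show "sieve_tables v3' a3" using I by (simp add: sieve_tables_def)
          show "graph_tables v3' a3 es"
            using et h SD q1 unfolding edge_tables_def graph_tables_def by (auto simp: lin_less)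
          show "a3 2 (i * v3' 3 + y) = tb i y \<and> tb i y < v3' 4" if "i < v3' 5" "y < v3' 3" for i y
            using tb[of i y] that by simp
          fix v4 a4 t4
          assume f4: "eqx {8, 9, 10, 11, 12, 13, 14, 15, 16, 18, 19} v3' v4" "eqx {6, 7, 8, 10, 11, 17} a3 a4"
            and z4: "\<And>x. a4 7 x = 0" and n4: "v4 8 = (\<Sum>i<v3' 5. colourful (set es) (v3' 6) (v3' 2) (\<lambda>u. tb i (a3 5 u)))"
            and t4: "t4 \<le> t3 + v3' 5 * (node_cost (v3' 4) (v3' 2) (v3' 6) (v3' 7) + 2) + 4"
          note [simp] = eqxD[OF f4(1)] eqxD[OF f4(2)]
          have "v4 8 = (\<Sum>i<v 5. colourful (set es) (v 6) (v 2) (\<lambda>u. tb i (lin ?q d c u)))"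
            unfolding n4 using h SD by (auto intro!: sum.cong colourful_cong)
          then have n: "v4 33 + v4 8 = ?num (lin ?q d c # hs)" using hs(3) by simp
          have gs': "greedy_state ?q d (lin ?q d c # hs) (a4 13)" using gs by simp
          have sv: "sieve_tables (v4(33 := v4 33 + v4 8, 34 := v4 34 + v4 35, 32 := Suc j)) a4"
            using I z4 by (simp add: sieve_tables_def)
          have t: "t4 + 2 \<le> t1 + round_cost ?q d (v 5) (v 4) (v 2) (v 6) (v 7)"
          proof -
            have "t4 + 2 \<le> t1 + (103 * ?q * ?q ^ d + 2) + 4 * ?q ^ d + (v 5 * (node_cost (v 4) (v 2) (v 6) (v 7) + 2) + 4) + 2"
              using t2 t3 t4 SD by simp
            moreover have "4 * ?q ^ d \<le> 4 * ?q * ?q ^ d" using q1 by simp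
            ultimately show ?thesis unfolding round_cost_def by linarith
          qed
          have "?I (Suc j) (v4(33 := v4 33 + v4 8, 34 := v4 34 + v4 35, 32 := Suc j)) a4"
          proof (intro conjI exI[of _ "lin ?q d c # hs"])
            show "(v4(33 := v4 33 + v4 8, 34 := v4 34 + v4 35, 32 := Suc j)) 33 = ?num (lin ?q d c # hs)"
              using n by simp
            show "(v4(33 := v4 33 + v4 8, 34 := v4 34 + v4 35, 32 := Suc j)) 34 = Suc j * v 35" using I by simp
          qed (use gs' hs sv in auto)
          then show "wp (33 ::= V 33 +. V 8) (wp (34 ::= V 34 +. V 35) ?P) v4 a4 t4"
            using t I by simp
        qed
      qed
    qed (use q SD in auto)
  next
    fix j and v1 :: vars and a1 :: arrays
    assume f1: "eqx (insert 32 (wv ROUND)) v v1"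
    show "ev (V 31) v1 a1 = v 31" using eqxD[OF f1, of 31] by simp
  next
    fix v1 a1 t1
    assume I: "?I (v 31) v1 a1" and t1: "t1 \<le> t + v 31 * (round_cost ?q d (v 5) (v 4) (v 2) (v 6) (v 7) + 2) + 2"
    then obtain hs where "length hs = v 31" "greedy_state ?q d hs (a1 13)" "v1 33 = ?num hs" by blast
    then show "Q v1 a1 t1" using I t1 by (intro post[of hs]) auto
  qed simp
qed

subsection \<open>Reading the graph\<close>

text \<open>Labels in array 14 start at 1 because 0 marks a vertex not yet seen; the edge tables
  store them decreased by one.\<close>

definition LABEL :: "nat \<Rightarrow> com" where
  "LABEL x = Ite (Ar 14 (V x)) Skip (6 ::= V 6 +. N 1 ;; Upd 14 (V x) (V 6))"

definition READ_EDGE :: "bool \<Rightarrow> com" where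
  "READ_EDGE und = Inp 10 (V 9 +. V 9) ;; Inp 11 (V 9 +. V 9 +. N 1) ;; LABEL 10 ;; LABEL 11 ;;
     Upd 3 (V 9) (Ar 14 (V 10) -. N 1) ;; Upd 4 (V 9) (Ar 14 (V 11) -. N 1) ;;
     (if und then Upd 3 (V 1 +. V 9) (Ar 14 (V 11) -. N 1) ;; Upd 4 (V 1 +. V 9) (Ar 14 (V 10) -. N 1)
      else Skip)"

text \<open>Only ends of edges get a number, in order of appearance, so all later costs depend on
  |E| and not on isolated vertices. An undirected edge is also stored reversed, |E| places further
  on.\<close>

definition READ :: "bool \<Rightarrow> com" where
  "READ und = 6 ::= N 0 ;; FOR 9 (V 1) (READ_EDGE und) ;; 7 ::= (if und then V 1 +. V 1 else V 1)"

lemma LABEL_frame [simp]: "wv (LABEL x) = {6}" "wa (LABEL x) = {14}"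
  by (auto simp: LABEL_def)

lemma READ_EDGE_frame [simp]: "wv (READ_EDGE und) = {6, 10, 11}" "wa (READ_EDGE und) = {3, 4, 14}"
  by (auto simp: READ_EDGE_def)

lemma READ_frame [simp]: "wv (READ und) = {6, 7, 9, 10, 11}" "wa (READ und) = {3, 4, 14}"
  by (auto simp: READ_def)

definition labelling :: "(nat \<Rightarrow> nat) \<Rightarrow> nat set \<Rightarrow> nat \<Rightarrow> bool" where
  "labelling lab D n \<longleftrightarrow> finite D \<and> (\<forall>x. lab x \<noteq> 0 \<longleftrightarrow> x \<in> D) \<and> inj_on lab D \<and> (\<forall>x. lab x \<le> n) \<and> n = card D"

lemma labelling_extend:
  assumes "labelling lab D n" "x \<notin> D"
  shows "labelling (lab(x := Suc n)) (insert x D) (Suc n)"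
proof -
  have D: "finite D" "inj_on lab D" "n = card D" and lab: "\<And>y. lab y \<noteq> 0 \<longleftrightarrow> y \<in> D" "\<And>y. lab y \<le> n"
    using assms(1) unfolding labelling_def by blast+
  have ne: "lab y \<noteq> Suc n" for y using lab(2)[of y] by linarith
  have "inj_on (lab(x := Suc n)) (insert x D)"
  proof (rule inj_onI)
    fix y z assume "y \<in> insert x D" "z \<in> insert x D" "(lab(x := Suc n)) y = (lab(x := Suc n)) z"
    then show "y = z" using D(2) ne[of y] ne[of z, symmetric] by (auto split: if_splits dest: inj_onD)
  qed
  moreover have "(lab(x := Suc n)) y \<noteq> 0 \<longleftrightarrow> y \<in> insert x D" for y using lab(1)[of y] by simp
  moreover have "(lab(x := Suc n)) y \<le> Suc n" for y using lab(2)[of y] by simp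
  moreover have "Suc n = card (insert x D)" using D assms(2) by simp
  ultimately show ?thesis using D(1) unfolding labelling_def by blast
qed

lemma LABEL_spec:
  assumes x: "x \<noteq> 6" and lab: "labelling (a 14) D (v 6)"
    and post: "\<And>v' a' t'. eqx {6} v v' \<Longrightarrow> eqx {14} a a' \<Longrightarrow> labelling (a' 14) (insert (v x) D) (v' 6) \<Longrightarrow>
      (\<And>y. y \<in> D \<Longrightarrow> a' 14 y = a 14 y) \<Longrightarrow> t' \<le> t + 3 \<Longrightarrow> Q v' a' t'"
  shows "wp (LABEL x) Q v a t"
proof (cases "v x \<in> D")
  case True
  then have "a 14 (v x) \<noteq> 0" using lab by (simp add: labelling_def)
  moreover have "Q v a (Suc t)" by (rule post) (use lab True in \<open>auto simp: insert_absorb\<close>)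
  ultimately show ?thesis by (simp add: LABEL_def)
next
  case False
  then have "a 14 (v x) = 0" using lab unfolding labelling_def by blast
  moreover have "Q (v(6 := Suc (v 6))) (a(14 := (a 14)(v x := Suc (v 6)))) (t + 3)"
    by (rule post) (use labelling_extend[OF lab False] False in \<open>auto simp: eqx_def\<close>)
  ultimately show ?thesis using x by (simp add: LABEL_def eval_nat_numeral)
qed

definition ends :: "(nat \<times> nat) list \<Rightarrow> nat set" where
  "ends es = fst ` set es \<union> snd ` set es"

definition both_ways :: "bool \<Rightarrow> (nat \<times> nat) list \<Rightarrow> (nat \<times> nat) list" where
  "both_ways und es = es @ (if und then map (\<lambda>(x, y). (y, x)) es else [])"

lemma READ_spec:
  assumes m: "v 1 = length es" and inp: "a 1 0 = 2 * length es"
    "\<And>i. i < length es \<Longrightarrow> a 0 (2 * i) = fst (es ! i) \<and> a 0 (2 * i + 1) = snd (es ! i)"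
    and lab: "\<And>x. a 14 x = 0"
    and post: "\<And>v' a' t' \<phi>. eqx {6, 7, 9, 10, 11} v v' \<Longrightarrow> eqx {3, 4, 14} a a' \<Longrightarrow>
      inj_on \<phi> (ends es) \<Longrightarrow> v' 6 = card (ends es) \<Longrightarrow> \<phi> ` ends es \<subseteq> {..<v' 6} \<Longrightarrow>
      v' 7 = length (both_ways und es) \<Longrightarrow>
      map (\<lambda>e. (a' 3 e, a' 4 e)) [0..<v' 7] = map (\<lambda>(x, y). (\<phi> x, \<phi> y)) (both_ways und es) \<Longrightarrow>
      t' \<le> t + 14 * length es + 4 \<Longrightarrow> Q v' a' t'"
  shows "wp (READ und) Q v a t"
proof -
  let ?m = "length es"
  let ?last = "7 ::= (if und then V 1 +. V 1 else V 1)"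
  let ?D = "\<lambda>j. ends (take j es)"
  let ?I = "\<lambda>j v' a'. labelling (a' 14) (?D j) (v' 6) \<and>
     (\<forall>i<j. a' 3 i = a' 14 (fst (es ! i)) - 1 \<and> a' 4 i = a' 14 (snd (es ! i)) - 1 \<and>
       (und \<longrightarrow> a' 3 (?m + i) = a' 14 (snd (es ! i)) - 1 \<and> a' 4 (?m + i) = a' 14 (fst (es ! i)) - 1))"
  have Dj: "?D (Suc j) = insert (snd (es ! j)) (insert (fst (es ! j)) (?D j))" if "j < ?m" for j
    using that by (auto simp: ends_def take_Suc_conv_app_nth)
  have inD: "fst (es ! i) \<in> ?D j" "snd (es ! i) \<in> ?D j" if "i < j" "j \<le> ?m" for i j
  proof -
    have "es ! i \<in> set (take j es)" using that by (auto simp: in_set_conv_nth intro!: exI[of _ i])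
    then show "fst (es ! i) \<in> ?D j" "snd (es ! i) \<in> ?D j" by (auto simp: ends_def)
  qed
  have "wp (FOR 9 (V 1) (READ_EDGE und)) (wp ?last Q) (v(6 := 0)) a (Suc t)"
  proof (rule wp_FOR[where n = ?m and B = 12 and I = ?I])
    show "?I 0 (v(6 := 0, 9 := 0)) a" using lab by (simp add: labelling_def ends_def)
  next
    fix j and t1 :: nat and v1 :: vars and a1 :: arrays
    assume j: "j < ?m" and I: "?I j v1 a1" and v9: "v1 9 = j"
      and f1: "eqx (insert 9 (wv (READ_EDGE und))) (v(6 := 0)) v1" "eqx (wa (READ_EDGE und)) a a1"
    let ?x = "fst (es ! j)" and ?y = "snd (es ! j)"
    define P where "P = (\<lambda>(v' :: vars) (a' :: arrays) (t' :: nat). ?I (Suc j) (v'(9 := Suc j)) a' \<and> t' \<le> t1 + 12)"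
    let ?rest = "wp (Upd 3 (V 9) (Ar 14 (V 10) -. N 1)) (wp (Upd 4 (V 9) (Ar 14 (V 11) -. N 1)) (wp
     (if und then Upd 3 (V 1 +. V 9) (Ar 14 (V 11) -. N 1) ;; Upd 4 (V 1 +. V 9) (Ar 14 (V 10) -. N 1)
      else Skip) P))"
    have a01: "a1 0 = a 0" "a1 1 = a 1" "v1 1 = ?m" using eqxD[OF f1(2), of 0] eqxD[OF f1(2), of 1] eqxD[OF f1(1), of 1] m by simp_all
    have "wp (LABEL 10) (wp (LABEL 11) ?rest) (v1(10 := ?x, 11 := ?y)) a1 (Suc (Suc t1))"
    proof (rule LABEL_spec[where D = "?D j"])
      fix v2 a2 t2
      assume f2: "eqx {6} (v1(10 := ?x, 11 := ?y)) v2" "eqx {14} a1 a2"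
        and l2: "labelling (a2 14) (insert ((v1(10 := ?x, 11 := ?y)) 10) (?D j)) (v2 6)"
        and s2: "\<And>z. z \<in> ?D j \<Longrightarrow> a2 14 z = a1 14 z" and t2: "t2 \<le> Suc (Suc t1) + 3"
      show "wp (LABEL 11) ?rest v2 a2 t2"
      proof (rule LABEL_spec[where D = "insert ?x (?D j)"])
        show "labelling (a2 14) (insert ?x (?D j)) (v2 6)" using l2 by simp
        fix v3 a3 t3
        assume f3: "eqx {6} v2 v3" "eqx {14} a2 a3"
          and l3: "labelling (a3 14) (insert (v2 11) (insert ?x (?D j))) (v3 6)"
          and s3: "\<And>z. z \<in> insert ?x (?D j) \<Longrightarrow> a3 14 z = a2 14 z" and t3: "t3 \<le> t2 + 3"
        have v3: "v3 9 = j" "v3 1 = ?m" "v3 10 = ?x" "v3 11 = ?y" "v2 11 = ?y"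
          using eqxD[OF f3(1), of 9] eqxD[OF f2(1), of 9] eqxD[OF f3(1), of 1] eqxD[OF f2(1), of 1]
            eqxD[OF f3(1), of 10] eqxD[OF f2(1), of 10] eqxD[OF f3(1), of 11] eqxD[OF f2(1), of 11] v9 a01 by simp_all
        have l3': "labelling (a3 14) (?D (Suc j)) (v3 6)" using l3 v3 Dj[OF j] by simp
        have a34: "a3 3 = a1 3" "a3 4 = a1 4"
          using eqxD[OF f3(2), of 3] eqxD[OF f2(2), of 3] eqxD[OF f3(2), of 4] eqxD[OF f2(2), of 4] by simp_all
        have s: "a3 14 (fst (es ! i)) = a1 14 (fst (es ! i))" "a3 14 (snd (es ! i)) = a1 14 (snd (es ! i))" if "i < j" for i
          using s2 s3 inD[OF that] j by simp_all
        let ?a = "a3(3 := (a3 3)(j := a3 14 ?x - 1), 4 := (a3 4)(j := a3 14 ?y - 1))"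
        let ?b = "if und then ?a(3 := (?a 3)(?m + j := a3 14 ?y - 1), 4 := (?a 4)(?m + j := a3 14 ?x - 1)) else ?a"
        have "?I (Suc j) (v3(9 := Suc j)) ?b"
        proof (intro conjI allI impI)
          show "labelling (?b 14) (?D (Suc j)) ((v3(9 := Suc j)) 6)" using l3' by simp
          fix i assume i: "i < Suc j"
          have im: "i \<noteq> ?m + j" "?m + i \<noteq> j" using i j by auto
          show "?b 3 i = ?b 14 (fst (es ! i)) - 1" "?b 4 i = ?b 14 (snd (es ! i)) - 1"
            using i im I s[of i] a34 by (auto simp: less_Suc_eq)
          assume und
          then show "?b 3 (?m + i) = ?b 14 (snd (es ! i)) - 1" "?b 4 (?m + i) = ?b 14 (fst (es ! i)) - 1"
            using i im I s[of i] a34 by (auto simp: less_Suc_eq)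
        qed
        then have P: "P v3 ?b t'" if "t' \<le> t1 + 12" for t' using that unfolding P_def by blast
        show "?rest v3 a3 t3" using P[of "t3 + 2"] P[of "t3 + 4"] t2 t3 v3 by (cases und) (simp_all add: eval_nat_numeral)
      qed simp
    qed (use I in \<open>auto simp: labelling_def\<close>)
    then have "wp (READ_EDGE und) P v1 a1 t1"
      using inp j v9 a01 by (simp add: READ_EDGE_def mult_2)
    then show "wp (READ_EDGE und) (\<lambda>v' a' t'. ?I (Suc j) (v'(9 := Suc j)) a' \<and> t' \<le> t1 + 12) v1 a1 t1"
      unfolding P_def .
  next
    fix j and v1 :: vars and a1 :: arrays
    assume f1: "eqx (insert 9 (wv (READ_EDGE und))) (v(6 := 0)) v1"
    show "ev (V 1) v1 a1 = ?m" using eqxD[OF f1, of 1] m by simp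
  next
    fix v1 a1 t1
    assume I: "?I ?m v1 a1" and f1: "eqx (insert 9 (wv (READ_EDGE und))) (v(6 := 0)) v1" "eqx (wa (READ_EDGE und)) a a1"
      and t1: "t1 \<le> Suc t + ?m * (12 + 2) + 2"
    have l: "labelling (a1 14) (ends es) (v1 6)" using I by simp
    let ?\<phi> = "\<lambda>x. a1 14 x - 1"
    let ?n = "if und then ?m + ?m else ?m"
    have v1': "v1 1 = ?m" using eqxD[OF f1(1), of 1] m by simp
    have "Q (v1(7 := ?n)) a1 (Suc t1)"
    proof (rule post[where \<phi> = ?\<phi>])
      show "eqx {6, 7, 9, 10, 11} v (v1(7 := ?n))" "eqx {3, 4, 14} a a1" using f1 by (auto simp: eqx_def)
      have pos: "0 < a1 14 x" if "x \<in> ends es" for x using l that by (auto simp: labelling_def)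
      show "inj_on ?\<phi> (ends es)"
      proof (rule inj_onI)
        fix x y assume xy: "x \<in> ends es" "y \<in> ends es" "?\<phi> x = ?\<phi> y"
        then have "a1 14 x = a1 14 y" using pos[of x] pos[of y] by linarith
        then show "x = y" using l xy by (auto simp: labelling_def dest: inj_onD)
      qed
      show "(v1(7 := ?n)) 6 = card (ends es)" using l by (simp add: labelling_def)
      show "?\<phi> ` ends es \<subseteq> {..<(v1(7 := ?n)) 6}"
      proof
        fix z assume "z \<in> ?\<phi> ` ends es"
        then obtain x where x: "x \<in> ends es" "z = ?\<phi> x" by blast
        have "a1 14 x \<le> v1 6" using l by (auto simp: labelling_def)
        then show "z \<in> {..<(v1(7 := ?n)) 6}" using pos[OF x(1)] x(2) by simp
      qed
      show "(v1(7 := ?n)) 7 = length (both_ways und es)" by (simp add: both_ways_def)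
      show "map (\<lambda>e. (a1 3 e, a1 4 e)) [0..<(v1(7 := ?n)) 7] = map (\<lambda>(x, y). (?\<phi> x, ?\<phi> y)) (both_ways und es)"
      proof (rule nth_equalityI)
        fix e assume "e < length (map (\<lambda>e. (a1 3 e, a1 4 e)) [0..<(v1(7 := ?n)) 7])"
        then have e: "e < ?n" by simp
        show "map (\<lambda>e. (a1 3 e, a1 4 e)) [0..<(v1(7 := ?n)) 7] ! e = map (\<lambda>(x, y). (?\<phi> x, ?\<phi> y)) (both_ways und es) ! e"
        proof (cases "e < ?m")
          case True
          then show ?thesis using I e by (simp add: both_ways_def nth_append split_def)
        next
          case False
          then have u: "und" "e - ?m < ?m" using e by (auto split: if_splits)
          then have "a1 3 (?m + (e - ?m)) = a1 14 (snd (es ! (e - ?m))) - 1"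
            "a1 4 (?m + (e - ?m)) = a1 14 (fst (es ! (e - ?m))) - 1" using I by blast+
          then show ?thesis using e u False by (simp add: both_ways_def nth_append split_def)
        qed
      qed (simp add: both_ways_def)
      show "Suc t1 \<le> t + 14 * ?m + 4" using t1 by simp
    qed
    then show "wp ?last Q v1 a1 t1" using v1' by (cases und) simp_all
  qed simp
  then show ?thesis by (simp add: READ_def)
qed

subsection \<open>Choosing the colours\<close>

text \<open>Computes L = \<open>digits_needed 2 k\<close> in \<open>V 36\<close> and 16^L in
  \<open>V 37\<close>, the latter by four doublings per turn; \<open>V 38\<close> is 2^L.\<close>

definition LOG :: com where
  "LOG = 36 ::= N 1 ;; 37 ::= N 16 ;; 38 ::= N 2 ;; Wh (V 2 -. V 38)
     (36 ::= V 36 +. N 1 ;; 38 ::= V 38 +. V 38 ;; 37 ::= V 37 +. V 37 ;; 37 ::= V 37 +. V 37 ;;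
      37 ::= V 37 +. V 37 ;; 37 ::= V 37 +. V 37)"

text \<open>A remainder without division: a counter that returns to 0 at \<open>V 9 +. N 2\<close>
  is advanced q times.\<close>

definition DIVIDES :: com where
  "DIVIDES = 39 ::= N 0 ;; FOR 10 (V 3) (39 ::= V 39 +. N 1 ;; Ite (V 9 +. N 2 -. V 39) Skip (39 ::= N 0))"

definition IS_PRIME :: com where
  "IS_PRIME = 40 ::= N 0 ;; FOR 9 (V 3 -. N 2) (DIVIDES ;; Ite (V 39) Skip (40 ::= N 1)) ;;
     Ite (V 40) (3 ::= V 3 +. N 1) Skip"

definition PRIME :: com where
  "PRIME = 3 ::= V 37 ;; 40 ::= N 1 ;; Wh (V 40) IS_PRIME"

text \<open>Seven doublings produce 128 k; then D = \<open>V 41\<close> is the number of steps of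
  length L needed to reach it.\<close>

definition DEGREE :: com where
  "DEGREE = 43 ::= V 2 +. V 2 ;; 43 ::= V 43 +. V 43 ;; 43 ::= V 43 +. V 43 ;; 43 ::= V 43 +. V 43 ;;
     43 ::= V 43 +. V 43 ;; 43 ::= V 43 +. V 43 ;; 43 ::= V 43 +. V 43 ;; 41 ::= N 0 ;; 42 ::= N 0 ;;
     Wh (V 43 -. V 42) (42 ::= V 42 +. V 36 ;; 41 ::= V 41 +. N 1)"

lemma LOG_frame [simp]: "wv LOG = {36, 37, 38}" "wa LOG = {}"
  by (auto simp: LOG_def)

lemma DIVIDES_frame [simp]: "wv DIVIDES = {10, 39}" "wa DIVIDES = {}"
  by (auto simp: DIVIDES_def)

lemma IS_PRIME_frame [simp]: "wv IS_PRIME = {3, 9, 10, 39, 40}" "wa IS_PRIME = {}"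
  by (auto simp: IS_PRIME_def)

lemma PRIME_frame [simp]: "wv PRIME = {3, 9, 10, 39, 40}" "wa PRIME = {}"
  by (auto simp: PRIME_def)

lemma DEGREE_frame [simp]: "wv DEGREE = {41, 42, 43}" "wa DEGREE = {}"
  by (auto simp: DEGREE_def)

lemma eqx_empty: "eqx {} u w \<longleftrightarrow> w = u"
  by (auto simp: eqx_def)

lemma LOG_spec:
  assumes post: "\<And>v' t'. eqx {36, 37, 38} v v' \<Longrightarrow> v' 36 = digits_needed 2 (v 2) \<Longrightarrow>
    v' 37 = 16 ^ digits_needed 2 (v 2) \<Longrightarrow> t' \<le> t + 7 * digits_needed 2 (v 2) + 4 \<Longrightarrow> Q v' a t'"
  shows "wp LOG Q v a t"
proof -
  let ?L = "digits_needed 2 (v 2)"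
  note d = digits_needed[of 2, where n = "v 2", OF order_refl]
  have "wp (Wh (V 2 -. V 38)
     (36 ::= V 36 +. N 1 ;; 38 ::= V 38 +. V 38 ;; 37 ::= V 37 +. V 37 ;; 37 ::= V 37 +. V 37 ;;
      37 ::= V 37 +. V 37 ;; 37 ::= V 37 +. V 37)) Q (v(36 := 1, 37 := 16, 38 := 2)) a (Suc (Suc (Suc t)))"
  proof (rule wp_Wh_count[where n = "?L - 1" and B = 6 and
        I = "\<lambda>j v' a'. v' 36 = Suc j \<and> v' 37 = 16 ^ Suc j \<and> v' 38 = 2 ^ Suc j"])
    fix j t1 and v1 :: vars and a1 :: arrays
    assume j: "j < ?L - 1" and I: "v1 36 = Suc j \<and> v1 37 = 16 ^ Suc j \<and> v1 38 = 2 ^ Suc j"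
      and f: "eqx (wv (36 ::= V 36 +. N 1 ;; 38 ::= V 38 +. V 38 ;; 37 ::= V 37 +. V 37 ;; 37 ::= V 37 +. V 37 ;;
      37 ::= V 37 +. V 37 ;; 37 ::= V 37 +. V 37)) (v(36 := 1, 37 := 16, 38 := 2)) v1"
    have "2 ^ Suc j < v 2" using d(3)[where d = "Suc j"] j by simp
    moreover have "v1 2 = v 2" using eqxD[OF f, of 2] by simp
    ultimately show "ev (V 2 -. V 38) v1 a1 \<noteq> 0 \<and> wp (36 ::= V 36 +. N 1 ;; 38 ::= V 38 +. V 38 ;; 37 ::= V 37 +. V 37 ;; 37 ::= V 37 +. V 37 ;;
      37 ::= V 37 +. V 37 ;; 37 ::= V 37 +. V 37)
      (\<lambda>v' a' t'. (v' 36 = Suc (Suc j) \<and> v' 37 = 16 ^ Suc (Suc j) \<and> v' 38 = 2 ^ Suc (Suc j)) \<and> t' \<le> t1 + 6) v1 a1 t1"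
      using I by simp
  next
    fix v1 :: vars and a1 :: arrays
    assume I: "v1 36 = Suc (?L - 1) \<and> v1 37 = 16 ^ Suc (?L - 1) \<and> v1 38 = 2 ^ Suc (?L - 1)"
      and f: "eqx (wv (36 ::= V 36 +. N 1 ;; 38 ::= V 38 +. V 38 ;; 37 ::= V 37 +. V 37 ;; 37 ::= V 37 +. V 37 ;;
      37 ::= V 37 +. V 37 ;; 37 ::= V 37 +. V 37)) (v(36 := 1, 37 := 16, 38 := 2)) v1"
    have "v1 2 = v 2" using eqxD[OF f, of 2] by simp
    then show "ev (V 2 -. V 38) v1 a1 = 0" using I d(1,2) by simp
  next
    fix v1 t1 and a1 :: arrays
    assume I: "v1 36 = Suc (?L - 1) \<and> v1 37 = 16 ^ Suc (?L - 1) \<and> v1 38 = 2 ^ Suc (?L - 1)"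
      and f: "eqx (wv (36 ::= V 36 +. N 1 ;; 38 ::= V 38 +. V 38 ;; 37 ::= V 37 +. V 37 ;; 37 ::= V 37 +. V 37 ;;
      37 ::= V 37 +. V 37 ;; 37 ::= V 37 +. V 37)) (v(36 := 1, 37 := 16, 38 := 2)) v1"
      "eqx (wa (36 ::= V 36 +. N 1 ;; 38 ::= V 38 +. V 38 ;; 37 ::= V 37 +. V 37 ;; 37 ::= V 37 +. V 37 ;;
      37 ::= V 37 +. V 37 ;; 37 ::= V 37 +. V 37)) a a1"
      and t1: "t1 \<le> Suc (Suc (Suc t)) + (?L - 1) * (6 + 1) + 1"
    have "a1 = a" using f(2) by (simp add: eqx_empty)
    moreover have "Q v1 a t1"
      by (rule post) (use f(1) I t1 d(1) in \<open>auto simp: eqx_def\<close>)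
    ultimately show "Q v1 a1 t1" by simp
  qed simp
  then show ?thesis by (simp add: LOG_def)
qed

lemma DIVIDES_spec:
  assumes post: "\<And>v' t'. eqx {10, 39} v v' \<Longrightarrow> v' 39 = v 3 mod (v 9 + 2) \<Longrightarrow> t' \<le> t + 5 * v 3 + 3 \<Longrightarrow> Q v' a t'"
  shows "wp DIVIDES Q v a t"
proof -
  let ?c = "39 ::= V 39 +. N 1 ;; Ite (V 9 +. N 2 -. V 39) Skip (39 ::= N 0)"
  have "wp (FOR 10 (V 3) ?c) Q (v(39 := 0)) a (Suc t)"
  proof (rule wp_FOR[where n = "v 3" and B = 3 and I = "\<lambda>j v' a'. v' 39 = j mod (v 9 + 2)"])
    fix j t1 and v1 :: vars and a1 :: arrays
    assume I: "v1 39 = j mod (v 9 + 2)" and f: "eqx (insert 10 (wv ?c)) (v(39 := 0)) v1"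
    have "v1 9 = v 9" using eqxD[OF f, of 9] by simp
    moreover obtain r where "j mod (v 9 + 2) = r" "r < v 9 + 2" by simp
    ultimately show "wp ?c (\<lambda>v' a' t'. (v'(10 := Suc j)) 39 = Suc j mod (v 9 + 2) \<and> t' \<le> t1 + 3) v1 a1 t1"
      using I by (auto simp: mod_Suc)
  next
    fix j and v1 :: vars and a1 :: arrays
    assume f: "eqx (insert 10 (wv ?c)) (v(39 := 0)) v1"
    show "ev (V 3) v1 a1 = v 3" using eqxD[OF f, of 3] by simp
  next
    fix v1 t1 and a1 :: arrays
    assume I: "v1 39 = v 3 mod (v 9 + 2)" and f: "eqx (insert 10 (wv ?c)) (v(39 := 0)) v1" "eqx (wa ?c) a a1"
      and t1: "t1 \<le> Suc t + v 3 * (3 + 2) + 2"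
    have "a1 = a" using f(2) by (simp add: eqx_empty)
    moreover have "Q v1 a t1" by (rule post) (use f(1) I t1 in \<open>auto simp: eqx_def\<close>)
    ultimately show "Q v1 a1 t1" by simp
  qed simp_all
  then show ?thesis by (simp add: DIVIDES_def)
qed

lemma prime_trial:
  assumes "2 \<le> (q::nat)"
  shows "prime q \<longleftrightarrow> (\<forall>i<q - 2. q mod (i + 2) \<noteq> 0)"
proof
  assume p: "prime q"
  show "\<forall>i<q - 2. q mod (i + 2) \<noteq> 0"
  proof (intro allI impI notI)
    fix i assume i: "i < q - 2" "q mod (i + 2) = 0"
    then have "i + 2 dvd q" by (simp add: dvd_eq_mod_eq_0)
    then have "i + 2 = 1 \<or> i + 2 = q" using p unfolding prime_nat_iff by blast
    then show False using i(1) by linarith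
  qed
next
  assume a: "\<forall>i<q - 2. q mod (i + 2) \<noteq> 0"
  have "m = 1 \<or> m = q" if "m dvd q" for m
  proof (rule ccontr)
    assume n: "\<not> (m = 1 \<or> m = q)"
    have "m \<le> q" "m \<noteq> 0" using that assms by (auto intro: dvd_imp_le intro!: Nat.gr0I)
    then have "m - 2 < q - 2" "m - 2 + 2 = m" using n by linarith+
    then have "q mod m \<noteq> 0" using a[rule_format, of "m - 2"] by simp
    then show False using that by (simp add: dvd_eq_mod_eq_0)
  qed
  then show "prime q" using assms unfolding prime_nat_iff by auto
qed

lemma IS_PRIME_spec:
  assumes q: "2 \<le> v 3"
    and post: "\<And>v' t'. eqx {3, 9, 10, 39, 40} v v' \<Longrightarrow> v' 3 = (if prime (v 3) then v 3 else Suc (v 3)) \<Longrightarrow>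
      v' 40 = (if prime (v 3) then 0 else 1) \<Longrightarrow> t' \<le> t + 20 * v 3 * v 3 \<Longrightarrow> Q v' a t'"
  shows "wp IS_PRIME Q v a t"
proof -
  let ?c = "DIVIDES ;; Ite (V 39) Skip (40 ::= N 1)" let ?q = "v 3"
  let ?I = "\<lambda>j v' a'. v' 40 = (if \<forall>i<j. ?q mod (i + 2) \<noteq> 0 then 0 else 1)"
  have "wp (FOR 9 (V 3 -. N 2) ?c) (wp (Ite (V 40) (3 ::= V 3 +. N 1) Skip) Q) (v(40 := 0)) a (Suc t)"
  proof (rule wp_FOR[where n = "?q - 2" and B = "5 * ?q + 5" and I = ?I])
    fix j t1 and v1 :: vars and a1 :: arrays
    assume I: "?I j v1 a1" and v9: "v1 9 = j" and f: "eqx (insert 9 (wv ?c)) (v(40 := 0)) v1"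
    have v3: "v1 3 = ?q" using eqxD[OF f, of 3] by simp
    have "wp DIVIDES (wp (Ite (V 39) Skip (40 ::= N 1))
        (\<lambda>v' a' t'. ?I (Suc j) (v'(9 := Suc j)) a' \<and> t' \<le> t1 + (5 * ?q + 5))) v1 a1 t1"
    proof (rule DIVIDES_spec)
      fix v2 t2
      assume f2: "eqx {10, 39} v1 v2" and m: "v2 39 = v1 3 mod (v1 9 + 2)" and t2: "t2 \<le> t1 + 5 * v1 3 + 3"
      have "v2 40 = v1 40" using eqxD[OF f2, of 40] by simp
      then show "wp (Ite (V 39) Skip (40 ::= N 1))
        (\<lambda>v' a' t'. ?I (Suc j) (v'(9 := Suc j)) a' \<and> t' \<le> t1 + (5 * ?q + 5)) v2 a1 t2"
        using m t2 v3 v9 I by (auto simp: All_less_Suc)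
    qed
    then show "wp ?c (\<lambda>v' a' t'. ?I (Suc j) (v'(9 := Suc j)) a' \<and> t' \<le> t1 + (5 * ?q + 5)) v1 a1 t1" by simp
  next
    fix j and v1 :: vars and a1 :: arrays
    assume f: "eqx (insert 9 (wv ?c)) (v(40 := 0)) v1"
    show "ev (V 3 -. N 2) v1 a1 = ?q - 2" using eqxD[OF f, of 3] by simp
  next
    fix v1 t1 and a1 :: arrays
    assume I: "?I (?q - 2) v1 a1" and f: "eqx (insert 9 (wv ?c)) (v(40 := 0)) v1" "eqx (wa ?c) a a1"
      and t1: "t1 \<le> Suc t + (?q - 2) * (5 * ?q + 5 + 2) + 2"
    have a1: "a1 = a" using f(2) by (simp add: eqx_empty)
    have v40: "v1 40 = (if prime ?q then 0 else 1)" using I prime_trial[OF q] by simp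
    have v3: "v1 3 = ?q" using eqxD[OF f(1), of 3] by simp
    obtain r where r: "?q = r + 2" using q by (metis add.commute le_Suc_ex)
    have tm: "Suc (Suc t1) \<le> t + 20 * ?q * ?q" using t1 unfolding r by (simp add: algebra_simps)
    have "Q (v1(3 := if prime ?q then ?q else Suc ?q)) a (if prime ?q then Suc t1 else Suc (Suc t1))"
      by (rule post) (use f(1) v40 tm in \<open>auto simp: eqx_def split: if_splits\<close>)
    then show "wp (Ite (V 40) (3 ::= V 3 +. N 1) Skip) Q v1 a1 t1"
      using a1 v40 v3 fun_upd_triv[of v1 3] by (auto split: if_splits)
  qed simp_all
  then show ?thesis by (simp add: IS_PRIME_def)
qed

lemma add_bound: "t \<le> x + y + z \<Longrightarrow> y \<le> y' \<Longrightarrow> t \<le> x + y' + (z::nat)"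
  by linarith

lemma PRIME_spec:
  assumes Q: "2 \<le> v 37"
    and post: "\<And>v' t'. eqx {3, 9, 10, 39, 40} v v' \<Longrightarrow> prime (v' 3) \<Longrightarrow> v 37 \<le> v' 3 \<Longrightarrow> v' 3 \<le> 8 * (v 37)\<^sup>2 \<Longrightarrow>
      t' \<le> t + 30 * v' 3 ^ 3 \<Longrightarrow> P v' a t'"
  shows "wp PRIME P v a t"
proof -
  let ?Q = "v 37"
  define p where "p = (LEAST p. prime p \<and> ?Q \<le> p)"
  obtain r where r: "prime r" "?Q \<le> r" "r \<le> 8 * ?Q\<^sup>2" using prime_between[of ?Q] Q by auto
  have p: "prime p \<and> ?Q \<le> p" unfolding p_def by (rule LeastI[of _ r]) (use r in simp)
  have least: "p \<le> s" if "prime s" "?Q \<le> s" for s unfolding p_def using that by (intro Least_le) simp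
  have pr: "p \<le> 8 * ?Q\<^sup>2" using least[OF r(1,2)] r(3) by simp
  \<comment> \<open>One turn for each candidate from 16^L to p. The last turn finds p prime and
    clears the flag without advancing, hence the \<open>min\<close> in the invariant.\<close>
  let ?n = "Suc (p - ?Q)"
  have "wp (Wh (V 40) IS_PRIME) P (v(3 := ?Q, 40 := 1)) a (Suc (Suc t))"
  proof (rule wp_Wh_count[where n = ?n and B = "20 * p * p" and
        I = "\<lambda>j v' a'. v' 3 = min (?Q + j) p \<and> v' 40 = (if j = ?n then 0 else 1)"])
    show "(v(3 := ?Q, 40 := 1)) 3 = min (?Q + 0) p \<and> (v(3 := ?Q, 40 := 1)) 40 = (if 0 = ?n then 0 else 1)"
      using p by simp
  next
    fix j t1 and v1 :: vars and a1 :: arrays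
    assume j: "j < ?n" and I: "v1 3 = min (?Q + j) p \<and> v1 40 = (if j = ?n then 0 else 1)"
    have v3: "v1 3 = ?Q + j" "?Q + j \<le> p" using I j p by auto
    have pj: "prime (v1 3) \<longleftrightarrow> j = p - ?Q"
    proof
      assume "prime (v1 3)"
      then have "p \<le> v1 3" using least v3 by simp
      then show "j = p - ?Q" using v3 by linarith
    next
      assume "j = p - ?Q"
      then have "v1 3 = p" using v3 p by simp
      then show "prime (v1 3)" using p by simp
    qed
    have "wp IS_PRIME (\<lambda>v' a' t'. (v' 3 = min (?Q + Suc j) p \<and> v' 40 = (if Suc j = ?n then 0 else 1)) \<and> t' \<le> t1 + 20 * p * p) v1 a1 t1"
    proof (rule IS_PRIME_spec)
      fix v2 t2
      assume a: "v2 3 = (if prime (v1 3) then v1 3 else Suc (v1 3))" "v2 40 = (if prime (v1 3) then 0 else 1)"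
        "t2 \<le> t1 + 20 * v1 3 * v1 3"
      have "20 * v1 3 * v1 3 \<le> 20 * p * p" using v3 by (intro mult_le_mono) auto
      then have "t2 \<le> t1 + 20 * p * p" using a(3) by linarith
      then show "(v2 3 = min (?Q + Suc j) p \<and> v2 40 = (if Suc j = ?n then 0 else 1)) \<and> t2 \<le> t1 + 20 * p * p"
        using a(1,2) v3 j unfolding pj by auto
    qed (use v3 Q in linarith)
    then show "ev (V 40) v1 a1 \<noteq> 0 \<and> wp IS_PRIME (\<lambda>v' a' t'. (v' 3 = min (?Q + Suc j) p \<and> v' 40 = (if Suc j = ?n then 0 else 1)) \<and> t' \<le> t1 + 20 * p * p) v1 a1 t1"
      using I j by simp
  next
    fix v1 t1 and a1 :: arrays
    assume I: "v1 3 = min (?Q + ?n) p \<and> v1 40 = (if ?n = ?n then 0 else 1)"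
      and f: "eqx (wv IS_PRIME) (v(3 := ?Q, 40 := 1)) v1" "eqx (wa IS_PRIME) a a1"
      and t1: "t1 \<le> Suc (Suc t) + ?n * (20 * p * p + 1) + 1"
    have v3: "v1 3 = p" using I p by simp
    have "?n * (20 * p * p + 1) \<le> p * (20 * p * p + 1)" using p Q by (intro mult_le_mono1) linarith
    moreover have "p * (20 * p * p + 1) = 20 * p ^ 3 + p" by (simp add: algebra_simps power3_eq_cube)
    moreover have "p + 3 \<le> 10 * p ^ 3"
    proof -
      have "2 \<le> p" using p Q by linarith
      moreover have "p \<le> p ^ 3" using \<open>2 \<le> p\<close> by (intro self_le_power) simp_all
      ultimately show ?thesis by linarith
    qed
    ultimately have "?n * (20 * p * p + 1) \<le> 20 * p ^ 3 + p" "p + 3 \<le> 10 * p ^ 3" by simp_all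
    then have "t1 \<le> t + 30 * v1 3 ^ 3" using add_bound[OF t1] v3 by fastforce
    moreover have "a1 = a" using f(2) by (simp add: eqx_empty)
    moreover have "eqx {3, 9, 10, 39, 40} v v1" using f(1) by (auto simp: eqx_def)
    ultimately show "P v1 a1 t1" using post p pr v3 by auto
  qed simp
  then show ?thesis by (simp add: PRIME_def)
qed

lemma DEGREE_spec:
  assumes L: "1 \<le> v 36"
    and post: "\<And>v' t'. eqx {41, 42, 43} v v' \<Longrightarrow> 128 * v 2 \<le> v' 41 * v 36 \<Longrightarrow> v' 41 * v 36 < 128 * v 2 + v 36 \<Longrightarrow>
      t' \<le> t + 3 * v' 41 + 10 \<Longrightarrow> Q v' a t'"
  shows "wp DEGREE Q v a t"
proof -
  let ?L = "v 36" and ?c = "42 ::= V 42 +. V 36 ;; 41 ::= V 41 +. N 1"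
  define D where "D = (128 * v 2 + ?L - 1) div ?L"
  have D1: "D * ?L \<le> 128 * v 2 + ?L - 1" unfolding D_def by (rule div_times_less_eq_dividend)
  have "128 * v 2 + ?L - 1 < D * ?L + ?L"
    unfolding D_def using div_mult_mod_eq[of "128 * v 2 + ?L - 1" ?L] mod_less_divisor[of ?L "128 * v 2 + ?L - 1"] L
    by linarith
  then have D2: "128 * v 2 \<le> D * ?L" by linarith
  have "wp (Wh (V 43 -. V 42) ?c) Q (v(43 := 128 * v 2, 41 := 0, 42 := 0)) a (Suc (Suc (Suc (Suc (Suc (Suc (Suc (Suc (Suc t)))))))))"
  proof (rule wp_Wh_count[where n = D and B = 2 and I = "\<lambda>j v' a'. v' 41 = j \<and> v' 42 = j * ?L"])
    fix j t1 and v1 :: vars and a1 :: arrays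
    assume j: "j < D" and I: "v1 41 = j \<and> v1 42 = j * ?L"
      and f: "eqx (wv ?c) (v(43 := 128 * v 2, 41 := 0, 42 := 0)) v1"
    have "Suc j * ?L \<le> D * ?L" using j by (intro mult_le_mono1) simp
    then have "j * ?L < 128 * v 2" using D1 L by simp
    then show "ev (V 43 -. V 42) v1 a1 \<noteq> 0 \<and> wp ?c (\<lambda>v' a' t'. (v' 41 = Suc j \<and> v' 42 = Suc j * ?L) \<and> t' \<le> t1 + 2) v1 a1 t1"
      using I eqxD[OF f, of 43] eqxD[OF f, of 36] by simp
  next
    fix v1 :: vars and a1 :: arrays
    assume I: "v1 41 = D \<and> v1 42 = D * ?L" and f: "eqx (wv ?c) (v(43 := 128 * v 2, 41 := 0, 42 := 0)) v1"
    show "ev (V 43 -. V 42) v1 a1 = 0" using I eqxD[OF f, of 43] D2 by simp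
  next
    fix v1 t1 and a1 :: arrays
    assume I: "v1 41 = D \<and> v1 42 = D * ?L" and f: "eqx (wv ?c) (v(43 := 128 * v 2, 41 := 0, 42 := 0)) v1" "eqx (wa ?c) a a1"
      and t1: "t1 \<le> Suc (Suc (Suc (Suc (Suc (Suc (Suc (Suc (Suc t)))))))) + D * (2 + 1) + 1"
    have "a1 = a" using f(2) by (simp add: eqx_empty)
    moreover have "Q v1 a t1" by (rule post) (use f(1) I t1 D1 D2 L in \<open>auto simp: eqx_def\<close>)
    ultimately show "Q v1 a1 t1" by simp
  qed simp
  then show ?thesis by (simp add: DEGREE_def mult_2[symmetric])
qed

subsection \<open>Tabulating all polynomials\<close>

text \<open>In round j, entry q^(j+1) + i is entry i plus x^j modulo q, where x = i mod q is kept in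
  \<open>V 46\<close> and array 16 holds the powers. Later entries build on ones written in the same
  round.\<close>

definition POLY_ROW :: com where
  "POLY_ROW = 14 ::= Ar 15 (V 9) +. Ar 16 (V 46) ;; Ite (V 3 -. V 14) Skip (14 ::= V 14 -. V 3) ;;
     Upd 15 (V 44 +. V 9) (V 14) ;; 46 ::= V 46 +. N 1 ;; Ite (V 3 -. V 46) Skip (46 ::= N 0)"

definition NEXT_POWER :: com where
  "NEXT_POWER = 46 ::= N 0 ;;
     FOR 10 (V 9) (46 ::= V 46 +. Ar 16 (V 9) ;; Ite (V 3 -. V 46) Skip (46 ::= V 46 -. V 3)) ;;
     Upd 16 (V 9) (V 46)"

definition POLY_ROUND :: com where
  "POLY_ROUND = 45 ::= N 0 ;; FOR 9 (V 3) (45 ::= V 45 +. V 44) ;;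
     46 ::= N 0 ;; FOR 9 (V 45 -. V 44) POLY_ROW ;;
     FOR 9 (V 3) NEXT_POWER ;; 5 ::= V 44 ;; 44 ::= V 45"

definition POLYS :: com where
  "POLYS = FOR 9 (V 3) (Upd 15 (V 9) (N 0) ;; Upd 16 (V 9) (N 1)) ;; 5 ::= N 1 ;; 44 ::= V 3 ;;
     FOR 47 (V 41) POLY_ROUND"

text \<open>Reduction modulo K by lookup: array 18 lists the residues of 0, ..., q - 1, obtained
  from a cyclic counter.\<close>

definition COLOURS :: com where
  "COLOURS = 46 ::= N 0 ;;
     FOR 9 (V 3) (Upd 18 (V 9) (V 46) ;; 46 ::= V 46 +. N 1 ;; Ite (V 4 -. V 46) Skip (46 ::= N 0)) ;;
     FOR 9 (V 44) (Upd 2 (V 9) (Ar 18 (Ar 15 (V 9))))"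

lemma POLY_ROW_frame [simp]: "wv POLY_ROW = {14, 46}" "wa POLY_ROW = {15}"
  by (auto simp: POLY_ROW_def)

lemma NEXT_POWER_frame [simp]: "wv NEXT_POWER = {10, 46}" "wa NEXT_POWER = {16}"
  by (auto simp: NEXT_POWER_def)

lemma POLY_ROUND_frame [simp]: "wv POLY_ROUND = {5, 9, 10, 14, 44, 45, 46}" "wa POLY_ROUND = {15, 16}"
  by (auto simp: POLY_ROUND_def)

lemma POLYS_frame [simp]: "wv POLYS = {5, 9, 10, 14, 44, 45, 46, 47}" "wa POLYS = {15, 16}"
  by (auto simp: POLYS_def)

lemma COLOURS_frame [simp]: "wv COLOURS = {9, 46}" "wa COLOURS = {2, 18}"
  by (auto simp: COLOURS_def)

lemma add_mod_small:
  assumes "x < (q::nat)" "y < q"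
  shows "(if x + y < q then x + y else x + y - q) = (x + y) mod q"
  using assms by (auto simp: mod_if)

lemma NEXT_POWER_spec:
  assumes q: "0 < v 3" and w: "a 16 (v 9) < v 3"
    and post: "\<And>v' t'. eqx {10, 46} v v' \<Longrightarrow> t' \<le> t + 5 * v 9 + 4 \<Longrightarrow>
      Q v' (a(16 := (a 16)(v 9 := (v 9 * a 16 (v 9)) mod v 3))) t'"
  shows "wp NEXT_POWER Q v a t"
proof -
  let ?c = "46 ::= V 46 +. Ar 16 (V 9) ;; Ite (V 3 -. V 46) Skip (46 ::= V 46 -. V 3)"
  let ?w = "a 16 (v 9)" and ?q = "v 3"
  have "wp (FOR 10 (V 9) ?c) (wp (Upd 16 (V 9) (V 46)) Q) (v(46 := 0)) a (Suc t)"
  proof (rule wp_FOR[where n = "v 9" and B = 3 and I = "\<lambda>j v' a'. v' 46 = (j * ?w) mod ?q"])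
    fix j t1 and v1 :: vars and a1 :: arrays
    assume I: "v1 46 = (j * ?w) mod ?q" and f: "eqx (insert 10 (wv ?c)) (v(46 := 0)) v1" "eqx (wa ?c) a a1"
    have e: "v1 9 = v 9" "v1 3 = ?q" "a1 = a"
      using eqxD[OF f(1), of 9] eqxD[OF f(1), of 3] f(2) by (simp_all add: eqx_empty)
    have "(Suc j * ?w) mod ?q = ((j * ?w) mod ?q + ?w) mod ?q" by (simp add: mod_simps add.commute)
    also have "\<dots> = (if (j * ?w) mod ?q + ?w < ?q then (j * ?w) mod ?q + ?w else (j * ?w) mod ?q + ?w - ?q)"
      by (rule add_mod_small[symmetric]) (use q w in simp_all)
    finally show "wp ?c (\<lambda>v' a' t'. (v'(10 := Suc j)) 46 = (Suc j * ?w) mod ?q \<and> t' \<le> t1 + 3) v1 a1 t1"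
      using I e by simp
  next
    fix j and v1 :: vars and a1 :: arrays
    assume f: "eqx (insert 10 (wv ?c)) (v(46 := 0)) v1"
    show "ev (V 9) v1 a1 = v 9" using eqxD[OF f, of 9] by simp
  next
    fix v1 t1 and a1 :: arrays
    assume I: "v1 46 = (v 9 * ?w) mod ?q" and f: "eqx (insert 10 (wv ?c)) (v(46 := 0)) v1" "eqx (wa ?c) a a1"
      and t1: "t1 \<le> Suc t + v 9 * (3 + 2) + 2"
    have e: "v1 9 = v 9" "a1 = a" using eqxD[OF f(1), of 9] f(2) by (simp_all add: eqx_empty)
    have "Q v1 (a(16 := (a 16)(v 9 := (v 9 * a 16 (v 9)) mod v 3))) (Suc t1)"
      by (rule post) (use f(1) t1 in \<open>auto simp: eqx_def\<close>)
    then show "wp (Upd 16 (V 9) (V 46)) Q v1 a1 t1" using e I by simp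
  qed simp_all
  then show ?thesis by (simp add: NEXT_POWER_def)
qed

text \<open>Entry \<open>y\<close> of the table is the value at \<open>y mod q\<close> of the polynomial with digits \<open>y div q\<close>.\<close>

definition pentry :: "nat \<Rightarrow> nat \<Rightarrow> nat \<Rightarrow> nat" where
  "pentry q D y = pval q D (y div q) (y mod q)"

lemma pentry_less: "0 < q \<Longrightarrow> pentry q D y < q"
  by (simp add: pentry_def pval_def lin_less)

text \<open>Lowering the leading coefficient by one moves the index back by q^(j+1), keeps the point
  and removes x^j from the value.\<close>

lemma pentry_step:
  assumes q: "2 \<le> q" and j: "j < D" and y: "q ^ Suc j \<le> y" "y < q ^ Suc (Suc j)"
  shows "pentry q D y = (pentry q D (y - q ^ Suc j) + (y mod q) ^ j mod q) mod q"
proof -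
  have "q ^ j \<le> y div q" using y(1) q by (simp add: less_eq_div_iff_mult_less_eq mult.commute)
  moreover have "y div q < q ^ Suc j" using y(2) q by (simp add: div_less_iff_less_mult mult.commute)
  ultimately have "pentry q D y = (lin q D (\<lambda>j. (y mod q) ^ j) (y div q - q ^ j) + (y mod q) ^ j) mod q"
    unfolding pentry_def pval_def by (rule lin_step[OF q j])
  moreover obtain z where z: "y = z + q * q ^ j" using y(1) by (metis add.commute le_Suc_ex power_Suc)
  then have "(y - q ^ Suc j) div q = y div q - q ^ j" "(y - q ^ Suc j) mod q = y mod q" using q by simp_all
  ultimately show ?thesis by (simp only: pentry_def pval_def mod_add_right_eq)
qed

text \<open>State after j rounds: all q^j polynomials of degree below j are tabulated at all q
  points.\<close>

definition poly_table :: "nat \<Rightarrow> nat \<Rightarrow> nat \<Rightarrow> vars \<Rightarrow> arrays \<Rightarrow> bool" where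
  "poly_table q D j v a \<longleftrightarrow> v 5 = q ^ j \<and> v 44 = q ^ Suc j \<and> (\<forall>y<q ^ Suc j. a 15 y = pentry q D y) \<and>
     (\<forall>x<q. a 16 x = x ^ j mod q)"

lemma POLY_ROW_spec:
  assumes q: "2 \<le> q" "v 3 = q" and j: "j < D" and S: "v 44 = q ^ Suc j" and i: "v 9 < q ^ Suc (Suc j) - q ^ Suc j"
    and x: "v 46 = v 9 mod q" and pv: "\<And>y. y < q ^ Suc j + v 9 \<Longrightarrow> a 15 y = pentry q D y"
    and pw: "\<And>x. x < q \<Longrightarrow> a 16 x = x ^ j mod q"
    and post: "\<And>v' t'. eqx {14, 46} v v' \<Longrightarrow> v' 46 = Suc (v 9) mod q \<Longrightarrow> t' \<le> t + 7 \<Longrightarrow>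
      Q v' (a(15 := (a 15)(q ^ Suc j + v 9 := pentry q D (q ^ Suc j + v 9)))) t'"
  shows "wp POLY_ROW Q v a t"
proof -
  let ?y = "q ^ Suc j + v 9"
  have "pentry q D ?y = (pentry q D (?y - q ^ Suc j) + (?y mod q) ^ j mod q) mod q"
    by (rule pentry_step[OF q(1) j]) (use i in simp_all)
  moreover have "?y mod q = v 9 mod q" by simp
  moreover have "v 9 < ?y" using q(1) by simp
  ultimately have p: "pentry q D ?y = (a 15 (v 9) + a 16 (v 46)) mod q" using pv pw q(1) x by simp
  have "(if a 15 (v 9) + a 16 (v 46) < q then a 15 (v 9) + a 16 (v 46) else a 15 (v 9) + a 16 (v 46) - q) = pentry q D ?y"
    unfolding p by (rule add_mod_small) (use pv pw q(1) x \<open>v 9 < ?y\<close> pentry_less in simp_all)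
  moreover have m: "Suc (v 9) mod q = (if Suc (v 9 mod q) < q then Suc (v 9 mod q) else 0)"
    unfolding mod_Suc using mod_less_divisor[of q "v 9"] q(1) by (auto simp del: mod_less_divisor)
  moreover have "Q (v(14 := pentry q D ?y, 46 := Suc (v 9) mod q)) (a(15 := (a 15)(?y := pentry q D ?y))) t'"
    if "t' \<le> t + 7" for t' by (rule post) (use that in \<open>auto simp: eqx_def\<close>)
  ultimately show ?thesis
    using S q(2) x by (auto simp: POLY_ROW_def simp del: mod_Suc_eq split: if_splits)
qed

lemma POLY_ROUND_spec:
  assumes q: "2 \<le> q" "v 3 = q" and j: "j < D" and pt: "poly_table q D j v a"
    and post: "\<And>v' a' t'. eqx {5, 9, 10, 14, 44, 45, 46} v v' \<Longrightarrow> eqx {15, 16} a a' \<Longrightarrow> poly_table q D (Suc j) v' a' \<Longrightarrow>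
      t' \<le> t + 40 * q ^ Suc (Suc j) \<Longrightarrow> Q v' a' t'"
  shows "wp POLY_ROUND Q v a t"
proof -
  let ?S = "q ^ Suc j" let ?T = "q ^ Suc (Suc j)"
  let ?r3 = "wp (5 ::= V 44) (wp (44 ::= V 45) Q)"
  let ?r2 = "wp (FOR 9 (V 3) NEXT_POWER) ?r3"
  let ?r1 = "wp (46 ::= N 0) (wp (FOR 9 (V 45 -. V 44) POLY_ROW) ?r2)"
  have S: "v 44 = ?S" "?S \<le> ?T" using pt q(1) by (auto simp: poly_table_def)
  have "wp (FOR 9 (V 3) (45 ::= V 45 +. V 44)) ?r1 (v(45 := 0)) a (Suc t)"
  proof (rule FOR_mult)
    fix v1 t1
    assume f1: "eqx {9, 45} (v(45 := 0)) v1" and v45: "v1 45 = (v(45 := 0)) 45 + (v(45 := 0)) 3 * (v(45 := 0)) 44"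
      and t1: "t1 \<le> Suc t + 3 * (v(45 := 0)) 3 + 2"
    have e1: "v1 45 = ?T" "v1 44 = ?S" "v1 3 = q" using v45 S(1) q(2) eqxD[OF f1, of 44] eqxD[OF f1, of 3] by simp_all
    have "wp (FOR 9 (V 45 -. V 44) POLY_ROW) ?r2 (v1(46 := 0)) a (Suc t1)"
    proof (rule wp_FOR[where n = "?T - ?S" and B = 7 and
          I = "\<lambda>i v' a'. v' 46 = i mod q \<and> (\<forall>y<?S + i. a' 15 y = pentry q D y)"])
      show "((v1(46 := 0))(9 := 0)) 46 = 0 mod q \<and> (\<forall>y<?S + 0. a 15 y = pentry q D y)"
        using pt by (simp add: poly_table_def)
    next
      fix i t2 and v2 :: vars and a2 :: arrays
      assume i: "i < ?T - ?S" and I: "v2 46 = i mod q \<and> (\<forall>y<?S + i. a2 15 y = pentry q D y)" and v9: "v2 9 = i"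
        and f2: "eqx (insert 9 (wv POLY_ROW)) (v1(46 := 0)) v2" "eqx (wa POLY_ROW) a a2"
      have e2: "v2 3 = q" "v2 44 = ?S" "a2 16 = a 16"
        using eqxD[OF f2(1), of 3] eqxD[OF f2(1), of 44] eqxD[OF f2(2), of 16] e1 by simp_all
      show "wp POLY_ROW (\<lambda>v' a' t'. ((v'(9 := Suc i)) 46 = Suc i mod q \<and> (\<forall>y<?S + Suc i. a' 15 y = pentry q D y)) \<and> t' \<le> t2 + 7) v2 a2 t2"
      proof (rule POLY_ROW_spec[OF q(1) e2(1) j e2(2)])
        show "a2 16 x = x ^ j mod q" if "x < q" for x using pt that e2(3) by (simp add: poly_table_def)
      qed (use i I v9 in \<open>auto simp: less_Suc_eq\<close>)
    next
      fix i and v2 :: vars and a2 :: arrays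
      assume f2: "eqx (insert 9 (wv POLY_ROW)) (v1(46 := 0)) v2"
      show "ev (V 45 -. V 44) v2 a2 = ?T - ?S" using eqxD[OF f2, of 45] eqxD[OF f2, of 44] e1 by simp
    next
      fix v2 t2 and a2 :: arrays
      assume I: "v2 46 = (?T - ?S) mod q \<and> (\<forall>y<?S + (?T - ?S). a2 15 y = pentry q D y)"
        and f2: "eqx (insert 9 (wv POLY_ROW)) (v1(46 := 0)) v2" "eqx (wa POLY_ROW) a a2"
        and t2: "t2 \<le> Suc t1 + (?T - ?S) * (7 + 2) + 2"
      have e2: "v2 3 = q" "v2 44 = ?S" "v2 45 = ?T" "a2 16 = a 16"
        using eqxD[OF f2(1), of 3] eqxD[OF f2(1), of 44] eqxD[OF f2(1), of 45] eqxD[OF f2(2), of 16] e1 by simp_all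
      show "?r2 v2 a2 t2"
      proof (rule wp_FOR[where n = q and B = "5 * q + 4" and
            I = "\<lambda>i v' a'. \<forall>x<q. a' 16 x = (if x < i then x ^ Suc j mod q else x ^ j mod q)"])
        show "\<forall>x<q. a2 16 x = (if x < 0 then x ^ Suc j mod q else x ^ j mod q)"
          using pt e2(4) by (simp add: poly_table_def)
      next
        fix i t3 and v3 :: vars and a3 :: arrays
        assume i: "i < q" and I3: "\<forall>x<q. a3 16 x = (if x < i then x ^ Suc j mod q else x ^ j mod q)" and v9: "v3 9 = i"
          and f3: "eqx (insert 9 (wv NEXT_POWER)) v2 v3"
        have v3: "v3 3 = q" using eqxD[OF f3, of 3] e2 by simp
        have ai: "a3 16 i = i ^ j mod q" using I3 i by simp
        show "wp NEXT_POWER (\<lambda>v' a' t'. (\<forall>x<q. a' 16 x = (if x < Suc i then x ^ Suc j mod q else x ^ j mod q)) \<and> t' \<le> t3 + (5 * q + 4)) v3 a3 t3"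
        proof (rule NEXT_POWER_spec)
          fix v4 t4 assume t4: "t4 \<le> t3 + 5 * v3 9 + 4"
          have "(i * (i ^ j mod q)) mod q = i ^ Suc j mod q" by (simp add: mod_simps)
          then show "(\<forall>x<q. (a3(16 := (a3 16)(v3 9 := (v3 9 * a3 16 (v3 9)) mod v3 3))) 16 x =
              (if x < Suc i then x ^ Suc j mod q else x ^ j mod q)) \<and> t4 \<le> t3 + (5 * q + 4)"
            using I3 v9 v3 ai t4 i by (auto simp: less_Suc_eq)
        qed (use v3 v9 ai q(1) in simp_all)
      next
        fix i and v3 :: vars and a3 :: arrays
        assume f3: "eqx (insert 9 (wv NEXT_POWER)) v2 v3"
        show "ev (V 3) v3 a3 = q" using eqxD[OF f3, of 3] e2 by simp
      next
        fix v3 t3 and a3 :: arrays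
        assume I3: "\<forall>x<q. a3 16 x = (if x < q then x ^ Suc j mod q else x ^ j mod q)"
          and f3: "eqx (insert 9 (wv NEXT_POWER)) v2 v3" "eqx (wa NEXT_POWER) a2 a3"
          and t3: "t3 \<le> t2 + q * (5 * q + 4 + 2) + 2"
        have e3: "v3 44 = ?S" "v3 45 = ?T" "a3 15 = a2 15"
          using eqxD[OF f3(1), of 44] eqxD[OF f3(1), of 45] eqxD[OF f3(2), of 15] e2 by simp_all
        have "Q (v3(5 := ?S, 44 := ?T)) a3 (Suc (Suc t3))"
        proof (rule post)
          show "eqx {5, 9, 10, 14, 44, 45, 46} v (v3(5 := ?S, 44 := ?T))" "eqx {15, 16} a a3"
            using f1 f2 f3 by (auto simp: eqx_def)
          show "poly_table q D (Suc j) (v3(5 := ?S, 44 := ?T)) a3"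
            using I I3 e3 S(2) by (simp add: poly_table_def)
          have "q * q \<le> ?T" "4 \<le> q * q" using q(1) mult_le_mono[OF q(1) q(1)] by simp_all
          moreover have "q \<le> q * q" using q(1) by simp
          moreover have "t1 \<le> t + 3 * q + 3" using t1 q(2) by simp
          moreover have "(?T - ?S) * (7 + 2) \<le> 9 * ?T" by simp
          moreover have "q * (5 * q + 4 + 2) = 5 * (q * q) + 6 * q" by (simp add: algebra_simps)
          ultimately show "Suc (Suc t3) \<le> t + 40 * ?T" using t2 t3 by linarith
        qed
        then show "?r3 v3 a3 t3" using e3 by simp
      qed simp
    qed simp
    then show "?r1 v1 a t1" by simp
  qed simp
  then show ?thesis by (simp add: POLY_ROUND_def)
qed

lemma POLYS_spec:
  assumes q: "2 \<le> v 3"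
    and post: "\<And>v' a' t'. eqx {5, 9, 10, 14, 44, 45, 46, 47} v v' \<Longrightarrow> eqx {15, 16} a a' \<Longrightarrow>
      poly_table (v 3) (v 41) (v 41) v' a' \<Longrightarrow> t' \<le> t + v 41 * (40 * v 3 ^ Suc (v 41) + 2) + 4 * v 3 + 6 \<Longrightarrow> Q v' a' t'"
  shows "wp POLYS Q v a t"
proof -
  let ?q = "v 3" let ?D = "v 41"
  let ?c = "Upd 15 (V 9) (N 0) ;; Upd 16 (V 9) (N 1)"
  have "wp (FOR 9 (V 3) ?c) (wp (5 ::= N 1) (wp (44 ::= V 3) (wp (FOR 47 (V 41) POLY_ROUND) Q))) v a t"
  proof (rule wp_FOR[where n = ?q and B = 2 and I = "\<lambda>i v' a'. \<forall>x<i. a' 15 x = 0 \<and> a' 16 x = 1"])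
    fix i and v1 :: vars and a1 :: arrays
    assume f1: "eqx (insert 9 (wv ?c)) v v1"
    show "ev (V 3) v1 a1 = ?q" using eqxD[OF f1, of 3] by simp
  next
    fix v1 t1 and a1 :: arrays
    assume I: "\<forall>x<?q. a1 15 x = 0 \<and> a1 16 x = 1" and f1: "eqx (insert 9 (wv ?c)) v v1" "eqx (wa ?c) a a1"
      and t1: "t1 \<le> t + ?q * (2 + 2) + 2"
    have e1: "v1 3 = ?q" "v1 41 = ?D" using eqxD[OF f1(1), of 3] eqxD[OF f1(1), of 41] by simp_all
    have "wp (FOR 47 (V 41) POLY_ROUND) Q (v1(5 := 1, 44 := ?q)) a1 (Suc (Suc t1))"
    proof (rule wp_FOR[where n = ?D and B = "40 * ?q ^ Suc ?D" and I = "\<lambda>j v' a'. poly_table ?q ?D j v' a'"])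
      show "poly_table ?q ?D 0 ((v1(5 := 1, 44 := ?q))(47 := 0)) a1"
        using I q by (simp add: poly_table_def pentry_def pval_def)
    next
      fix j t2 and v2 :: vars and a2 :: arrays
      assume j: "j < ?D" and I2: "poly_table ?q ?D j v2 a2" and f2: "eqx (insert 47 (wv POLY_ROUND)) (v1(5 := 1, 44 := ?q)) v2"
      show "wp POLY_ROUND (\<lambda>v' a' t'. poly_table ?q ?D (Suc j) (v'(47 := Suc j)) a' \<and> t' \<le> t2 + 40 * ?q ^ Suc ?D) v2 a2 t2"
      proof (rule POLY_ROUND_spec[OF q _ j I2])
        show "v2 3 = ?q" using eqxD[OF f2, of 3] e1 by simp
        fix v3 a3 t3
        assume pt: "poly_table ?q ?D (Suc j) v3 a3" and t3: "t3 \<le> t2 + 40 * ?q ^ Suc (Suc j)"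
        have "?q ^ Suc (Suc j) \<le> ?q ^ Suc ?D" using j q by (intro power_increasing) auto
        then have "t3 \<le> t2 + 40 * ?q ^ Suc ?D" using t3 by linarith
        then show "poly_table ?q ?D (Suc j) (v3(47 := Suc j)) a3 \<and> t3 \<le> t2 + 40 * ?q ^ Suc ?D"
          using pt by (simp add: poly_table_def)
      qed
    next
      fix j and v2 :: vars and a2 :: arrays
      assume f2: "eqx (insert 47 (wv POLY_ROUND)) (v1(5 := 1, 44 := ?q)) v2"
      show "ev (V 41) v2 a2 = ?D" using eqxD[OF f2, of 41] e1 by simp
    next
      fix v2 t2 and a2 :: arrays
      assume I2: "poly_table ?q ?D ?D v2 a2" and f2: "eqx (insert 47 (wv POLY_ROUND)) (v1(5 := 1, 44 := ?q)) v2"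
        "eqx (wa POLY_ROUND) a1 a2" and t2: "t2 \<le> Suc (Suc t1) + ?D * (40 * ?q ^ Suc ?D + 2) + 2"
      show "Q v2 a2 t2"
      proof (rule post)
        show "eqx {5, 9, 10, 14, 44, 45, 46, 47} v v2" "eqx {15, 16} a a2" using f1 f2 by (auto simp: eqx_def)
        show "t2 \<le> t + ?D * (40 * ?q ^ Suc ?D + 2) + 4 * ?q + 6" using t1 t2 by (simp add: algebra_simps)
      qed fact
    qed simp
    then show "wp (5 ::= N 1) (wp (44 ::= V 3) (wp (FOR 47 (V 41) POLY_ROUND) Q)) v1 a1 t1" using e1 by simp
  qed (auto simp: less_Suc_eq)
  then show ?thesis by (simp add: POLYS_def)
qed

lemma COLOURS_spec:
  assumes K: "0 < v 4" and pv: "\<And>y. y < v 44 \<Longrightarrow> a 15 y < v 3"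
    and post: "\<And>v' a' t'. eqx {9, 46} v v' \<Longrightarrow> eqx {2, 18} a a' \<Longrightarrow>
      (\<And>y. y < v 44 \<Longrightarrow> a' 2 y = a 15 y mod v 4) \<Longrightarrow> t' \<le> t + 6 * v 3 + 3 * v 44 + 5 \<Longrightarrow> Q v' a' t'"
  shows "wp COLOURS Q v a t"
proof -
  let ?c = "Upd 18 (V 9) (V 46) ;; 46 ::= V 46 +. N 1 ;; Ite (V 4 -. V 46) Skip (46 ::= N 0)"
  let ?d = "Upd 2 (V 9) (Ar 18 (Ar 15 (V 9)))"
  have "wp (FOR 9 (V 3) ?c) (wp (FOR 9 (V 44) ?d) Q) (v(46 := 0)) a (Suc t)"
  proof (rule wp_FOR[where n = "v 3" and B = 4 and I = "\<lambda>i v' a'. v' 46 = i mod v 4 \<and> (\<forall>x<i. a' 18 x = x mod v 4)"])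
    fix i t1 and v1 :: vars and a1 :: arrays
    assume I: "v1 46 = i mod v 4 \<and> (\<forall>x<i. a1 18 x = x mod v 4)" and v9: "v1 9 = i"
      and f: "eqx (insert 9 (wv ?c)) (v(46 := 0)) v1"
    have "v1 4 = v 4" using eqxD[OF f, of 4] by simp
    moreover obtain r where "i mod v 4 = r" "r < v 4" using K by simp
    ultimately show "wp ?c (\<lambda>v' a' t'. ((v'(9 := Suc i)) 46 = Suc i mod v 4 \<and> (\<forall>x<Suc i. a' 18 x = x mod v 4)) \<and> t' \<le> t1 + 4) v1 a1 t1"
      using I v9 by (auto simp: mod_Suc less_Suc_eq)
  next
    fix j and v1 :: vars and a1 :: arrays
    assume f: "eqx (insert 9 (wv ?c)) (v(46 := 0)) v1"
    show "ev (V 3) v1 a1 = v 3" using eqxD[OF f, of 3] by simp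
  next
    fix v1 t1 and a1 :: arrays
    assume I: "v1 46 = v 3 mod v 4 \<and> (\<forall>x<v 3. a1 18 x = x mod v 4)"
      and f: "eqx (insert 9 (wv ?c)) (v(46 := 0)) v1" "eqx (wa ?c) a a1" and t1: "t1 \<le> Suc t + v 3 * (4 + 2) + 2"
    have e1: "v1 44 = v 44" "a1 15 = a 15" using eqxD[OF f(1), of 44] eqxD[OF f(2), of 15] by simp_all
    show "wp (FOR 9 (V 44) ?d) Q v1 a1 t1"
    proof (rule wp_FOR[where n = "v 44" and B = 1 and I = "\<lambda>i v' a'. \<forall>y<i. a' 2 y = a 15 y mod v 4"])
      fix i t2 and v2 :: vars and a2 :: arrays
      assume i: "i < v 44" and I2: "\<forall>y<i. a2 2 y = a 15 y mod v 4" and v9: "v2 9 = i"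
        and f2: "eqx (insert 9 (wv ?d)) v1 v2" "eqx (wa ?d) a1 a2"
      have "a2 18 (a2 15 i) = a 15 i mod v 4"
        using eqxD[OF f2(2), of 18] eqxD[OF f2(2), of 15] e1 I pv[OF i] by simp
      then show "wp ?d (\<lambda>v' a' t'. (\<forall>y<Suc i. a' 2 y = a 15 y mod v 4) \<and> t' \<le> t2 + 1) v2 a2 t2"
        using I2 v9 by (auto simp: less_Suc_eq)
    next
      fix j and v2 :: vars and a2 :: arrays
      assume f2: "eqx (insert 9 (wv ?d)) v1 v2"
      show "ev (V 44) v2 a2 = v 44" using eqxD[OF f2, of 44] e1 by simp
    next
      fix v2 t2 and a2 :: arrays
      assume I2: "\<forall>y<v 44. a2 2 y = a 15 y mod v 4" and f2: "eqx (insert 9 (wv ?d)) v1 v2" "eqx (wa ?d) a1 a2"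
        and t2: "t2 \<le> t1 + v 44 * (1 + 2) + 2"
      show "Q v2 a2 t2" by (rule post) (use f f2 I2 t1 t2 in \<open>auto simp: eqx_def\<close>)
    qed simp_all
  qed simp_all
  then show ?thesis by (simp add: COLOURS_def)
qed

subsection \<open>The family of colourings\<close>

definition LARGE :: com where
  "LARGE = LOG ;; 39 ::= V 2 +. V 2 ;; 4 ::= N 0 ;; FOR 9 (V 36) (4 ::= V 4 +. V 39) ;; PRIME ;; DEGREE ;;
     POLYS ;; COLOURS"

lemma LARGE_frame [simp]:
  "wv LARGE = {3, 4, 5, 9, 10, 14, 36, 37, 38, 39, 40, 41, 42, 43, 44, 45, 46, 47}" "wa LARGE = {2, 15, 16, 18}"
  by (auto simp: LARGE_def)

lemma cell_bound:
  assumes "i < n" "y < (q::nat)"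
  shows "i * q + y < n * q"
proof -
  have "Suc i * q \<le> n * q" using assms(1) by (intro mult_le_mono1) simp
  then show ?thesis using assms(2) by simp
qed

lemma log_digits:
  assumes "2 \<le> k"
  shows "real (digits_needed 2 k) \<le> log 2 (real k) + 1" "digits_needed 2 k \<le> k"
proof -
  let ?L = "digits_needed 2 k"
  note d = digits_needed[of 2, where n = k, OF order_refl]
  show l: "real ?L \<le> log 2 (real k) + 1"
  proof (cases "?L = 1")
    case True
    then show ?thesis using assms by simp
  next
    case False
    then have "2 ^ (?L - 1) < k" using d(3)[where d = "?L - 1"] d(1) by simp
    then have "2 ^ (?L - 1) \<le> real k" using of_nat_le_iff[of "2 ^ (?L - 1)" k, where 'a = real] by simp
    then have "real (?L - 1) \<le> log 2 (real k)" using assms by (simp add: le_log_iff powr_realpow)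
    then show ?thesis using d(1) by simp
  qed
  show "?L \<le> k"
  proof (rule ccontr)
    assume "\<not> ?L \<le> k"
    then have "2 ^ k < k" using d(3)[where d = k] assms by simp
    then show False using less_exp[of k] by simp
  qed
qed

text \<open>This and \<open>large_family\<close> retain the sizes that enter the running time,
  separately from balance.\<close>

definition small_family :: "real \<Rightarrow> nat \<Rightarrow> nat \<Rightarrow> nat \<Rightarrow> nat \<Rightarrow> bool" where
  "small_family \<epsilon> k q K F \<longleftrightarrow> K = 2 * k \<and> real q \<le> 2000 * (real k ^ 2 / \<epsilon>)\<^sup>2 \<and>
     real F \<le> 2 ^ k * (real k + 1) * real q * (100 / \<epsilon>)\<^sup>2"

definition large_family :: "nat \<Rightarrow> nat \<Rightarrow> nat \<Rightarrow> nat \<Rightarrow> bool" where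
  "large_family k q K F \<longleftrightarrow> (let L = digits_needed 2 k in 8 \<le> k \<and> K = 2 * k * L \<and> q \<le> 8 * 16 ^ (2 * L) \<and>
     (\<exists>D. F = q ^ D \<and> D * L < 128 * k + L))"

text \<open>In the time bound q^3 pays for the search of the prime, at most q candidates with O(q^2)
  steps each; D = O(k) rounds of O(q^(D+1)) steps are the cost of the table.\<close>

lemma LARGE_spec:
  assumes \<epsilon>: "0 < \<epsilon>" "\<epsilon> \<le> 1"
    and k: "8 \<le> v 2" "12 \<le> \<epsilon> * real (v 2)"
      "\<And>L. real L \<le> log 2 (real (v 2)) + 1 \<Longrightarrow> 0 < L \<Longrightarrow> 48 / \<epsilon> \<le> exp (real (v 2) / real L)"
    and post: "\<And>v' a' t' tb. eqx (wv LARGE) v v' \<Longrightarrow> eqx (wa LARGE) a a' \<Longrightarrow>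
      balanced_family \<epsilon> (v 2) (v' 3) (v' 4) (v' 5) tb \<Longrightarrow> large_family (v 2) (v' 3) (v' 4) (v' 5) \<Longrightarrow>
      (\<And>i y. i < v' 5 \<Longrightarrow> y < v' 3 \<Longrightarrow> a' 2 (i * v' 3 + y) = tb i y) \<Longrightarrow>
      t' \<le> t + 50000 * (v 2 * v' 3 ^ 3 * v' 5) \<Longrightarrow> Q v' a' t'"
  shows "wp LARGE Q v a t"
  unfolding LARGE_def wp_Seq
proof (rule LOG_spec)
  let ?k = "v 2" let ?L = "digits_needed 2 ?k"
  let ?r4 = "wp POLYS (wp COLOURS Q)"
  let ?r2 = "wp PRIME (wp DEGREE ?r4)"
  have k2: "2 \<le> ?k" using k by simp
  note L = log_digits[OF k2]
  have L1: "1 \<le> ?L" "?k \<le> 2 ^ ?L" using digits_needed[of 2, where n = ?k] by auto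
  have L2: "2 \<le> ?L"
  proof (rule ccontr)
    assume "\<not> 2 \<le> ?L"
    then have "?L = 1" using L1(1) by linarith
    then show False using L1(2) k by simp
  qed
  fix v1 t1
  assume f1: "eqx {36, 37, 38} v v1" and v36: "v1 36 = ?L" "v1 37 = 16 ^ ?L" and t1: "t1 \<le> t + 7 * ?L + 4"
  have v1k: "v1 2 = ?k" using eqxD[OF f1, of 2] by simp
  have "wp (FOR 9 (V 36) (4 ::= V 4 +. V 39)) ?r2 (v1(39 := 2 * ?k, 4 := 0)) a (Suc (Suc t1))"
  proof (rule FOR_mult)
    fix v2 t2
    assume f2: "eqx {9, 4} (v1(39 := 2 * ?k, 4 := 0)) v2"
      and K2: "v2 4 = (v1(39 := 2 * ?k, 4 := 0)) 4 + (v1(39 := 2 * ?k, 4 := 0)) 36 * (v1(39 := 2 * ?k, 4 := 0)) 39"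
      and t2: "t2 \<le> Suc (Suc t1) + 3 * (v1(39 := 2 * ?k, 4 := 0)) 36 + 2"
    have e2: "v2 2 = ?k" "v2 36 = ?L" "v2 37 = 16 ^ ?L" "v2 4 = 2 * ?k * ?L"
      using eqxD[OF f2, of 2] eqxD[OF f2, of 36] eqxD[OF f2, of 37] v36 v1k K2 by simp_all
    show "?r2 v2 a t2"
    proof (rule PRIME_spec)
      have "16 ^ 1 \<le> (16::nat) ^ ?L" using L1(1) by (intro power_increasing) auto
      then show "2 \<le> v2 37" using e2 by simp
      fix v3 t3
      assume f3: "eqx {3, 9, 10, 39, 40} v2 v3" and p: "prime (v3 3)" and qlo: "v2 37 \<le> v3 3"
        and qhi: "v3 3 \<le> 8 * (v2 37)\<^sup>2" and t3: "t3 \<le> t2 + 30 * v3 3 ^ 3"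
      have e3: "v3 2 = ?k" "v3 36 = ?L" "v3 4 = 2 * ?k * ?L"
        using eqxD[OF f3, of 2] eqxD[OF f3, of 36] eqxD[OF f3, of 4] e2 by simp_all
      show "wp DEGREE ?r4 v3 a t3"
      proof (rule DEGREE_spec)
        show "1 \<le> v3 36" using e3 L1 by simp
        fix v4 t4
        assume f4: "eqx {41, 42, 43} v3 v4" and D: "128 * v3 2 \<le> v4 41 * v3 36" "v4 41 * v3 36 < 128 * v3 2 + v3 36"
          and t4: "t4 \<le> t3 + 3 * v4 41 + 10"
        let ?D = "v4 41" let ?q = "v3 3"
        have e4: "v4 2 = ?k" "v4 36 = ?L" "v4 4 = 2 * ?k * ?L" "v4 3 = ?q"
          using eqxD[OF f4, of 2] eqxD[OF f4, of 36] eqxD[OF f4, of 4] eqxD[OF f4, of 3] e3 by simp_all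
        have q: "2 \<le> ?q" using p by (simp add: prime_ge_2_nat)
        have Dk: "?D \<le> 128 * ?k"
        proof (rule ccontr)
          assume "\<not> ?D \<le> 128 * ?k"
          then have "Suc (128 * ?k) * ?L \<le> ?D * ?L" by (intro mult_le_mono1) simp
          moreover have "128 * ?k * 1 \<le> 128 * ?k * ?L" using L1(1) by (intro mult_le_mono2)
          ultimately show False using D(2) unfolding e3 mult_Suc by linarith
        qed
        show "?r4 v4 a t4"
        proof (rule POLYS_spec)
          show "2 \<le> v4 3" using q e4 by simp
          fix v5 a5 t5
          assume f5: "eqx {5, 9, 10, 14, 44, 45, 46, 47} v4 v5" "eqx {15, 16} a a5"
            and pt: "poly_table (v4 3) (v4 41) (v4 41) v5 a5"
            and t5: "t5 \<le> t4 + v4 41 * (40 * v4 3 ^ Suc (v4 41) + 2) + 4 * v4 3 + 6"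
          have e5: "v5 4 = 2 * ?k * ?L" "v5 3 = ?q" "v5 5 = ?q ^ ?D" "v5 44 = ?q ^ Suc ?D"
            using eqxD[OF f5(1), of 4] eqxD[OF f5(1), of 3] e4 pt by (simp_all add: poly_table_def)
          have a5: "a5 15 y = pentry ?q ?D y" if "y < ?q ^ Suc ?D" for y
            using pt that e4 by (simp add: poly_table_def)
          show "wp COLOURS Q v5 a5 t5"
          proof (rule COLOURS_spec)
            show "0 < v5 4" using e5 k L1 by simp
            show "a5 15 y < v5 3" if "y < v5 44" for y using a5 that e5 q by (simp add: pentry_less)
            fix v6 a6 t6
            assume f6: "eqx {9, 46} v5 v6" "eqx {2, 18} a5 a6" and tb: "\<And>y. y < v5 44 \<Longrightarrow> a6 2 y = a5 15 y mod v5 4"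
              and t6: "t6 \<le> t5 + 6 * v5 3 + 3 * v5 44 + 5"
            have e6: "v6 3 = ?q" "v6 4 = 2 * ?k * ?L" "v6 5 = ?q ^ ?D"
              using eqxD[OF f6(1), of 3] eqxD[OF f6(1), of 4] eqxD[OF f6(1), of 5] e5 by simp_all
            show "Q v6 a6 t6"
            proof (rule post[where tb = "\<lambda>N x. pval ?q ?D N x mod (2 * ?k * ?L)"])
              show "eqx (wv LARGE) v v6" "eqx (wa LARGE) a a6" using f1 f2 f3 f4 f5 f6 by (auto simp: eqx_def)
              show "balanced_family \<epsilon> ?k (v6 3) (v6 4) (v6 5) (\<lambda>N x. pval ?q ?D N x mod (2 * ?k * ?L))"
                unfolding e6
                by (rule polynomial_family_balanced[OF \<epsilon> k(1) k(3) k(2) L2 L(2) L1(2) p])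
                  (use L L1 qlo e2 D e3 Dk in simp_all)
              show "large_family ?k (v6 3) (v6 4) (v6 5)"
                unfolding large_family_def Let_def e6
                using k(1) qhi e2 D(2) e3 by (auto simp: power_mult mult.commute[of 2] intro!: exI[of _ ?D])
              fix i y assume iy: "i < v6 5" "y < v6 3"
              then have "i * ?q + y < ?q ^ Suc ?D"
                using e6 cell_bound[of i "?q ^ ?D" y ?q] by (simp add: mult.commute)
              then show "a6 2 (i * v6 3 + y) = pval ?q ?D i y mod (2 * ?k * ?L)"
                using tb[of "i * ?q + y"] a5 e5 e6 iy q by (simp add: pentry_def)
            next
              let ?X = "?k * (?q ^ 3 * ?q ^ ?D)"
              have pos: "1 \<le> ?q ^ ?D" "1 \<le> ?q ^ 3" "?q \<le> ?q ^ 3" using q by (simp_all add: self_le_power)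
              have X1: "?k \<le> ?X" using mult_le_mono2[of 1 "?q ^ 3 * ?q ^ ?D" ?k] pos by (simp add: Suc_leI)
              have X2: "?q ^ 3 \<le> ?X" "?q \<le> ?X" "?q ^ Suc ?D \<le> ?X"
              proof -
                have "1 * (?q ^ 3 * 1) \<le> ?X" using k pos by (intro mult_le_mono) auto
                then show "?q ^ 3 \<le> ?X" by simp
                then show "?q \<le> ?X" using pos by linarith
                have "1 * (?q * ?q ^ ?D) \<le> ?X" using k pos by (intro mult_le_mono) auto
                then show "?q ^ Suc ?D \<le> ?X" by simp
              qed
              have "?D * (40 * ?q ^ Suc ?D + 2) \<le> 128 * ?k * (42 * (?q ^ 3 * ?q ^ ?D))"
              proof (rule mult_le_mono[OF Dk])
                have "?q * ?q ^ ?D \<le> ?q ^ 3 * ?q ^ ?D" using pos by simp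
                moreover have "1 * 1 \<le> ?q ^ 3 * ?q ^ ?D" using pos by (intro mult_le_mono) auto
                ultimately show "40 * ?q ^ Suc ?D + 2 \<le> 42 * (?q ^ 3 * ?q ^ ?D)" unfolding power_Suc by linarith
              qed
              also have "\<dots> = 5376 * ?X" by simp
              finally have big: "?D * (40 * ?q ^ Suc ?D + 2) \<le> 5376 * ?X" .
              have tt: "t5 \<le> t4 + 5376 * ?X + 4 * ?q + 6" using t5 big e4 by simp
              have "t2 \<le> t1 + 3 * ?L + 4" using t2 v36 by simp
              then have "t6 \<le> t + 50000 * ?X"
                using t1 t3 t4 tt t6 e5 L(2) Dk X1 X2 k(1) unfolding e5 by linarith
              then show "t6 \<le> t + 50000 * (?k * v6 3 ^ 3 * v6 5)" using e6 by (simp add: mult.assoc)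
            qed
          qed
        qed
      qed
    qed
  qed simp
  then show "wp (39 ::= V 2 +. V 2) (wp (4 ::= N 0) (wp (FOR 9 (V 36) (4 ::= V 4 +. V 39)) ?r2)) v1 a t1"
    using v1k by (simp add: mult_2)
qed

section \<open>Stored families for small k, and the choice between the two kinds\<close>

fun STORES :: "nat \<Rightarrow> nat list \<Rightarrow> com" where
  "STORES i [] = Skip"
| "STORES i (x # xs) = Upd 2 (N i) (N x) ;; STORES (Suc i) xs"

lemma STORES_ok: "20 \<le> \<kappa> \<Longrightarrow> com_ok \<kappa> (STORES i xs)"
  by (induction xs arbitrary: i) auto

lemma STORES_spec:
  assumes "\<And>a'. eqx {2} a a' \<Longrightarrow> (\<And>j. j < i \<Longrightarrow> a' 2 j = a 2 j) \<Longrightarrow> (\<And>j. j < length xs \<Longrightarrow> a' 2 (i + j) = xs ! j) \<Longrightarrow>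
    Q v a' (t + length xs)"
  shows "wp (STORES i xs) Q v a t"
  using assms
proof (induction xs arbitrary: i a t)
  case Nil
  then show ?case by simp
next
  case (Cons x xs)
  have "wp (STORES (Suc i) xs) Q v (a(2 := (a 2)(i := x))) (Suc t)"
  proof (rule Cons.IH)
    fix a'
    assume f: "eqx {2} (a(2 := (a 2)(i := x))) a'" and old: "\<And>j. j < Suc i \<Longrightarrow> a' 2 j = (a(2 := (a 2)(i := x))) 2 j"
      and new: "\<And>j. j < length xs \<Longrightarrow> a' 2 (Suc i + j) = xs ! j"
    have "Q v a' (t + length (x # xs))"
    proof (rule Cons.prems)
      show "eqx {2} a a'" using f by (auto simp: eqx_def)
      show "a' 2 j = a 2 j" if "j < i" for j using old[of j] that by simp
      show "a' 2 (i + j) = (x # xs) ! j" if "j < length (x # xs)" for j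
        using old[of i] new[of "j - 1"] that by (cases j) auto
    qed
    then show "Q v a' (Suc t + length xs)" by simp
  qed
  then show ?case by simp
qed

definition HARD :: "nat \<Rightarrow> nat \<Rightarrow> nat \<Rightarrow> (nat \<Rightarrow> nat \<Rightarrow> nat) \<Rightarrow> com" where
  "HARD q K F tb = 3 ::= N q ;; 4 ::= N K ;; 5 ::= N F ;;
     STORES 0 (map (\<lambda>p. tb (p div q) (p mod q)) [0..<F * q])"

text \<open>\<open>V 2 -. N j\<close> is zero iff k \<le> j, and the earlier tests have excluded k <
  j. After \<open>r\<close> unsuccessful tests the polynomials are used.\<close>

fun SELECT :: "(nat \<Rightarrow> com) \<Rightarrow> nat \<Rightarrow> nat \<Rightarrow> com" where
  "SELECT h j 0 = LARGE"
| "SELECT h j (Suc r) = Ite (V 2 -. N j) (SELECT h (Suc j) r) (h j)"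

lemma SELECT_wp:
  assumes "j < v 2 + 1"
    and "j + r \<le> v 2 \<Longrightarrow> wp LARGE Q v a (t + r)"
    and "v 2 < j + r \<Longrightarrow> wp (h (v 2)) Q v a (t + (v 2 - j) + 1)"
  shows "wp (SELECT h j r) Q v a t"
  using assms
proof (induction r arbitrary: j t)
  case 0
  then show ?case by simp
next
  case (Suc r)
  show ?case
  proof (cases "v 2 = j")
    case True
    then show ?thesis using Suc.prems(3) by simp
  next
    case False
    then have j: "j < v 2" using Suc.prems(1) by simp
    have "wp (SELECT h (Suc j) r) Q v a (Suc t)"
    proof (rule Suc.IH)
      show "Suc j + r \<le> v 2 \<Longrightarrow> wp LARGE Q v a (Suc t + r)" using Suc.prems(2) by simp
      assume l: "v 2 < Suc j + r"
      have e: "Suc t + (v 2 - Suc j) + 1 = t + (v 2 - j) + 1" using j by simp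
      show "wp (h (v 2)) Q v a (Suc t + (v 2 - Suc j) + 1)" unfolding e by (rule Suc.prems(3)) (use l in simp)
    qed (use j in simp)
    then show ?thesis using j by simp
  qed
qed

lemma SELECT_frame:
  assumes "\<And>i. wv (h i) = {3, 4, 5}" "\<And>i. wa (h i) \<subseteq> {2}"
  shows "wv (SELECT h j r) = wv LARGE" "wa (SELECT h j r) = wa LARGE"
proof -
  have a: "x = 2" if "x \<in> wa (h i)" for i x using assms(2) that by blast
  show "wv (SELECT h j r) = wv LARGE" by (induction r arbitrary: j) (auto simp: assms(1))
  show "wa (SELECT h j r) = wa LARGE" by (induction r arbitrary: j) (auto dest: a)
qed

lemma SELECT_ok:
  assumes "\<And>i. com_ok \<kappa> (h i)" "com_ok \<kappa> LARGE" "6 \<le> \<kappa>"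
  shows "com_ok \<kappa> (SELECT h j r)"
  by (induction r arbitrary: j) (use assms in auto)

lemma STORES_frame: "wv (STORES i xs) = {}" "wa (STORES i xs) \<subseteq> {2}"
  by (induction xs arbitrary: i) auto

lemma HARD_spec:
  assumes q: "0 < q" and post: "\<And>v' a' t'. eqx {3, 4, 5} v v' \<Longrightarrow> eqx {2} a a' \<Longrightarrow> v' 3 = q \<Longrightarrow> v' 4 = K \<Longrightarrow> v' 5 = F \<Longrightarrow>
      (\<And>i y. i < F \<Longrightarrow> y < q \<Longrightarrow> a' 2 (i * q + y) = tb i y) \<Longrightarrow> t' \<le> t + F * q + 3 \<Longrightarrow> Q v' a' t'"
  shows "wp (HARD q K F tb) Q v a t"
proof -
  have "wp (STORES 0 (map (\<lambda>p. tb (p div q) (p mod q)) [0..<F * q])) Q (v(3 := q, 4 := K, 5 := F)) a (Suc (Suc (Suc t)))"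
  proof (rule STORES_spec)
    fix a'
    assume f: "eqx {2} a a'"
      and s: "\<And>j. j < length (map (\<lambda>p. tb (p div q) (p mod q)) [0..<F * q]) \<Longrightarrow>
        a' 2 (0 + j) = map (\<lambda>p. tb (p div q) (p mod q)) [0..<F * q] ! j"
    show "Q (v(3 := q, 4 := K, 5 := F)) a' (Suc (Suc (Suc t)) + length (map (\<lambda>p. tb (p div q) (p mod q)) [0..<F * q]))"
    proof (rule post)
      fix i y assume iy: "i < F" "y < q"
      then have "i * q + y < F * q" by (rule cell_bound)
      then show "a' 2 (i * q + y) = tb i y" using s[of "i * q + y"] iy by simp
    qed (use f in \<open>auto simp: eqx_def\<close>)
  qed
  then show ?thesis by (simp add: HARD_def)
qed

text \<open>
  The polynomials are balanced only for \<open>k\<close> above a bound depending on \<open>\<epsilon>\<close>; the finitely many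
  remaining families are part of the program.
\<close>

definition small_choice :: "real \<Rightarrow> nat \<Rightarrow> nat \<times> nat \<times> (nat \<Rightarrow> nat \<Rightarrow> nat)" where
  "small_choice \<epsilon> k = (SOME (q, F, tb). balanced_family \<epsilon> k q (2 * k) F tb \<and> small_family \<epsilon> k q (2 * k) F)"

definition SMALL :: "real \<Rightarrow> nat \<Rightarrow> com" where
  "SMALL \<epsilon> k = (case small_choice \<epsilon> k of (q, F, tb) \<Rightarrow> HARD q (2 * k) F tb)"

lemma small_choice:
  assumes "0 < \<epsilon>" "\<epsilon> \<le> 1" "1 \<le> k" "small_choice \<epsilon> k = (q, F, tb)"
  shows "balanced_family \<epsilon> k q (2 * k) F tb" "small_family \<epsilon> k q (2 * k) F"
proof -
  obtain q' F' tb' where "balanced_family \<epsilon> k q' (2 * k) F' tb' \<and> small_family \<epsilon> k q' (2 * k) F'"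
    using balanced_family_exists[OF assms(1-3)] unfolding small_family_def by blast
  then have "case (q', F', tb') of (q, F, tb) \<Rightarrow> balanced_family \<epsilon> k q (2 * k) F tb \<and> small_family \<epsilon> k q (2 * k) F"
    by simp
  then have "case small_choice \<epsilon> k of (q, F, tb) \<Rightarrow> balanced_family \<epsilon> k q (2 * k) F tb \<and> small_family \<epsilon> k q (2 * k) F"
    unfolding small_choice_def by (rule someI)
  then show "balanced_family \<epsilon> k q (2 * k) F tb" "small_family \<epsilon> k q (2 * k) F" using assms(4) by simp_all
qed

text \<open>The threshold is a function of \<epsilon> alone, so this is a single program for all
  graphs and all k.\<close>

definition SEL :: "real \<Rightarrow> com" where
  "SEL \<epsilon> = SELECT (SMALL \<epsilon>) 1 (SOME K0. \<forall>k>K0. 8 \<le> k \<and> 12 \<le> \<epsilon> * real k \<and>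
    (\<forall>L. real L \<le> log 2 (real k) + 1 \<longrightarrow> 0 < L \<longrightarrow> 48 / \<epsilon> \<le> exp (real k / real L)))"

lemma SMALL_frame: "wv (SMALL \<epsilon> k) = {3, 4, 5}" "wa (SMALL \<epsilon> k) \<subseteq> {2}"
  by (auto simp: SMALL_def HARD_def STORES_frame dest: subsetD[OF STORES_frame(2)] split: prod.split)

lemma SEL_frame [simp]: "wv (SEL \<epsilon>) = wv LARGE" "wa (SEL \<epsilon>) = wa LARGE"
  unfolding SEL_def by (rule SELECT_frame[OF SMALL_frame])+

lemma SEL_spec:
  assumes \<epsilon>: "0 < \<epsilon>" "\<epsilon> \<le> 1" and k: "1 \<le> v 2"
    and post: "\<And>v' a' t' tb. eqx (wv LARGE) v v' \<Longrightarrow> eqx (wa LARGE) a a' \<Longrightarrow>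
      balanced_family \<epsilon> (v 2) (v' 3) (v' 4) (v' 5) tb \<Longrightarrow>
      small_family \<epsilon> (v 2) (v' 3) (v' 4) (v' 5) \<or> large_family (v 2) (v' 3) (v' 4) (v' 5) \<Longrightarrow>
      (\<And>i y. i < v' 5 \<Longrightarrow> y < v' 3 \<Longrightarrow> a' 2 (i * v' 3 + y) = tb i y) \<Longrightarrow>
      t' \<le> t + 50010 * (v 2 * v' 3 ^ 3 * v' 5) \<Longrightarrow> Q v' a' t'"
  shows "wp (SEL \<epsilon>) Q v a t"
proof -
  let ?P = "\<lambda>K0. \<forall>k>K0. 8 \<le> k \<and> 12 \<le> \<epsilon> * real k \<and>
    (\<forall>L. real L \<le> log 2 (real k) + 1 \<longrightarrow> 0 < L \<longrightarrow> 48 / \<epsilon> \<le> exp (real k / real L))"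
  define K0 where "K0 = (SOME K0. ?P K0)"
  obtain K1 where "?P K1" using eventually_large[OF \<epsilon>(1)] less_imp_le by meson
  then have K0: "?P K0" unfolding K0_def by (rule someI)
  have pos: "1 \<le> F" "1 \<le> q" if "balanced_family \<epsilon> (v 2) q K F tb" for q K F tb
  proof -
    have "prime q" "0 < inj_count F tb {..<v 2}" using that by (auto simp: balanced_family_def)
    moreover have "F \<noteq> 0"
    proof
      assume "F = 0"
      then show False using \<open>0 < inj_count F tb {..<v 2}\<close> by (simp add: inj_count_def)
    qed
    ultimately show "1 \<le> q" "1 \<le> F" by (auto simp: prime_gt_0_nat Suc_leI)
  qed
  have X: "v 2 \<le> v 2 * q ^ 3 * F" "F * q \<le> v 2 * q ^ 3 * F" if "1 \<le> F" "1 \<le> q" for q F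
  proof -
    have "q * 1 \<le> q * (q * q)" using that by (intro mult_le_mono2) (simp add: Suc_leI)
    then have q3: "q \<le> q ^ 3" by (simp add: power3_eq_cube)
    have "v 2 * 1 * 1 \<le> v 2 * q ^ 3 * F" using that by (intro mult_le_mono) auto
    then show "v 2 \<le> v 2 * q ^ 3 * F" by simp
    have "1 * q * F \<le> v 2 * q ^ 3 * F" using k q3 by (intro mult_le_mono) auto
    then show "F * q \<le> v 2 * q ^ 3 * F" by (simp add: mult.commute)
  qed
  have "wp (SELECT (SMALL \<epsilon>) 1 K0) Q v a t"
  proof (rule SELECT_wp)
    assume "1 + K0 \<le> v 2"
    then have k': "8 \<le> v 2" "12 \<le> \<epsilon> * real (v 2)"
      "\<And>L. real L \<le> log 2 (real (v 2)) + 1 \<Longrightarrow> 0 < L \<Longrightarrow> 48 / \<epsilon> \<le> exp (real (v 2) / real L)"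
      using K0[rule_format, of "v 2"] by auto
    show "wp LARGE Q v a (t + K0)"
    proof (rule LARGE_spec[where v = v, OF \<epsilon> k'])
      fix v' a' t' tb
      assume A: "eqx (wv LARGE) v v'" "eqx (wa LARGE) a a'" "balanced_family \<epsilon> (v 2) (v' 3) (v' 4) (v' 5) tb"
        "large_family (v 2) (v' 3) (v' 4) (v' 5)"
        "\<And>i y. i < v' 5 \<Longrightarrow> y < v' 3 \<Longrightarrow> a' 2 (i * v' 3 + y) = tb i y"
        and t': "t' \<le> t + K0 + 50000 * (v 2 * v' 3 ^ 3 * v' 5)"
      \<comment> \<open>The \<open>K0\<close> tests cost less than k here, so they disappear in a
        bound whose constant does not depend on \<epsilon>.\<close>
      have "t' \<le> t + 50010 * (v 2 * v' 3 ^ 3 * v' 5)"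
        using t' X[OF pos[OF A(3)]] \<open>1 + K0 \<le> v 2\<close> by linarith
      then show "Q v' a' t'" using A by (intro post) auto
    qed
  next
    assume "v 2 < 1 + K0"
    obtain q F tb where s: "small_choice \<epsilon> (v 2) = (q, F, tb)" by (cases "small_choice \<epsilon> (v 2)") auto
    note b = small_choice[OF \<epsilon> k s]
    show "wp (SMALL \<epsilon> (v 2)) Q v a (t + (v 2 - 1) + 1)"
      unfolding SMALL_def s split
    proof (rule HARD_spec)
      show "0 < q" using pos(2)[OF b(1)] by simp
      fix v' a' t'
      assume f: "eqx {3, 4, 5} v v'" "eqx {2} a a'" and e: "v' 3 = q" "v' 4 = 2 * v 2" "v' 5 = F"
        and tb: "\<And>i y. i < F \<Longrightarrow> y < q \<Longrightarrow> a' 2 (i * q + y) = tb i y"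
        and t': "t' \<le> t + (v 2 - 1) + 1 + F * q + 3"
      show "Q v' a' t'"
      proof (rule post)
        show "eqx (wv LARGE) v v'" "eqx (wa LARGE) a a'" using f by (auto simp: eqx_def)
        show "balanced_family \<epsilon> (v 2) (v' 3) (v' 4) (v' 5) tb" using b(1) e by simp
        show "small_family \<epsilon> (v 2) (v' 3) (v' 4) (v' 5) \<or> large_family (v 2) (v' 3) (v' 4) (v' 5)" using b(2) e by simp
        show "a' 2 (i * v' 3 + y) = tb i y" if "i < v' 5" "y < v' 3" for i y using tb that e by simp
        show "t' \<le> t + 50010 * (v 2 * v' 3 ^ 3 * v' 5)"
          using t' X[OF pos[OF b(1)]] k unfolding e by linarith
      qed
    qed
  qed (use k in simp)
  then show ?thesis unfolding SEL_def K0_def .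
qed

subsection \<open>Paths of the input graph\<close>

lemma vwalk_arcs_snoc: "vwalk_arcs (xs @ [u, v]) = vwalk_arcs (xs @ [u]) @ [(u, v)]"
  by (induction xs rule: vwalk_arcs.induct) auto

lemma rwalk_vwalk_arcs: "rwalk E p \<longleftrightarrow> set (vwalk_arcs (rev p)) \<subseteq> E"
proof (induction E p rule: rwalk.induct)
  case (1 E v u p)
  then show ?case using vwalk_arcs_snoc[of "rev p" u v] by auto
qed auto

lemma rwalk_ends: "rwalk E p \<Longrightarrow> 2 \<le> length p \<Longrightarrow> set p \<subseteq> fst ` E \<union> snd ` E"
proof (induction E p rule: rwalk.induct)
  case (1 E v u p)
  then have e: "(u, v) \<in> E" "rwalk E (u # p)" by auto
  have uv: "u \<in> fst ` E" "v \<in> snd ` E" using e(1) by force+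
  show ?case
  proof (cases p)
    case Nil
    then show ?thesis using uv by simp
  next
    case (Cons x xs)
    then have "set (u # p) \<subseteq> fst ` E \<union> snd ` E" using 1 e by simp
    then show ?thesis using uv by auto
  qed
qed auto

lemma rwalk_map:
  assumes "inj_on \<phi> A" "fst ` E \<union> snd ` E \<subseteq> A" "set p \<subseteq> A"
  shows "rwalk ((\<lambda>(x, y). (\<phi> x, \<phi> y)) ` E) (map \<phi> p) \<longleftrightarrow> rwalk E p"
  using assms(2,3)
proof (induction E p rule: rwalk.induct)
  case (1 E v u p)
  have "(\<phi> u, \<phi> v) \<in> (\<lambda>(x, y). (\<phi> x, \<phi> y)) ` E \<longleftrightarrow> (u, v) \<in> E"
  proof
    assume "(\<phi> u, \<phi> v) \<in> (\<lambda>(x, y). (\<phi> x, \<phi> y)) ` E"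
    then obtain x y where xy: "(x, y) \<in> E" "\<phi> u = \<phi> x" "\<phi> v = \<phi> y" by auto
    then have "x \<in> A" "y \<in> A" using 1(2) by force+
    then have "u = x" "v = y" using xy assms(1) 1(3) by (auto dest: inj_onD)
    then show "(u, v) \<in> E" using xy by simp
  qed force
  then show ?case using 1 by simp
qed auto

definition simple_walks :: "(nat \<times> nat) set \<Rightarrow> nat \<Rightarrow> nat list set" where
  "simple_walks E k = {p. length p = k \<and> rwalk E p \<and> distinct p}"

text \<open>For k \<ge> 2 every vertex of a walk is an end of an edge, so nothing is lost by
  numbering only those vertices.\<close>

lemma card_simple_walks_map:
  assumes \<phi>: "inj_on \<phi> A" "\<phi> ` A \<subseteq> {..<n}" and A: "fst ` E \<union> snd ` E \<subseteq> A" and k: "2 \<le> k"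
  shows "card {p \<in> walks ((\<lambda>(x, y). (\<phi> x, \<phi> y)) ` E) k (\<lambda>v. v < n). distinct p} = card (simple_walks E k)"
proof -
  let ?E = "(\<lambda>(x, y). (\<phi> x, \<phi> y)) ` E"
  have sub: "set p \<subseteq> A" if "p \<in> simple_walks E k" for p
    using rwalk_ends[of E p] that k A unfolding simple_walks_def by blast
  have "{p \<in> walks ?E k (\<lambda>v. v < n). distinct p} = map \<phi> ` simple_walks E k"
  proof (intro equalityI subsetI)
    fix q assume "q \<in> {p \<in> walks ?E k (\<lambda>v. v < n). distinct p}"
    then have q: "length q = k" "rwalk ?E q" "distinct q" by (auto simp: walks_def)
    have "set q \<subseteq> fst ` ?E \<union> snd ` ?E" by (rule rwalk_ends[OF q(2)]) (use q k in simp)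
    moreover have "fst ` ?E = \<phi> ` (fst ` E)" "snd ` ?E = \<phi> ` (snd ` E)"
      unfolding image_image by (rule image_cong[OF refl], simp add: split_def)+
    ultimately have qA: "set q \<subseteq> \<phi> ` A" using image_mono[OF A, of \<phi>] by (simp only: image_Un)
    define p where "p = map (inv_into A \<phi>) q"
    have m: "map \<phi> p = q" unfolding p_def map_map
      by (rule map_idI) (use qA in \<open>auto simp: f_inv_into_f\<close>)
    have pA: "set p \<subseteq> A"
    proof
      fix x assume "x \<in> set p"
      then obtain y where "y \<in> set q" "x = inv_into A \<phi> y" by (auto simp: p_def)
      then show "x \<in> A" using qA inv_into_into[of y \<phi> A] by blast
    qed
    have "rwalk E p" using rwalk_map[OF \<phi>(1) A pA] q(2) m by simp
    moreover have "distinct p" using q(3) m[symmetric] by (simp add: distinct_map)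
    moreover have "length p = k" using q(1) by (simp add: p_def)
    ultimately show "q \<in> map \<phi> ` simple_walks E k" using m[symmetric] by (auto simp: simple_walks_def)
  next
    fix q assume "q \<in> map \<phi> ` simple_walks E k"
    then obtain p where p: "p \<in> simple_walks E k" "q = map \<phi> p" by blast
    note pA = sub[OF p(1)]
    have "rwalk ?E q" using rwalk_map[OF \<phi>(1) A pA] p by (simp add: simple_walks_def)
    moreover have "distinct q" using p pA \<phi>(1) by (auto simp: simple_walks_def distinct_map intro: inj_on_subset)
    moreover have "\<forall>x\<in>set q. x < n" using p pA \<phi>(2) by auto
    ultimately show "q \<in> {p \<in> walks ?E k (\<lambda>v. v < n). distinct p}" using p by (simp add: walks_def simple_walks_def)
  qed
  moreover have "inj_on (map \<phi>) (simple_walks E k)"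
  proof (rule inj_onI)
    fix p q assume pq: "p \<in> simple_walks E k" "q \<in> simple_walks E k" "map \<phi> p = map \<phi> q"
    have "inj_on \<phi> (set p \<union> set q)" using sub[OF pq(1)] sub[OF pq(2)] \<phi>(1) by (meson Un_least inj_on_subset)
    then show "p = q" using pq(3) by (simp add: inj_on_map_eq_map)
  qed
  ultimately show ?thesis by (simp add: card_image)
qed

lemma card_directed_paths:
  assumes "pair_digraph G" and k: "2 \<le> k"
  shows "card (directed_paths G (k - 1)) = card (simple_walks (parcs G) k)"
proof -
  interpret pair_digraph G by fact
  have "directed_paths G (k - 1) = rev ` simple_walks (parcs G) k"
  proof (intro equalityI subsetI)
    fix p assume "p \<in> directed_paths G (k - 1)"
    then have "distinct p" "length p - 1 = k - 1" "set (vwalk_arcs p) \<subseteq> parcs G"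
      by (auto simp: directed_paths_def vpath_def vwalk_def arcs_ends_def arc_to_ends_def)
    then have "rev p \<in> simple_walks (parcs G) k" using k by (auto simp: simple_walks_def rwalk_vwalk_arcs)
    then show "p \<in> rev ` simple_walks (parcs G) k" by (metis imageI rev_rev_ident)
  next
    fix p assume "p \<in> rev ` simple_walks (parcs G) k"
    then have r: "length p = k" "rwalk (parcs G) (rev p)" "distinct p" by (auto simp: simple_walks_def)
    have "set (rev p) \<subseteq> fst ` parcs G \<union> snd ` parcs G" by (rule rwalk_ends) (use r k in simp_all)
    moreover have "fst ` parcs G \<subseteq> pverts G" "snd ` parcs G \<subseteq> pverts G"
      using arc_fst_in_verts arc_snd_in_verts by (blast intro: image_subsetI)+
    ultimately have "set p \<subseteq> pverts G" by auto
    moreover have "set (vwalk_arcs p) \<subseteq> parcs G" using r(2) by (simp add: rwalk_vwalk_arcs)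
    moreover have "p \<noteq> []" using r k by auto
    ultimately show "p \<in> directed_paths G (k - 1)"
      using r by (auto simp: directed_paths_def vpath_def vwalk_def arcs_ends_def arc_to_ends_def)
  qed
  then show ?thesis by (simp add: card_image)
qed

text \<open>Paths of length 0 are treated apart, because here isolated vertices count.\<close>

lemma directed_paths_0: "directed_paths G 0 = (\<lambda>v. [v]) ` pverts G"
proof (intro equalityI subsetI)
  fix p assume "p \<in> directed_paths G 0"
  then have p: "length p - 1 = 0" "p \<noteq> []" "set p \<subseteq> pverts G" by (auto simp: directed_paths_def vpath_def vwalk_def)
  then obtain v where "p = [v]" by (cases p) auto
  then show "p \<in> (\<lambda>v. [v]) ` pverts G" using p(3) by simp
qed (auto simp: directed_paths_def vpath_def vwalk_def)

lemma card_directed_paths_0: "card (directed_paths G 0) = card (pverts G)"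
  unfolding directed_paths_0 by (rule card_image) (auto intro: inj_onI)

lemma card_undirected_paths_0: "card (undirected_paths G 0) = card (pverts G)"
  unfolding undirected_paths_def directed_paths_0 image_image
  by (rule card_image) (auto intro: inj_onI)

text \<open>A simple path with at least two vertices has different ends and so differs from its
  reverse; hence each class consists of exactly two traversals.\<close>

lemma card_undirected_paths:
  assumes "pair_graph G" and k: "2 \<le> k"
  shows "2 * card (undirected_paths G (k - 1)) = card (directed_paths G (k - 1))"
proof -
  interpret pair_graph G by fact
  let ?D = "directed_paths G (k - 1)" and ?f = "\<lambda>p :: 'a list. {p, rev p}"
  have fin: "finite ?D"
    by (rule finite_subset[OF _ finite_lists_length_eq[OF pair_finite_verts, of k]])
      (use k in \<open>auto simp: directed_paths_def vpath_def vwalk_def\<close>)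
  have sym: "(y, x) \<in> parcs G" if "(x, y) \<in> parcs G" for x y
    using that pair_sym_arcs by (auto simp: symmetric_def arcs_ends_def arc_to_ends_def sym_def)
  have arcs_rev: "set (vwalk_arcs (rev p)) = (\<lambda>(x, y). (y, x)) ` set (vwalk_arcs p)" for p :: "'a list"
  proof (induction p rule: vwalk_arcs.induct)
    case (3 x y xs)
    then show ?case using vwalk_arcs_snoc[of "rev xs" y x] by auto
  qed auto
  have rv: "rev p \<in> ?D" if "p \<in> ?D" for p
    using that sym by (auto simp: directed_paths_def vpath_def vwalk_def arcs_ends_def arc_to_ends_def arcs_rev)
  have ne: "rev p \<noteq> p" if "p \<in> ?D" for p
  proof
    assume e: "rev p = p"
    have p: "length p = k" "distinct p" using that k by (auto simp: directed_paths_def vpath_def vwalk_def)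
    have "p ! 0 = p ! (k - 1)" using rev_nth[of 0 p] e p k by simp
    then show False using p k nth_eq_iff_index_eq[of p 0 "k - 1"] by simp
  qed
  have "card ?D = (\<Sum>C\<in>?f ` ?D. card {p \<in> ?D. ?f p = C})"
    unfolding card_eq_sum by (rule sum.image_gen[OF fin])
  also have "\<dots> = (\<Sum>C\<in>?f ` ?D. 2)"
  proof (rule sum.cong[OF refl])
    fix C assume "C \<in> ?f ` ?D"
    then obtain p where p: "p \<in> ?D" "C = ?f p" by blast
    have "{p' \<in> ?D. ?f p' = C} = {p, rev p}"
      using p rv[OF p(1)] unfolding p(2) by (auto simp: doubleton_eq_iff)
    then show "card {p' \<in> ?D. ?f p' = C} = 2" using ne[OF p(1)] by simp
  qed
  finally show ?thesis by (simp add: undirected_paths_def)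
qed

text \<open>An arc and its reverse cannot both be listed, as they would be the same edge; they are
  distinct arcs because there are no loops.\<close>

lemma both_ways_undirected:
  assumes "undirected_input n G es"
  shows "distinct (both_ways True es)" "set (both_ways True es) = parcs G" "card (undirected_edges G) = length es"
proof -
  have G: "pair_graph G" and d: "distinct (map (\<lambda>(u, v). {u, v}) es)" and s: "set es \<union> (set es)\<inverse> = parcs G"
    using assms by (auto simp: undirected_input_def)
  interpret pair_graph G by fact
  have dd: "distinct es" "inj_on (\<lambda>(u, v). {u, v}) (set es)" using d by (auto simp: distinct_map)
  have "False" if "(x, y) \<in> set es" "(y, x) \<in> set es" for x y
  proof -
    have "(x, y) = (y, x)" by (rule inj_onD[OF dd(2)]) (use that in auto)
    moreover have "(x, y) \<in> parcs G" using that s by auto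
    ultimately show False using pair_no_loops by fastforce
  qed
  then have "set es \<inter> set (map (\<lambda>(x, y). (y, x)) es) = {}" by auto
  moreover have "distinct (map (\<lambda>(x, y). (y, x)) es)" using dd(1) by (auto simp: distinct_map inj_on_def)
  ultimately show "distinct (both_ways True es)" using dd(1) by (simp add: both_ways_def)
  show "set (both_ways True es) = parcs G" using s by (auto simp: both_ways_def converse_def)
  have "undirected_edges G = set (map (\<lambda>(u, v). {u, v}) es)"
    unfolding undirected_edges_def s[symmetric] by (auto simp: insert_commute image_iff)
  then show "card (undirected_edges G) = length es" using distinct_card[OF d] by simp
qed

lemma both_ways_directed:
  assumes "directed_input n G es"
  shows "distinct (both_ways False es)" "set (both_ways False es) = parcs G" "card (parcs G) = length es"
  using assms distinct_card[of es] by (auto simp: directed_input_def both_ways_def)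

lemma ends_both_ways: "fst ` set (both_ways und es) \<union> snd ` set (both_ways und es) = ends es"
  by (force simp: both_ways_def ends_def)

lemma card_ends_le: "card (ends es) \<le> 2 * length es"
proof -
  have "card (fst ` set es \<union> snd ` set es) \<le> card (fst ` set es) + card (snd ` set es)" by (rule card_Un_le)
  moreover have "card (fst ` set es) \<le> length es" "card (snd ` set es) \<le> length es"
    using card_image_le[of "set es" fst] card_image_le[of "set es" snd] card_length[of es] by simp_all
  ultimately show ?thesis unfolding ends_def by linarith
qed

subsection \<open>The algorithm\<close>

definition CORE :: "real \<Rightarrow> bool \<Rightarrow> com" where
  "CORE \<epsilon> und = SEL \<epsilon> ;; TABLES ;; REF ;; CNT ;; 35 ::= V 8 ;; READ und ;; SETUP ;; OUTER ;;
     0 ::= V 33 ;; 1 ::= (if und then V 34 +. V 34 else V 34)"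

text \<open>For k = 1 the answer is |V|, which variable 0 holds from the start; for k \<ge> 2
  without edges it is 0. The core thus always sees k \<ge> 2 and some edge.\<close>

definition ALG :: "real \<Rightarrow> bool \<Rightarrow> com" where
  "ALG \<epsilon> und = Ite (V 2 -. N 1) (Ite (V 1) (CORE \<epsilon> und) (0 ::= N 0 ;; 1 ::= N 1)) (1 ::= N 1)"

lemma sieve_tables_cong:
  assumes "sieve_tables v a" "v' 2 = v 2" "v' 4 = v 4" "\<And>x. a' 7 x = 0" "a' 9 = a 9" "a' 12 = a 12"
  shows "sieve_tables v' a'"
  using assms by (simp add: sieve_tables_def)

definition core_cost :: "nat \<Rightarrow> nat \<Rightarrow> nat \<Rightarrow> nat \<Rightarrow> nat \<Rightarrow> nat \<Rightarrow> nat \<Rightarrow> nat \<Rightarrow> nat" where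
  "core_cost k q K F d n m ne = 50010 * (k * q ^ 3 * F) + 20 * (K * k) + 5 * k + F * (node_cost K k k (k - 1) + 2) +
     14 * m + 20 * q * d + 3 * q ^ d + q * q * d * (round_cost q d F K k n ne + 2) + 40"

text \<open>The lower bound needs (1 + \<epsilon>) (1 - \<epsilon>/8) (1 - \<epsilon>/4) \<ge> (1 +
  \<epsilon>) (1 - 3\<epsilon>/8) \<ge> 1, true for \<epsilon> \<le> 1. In the undirected case c =
  2, as both traversals of a path are counted.\<close>

lemma approximation_from_bounds:
  fixes R T :: nat and num :: real
  assumes \<epsilon>: "0 < \<epsilon>" "\<epsilon> \<le> 1" and T: "0 < T" and c: "0 < c" "R = c * M"
    and lo: "(1 - \<epsilon> / 8) * (1 - \<epsilon> / 4) * (real R * real T) \<le> num"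
    and hi: "num \<le> (1 + \<epsilon> / 8) * (real R * real T)"
  shows "approximates (1 + \<epsilon>) (num / real (c * T)) M"
proof -
  have cT: "0 < real (c * T)" using c T by simp
  have e: "real R * real T = real M * real (c * T)" using c by simp
  have "1 \<le> (1 + \<epsilon>) * ((1 - \<epsilon> / 8) * (1 - \<epsilon> / 4))"
  proof -
    have "1 - 3 * \<epsilon> / 8 \<le> (1 - \<epsilon> / 8) * (1 - \<epsilon> / 4)" using \<epsilon> by (simp add: field_simps)
    then have "(1 + \<epsilon>) * (1 - 3 * \<epsilon> / 8) \<le> (1 + \<epsilon>) * ((1 - \<epsilon> / 8) * (1 - \<epsilon> / 4))" using \<epsilon> by (intro mult_left_mono) auto
    moreover have "\<epsilon> * \<epsilon> \<le> \<epsilon>" using \<epsilon> by (simp add: mult_left_le)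
    then have "1 \<le> (1 + \<epsilon>) * (1 - 3 * \<epsilon> / 8)" using \<epsilon> by (simp add: field_simps)
    ultimately show ?thesis by linarith
  qed
  then have "1 / (1 + \<epsilon>) \<le> (1 - \<epsilon> / 8) * (1 - \<epsilon> / 4)" using \<epsilon> by (simp add: divide_le_eq mult.commute)
  then have "1 / (1 + \<epsilon>) * (real M * real (c * T)) \<le> (1 - \<epsilon> / 8) * (1 - \<epsilon> / 4) * (real M * real (c * T))"
    by (intro mult_right_mono) auto
  then have "real M / (1 + \<epsilon>) * real (c * T) \<le> num" using lo unfolding e by simp
  then have 1: "real M / (1 + \<epsilon>) \<le> num / real (c * T)" using cT by (simp add: pos_le_divide_eq)
  have "(1 + \<epsilon> / 8) * (real M * real (c * T)) \<le> (1 + \<epsilon>) * (real M * real (c * T))"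
    using \<epsilon> by (intro mult_right_mono) auto
  then have "num \<le> (1 + \<epsilon>) * real M * real (c * T)" using hi unfolding e by (simp add: mult.assoc)
  then have "num / real (c * T) \<le> (1 + \<epsilon>) * real M" using cT by (simp add: pos_divide_le_eq)
  with 1 show ?thesis by (simp add: approximates_def)
qed

text \<open>The counting program is run on the reference path before the graph is read. The result T
  moves to variable 35, while the colourings and the sieve tables survive for the rounds on the real
  graph.\<close>

lemma CORE_spec:
  assumes \<epsilon>: "0 < \<epsilon>" "\<epsilon> \<le> 1" and k: "2 \<le> v 2" and m: "v 1 = length es"
    and inp: "a 1 0 = 2 * length es"
      "\<And>i. i < length es \<Longrightarrow> a 0 (2 * i) = fst (es ! i) \<and> a 0 (2 * i + 1) = snd (es ! i)"
    and zero: "\<And>x. a 7 x = 0" "\<And>x. a 14 x = 0" and dist: "distinct (both_ways und es)"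
    and M: "card (simple_walks (set (both_ways und es)) (v 2)) = (if und then 2 else 1) * M"
    and post: "\<And>v' a' t' q K F n. n \<le> 2 * length es \<Longrightarrow> prime q \<Longrightarrow> v 2 \<le> K \<Longrightarrow> 1 \<le> F \<Longrightarrow>
      small_family \<epsilon> (v 2) q K F \<or> large_family (v 2) q K F \<Longrightarrow>
      0 < v' 1 \<Longrightarrow> approximates (1 + \<epsilon>) (real (v' 0) / real (v' 1)) M \<Longrightarrow>
      n = card (ends es) \<Longrightarrow>
      t' \<le> t + core_cost (v 2) q K F (digits_needed q n) n (length es) (length (both_ways und es)) \<Longrightarrow> Q v' a' t'"
  shows "wp (CORE \<epsilon> und) Q v a t"
proof -
  let ?k = "v 2" let ?es = "both_ways und es"
  let ?r6 = "wp (0 ::= V 33) (wp (1 ::= (if und then V 34 +. V 34 else V 34)) Q)"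
  let ?r5 = "wp SETUP (wp OUTER ?r6)"
  let ?r4 = "wp (35 ::= V 8) (wp (READ und) ?r5)"
  have k1: "1 \<le> ?k" using k by simp
  have "wp (SEL \<epsilon>) (wp TABLES (wp REF (wp CNT ?r4))) v a t"
  proof (rule SEL_spec[where v = v, OF \<epsilon> k1])
    fix v1 a1 t1 tb
    assume f1: "eqx (wv LARGE) v v1" "eqx (wa LARGE) a a1"
      and bal: "balanced_family \<epsilon> ?k (v1 3) (v1 4) (v1 5) tb"
      and fam: "small_family \<epsilon> ?k (v1 3) (v1 4) (v1 5) \<or> large_family ?k (v1 3) (v1 4) (v1 5)"
      and tb1: "\<And>i y. i < v1 5 \<Longrightarrow> y < v1 3 \<Longrightarrow> a1 2 (i * v1 3 + y) = tb i y"
      and t1: "t1 \<le> t + 50010 * (?k * v1 3 ^ 3 * v1 5)"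
    define q K F where "q = v1 3" "K = v1 4" "F = v1 5"
    note qKF = this
    have b: "prime q" "?k \<le> q" "?k \<le> K" "\<And>i x. i < F \<Longrightarrow> x < q \<Longrightarrow> tb i x < K" "0 < inj_count F tb {..<?k}"
      using bal unfolding balanced_family_def qKF[symmetric] by auto
    have F1: "1 \<le> F"
    proof (rule ccontr)
      assume "\<not> 1 \<le> F"
      then show False using b(5) by (simp add: inj_count_def)
    qed
    have q2: "2 \<le> q" using b(1) by (simp add: prime_ge_2_nat)
    have e1: "v1 2 = ?k" "v1 1 = length es" using eqxD[OF f1(1), of 1] eqxD[OF f1(1), of 2] m by simp_all
    have g1: "a1 7 = a 7" "a1 14 = a 14" "a1 0 = a 0" "a1 1 = a 1"
      using eqxD[OF f1(2), of 7] eqxD[OF f1(2), of 14] eqxD[OF f1(2), of 0] eqxD[OF f1(2), of 1] by simp_all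
    show "wp TABLES (wp REF (wp CNT ?r4)) v1 a1 t1"
    proof (rule TABLES_spec)
      show "1 \<le> v1 2" "v1 2 \<le> v1 4" using e1 k b(3) qKF by simp_all
      show "a1 7 x = 0" for x using g1 zero by simp
      fix v2 a2 t2
      assume f2: "eqx {9, 10} v1 v2" "eqx {9, 12} a1 a2" and st2: "sieve_tables v2 a2"
        and t2: "t2 \<le> t1 + 20 * (v1 4 * v1 2)"
      have e2: "v2 2 = ?k" "v2 3 = q" "v2 4 = K" "v2 5 = F" "v2 1 = length es"
        using eqxD[OF f2(1), of 1] eqxD[OF f2(1), of 2] eqxD[OF f2(1), of 3] eqxD[OF f2(1), of 4] eqxD[OF f2(1), of 5] e1 qKF
        by simp_all
      show "wp REF (wp CNT ?r4) v2 a2 t2"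
      proof (rule REF_spec)
        show "v2 2 \<le> v2 3" using e2 b(2) by simp
        fix v3 a3 t3
        assume f3: "eqx {6, 7, 9} v2 v3" "eqx {3, 4, 5} a2 a3" and gt3: "graph_tables v3 a3 (path_edges (v2 2))"
          and r3: "v3 6 = v2 2" "v3 7 = v2 2 - 1" "\<And>u. u < v2 2 \<Longrightarrow> a3 5 u = u" and t3: "t3 \<le> t2 + 5 * v2 2 + 4"
        have e3: "v3 2 = ?k" "v3 3 = q" "v3 4 = K" "v3 5 = F" "v3 1 = length es"
          using eqxD[OF f3(1), of 1] eqxD[OF f3(1), of 2] eqxD[OF f3(1), of 3] eqxD[OF f3(1), of 4] eqxD[OF f3(1), of 5] e2
          by simp_all
        have g3: "a3 2 = a1 2" "a3 14 = a 14" "a3 0 = a 0" "a3 1 = a 1" "a3 9 = a2 9" "a3 12 = a2 12" "a3 7 = a2 7"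
          using eqxD[OF f3(2), of 2] eqxD[OF f2(2), of 2] eqxD[OF f3(2), of 14] eqxD[OF f2(2), of 14]
            eqxD[OF f3(2), of 0] eqxD[OF f2(2), of 0] eqxD[OF f3(2), of 1] eqxD[OF f2(2), of 1]
            eqxD[OF f3(2), of 9] eqxD[OF f3(2), of 12] eqxD[OF f3(2), of 7] g1 by simp_all
        have st3: "sieve_tables v3 a3"
          by (rule sieve_tables_cong[OF st2]) (use e3 e2 g3 st2 in \<open>simp_all add: sieve_tables_def\<close>)
        have tb3: "a3 2 (i * q + y) = tb i y" if "i < F" "y < q" for i y
          using tb1 that g3 qKF by simp
        show "wp CNT ?r4 v3 a3 t3"
        proof (rule CNT_spec[OF st3 gt3, where tb = tb])
          show "a3 2 (i * v3 3 + y) = tb i y \<and> tb i y < v3 4" if "i < v3 5" "y < v3 3" for i y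
            using tb3 b(4) that e3 by simp
          fix v4 a4 t4
          assume f4: "eqx {8, 9, 10, 11, 12, 13, 14, 15, 16, 18, 19} v3 v4" "eqx {6, 7, 8, 10, 11, 17} a3 a4"
            and z4: "\<And>x. a4 7 x = 0"
            and v48: "v4 8 = (\<Sum>i<v3 5. colourful (set (path_edges (v2 2))) (v3 6) (v3 2) (\<lambda>u. tb i (a3 5 u)))"
            and t4: "t4 \<le> t3 + v3 5 * (node_cost (v3 4) (v3 2) (v3 6) (v3 7) + 2) + 4"
          let ?T = "inj_count F tb {..<?k}"
          have T: "v4 8 = ?T"
          proof -
            have "colourful (set (path_edges ?k)) ?k ?k (\<lambda>u. tb i (a3 5 u)) = of_bool (inj_on (tb i) {..<?k})" for i
            proof -
              have "colourful (set (path_edges ?k)) ?k ?k (\<lambda>u. tb i (a3 5 u)) = colourful (set (path_edges ?k)) ?k ?k (tb i)"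
                by (rule colourful_cong) (use r3(3) e2 in simp)
              then show ?thesis by (simp add: colourful_path[OF k1])
            qed
            then have "v4 8 = (\<Sum>i<F. of_bool (inj_on (tb i) {..<?k}))" using v48 e2 e3 r3 by simp
            also have "\<dots> = card ({..<F} \<inter> {i. inj_on (tb i) {..<?k}})"
              by (subst sum_of_bool_eq) simp_all
            also have "{..<F} \<inter> {i. inj_on (tb i) {..<?k}} = {i. i < F \<and> inj_on (tb i) {..<?k}}" by auto
            finally show ?thesis by (simp add: inj_count_def)
          qed
          have e4: "v4 2 = ?k" "v4 3 = q" "v4 4 = K" "v4 5 = F" "v4 1 = length es"
            using eqxD[OF f4(1), of 1] eqxD[OF f4(1), of 2] eqxD[OF f4(1), of 3] eqxD[OF f4(1), of 4] eqxD[OF f4(1), of 5] e3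
            by simp_all
          have g4: "a4 2 = a3 2" "a4 14 = a 14" "a4 0 = a 0" "a4 1 = a 1" "a4 9 = a3 9" "a4 12 = a3 12"
            using eqxD[OF f4(2), of 2] eqxD[OF f4(2), of 14] eqxD[OF f4(2), of 0] eqxD[OF f4(2), of 1]
              eqxD[OF f4(2), of 9] eqxD[OF f4(2), of 12] g3 by simp_all
          have "wp (READ und) ?r5 (v4(35 := ?T)) a4 (Suc t4)"
          proof (rule READ_spec[where es = es])
            fix v5 a5 t5 \<phi>
            assume f5: "eqx {6, 7, 9, 10, 11} (v4(35 := ?T)) v5" "eqx {3, 4, 14} a4 a5"
              and \<phi>: "inj_on \<phi> (ends es)" "v5 6 = card (ends es)" "\<phi> ` ends es \<subseteq> {..<v5 6}"
              and v57: "v5 7 = length ?es"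
              and me: "map (\<lambda>e. (a5 3 e, a5 4 e)) [0..<v5 7] = map (\<lambda>(x, y). (\<phi> x, \<phi> y)) ?es"
              and t5: "t5 \<le> Suc t4 + 14 * length es + 4"
            have e5: "v5 2 = ?k" "v5 3 = q" "v5 4 = K" "v5 5 = F" "v5 35 = ?T"
              using eqxD[OF f5(1), of 2] eqxD[OF f5(1), of 3] eqxD[OF f5(1), of 4] eqxD[OF f5(1), of 5] eqxD[OF f5(1), of 35] e4
              by simp_all
            have g5: "a5 2 = a3 2" "a5 9 = a3 9" "a5 12 = a3 12" "a5 7 = a4 7"
              using eqxD[OF f5(2), of 2] eqxD[OF f5(2), of 9] eqxD[OF f5(2), of 12] eqxD[OF f5(2), of 7] g4 by simp_all
            let ?n = "card (ends es)" let ?d = "digits_needed q ?n"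
            let ?E = "map (\<lambda>(x, y). (\<phi> x, \<phi> y)) ?es"
            show "?r5 v5 a5 t5"
            proof (rule SETUP_spec)
              show "2 \<le> v5 3" using e5 q2 by simp
              fix v6 a6 t6
              assume f6: "eqx {9, 27, 28, 29, 30, 31, 33, 34} v5 v6" "eqx {13} a5 a6"
                and s6: "v6 27 = v5 3 ^ digits_needed (v5 3) (v5 6)" "v6 31 = v5 3 * v5 3 * digits_needed (v5 3) (v5 6)"
                  "\<And>x. x < v5 3 ^ digits_needed (v5 3) (v5 6) \<Longrightarrow> a6 13 x = 1" "v6 33 = 0" "v6 34 = 0"
                and t6: "t6 \<le> t5 + 20 * v5 3 * digits_needed (v5 3) (v5 6) + 3 * v5 3 ^ digits_needed (v5 3) (v5 6) + 20"
              have e6: "v6 2 = ?k" "v6 3 = q" "v6 4 = K" "v6 5 = F" "v6 35 = ?T" "v6 6 = ?n" "v6 7 = length ?es"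
                using eqxD[OF f6(1), of 2] eqxD[OF f6(1), of 3] eqxD[OF f6(1), of 4] eqxD[OF f6(1), of 5] eqxD[OF f6(1), of 35]
                  eqxD[OF f6(1), of 6] eqxD[OF f6(1), of 7] e5 \<phi> v57 by simp_all
              have g6: "a6 2 = a3 2" "a6 9 = a3 9" "a6 12 = a3 12" "a6 7 = a4 7" "a6 3 = a5 3" "a6 4 = a5 4"
                using eqxD[OF f6(2), of 2] eqxD[OF f6(2), of 9] eqxD[OF f6(2), of 12] eqxD[OF f6(2), of 7]
                  eqxD[OF f6(2), of 3] eqxD[OF f6(2), of 4] g5 by simp_all
              show "wp OUTER ?r6 v6 a6 t6"
              proof (rule OUTER_spec[where d = ?d and tb = tb and es = ?E])
                show "prime (v6 3)" "v6 27 = v6 3 ^ ?d" "v6 6 \<le> v6 3 ^ ?d" "v6 33 = 0" "v6 34 = 0"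
                  using b(1) e6 s6 e5 \<phi>(2) digits_needed(2)[OF q2] by simp_all
                show "sieve_tables v6 a6"
                  by (rule sieve_tables_cong[OF st3]) (use e6 e3 g6 z4 in simp_all)
                show "edge_tables v6 a6 ?E"
                  unfolding edge_tables_def
                proof (intro conjI allI impI)
                  show eq: "?E = map (\<lambda>e. (a6 3 e, a6 4 e)) [0..<v6 7]" using me g6 e6 v57 by simp
                  have "inj_on (\<lambda>(x, y). (\<phi> x, \<phi> y)) (set ?es)"
                  proof (rule inj_onI)
                    fix e f assume ef: "e \<in> set ?es" "f \<in> set ?es" "(\<lambda>(x, y). (\<phi> x, \<phi> y)) e = (\<lambda>(x, y). (\<phi> x, \<phi> y)) f"
                    then have "fst e \<in> ends es" "snd e \<in> ends es" "fst f \<in> ends es" "snd f \<in> ends es"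
                      using ends_both_ways[of und es] by blast+
                    then have "fst e = fst f" "snd e = snd f" using ef(3) \<phi>(1) by (auto simp: split_def dest: inj_onD)
                    then show "e = f" by (rule prod_eqI)
                  qed
                  then show "distinct ?E" using dist by (simp add: distinct_map)
                  fix e assume "e < v6 7"
                  then have "(a6 3 e, a6 4 e) \<in> set ?E" unfolding eq by simp
                  then obtain x y where xy: "(x, y) \<in> set ?es" "a6 3 e = \<phi> x" "a6 4 e = \<phi> y" by auto
                  then have "fst (x, y) \<in> ends es" "snd (x, y) \<in> ends es" using ends_both_ways[of und es] by blast+
                  then show "a6 3 e < v6 6" "a6 4 e < v6 6" using xy \<phi>(2,3) e6 by auto
                qed
                show "a6 2 (i * v6 3 + y) = tb i y \<and> tb i y < v6 4" if "i < v6 5" "y < v6 3" for i y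
                  using tb3 b(4) that e6 g6 by simp
                show "a6 13 x = 1" if "x < v6 3 ^ ?d" for x using s6(3) that e6 e5 \<phi>(2) by simp
                fix v7 :: vars and a7 :: arrays and t7 hs
                assume hs: "length hs = v6 31" and gs: "greedy_state (v6 3) ?d hs (a7 13)"
                  and num: "v7 33 = (\<Sum>h\<leftarrow>hs. \<Sum>i<v6 5. colourful (set ?E) (v6 6) (v6 2) (\<lambda>u. tb i (h u)))"
                  and den: "v7 34 = v6 31 * v6 35"
                  and t7: "t7 \<le> t6 + v6 31 * (round_cost (v6 3) ?d (v6 5) (v6 4) (v6 2) (v6 6) (v6 7) + 2) + 2"
                have h: "length hs = q * q * ?d" using hs s6 e5 \<phi>(2) by simp
                have d1: "1 \<le> ?d" by (rule digits_needed(1)[OF q2])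
                have gs': "greedy_state q ?d hs (a7 13)" using gs e6 by simp
                have lin: "\<exists>c. h = lin q ?d c" if "h \<in> set hs" for h
                  using gs' that by (simp add: greedy_state_def)
                have pot: "q ^ length hs * (\<Sum>x\<in>{1..<q ^ ?d}. 2 ^ zero_count hs x) \<le> (q + 1) ^ length hs * q ^ ?d"
                proof -
                  have "(\<Sum>x\<in>{1..<q ^ ?d}. a7 13 x) = (\<Sum>x\<in>{1..<q ^ ?d}. 2 ^ zero_count hs x)"
                    by (rule sum.cong) (use gs' in \<open>simp_all add: greedy_state_def\<close>)
                  then show ?thesis using gs' by (simp add: greedy_state_def)
                qed
                have zc: "zero_count hs z \<le> 3 * (q * ?d)" if "1 \<le> z" "z < q ^ ?d" for z
                  by (rule zero_count_bound[OF q2 h pot that])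
                let ?R = "card {p \<in> walks (set ?E) ?k (\<lambda>v. v < ?n). distinct p}"
                have R: "?R = (if und then 2 else 1) * M"
                  using card_simple_walks_map[OF \<phi>(1) _ _ k, of ?n "set ?es"] ends_both_ways[of und es] \<phi>(2,3) M by simp
                have bal': "balanced_family \<epsilon> ?k q K F tb" using bal qKF by simp
                have nd: "?n \<le> q ^ ?d" by (rule digits_needed(2)[OF q2])
                have num': "v7 33 = (\<Sum>h\<leftarrow>hs. \<Sum>i<F. colourful (set ?E) ?n ?k (\<lambda>u. tb i (h u)))"
                  using num e6 by simp
                note est = estimate_bounds[OF bal' \<epsilon> h lin zc nd, of "set ?E", folded num']
                let ?c = "if und then 2 else 1 :: nat" let ?FT = "q * q * ?d * ?T"
                have FT: "0 < ?FT" using q2 d1 b(5) by simp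
                have ap: "approximates (1 + \<epsilon>) (real (v7 33) / real (?c * ?FT)) M"
                  by (rule approximation_from_bounds[OF \<epsilon> FT _ R]) (use est h in simp_all)
                have den': "(if und then v7 34 + v7 34 else v7 34) = ?c * ?FT" using den s6 e5 e6 \<phi>(2) by simp
                have "Q (v7(0 := v7 33, 1 := ?c * ?FT)) a7 (Suc (Suc t7))"
                proof (rule post[OF card_ends_le b(1) b(3) F1])
                  show "small_family \<epsilon> ?k q K F \<or> large_family ?k q K F" using fam qKF by simp
                  show "0 < (v7(0 := v7 33, 1 := ?c * ?FT)) 1" using FT by simp
                  show "approximates (1 + \<epsilon>) (real ((v7(0 := v7 33, 1 := ?c * ?FT)) 0) / real ((v7(0 := v7 33, 1 := ?c * ?FT)) 1)) M"
                    using ap by simp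
                  have "t1 \<le> t + 50010 * (?k * q ^ 3 * F)" using t1 by (simp only: qKF)
                  moreover have "t2 \<le> t1 + 20 * (K * ?k)" using t2 by (simp only: qKF e1)
                  moreover have "t3 \<le> t2 + 5 * ?k + 4" using t3 by (simp only: e2)
                  moreover have "t4 \<le> t3 + F * (node_cost K ?k ?k (?k - 1) + 2) + 4" using t4 by (simp only: e3 r3 e2)
                  moreover have "t5 \<le> Suc t4 + 14 * length es + 4" by (fact t5)
                  moreover have "t6 \<le> t5 + 20 * q * ?d + 3 * q ^ ?d + 20" using t6 by (simp only: e5 \<phi>(2))
                  moreover have "t7 \<le> t6 + q * q * ?d * (round_cost q ?d F K ?k ?n (length ?es) + 2) + 2"
                    using t7 by (simp only: e6 s6(2) e5 \<phi>(2))
                  ultimately show "Suc (Suc t7) \<le> t + core_cost ?k q K F ?d ?n (length es) (length ?es)"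
                    unfolding core_cost_def by linarith
                qed simp
                then have "Q (v7(0 := v7 33, 1 := (if und then v7 34 + v7 34 else v7 34))) a7 (Suc (Suc t7))"
                  by (simp only: den')
                moreover have "ev (if und then V 34 +. V 34 else V 34) (v7(0 := v7 33)) a7 = (if und then v7 34 + v7 34 else v7 34)"
                  by simp
                ultimately show "?r6 v7 a7 t7" by (simp only: wp_Asn ev.simps(2))
              qed
            qed
          qed (use e4 g4 inp zero in simp_all)
          then show "?r4 v4 a4 t4" using T by simp
        qed
      qed
    qed
  qed
  then show ?thesis by (simp add: CORE_def)
qed

subsection \<open>Running time\<close>

text \<open>With x = k/K \<le> 1 each set of size at most k has x^|X| \<ge> x^k, so the number is at
  most x^(-k) (1 + x)^K \<le> x^(-k) e^k.\<close>

lemma set_count_le: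
  assumes "1 \<le> k" "k \<le> K"
  shows "real (set_count K k) \<le> (3 * real K / real k) ^ k"
proof -
  let ?S = "{X. X \<subseteq> {..<K} \<and> X \<noteq> {} \<and> card X \<le> k}" and ?x = "real k / real K"
  have x: "0 < ?x" "?x \<le> 1" using assms by auto
  have "real (card ?S) * ?x ^ k = (\<Sum>X\<in>?S. ?x ^ k)" by simp
  also have "\<dots> \<le> (\<Sum>X\<in>?S. ?x ^ card X)"
    by (intro sum_mono power_decreasing) (use x in auto)
  also have "\<dots> \<le> (\<Sum>X\<in>Pow {..<K}. ?x ^ card X)" by (intro sum_mono2) (use x in auto)
  also have "\<dots> = (1 + ?x) ^ K" by (simp add: sum_Pow_power)
  also have "\<dots> \<le> exp ?x ^ K" by (intro power_mono) (use x in auto)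
  also have "\<dots> = exp 1 ^ k" using assms by (simp add: exp_of_nat_mult[symmetric])
  also have "\<dots> \<le> 3 ^ k" by (intro power_mono exp_le) auto
  finally have "real (card ?S) \<le> 3 ^ k / ?x ^ k" using x by (simp add: pos_le_divide_eq)
  then show ?thesis by (simp add: set_count_def power_divide[symmetric])
qed

lemma choose_le_set_count:
  assumes "1 \<le> k"
  shows "K choose k \<le> set_count K k"
proof -
  have "K choose k = card {X. X \<subseteq> {..<K} \<and> card X = k}" using n_subsets[of "{..<K}" k] by simp
  also have "\<dots> \<le> set_count K k" unfolding set_count_def
    by (rule card_mono) (use assms in \<open>auto intro: finite_subset[of _ "Pow {..<K}"]\<close>)
  finally show ?thesis .
qed

lemma set_count_pos: "1 \<le> k \<Longrightarrow> k \<le> K \<Longrightarrow> 1 \<le> set_count K k"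
  using choose_le_set_count[of k K] zero_less_binomial[of k K] by linarith

text \<open>If d > 1 then q^(d-1) < n by minimality, so q^d overshoots n by at most a factor q. The
  bound on d is in terms of |V|, the other one in terms of the nonisolated vertices.\<close>

lemma digits_needed_le:
  assumes q: "2 \<le> q" and n: "1 \<le> n" "n \<le> nv" "2 \<le> nv"
  shows "q ^ digits_needed q n \<le> q * n" "real (digits_needed q n) \<le> 2 * log 2 (real nv)"
proof -
  let ?d = "digits_needed q n"
  have l: "1 \<le> log 2 (real nv)" using n(3) by simp
  show "q ^ ?d \<le> q * n" "real ?d \<le> 2 * log 2 (real nv)"
  proof (atomize(full), cases "?d = 1")
    case True
    then show "q ^ ?d \<le> q * n \<and> real ?d \<le> 2 * log 2 (real nv)" using n(1) l by simp
  next
    case False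
    then obtain e where e: "?d = Suc e" "1 \<le> e" using digits_needed(1)[OF q, of n] by (cases ?d) auto
    then have lt: "q ^ e < n" using digits_needed(3)[OF q, of e n] by simp
    have "2 ^ e \<le> q ^ e" using q by (intro power_mono) auto
    then have "2 ^ e \<le> nv" using lt n(2) by linarith
    then have "2 ^ e \<le> real nv" using of_nat_le_iff[of "2 ^ e" nv, where 'a = real] by simp
    then have "real e \<le> log 2 (real nv)" using n(3) by (simp add: le_log_iff powr_realpow)
    then show "q ^ ?d \<le> q * n \<and> real ?d \<le> 2 * log 2 (real nv)" using lt e l by simp
  qed
qed

text \<open>Every summand is absorbed into one monomial. The dominant term is q^2 d rounds times
  O(q^2 F Y^2 k m): filling the hash tables costs O(q q^d) = O(q^2 m), and Y^2 is the number of
  colour sets times a weight of at most Y.\<close>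

lemma core_cost_le:
  assumes k: "1 \<le> k" "k \<le> K" and q: "1 \<le> q" and F: "1 \<le> F" and m: "1 \<le> m" and d: "1 \<le> d"
    and n: "n \<le> 2 * m" "ne \<le> 2 * m" "q ^ d \<le> q * n"
  defines "Y \<equiv> set_count K k"
  shows "core_cost k q K F d n m ne \<le> 51000 * (q ^ 4 * F * Y\<^sup>2 * k\<^sup>2 * K * m * d)"
proof -
  let ?B = "K choose k"
  have Y: "1 \<le> Y" "?B \<le> Y" unfolding Y_def using set_count_pos[OF k] choose_le_set_count[OF k(1)] by simp_all
  have K: "1 \<le> K" using k by linarith
  have pos: "1 \<le> x * y" if "1 \<le> x" "1 \<le> (y::nat)" for x y using mult_le_mono[OF that] by simp
  have le1: "x \<le> x * y" if "1 \<le> y" for x y :: nat using mult_le_mono2[OF that, of x] by simp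
  have le2: "x \<le> y * x" if "1 \<le> y" for x y :: nat using mult_le_mono1[OF that, of x] by simp
  let ?N = "Y * Y * k * m"
  have N: "1 \<le> ?N" "Y * (k * m) \<le> ?N" "Y * Y \<le> ?N" "Y \<le> ?N" "m \<le> ?N"
  proof -
    show "1 \<le> ?N" by (intro pos Y k m)
    have "Y * (k * m) \<le> Y * (Y * (k * m))" by (intro mult_le_mono2 le2 Y)
    then show "Y * (k * m) \<le> ?N" by (simp add: mult.assoc)
    show YY: "Y * Y \<le> ?N" using le1[OF pos[OF k(1) m], of "Y * Y"] by (simp add: mult.assoc)
    show "Y \<le> ?N" using le1[OF Y(1), of Y] YY by linarith
    show "m \<le> ?N" by (intro le2 pos Y k)
  qed
  have nc: "node_cost K k n ne \<le> 137 * ?N"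
  proof -
    have "n + ne + 1 \<le> 5 * m" using n m by linarith
    then have "20 * (k * (n + ne + 1)) + 3 * ?B + 18 \<le> 20 * (k * (5 * m)) + 3 * Y + 18"
      using Y(2) by (intro add_mono mult_le_mono) auto
    then have "Y * (20 * (k * (n + ne + 1)) + 3 * ?B + 18) \<le> Y * (20 * (k * (5 * m)) + 3 * Y + 18)"
      by (rule mult_le_mono2)
    also have "\<dots> = 100 * (Y * (k * m)) + 3 * (Y * Y) + 18 * Y" by (simp add: algebra_simps)
    finally show ?thesis unfolding node_cost_def Y_def[symmetric] using n N by linarith
  qed
  let ?M = "Y * Y * (k * k)"
  have nc': "node_cost K k k (k - 1) \<le> 74 * ?M"
  proof -
    have "k + (k - 1) + 1 = 2 * k" using k by simp
    then have "Y * (20 * (k * (k + (k - 1) + 1)) + 3 * ?B + 18) \<le> Y * (20 * (k * (2 * k)) + 3 * Y + 18)"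
      using Y(2) by (intro mult_le_mono2 add_mono mult_le_mono) auto
    also have "\<dots> = 40 * (Y * (k * k)) + 3 * (Y * Y) + 18 * Y" by (simp add: algebra_simps)
    finally have 1: "node_cost K k k (k - 1) \<le> 40 * (Y * (k * k)) + 3 * (Y * Y) + 18 * Y + 3 * k + 10"
      unfolding node_cost_def Y_def[symmetric] by linarith
    have "Y * (k * k) \<le> Y * (Y * (k * k))" by (intro mult_le_mono2 le2 Y)
    moreover have YY: "Y * Y \<le> ?M" by (intro le1 pos k)
    moreover have "Y \<le> ?M" using le1[OF Y(1), of Y] YY by linarith
    moreover have "k \<le> ?M" using le1[OF k(1), of k] le2[OF pos[OF Y(1) Y(1)], of "k * k"] by linarith
    moreover have "1 \<le> ?M" by (intro pos Y k)
    ultimately show ?thesis using 1 unfolding mult.assoc by linarith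
  qed
  let ?R = "q * q * F * ?N"
  have rc: "round_cost q d F K k n ne \<le> 361 * ?R"
  proof -
    have "q * q ^ d \<le> q * (q * (2 * m))" using n(1,3) by (intro mult_le_mono2) (meson le_trans mult_le_mono2)
    moreover have "q * (q * (2 * m)) \<le> 2 * ?R"
    proof -
      have "q * q * m \<le> q * q * (F * ?N)" by (intro mult_le_mono2 order_trans[OF N(5)] le2 F)
      then show ?thesis by (simp add: mult.assoc)
    qed
    moreover have "F * (node_cost K k n ne + 2) \<le> F * (139 * ?N)" using nc N by (intro mult_le_mono2) linarith
    moreover have "F * (139 * ?N) \<le> 139 * ?R"
    proof -
      have "F * ?N \<le> q * q * (F * ?N)" by (intro le2 pos q)
      then show ?thesis by (simp add: mult.assoc mult.left_commute)
    qed
    moreover have "1 \<le> ?R" by (intro pos q F Y k m)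
    ultimately show ?thesis unfolding round_cost_def mult.assoc by linarith
  qed
  let ?Z = "q ^ 4 * F * Y\<^sup>2 * k\<^sup>2 * K * m * d"
  have Zq: "?Z = (q * q * d) * ?R * (k * K)" by (simp add: power2_eq_square power4_eq_xxxx mult_ac)
  have Z1: "?R * (q * q * d) \<le> ?Z" unfolding Zq using le1[OF pos[OF k(1) K], of "?R * (q * q * d)"] by (simp add: mult_ac)
  have R1: "1 \<le> ?R" by (intro pos q F Y k m)
  have D1: "1 \<le> q * q * d" by (intro pos q d)
  have Z0: "1 \<le> ?Z" unfolding Zq by (intro pos q F Y k m d K)
  have Za: "k * q ^ 3 * F \<le> ?Z"
  proof -
    have "q ^ 4 = q ^ 3 * q" by (simp add: power4_eq_xxxx power3_eq_cube)
    then have "?Z = (k * q ^ 3 * F) * (q * (Y * Y) * k * K * m * d)"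
      unfolding power2_eq_square by (simp only: mult_ac)
    moreover have "1 \<le> q * (Y * Y) * k * K * m * d" by (intro pos q Y k m d K)
    ultimately show ?thesis using le1 by metis
  qed
  have Zb: "K * k \<le> ?Z" "k \<le> ?Z"
  proof -
    have e: "?Z = (K * k) * ((q * q * d) * ?R)" unfolding Zq by (simp only: mult_ac)
    show "K * k \<le> ?Z" unfolding e by (intro le1 pos D1 R1)
    then show "k \<le> ?Z" using le2[OF K, of k] by linarith
  qed
  have Zc: "F * ?M \<le> ?Z"
  proof -
    have e: "?Z = (F * ?M) * (q * q * (q * q) * K * m * d)"
      unfolding power2_eq_square power4_eq_xxxx by (simp only: mult_ac)
    show ?thesis unfolding e by (intro le1 pos q K m d)
  qed
  have Zd: "m \<le> ?Z" "q * d \<le> ?Z" "q * m \<le> ?Z"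
  proof -
    have mR: "q * m \<le> ?R"
    proof -
      have "q * m \<le> q * (q * (F * ?N))" by (intro mult_le_mono2 order_trans[OF N(5)] le2 order_trans[OF _ le2]) (use q F in auto)
      then show ?thesis by (simp add: mult.assoc)
    qed
    have "?R \<le> ?Z" using Z1 le1[OF D1, of ?R] by linarith
    then show "q * m \<le> ?Z" using mR by linarith
    then show "m \<le> ?Z" using le2[OF q, of m] by linarith
    have "q * d \<le> q * (q * d)" by (intro mult_le_mono2 le2 q)
    then have "q * d \<le> ?R * (q * q * d)" using le2[OF R1, of "q * q * d"] by (simp add: mult.assoc)
    then show "q * d \<le> ?Z" using Z1 by linarith
  qed
  have "F * (node_cost K k k (k - 1) + 2) \<le> F * (76 * ?M)"
  proof (rule mult_le_mono2)
    have "1 \<le> ?M" by (intro pos Y k)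
    then show "node_cost K k k (k - 1) + 2 \<le> 76 * ?M" using nc' by linarith
  qed
  also have "F * (76 * ?M) = 76 * (F * ?M)" by (simp only: mult_ac)
  also have "\<dots> \<le> 76 * ?Z" by (rule mult_le_mono2[OF Zc])
  finally have T1: "F * (node_cost K k k (k - 1) + 2) \<le> 76 * ?Z" .
  have "q * q * d * (round_cost q d F K k n ne + 2) \<le> q * q * d * (363 * ?R)"
    using rc R1 by (intro mult_le_mono2) linarith
  also have "\<dots> = 363 * (?R * (q * q * d))" by (simp add: mult_ac)
  finally have T2: "q * q * d * (round_cost q d F K k n ne + 2) \<le> 363 * ?Z" using Z1 by linarith
  have "q ^ d \<le> q * (2 * m)" using n(1,3) by (meson le_trans mult_le_mono2)
  also have "q * (2 * m) = 2 * (q * m)" by (simp only: mult_ac)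
  also have "\<dots> \<le> 2 * ?Z" by (rule mult_le_mono2[OF Zd(3)])
  finally have T3: "3 * q ^ d \<le> 6 * ?Z" by linarith
  show ?thesis
    unfolding core_cost_def using Za Zb Zd T1 T2 T3 Z0 by linarith
qed

lemma power_le_two_powr:
  assumes "0 \<le> x" "x \<le> 2 powr y"
  shows "x ^ j \<le> 2 powr (real j * y)"
proof -
  have "x ^ j \<le> (2 powr y) ^ j" using assms by (intro power_mono) auto
  then show ?thesis by (simp add: powr_realpow[symmetric] powr_powr mult.commute)
qed

lemma nat_le_two_powr: "real k \<le> 2 powr real k"
  using of_nat_le_iff[of k "2 ^ k", where 'a = real] less_exp[of k] by (simp add: powr_realpow)

lemma loglog1_ge: "1 \<le> loglog1 k" "1 \<le> log1 k"
  by (simp_all add: loglog1_def log1_def)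

text \<open>F contains another factor q, so the cost grows like q^5; as q = O((k^2 / \<epsilon>)^2)
  this gives \<epsilon>^(-10), and the explicit 1 / \<epsilon>^2 in F makes it \<epsilon>^(-12).
  Since \<epsilon> \<le> 1 \<le> \<open>log1 k\<close>, this is below \<epsilon>^(-12
  \<open>log1 k\<close>).\<close>

lemma small_family_cost:
  assumes \<epsilon>: "0 < \<epsilon>" "\<epsilon> \<le> 1" and k: "1 \<le> k" and fam: "small_family \<epsilon> k q K F"
  shows "real (q ^ 4 * F * (set_count K k)\<^sup>2 * k\<^sup>2 * K) \<le>
    4 * 2000 ^ 5 * 100\<^sup>2 * (2 powr (1500 * (real k * loglog1 k)) / \<epsilon> powr (12 * log1 k))"
proof -
  let ?k = "real k"
  have K: "K = 2 * k" and q: "real q \<le> 2000 * (?k ^ 2 / \<epsilon>)\<^sup>2" and F: "real F \<le> 2 ^ k * (?k + 1) * real q * (100 / \<epsilon>)\<^sup>2"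
    using fam by (auto simp: small_family_def)
  have k1: "1 \<le> ?k" using k by simp
  have Y: "real (set_count K k) \<le> 6 ^ k" using set_count_le[of k K] k by (simp add: K)
  have Y2: "(real (set_count K k))\<^sup>2 \<le> 36 ^ k"
  proof -
    have "(real (set_count K k))\<^sup>2 \<le> (6 ^ k)\<^sup>2" using Y by (intro power_mono) auto
    then show ?thesis by (simp add: power_mult[symmetric] mult.commute[of k] power_mult)
  qed
  have p72: "(72::real) ^ k = 2 ^ k * 36 ^ k" by (simp add: power_mult_distrib[symmetric])
  have F': "real F \<le> 2 ^ k * (2 * ?k) * real q * (100 / \<epsilon>)\<^sup>2"
    by (rule order_trans[OF F]) (use k1 in \<open>intro mult_right_mono mult_left_mono, auto\<close>)
  have "real (q ^ 4 * F * (set_count K k)\<^sup>2 * k\<^sup>2 * K) = real q ^ 4 * real F * (real (set_count K k))\<^sup>2 * (?k\<^sup>2 * (2 * ?k))"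
    by (simp add: K)
  also have "\<dots> \<le> real q ^ 4 * (2 ^ k * (2 * ?k) * real q * (100 / \<epsilon>)\<^sup>2) * 36 ^ k * (?k\<^sup>2 * (2 * ?k))"
    using F' Y2 by (intro mult_mono) auto
  also have "real q ^ 4 * (2 ^ k * (2 * ?k) * real q * (100 / \<epsilon>)\<^sup>2) * 36 ^ k * (?k\<^sup>2 * (2 * ?k)) = real q ^ 5 * (4 * 100\<^sup>2 * (72 ^ k * ?k ^ 4 * (1 / \<epsilon>) ^ 2))"
    unfolding p72 by (simp add: power_divide eval_nat_numeral)
  also have "\<dots> \<le> (2000 * (?k ^ 2 / \<epsilon>)\<^sup>2) ^ 5 * (4 * 100\<^sup>2 * (72 ^ k * ?k ^ 4 * (1 / \<epsilon>) ^ 2))"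
    using q by (intro mult_right_mono power_mono) auto
  also have "\<dots> = 4 * 2000 ^ 5 * 100\<^sup>2 * (72 ^ k * ?k ^ 24 * (1 / \<epsilon>) ^ 12)"
  proof -
    have "(2000 * (?k ^ 2 / \<epsilon>)\<^sup>2) ^ 5 = 2000 ^ 5 * (?k ^ 20 * (1 / \<epsilon>) ^ 10)"
      by (simp add: power_mult_distrib power_divide power_mult[symmetric])
    moreover have "?k ^ 24 = ?k ^ 20 * ?k ^ 4" "(1 / \<epsilon>) ^ 12 = (1 / \<epsilon>) ^ 10 * (1 / \<epsilon>) ^ 2"
      by (simp_all only: power_add[symmetric]) simp_all
    ultimately show ?thesis by (simp only: mult_ac)
  qed
  also have "\<dots> \<le> 4 * 2000 ^ 5 * 100\<^sup>2 * (2 powr (1500 * (?k * loglog1 k)) / \<epsilon> powr (12 * log1 k))"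
  proof (rule mult_left_mono)
    have "(72::real) ^ k \<le> 2 powr (?k * 7)" by (rule power_le_two_powr) auto
    moreover have "?k ^ 24 \<le> 2 powr (real 24 * ?k)" by (rule power_le_two_powr[OF _ nat_le_two_powr]) simp
    ultimately have "72 ^ k * ?k ^ 24 \<le> 2 powr (?k * 7) * 2 powr (real 24 * ?k)" by (intro mult_mono) auto
    also have "\<dots> = 2 powr (31 * ?k)" by (simp add: powr_add[symmetric])
    also have "\<dots> \<le> 2 powr (1500 * (?k * loglog1 k))"
    proof (rule powr_mono)
      have "?k * 1 \<le> ?k * loglog1 k" using loglog1_ge[of k] by (intro mult_left_mono) auto
      then show "31 * ?k \<le> 1500 * (?k * loglog1 k)" using k1 by linarith
    qed simp
    finally have A: "72 ^ k * ?k ^ 24 \<le> 2 powr (1500 * (?k * loglog1 k))" .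
    have "\<epsilon> powr (12 * log1 k) \<le> \<epsilon> powr 12" using \<epsilon> loglog1_ge(2)[of k] by (intro powr_mono') auto
    then have "1 / \<epsilon> powr 12 \<le> 1 / \<epsilon> powr (12 * log1 k)" using \<epsilon> by (intro divide_left_mono) auto
    moreover have "\<epsilon> powr 12 = \<epsilon> ^ 12" using \<epsilon> powr_realpow[of \<epsilon> 12] by simp
    ultimately have "(1 / \<epsilon>) ^ 12 \<le> 1 / \<epsilon> powr (12 * log1 k)" by (simp add: power_divide)
    then have "72 ^ k * ?k ^ 24 * (1 / \<epsilon>) ^ 12 \<le> 2 powr (1500 * (?k * loglog1 k)) * (1 / \<epsilon> powr (12 * log1 k))"
      using A \<epsilon> by (intro mult_mono) auto
    then show "72 ^ k * ?k ^ 24 * (1 / \<epsilon>) ^ 12 \<le> 2 powr (1500 * (?k * loglog1 k)) / \<epsilon> powr (12 * log1 k)" by simp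
  qed simp
  finally show ?thesis .
qed

text \<open>q \<le> 8 16^(2L) \<le> 2^(11 L) and D L < 128 k + L give q^(4 + D) \<le> 2^(11 133 k) =
  2^(1463 k). The square of the number of colour sets is at most (6 L)^(2k) \<le> 2^(10 k log log
  k), and the remaining factors are at most 2 k^4 \<le> 2 2^(4k). No power of 1 / \<epsilon>
  occurs.\<close>

lemma large_family_cost:
  assumes fam: "large_family k q K F" and q: "1 \<le> q"
  shows "real (q ^ 4 * F * (set_count K k)\<^sup>2 * k\<^sup>2 * K) \<le> 2 * 2 powr (1500 * (real k * loglog1 k))"
proof -
  define L where "L = digits_needed 2 k"
  let ?k = "real k" let ?l = "loglog1 k"
  obtain D where k: "8 \<le> k" and K: "K = 2 * k * L" and q': "q \<le> 8 * 16 ^ (2 * L)" and F: "F = q ^ D" and D: "D * L < 128 * k + L"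
    using fam unfolding large_family_def Let_def L_def by blast
  have L1: "1 \<le> L" unfolding L_def by (rule digits_needed(1)) simp
  have k2: "2 \<le> k" using k by simp
  have L: "real L \<le> log 2 ?k + 1" "L \<le> k" using log_digits[OF k2] unfolding L_def by auto
  have kl: "?k \<le> ?k * ?l" using loglog1_ge(1)[of k] mult_left_mono[of 1 ?l ?k] by simp
  have "8 * 16 ^ (2 * L) = (2::real) ^ (3 + 8 * L)" by (simp add: power_add power_mult)
  also have "\<dots> \<le> 2 ^ (11 * L)" using L1 by (intro power_increasing) auto
  finally have q2: "8 * 16 ^ (2 * L) \<le> (2::real) ^ (11 * L)" .
  have "real q \<le> 8 * 16 ^ (2 * L)" using of_nat_mono[OF q', where 'a = real] by simp
  then have "real q \<le> 2 ^ (11 * L)" using q2 by (rule order_trans)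
  then have "real q ^ (4 + D) \<le> (2 ^ (11 * L)) ^ (4 + D)" by (intro power_mono) auto
  also have "\<dots> = 2 ^ (11 * (4 * L + D * L))" by (simp add: power_mult[symmetric] algebra_simps)
  also have "\<dots> \<le> 2 ^ (1463 * k)" using D L(2) by (intro power_increasing) auto
  also have "(2::real) ^ (1463 * k) = 2 powr (1463 * ?k)" using powr_realpow[of 2 "1463 * k"] by simp
  finally have A: "real q ^ 4 * real F \<le> 2 powr (1463 * ?k)" by (simp add: F power_add)
  have lk: "1 \<le> log 2 ?k" using k by simp
  have "real (set_count K k) \<le> (3 * real K / ?k) ^ k" using set_count_le[of k K] k L1 by (simp add: K)
  also have "3 * real K / ?k = 6 * real L" using k by (simp add: K)
  also have "(6 * real L) ^ k \<le> 2 powr (?k * (5 * ?l))"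
  proof (rule power_le_two_powr)
    have "6 * real L \<le> 12 * log1 k" using L(1) lk by (simp add: log1_def)
    also have "\<dots> \<le> 2 powr 4 * 2 powr (log 2 (log1 k))" using loglog1_ge(2)[of k] by simp
    also have "\<dots> = 2 powr (4 + log 2 (log1 k))" by (simp add: powr_add)
    also have "\<dots> \<le> 2 powr (5 * ?l)"
      using loglog1_ge(1)[of k] by (intro powr_mono) (auto simp: loglog1_def)
    finally show "6 * real L \<le> 2 powr (5 * ?l)" .
  qed simp
  finally have "(real (set_count K k))\<^sup>2 \<le> 2 powr (real 2 * (?k * (5 * ?l)))" by (intro power_le_two_powr) auto
  then have B: "(real (set_count K k))\<^sup>2 \<le> 2 powr (10 * (?k * ?l))" by (simp add: mult_ac)
  have "?k\<^sup>2 * real K \<le> 2 * ?k ^ 4"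
  proof -
    have "?k\<^sup>2 * real K = 2 * (?k ^ 3 * real L)" by (simp add: K power2_eq_square power3_eq_cube)
    also have "\<dots> \<le> 2 * (?k ^ 3 * ?k)" using L(2) by (intro mult_left_mono) auto
    finally show ?thesis by (simp add: eval_nat_numeral)
  qed
  also have "?k ^ 4 \<le> 2 powr (real 4 * ?k)" by (rule power_le_two_powr[OF _ nat_le_two_powr]) simp
  finally have C: "?k\<^sup>2 * real K \<le> 2 * 2 powr (4 * ?k)" by simp
  have "real (q ^ 4 * F * (set_count K k)\<^sup>2 * k\<^sup>2 * K) = (real q ^ 4 * real F) * (real (set_count K k))\<^sup>2 * (?k\<^sup>2 * real K)"
    by simp
  also have "\<dots> \<le> 2 powr (1463 * ?k) * 2 powr (10 * (?k * ?l)) * (2 * 2 powr (4 * ?k))"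
    by (rule mult_mono[OF mult_mono[OF A B] C]) simp_all
  also have "\<dots> = 2 * 2 powr (1463 * ?k + 10 * (?k * ?l) + 4 * ?k)" unfolding powr_add by (simp only: mult_ac)
  also have "\<dots> \<le> 2 * 2 powr (1500 * (?k * ?l))"
  proof (intro mult_left_mono powr_mono)
    have "0 \<le> ?k" by simp
    then show "1463 * ?k + 10 * (?k * ?l) + 4 * ?k \<le> 1500 * (?k * ?l)" using kl by linarith
  qed simp_all
  finally show ?thesis .
qed

lemma ALG_ok: "com_ok 100 (ALG \<epsilon> und)"
proof -
  have "com_ok 100 LARGE"
    by (simp add: LARGE_def LOG_def PRIME_def IS_PRIME_def DIVIDES_def DEGREE_def POLYS_def POLY_ROUND_def
        POLY_ROW_def NEXT_POWER_def COLOURS_def)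
  moreover have "com_ok 100 (SMALL \<epsilon> i)" for i
    by (simp add: SMALL_def HARD_def STORES_ok split: prod.split)
  ultimately have "com_ok 100 (SEL \<epsilon>)" unfolding SEL_def by (intro SELECT_ok) simp_all
  moreover have "com_ok 100 CNT" by (simp add: CNT_def CNT_BODY_def WALK_ROUND_def WALK_def NODE_def PUSH_def POP_def DFS_LOOP_def DFS_def )
  moreover have "com_ok 100 TABLES" "com_ok 100 REF" by (simp_all add: TABLES_def REF_def)
  moreover have "com_ok 100 (READ und)" by (simp add: READ_def READ_EDGE_def LABEL_def)
  moreover have "com_ok 100 SETUP" by (simp add: SETUP_def GROW_def)
  moreover have "com_ok 100 HASH" "com_ok 100 DOUBLE"
    by (simp_all add: HASH_def BLOCK_def FILL_def DOUBLE_def)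
  ultimately show ?thesis by (simp add: ALG_def CORE_def OUTER_def ROUND_def)
qed

abbreviation cost_factor :: real where
  "cost_factor \<equiv> 4 * 2000 ^ 5 * 100\<^sup>2"

text \<open>A unit of cost takes at most 100 machine steps; the 2 are the tests of
  \<open>ALG\<close>, the 4 the prologue and epilogue. So 5100204 = 100 51000 + 204, and 11000000
  also covers the factor 2 in d \<le> 2 log |V|.\<close>

lemma core_time_le:
  assumes \<epsilon>: "0 < \<epsilon>" "\<epsilon> \<le> 1" and k: "1 \<le> k" "k \<le> K" and q: "prime q" and F: "1 \<le> F"
    and fam: "small_family \<epsilon> k q K F \<or> large_family k q K F"
    and m: "1 \<le> m" "ne \<le> 2 * m" and n: "1 \<le> n'" "n' \<le> n" "2 \<le> n" "n' \<le> 2 * m"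
  shows "real (100 * (core_cost k q K F (digits_needed q n') n' m ne + 2) + 4) \<le>
    time_bound (11000000 * cost_factor) 1500 12 0 (1 + \<epsilon>) k n m"
proof -
  let ?d = "digits_needed q n'" and ?Y = "set_count K k"
  let ?Z = "q ^ 4 * F * ?Y\<^sup>2 * k\<^sup>2 * K"
  let ?E = "2 powr (1500 * (real k * loglog1 k)) / \<epsilon> powr (12 * log1 k)"
  have q2: "2 \<le> q" using q by (simp add: prime_ge_2_nat)
  note d = digits_needed_le[OF q2 n(1,2,3)] digits_needed(1)[OF q2, of n']
  have Y: "1 \<le> ?Y" by (rule set_count_pos[OF k])
  have "core_cost k q K F ?d n' m ne \<le> 51000 * (?Z * m * ?d)"
    by (rule core_cost_le[OF k _ F m(1) d(3) n(4) m(2) d(1)]) (use q2 in simp)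
  moreover have "1 \<le> ?Z * m * ?d"
  proof -
    have "0 < ?Z * m * ?d" using q2 F Y k m(1) d(3) by simp
    then show ?thesis by linarith
  qed
  moreover have "100 * (c + 2) + 4 \<le> 5100204 * z" if "c \<le> 51000 * z" "1 \<le> z" for c z :: nat
  proof -
    have "100 * c \<le> 5100000 * z" using mult_le_mono2[OF that(1), of 100] by simp
    then have "100 * c + 204 \<le> 5100000 * z + 204 * z" using that(2) by (intro add_mono) simp_all
    then show ?thesis by simp
  qed
  ultimately have "100 * (core_cost k q K F ?d n' m ne + 2) + 4 \<le> 5100204 * (?Z * m * ?d)" by blast
  then have "real (100 * (core_cost k q K F ?d n' m ne + 2) + 4) \<le> real (5100204 * (?Z * m * ?d))"
    by (rule of_nat_mono)
  also have "\<dots> = 5100204 * (real ?Z * real m * real ?d)" by (simp only: of_nat_mult of_nat_numeral)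
  also have "\<dots> \<le> 5100204 * (cost_factor * ?E * real m * (2 * log 2 (real n)))"
  proof (intro mult_left_mono mult_mono)
    show "real ?Z \<le> cost_factor * ?E"
    proof (rule disjE[OF fam])
      assume "small_family \<epsilon> k q K F"
      then show ?thesis by (rule small_family_cost[OF \<epsilon> k(1)])
    next
      assume "large_family k q K F"
      then have "real ?Z \<le> 2 * 2 powr (1500 * (real k * loglog1 k))" by (rule large_family_cost) (use q2 in simp)
      also have "\<dots> \<le> cost_factor * ?E"
      proof (rule mult_mono)
        have "\<epsilon> powr (12 * log1 k) \<le> 1 powr (12 * log1 k)"
          using \<epsilon> loglog1_ge(2)[of k] by (intro powr_mono2) auto
        then show "2 powr (1500 * (real k * loglog1 k)) \<le> ?E"
          using \<epsilon> by (simp add: pos_le_divide_eq mult_left_le)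
      qed simp_all
      finally show ?thesis .
    qed
  qed (use d(2) in simp_all)
  also have "\<dots> \<le> 11000000 * cost_factor * (?E * real m * log 2 (real n))"
  proof -
    have scale: "5100204 * (C * e * m' * (2 * l)) \<le> 11000000 * C * (e * m' * l)"
      if "0 \<le> C" "0 \<le> e * m' * l" for C e m' l :: real
    proof -
      have "0 \<le> C * (e * m' * l)" using that by (rule mult_nonneg_nonneg)
      then show ?thesis by (simp add: mult_ac)
    qed
    show ?thesis by (rule scale) (use n(3) in simp_all)
  qed
  also have "\<dots> \<le> time_bound (11000000 * cost_factor) 1500 12 0 (1 + \<epsilon>) k n m"
    unfolding time_bound_def by (rule mult_left_mono) simp_all
  finally show ?thesis .
qed

lemma ALG_outputs:
  assumes \<epsilon>: "0 < \<epsilon>" "\<epsilon> \<le> 1" and k: "1 \<le> k" and dist: "distinct (both_ways und es)"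
    and M: "2 \<le> k \<Longrightarrow> card (simple_walks (set (both_ways und es)) k) = (if und then 2 else 1) * M"
      "k = 1 \<Longrightarrow> M = n"
    and n: "ends es \<subseteq> {..<n}" "es \<noteq> [] \<Longrightarrow> 2 \<le> n"
  shows "outputs_approximation (assemble (ALG \<epsilon> und)) (input_config n k es)
    (time_bound (11000000 * cost_factor) 1500 12 0 (1 + \<epsilon>) k n (length es)) (1 + \<epsilon>) M"
proof (rule assemble_outputs[OF _ ALG_ok])
  let ?T = "time_bound (11000000 * cost_factor) 1500 12 0 (1 + \<epsilon>) k n (length es)"
  let ?v = "input_vars n (length es) k"
  let ?Q = "\<lambda>v (a :: arrays) t. real (100 * t + 4) \<le> ?T \<and> 0 < v 1 \<and> approximates (1 + \<epsilon>) (real (v 0) / real (v 1)) M"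
  have v: "?v 0 = n" "?v 1 = length es" "?v 2 = k" by (simp_all add: input_vars_def)
  \<comment> \<open>With last constant 0 the second summand of the time bound is 1; it pays for the
    answers given at once, in particular for edgeless graphs.\<close>
  have T: "real (100 * t + 4) \<le> ?T" if "t \<le> 4" for t
  proof -
    \<comment> \<open>For n = 0 the logarithm has its default value, which is nonnegative as
      well.\<close>
    have "0 \<le> log 2 (real n)" by (cases "n = 0") (auto simp: log_def)
    then have "1 \<le> 2 powr (1500 * (real k * loglog1 k)) / \<epsilon> powr (12 * log1 k) * real (length es) * log 2 (real n) + \<epsilon> powr 0"
      using \<epsilon> by simp
    then have "11000000 * cost_factor * 1 \<le> ?T" unfolding time_bound_def using \<epsilon> by (intro mult_left_mono) simp_all
    moreover have "real (100 * t + 4) \<le> 404" using that by simp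
    ultimately show ?thesis by simp
  qed
  have ap: "approximates (1 + \<epsilon>) (real x) x" for x
    using \<epsilon> by (simp add: approximates_def pos_divide_le_eq mult_le_cancel_left1 mult_le_cancel_right1)
  show "wp (ALG \<epsilon> und) ?Q ?v (input_array es) 0"
  proof (cases "2 \<le> k \<and> es \<noteq> []")
    case True
    have "wp (CORE \<epsilon> und) ?Q ?v (input_array es) 2"
    proof (rule CORE_spec[OF \<epsilon>, where es = es and M = M])
      show "card (simple_walks (set (both_ways und es)) (?v 2)) = (if und then 2 else 1) * M" using M(1) True v by simp
      fix v' :: vars and a' :: arrays and t' q K F n'
      assume A: "n' \<le> 2 * length es" "prime q" "?v 2 \<le> K" "1 \<le> F" "small_family \<epsilon> (?v 2) q K F \<or> large_family (?v 2) q K F"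
        "0 < v' 1" "approximates (1 + \<epsilon>) (real (v' 0) / real (v' 1)) M" "n' = card (ends es)"
        "t' \<le> 2 + core_cost (?v 2) q K F (digits_needed q n') n' (length es) (length (both_ways und es))"
      have fe: "finite (ends es)" by (simp add: ends_def)
      have "ends es \<noteq> {}" using True by (simp add: ends_def)
      then have n1: "1 \<le> n'" using A(8) fe by (simp add: Suc_leI card_gt_0_iff)
      have n2: "n' \<le> n" using card_mono[OF _ n(1)] A(8) by simp
      have m: "1 \<le> length es" using True by (cases es) auto
      have "real (100 * t' + 4) \<le> real (100 * (core_cost k q K F (digits_needed q n') n' (length es) (length (both_ways und es)) + 2) + 4)"
        using A(9) v by (intro of_nat_mono) simp
      also have "\<dots> \<le> ?T"
        by (rule core_time_le[OF \<epsilon> k _ A(2) A(4) _ m _ n1 n2 _ A(1)]) (use A v True n(2) in \<open>simp_all add: both_ways_def\<close>)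
      finally show "?Q v' a' t'" using A by simp
    qed (use True v dist in \<open>simp_all add: input_array_def\<close>)
    then show ?thesis using True v by (simp add: ALG_def numeral_2_eq_2)
  next
    case False
    show ?thesis
    proof (cases "k = 1")
      case True
      then show ?thesis using T[of 2] ap[of n] M(2) v by (simp add: ALG_def numeral_2_eq_2)
    next
      case k1: False
      then have e: "2 \<le> k" "es = []" using False k by auto
      have "simple_walks (set (both_ways und es)) k = {}"
      proof -
        have "p \<notin> simple_walks {} k" for p
        proof
          assume "p \<in> simple_walks {} k"
          then have "set p \<subseteq> {}" "length p = k" using rwalk_ends[of "{}" p] e(1) by (auto simp: simple_walks_def)
          then show False using e(1) by simp
        qed
        then show ?thesis using e(2) by (auto simp: both_ways_def)
      qed
      then have "M = 0" using M(1)[OF e(1)] by (simp split: if_splits)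
      then show ?thesis using e T[of 4] ap[of 0] v by (simp add: ALG_def eval_nat_numeral)
    qed
  qed
qed

lemma ends_vertices:
  assumes "pair_digraph G" "pverts G = {..<n}" "set es \<subseteq> parcs G"
  shows "ends es \<subseteq> {..<n}" "es \<noteq> [] \<Longrightarrow> 2 \<le> n"
proof -
  interpret pair_digraph G by fact
  have e: "fst e < n" "snd e < n" "fst e \<noteq> snd e" if "e \<in> set es" for e
    using that assms(2,3) arc_fst_in_verts[of e] arc_snd_in_verts[of e] pair_no_loops[of e] by auto
  show "ends es \<subseteq> {..<n}" using e by (auto simp: ends_def)
  show "2 \<le> n" if "es \<noteq> []"
  proof -
    have "hd es \<in> set es" using that by simp
    then show ?thesis using e[of "hd es"] by linarith
  qed
qed

theorem theorem8:
  shows "\<exists>c\<^sub>0 c\<^sub>1 c\<^sub>2 c\<^sub>3 :: real. \<forall>\<delta> :: real. 1 < \<delta> \<and> \<delta> \<le> 2 \<longrightarrow>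
    (\<exists>P :: program. \<forall>n G es k. directed_input n G es \<and> 1 \<le> k \<longrightarrow>
       outputs_approximation P (input_config n k es)
         (time_bound c\<^sub>0 c\<^sub>1 c\<^sub>2 c\<^sub>3 \<delta> k (card (pverts G)) (card (parcs G)))
         \<delta> (card (directed_paths G (k - 1)))) \<and>
    (\<exists>P :: program. \<forall>n G es k. undirected_input n G es \<and> 1 \<le> k \<longrightarrow>
       outputs_approximation P (input_config n k es)
         (time_bound c\<^sub>0 c\<^sub>1 c\<^sub>2 c\<^sub>3 \<delta> k (card (pverts G)) (card (undirected_edges G)))
         \<delta> (card (undirected_paths G (k - 1))))"
\<comment> \<open>The exponents 1500 and 12 are those of \<open>large_family_cost\<close> and
  \<open>small_family_cost\<close>. The program is chosen after \<delta>, so it may contain the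
  tables for the finitely many small k.\<close>
proof (rule exI[of _ "11000000 * cost_factor"], rule exI[of _ 1500], rule exI[of _ 12], rule exI[of _ 0],
    intro allI impI conjI)
  fix \<delta> :: real
  assume \<delta>: "1 < \<delta> \<and> \<delta> \<le> 2"
  define \<epsilon> where "\<epsilon> = \<delta> - 1"
  have \<epsilon>: "0 < \<epsilon>" "\<epsilon> \<le> 1" "\<delta> = 1 + \<epsilon>" using \<delta> by (auto simp: \<epsilon>_def)
  show "\<exists>P :: program. \<forall>n G es k. directed_input n G es \<and> 1 \<le> k \<longrightarrow>
       outputs_approximation P (input_config n k es)
         (time_bound (11000000 * cost_factor) 1500 12 0 \<delta> k (card (pverts G)) (card (parcs G)))
         \<delta> (card (directed_paths G (k - 1)))"
  proof (intro exI[of _ "assemble (ALG \<epsilon> False)"] allI impI, elim conjE)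
    fix n k :: nat and G es assume inp: "directed_input n G es" and k: "1 \<le> k"
    have G: "pair_digraph G" "pverts G = {..<n}" using inp by (auto simp: directed_input_def)
    note b = both_ways_directed[OF inp]
    note e = ends_vertices[OF G, of es]
    have "outputs_approximation (assemble (ALG \<epsilon> False)) (input_config n k es)
        (time_bound (11000000 * cost_factor) 1500 12 0 (1 + \<epsilon>) k n (length es)) (1 + \<epsilon>) (card (directed_paths G (k - 1)))"
    proof (rule ALG_outputs[OF \<epsilon>(1,2) k b(1)])
      show "card (simple_walks (set (both_ways False es)) k) = (if False then 2 else 1) * card (directed_paths G (k - 1))"
        if "2 \<le> k" using card_directed_paths[OF G(1) that] b(2) by simp
      show "card (directed_paths G (k - 1)) = n" if "k = 1"
        using card_directed_paths_0[of G] that G(2) by simp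
    qed (use e b(2) in \<open>auto simp: both_ways_def\<close>)
    then show "outputs_approximation (assemble (ALG \<epsilon> False)) (input_config n k es)
        (time_bound (11000000 * cost_factor) 1500 12 0 \<delta> k (card (pverts G)) (card (parcs G))) \<delta> (card (directed_paths G (k - 1)))"
      using G(2) b(3) \<epsilon>(3) by simp
  qed
  show "\<exists>P :: program. \<forall>n G es k. undirected_input n G es \<and> 1 \<le> k \<longrightarrow>
       outputs_approximation P (input_config n k es)
         (time_bound (11000000 * cost_factor) 1500 12 0 \<delta> k (card (pverts G)) (card (undirected_edges G)))
         \<delta> (card (undirected_paths G (k - 1)))"
  proof (intro exI[of _ "assemble (ALG \<epsilon> True)"] allI impI, elim conjE)
    fix n k :: nat and G es assume inp: "undirected_input n G es" and k: "1 \<le> k"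
    have G: "pair_graph G" "pverts G = {..<n}" "set es \<subseteq> parcs G" using inp by (auto simp: undirected_input_def)
    have G': "pair_digraph G" using G(1) by (rule pair_graph.axioms)
    note b = both_ways_undirected[OF inp]
    note e = ends_vertices[OF G' G(2,3)]
    have "outputs_approximation (assemble (ALG \<epsilon> True)) (input_config n k es)
        (time_bound (11000000 * cost_factor) 1500 12 0 (1 + \<epsilon>) k n (length es)) (1 + \<epsilon>) (card (undirected_paths G (k - 1)))"
    proof (rule ALG_outputs[OF \<epsilon>(1,2) k b(1)])
      show "card (simple_walks (set (both_ways True es)) k) = (if True then 2 else 1) * card (undirected_paths G (k - 1))"
        if "2 \<le> k" using card_directed_paths[OF G' that] card_undirected_paths[OF G(1) that] b(2) by simp
      show "card (undirected_paths G (k - 1)) = n" if "k = 1"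
        using card_undirected_paths_0[of G] that G(2) by simp
    qed (use e in auto)
    then show "outputs_approximation (assemble (ALG \<epsilon> True)) (input_config n k es)
        (time_bound (11000000 * cost_factor) 1500 12 0 \<delta> k (card (pverts G)) (card (undirected_edges G))) \<delta> (card (undirected_paths G (k - 1)))"
      using G(2) b(3) \<epsilon>(3) by simp
  qed
qed

end
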